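(* Let $N\ge2$, let $f_1(t)=\sum_{m\ge0}b_mt^m$ on $[-1,1]$ with $b_m\ge0$ and $b_m\le c_1r^m$ for all $m\ge0$ (constants $0<r<1$, $c_1>0$), and let $f_N\circ\cdots\circ f_2$ be a polynomial of degree $D\ge1$ with non-negative coefficients; set $d^*=\min(D,n)$. Let $\omega\ge1$ and $0<\beta\le2$. Then there exist constants $A,C>0$ independent of $\beta$ (and of $\rho,\tau,\ell$) such that for every $\rho\in\mathcal{G}_{\omega,\beta}$ and every $\tau\ge1$: (i) if $\beta>1$, $\lambda_\ell=\ell^{-1/\beta}$ and $\ell\ge\max\Big(e^\beta,\big(\frac{A}{\beta^{(d-1)d^*}}\big)^{\frac{\beta}{\beta-1}}\tau^{\frac{2\beta}{\beta-1}}\log(\ell)^{\frac{(d-1)d^*\beta}{\beta-1}}\Big)$, then with $\rho^\ell$-probability at least $1-e^{-4\tau}$, $\|f_{H_N,\mathbf{z},\lambda_\ell}-f_\rho\|_\rho^2\le3C\tau^2\frac{\log(\ell)^{(d-1)d^*}}{\ell}$; (ii) if $\beta=1$, $\lambda_\ell=\frac{\log(\ell)^\mu}{\ell}$ with $\mu>(d-1)d^*$, and $\ell\ge\max\big(\exp((A\tau)^{\frac1{\mu-(d-1)d^*}}),\,e\log(\ell)^\mu\big)$, then with $\rho^\ell$-probability at least $1-e^{-4\tau}$, $\|f_{H_N,\mathbf{z},\lambda_\ell}-f_\rho\|_\rho^2\le3C\tau^2\frac{\log(\ell)^\mu}{\ell}$; (iii) if $\beta<1$, $\lambda_\ell=\frac{\log(\ell)^{(d-1)d^*/\beta}}{\ell}$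 and $\ell\ge\max\big(\exp((A\tau)^{\frac{\beta}{(d-1)d^*(1-\beta)}}),\,e\log(\ell)^{(d-1)d^*/\beta}\big)$, then with $\rho^\ell$-probability at least $1-e^{-4\tau}$, $\|f_{H_N,\mathbf{z},\lambda_\ell}-f_\rho\|_\rho^2\le3C\tau^2\frac{\log(\ell)^{(d-1)d^*}}{\ell^\beta}$.
   Context: $d\ge2$, $n\ge1$, $\mathcal{I}=(S^{d-1})^n$, $P=\sigma_{d-1}^{\otimes n}$ the product of surface measures. $K_N(\mathbf{X},\mathbf{X}')=f_N\circ\cdots\circ f_2\big(\sum_{i=1}^nf_1(\langle\mathbf{X}_i,\mathbf{X}'_i\rangle)\big)$ and $H_N$ is its RKHS. Data: $\mathbf{z}=((x_1,y_1),\dots,(x_\ell,y_\ell))$ i.i.d. from a probability measure $\rho$ on $\mathcal{I}\times\mathcal{Y}$, $\mathcal{Y}\subset\mathbb{R}$, with marginal $\rho_{\mathcal{I}}$, regression function $f_\rho(x)=\int y\,d\rho(y|x)$, and $\|\cdot\|_\rho$ the norm of $L_2(\rho_{\mathcal{I}})$. The regularized least-squares estimator is $f_{H_N,\mathbf{z},\lambda}=\arg\min_{f\in H_N}\frac1\ell\sum_{i=1}^\ell(f(x_i)-y_i)^2+\lambda\|f\|_{H_N}^2$. $T_{\rho_{\mathcal{I}}}f=\int K_N(x,\cdot)f(x)\,d\rho_{\mathcal{I}}(x)$ on $L_2(\rho_{\mathcal{I}})$. $\mathcal{W}_\omega$ is the set of probability measures $\nu$ on $\mathcal{I}$ with $d\nu/dP<\omega$,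 and $\mathcal{W}_{\omega,h}\subset\mathcal{W}_\omega$ those with additionally $d\nu/dP>h$. For fixed constants $B,B_\infty,L,\sigma>0$, $\mathcal{G}_{\omega,\beta}$ is the set of $\rho$ with: $\rho_{\mathcal{I}}\in\mathcal{W}_\omega$, $\int y^2d\rho<\infty$, $\|f_\rho\|_{L_\infty(\rho_{\mathcal{I}})}^2\le B_\infty$; $f_\rho=T_{\rho_{\mathcal{I}}}^{\beta/2}g$ for some $g\in L_2(\rho_{\mathcal{I}})$ with $\|g\|_\rho^2\le B$; and $\int|y-f_\rho(x)|^m\,d\rho(y|x)\le\frac12m!\,\sigma^2L^{m-2}$ for all $m\ge2$ and $\rho_{\mathcal{I}}$-a.e. $x$. $\mathcal{G}_{\omega,h,\beta}$ is defined identically with $\mathcal{W}_{\omega,h}$ in place of $\mathcal{W}_\omega$. *)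

theory Defs
  imports "HOL-Probability.Probability" "HOL-Computational_Algebra.Polynomial"
begin

text \<open>Surface measure on the unit sphere of real^d via the cone construction:
  sigma(A) = d * Lebesgue({t u. u in A, 0 < t < 1}).\<close>
definition sph_meas :: "(real^'d::finite) measure" where
  "sph_meas = scale_measure (of_nat CARD('d))
      (distr (restrict_space lborel (ball 0 1)) borel (\<lambda>x. x /\<^sub>R norm x))"

definition I_meas :: "('n::finite \<Rightarrow> real^'d::finite) measure" where
  "I_meas = PiM UNIV (\<lambda>_. borel)"

definition P_meas :: "('n::finite \<Rightarrow> real^'d::finite) measure" where
  "P_meas = PiM UNIV (\<lambda>_. sph_meas)"

definition I_set :: "('n::finite \<Rightarrow> real^'d::finite) set" where
  "I_set = {X. \<forall>i. X i \<in> sphere 0 1}"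

definition W_omega :: "real \<Rightarrow> ('n::finite \<Rightarrow> real^'d::finite) measure \<Rightarrow> bool" where
  "W_omega \<omega> \<nu> \<longleftrightarrow> prob_space \<nu> \<and>
     (\<exists>h\<in>borel_measurable P_meas. \<nu> = density P_meas h \<and> (AE x in P_meas. h x < ennreal \<omega>))"

definition compose_fs :: "(nat \<Rightarrow> real \<Rightarrow> real) \<Rightarrow> nat \<Rightarrow> real \<Rightarrow> real" where
  "compose_fs fs N = fold (\<lambda>i h. fs i \<circ> h) [2..<N+1] id"

definition kerN :: "(real \<Rightarrow> real) \<Rightarrow> (nat \<Rightarrow> real \<Rightarrow> real) \<Rightarrow> nat
     \<Rightarrow> ('n::finite \<Rightarrow> real^'d::finite) \<Rightarrow> ('n \<Rightarrow> real^'d) \<Rightarrow> real" where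
  "kerN f1 fs N X X' = compose_fs fs N (\<Sum>i\<in>UNIV. f1 (X i \<bullet> X' i))"

section \<open>RKHS of a kernel on a set S (Aronszajn / Paulsen--Raghupathi characterisation);
  functions are extended by 0 outside S\<close>

definition rkhs_bound :: "('a \<Rightarrow> 'a \<Rightarrow> real) \<Rightarrow> 'a set \<Rightarrow> ('a \<Rightarrow> real) \<Rightarrow> real \<Rightarrow> bool" where
  "rkhs_bound K S f c \<longleftrightarrow> (\<forall>xs cs. set xs \<subseteq> S \<longrightarrow> length cs = length xs \<longrightarrow>
      (\<Sum>i<length xs. cs!i * f (xs!i))^2
        \<le> c * (\<Sum>i<length xs. \<Sum>j<length xs. cs!i * cs!j * K (xs!i) (xs!j)))"

definition in_rkhs :: "('a \<Rightarrow> 'a \<Rightarrow> real) \<Rightarrow> 'a set \<Rightarrow> ('a \<Rightarrow> real) \<Rightarrow> bool" where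
  "in_rkhs K S f \<longleftrightarrow> (\<forall>x. x \<notin> S \<longrightarrow> f x = 0) \<and> (\<exists>c. rkhs_bound K S f c)"

definition rkhs_norm2 :: "('a \<Rightarrow> 'a \<Rightarrow> real) \<Rightarrow> 'a set \<Rightarrow> ('a \<Rightarrow> real) \<Rightarrow> real" where
  "rkhs_norm2 K S f = Inf {c. 0 \<le> c \<and> rkhs_bound K S f c}"

definition rls_obj :: "('a \<Rightarrow> 'a \<Rightarrow> real) \<Rightarrow> 'a set \<Rightarrow> 'a list \<Rightarrow> real list \<Rightarrow> real \<Rightarrow> ('a \<Rightarrow> real) \<Rightarrow> real" where
  "rls_obj K S xs ys lam f =
     (1 / real (length xs)) * (\<Sum>i<length xs. (f (xs!i) - ys!i)^2) + lam * rkhs_norm2 K S f"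

definition rls_estimator :: "('a \<Rightarrow> 'a \<Rightarrow> real) \<Rightarrow> 'a set \<Rightarrow> 'a list \<Rightarrow> real list \<Rightarrow> real \<Rightarrow> ('a \<Rightarrow> real)" where
  "rls_estimator K S xs ys lam = (THE f. in_rkhs K S f \<and>
      (\<forall>g. in_rkhs K S g \<longrightarrow> rls_obj K S xs ys lam f \<le> rls_obj K S xs ys lam g))"

definition sample_est :: "('a \<Rightarrow> 'a \<Rightarrow> real) \<Rightarrow> 'a set \<Rightarrow> nat \<Rightarrow> (nat \<Rightarrow> 'a \<times> real) \<Rightarrow> real \<Rightarrow> ('a \<Rightarrow> real)" where
  "sample_est K S l z lam =
     rls_estimator K S (map (\<lambda>i. fst (z i)) [0..<l]) (map (\<lambda>i. snd (z i)) [0..<l]) lam"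

definition L2_mem :: "'a measure \<Rightarrow> ('a \<Rightarrow> real) \<Rightarrow> bool" where
  "L2_mem M f \<longleftrightarrow> f \<in> borel_measurable M \<and> integrable M (\<lambda>x. (f x)^2)"

definition L2_inner :: "'a measure \<Rightarrow> ('a \<Rightarrow> real) \<Rightarrow> ('a \<Rightarrow> real) \<Rightarrow> real" where
  "L2_inner M f g = (\<integral>x. f x * g x \<partial>M)"

definition L2_conv :: "'a measure \<Rightarrow> (nat \<Rightarrow> 'a \<Rightarrow> real) \<Rightarrow> ('a \<Rightarrow> real) \<Rightarrow> bool" where
  "L2_conv M F f \<longleftrightarrow> ((\<lambda>n. \<integral>\<^sup>+x. ennreal ((F n x - f x)^2) \<partial>M) \<longlonglongrightarrow> 0)"

definition T_op :: "('a \<Rightarrow> 'a \<Rightarrow> real) \<Rightarrow> 'a measure \<Rightarrow> ('a \<Rightarrow> real) \<Rightarrow> 'a \<Rightarrow> real" where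
  "T_op K M f = (\<lambda>x'. \<integral>x. K x x' * f x \<partial>M)"

definition spectral_decomp :: "'a measure \<Rightarrow> (('a \<Rightarrow> real) \<Rightarrow> 'a \<Rightarrow> real) \<Rightarrow> (nat \<Rightarrow> 'a \<Rightarrow> real) \<Rightarrow> (nat \<Rightarrow> real) \<Rightarrow> bool" where
  "spectral_decomp M T e \<mu> \<longleftrightarrow>
     (\<forall>k. L2_mem M (e k)) \<and> (\<forall>k j. L2_inner M (e k) (e j) = (if k = j then 1 else 0)) \<and>
     (\<forall>k. 0 \<le> \<mu> k) \<and>
     (\<forall>h. L2_mem M h \<longrightarrow> L2_conv M (\<lambda>n x. \<Sum>k<n. \<mu> k * L2_inner M h (e k) * e k x) (T h))"

definition is_op_power :: "'a measure \<Rightarrow> (('a \<Rightarrow> real) \<Rightarrow> 'a \<Rightarrow> real) \<Rightarrow> real \<Rightarrow> ('a \<Rightarrow> real) \<Rightarrow> ('a \<Rightarrow> real) \<Rightarrow> bool" where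
  "is_op_power M T s g f \<longleftrightarrow> (\<exists>e \<mu>. spectral_decomp M T e \<mu> \<and>
      L2_conv M (\<lambda>n x. \<Sum>k<n. \<mu> k powr s * L2_inner M g (e k) * e k x) f)"

definition marg :: "(('n::finite \<Rightarrow> real^'d::finite) \<times> real) measure \<Rightarrow> ('n \<Rightarrow> real^'d) measure" where
  "marg \<rho> = distr \<rho> I_meas fst"

definition cond_kernel :: "(('n::finite \<Rightarrow> real^'d::finite) \<times> real) measure \<Rightarrow> (('n \<Rightarrow> real^'d) \<Rightarrow> real measure) \<Rightarrow> bool" where
  "cond_kernel \<rho> \<kappa> \<longleftrightarrow>
     (\<forall>x. prob_space (\<kappa> x) \<and> sets (\<kappa> x) = sets (borel :: real measure)) \<and>
     (\<forall>B\<in>sets (borel :: real measure). (\<lambda>x. emeasure (\<kappa> x) B) \<in> borel_measurable I_meas) \<and>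
     (\<forall>A\<in>sets I_meas. \<forall>B\<in>sets (borel :: real measure).
        emeasure \<rho> (A \<times> B) = (\<integral>\<^sup>+x\<in>A. emeasure (\<kappa> x) B \<partial>marg \<rho>))"

definition regr :: "('a \<Rightarrow> real measure) \<Rightarrow> 'a \<Rightarrow> real" where
  "regr \<kappa> x = (\<integral>y. y \<partial>\<kappa> x)"

definition in_G :: "real \<Rightarrow> real \<Rightarrow> real \<Rightarrow> real \<Rightarrow> real \<Rightarrow> real
    \<Rightarrow> (('n::finite \<Rightarrow> real^'d::finite) \<Rightarrow> ('n \<Rightarrow> real^'d) \<Rightarrow> real)
    \<Rightarrow> (('n \<Rightarrow> real^'d) \<times> real) measure \<Rightarrow> (('n \<Rightarrow> real^'d) \<Rightarrow> real measure) \<Rightarrow> bool" where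
  "in_G B Binf L \<sigma> \<omega> \<beta> K \<rho> \<kappa> \<longleftrightarrow>
     prob_space \<rho> \<and> sets \<rho> = sets (I_meas \<Otimes>\<^sub>M (borel :: real measure)) \<and>
     W_omega \<omega> (marg \<rho>) \<and>
     integrable \<rho> (\<lambda>xy. (snd xy)^2) \<and>
     cond_kernel \<rho> \<kappa> \<and>
     (AE x in marg \<rho>. (regr \<kappa> x)^2 \<le> Binf) \<and>
     (\<exists>g. L2_mem (marg \<rho>) g \<and> (\<integral>x. (g x)^2 \<partial>marg \<rho>) \<le> B \<and>
          is_op_power (marg \<rho>) (T_op K (marg \<rho>)) (\<beta>/2) g (regr \<kappa>)) \<and>
     (\<forall>m::nat. m \<ge> 2 \<longrightarrow> (AE x in marg \<rho>.
        (\<integral>\<^sup>+y. ennreal (\<bar>y - regr \<kappa> x\<bar>^m) \<partial>\<kappa> x) \<le> ennreal (fact m * \<sigma>^2 * L^(m-2) / 2)))"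

definition err :: "(('n::finite \<Rightarrow> real^'d::finite) \<times> real) measure \<Rightarrow> (('n \<Rightarrow> real^'d) \<Rightarrow> real measure)
    \<Rightarrow> (('n \<Rightarrow> real^'d) \<Rightarrow> real) \<Rightarrow> ennreal" where
  "err \<rho> \<kappa> f = (\<integral>\<^sup>+x. ennreal ((f x - regr \<kappa> x)^2) \<partial>marg \<rho>)"

definition prob_at_least :: "'a measure \<Rightarrow> ('a \<Rightarrow> bool) \<Rightarrow> real \<Rightarrow> bool" where
  "prob_at_least M P p \<longleftrightarrow> (\<exists>E\<in>sets M. E \<subseteq> {z\<in>space M. P z} \<and> measure M E \<ge> p)"

end

theory Submission
  imports Defs
begin

text \<open>Truncating the power series at order \<open>M \<approx> log l\<close> splits the kernel into a head, whose features span at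
  most \<open>O(M ^ ((d - 1) * dstar))\<close> functions on the product of spheres (each monomial involves at most \<open>dstar\<close>
  blocks, and on a sphere one coordinate may be taken with exponent at most one), and a positive semidefinite
  tail of size \<open>l ^ (-3)\<close>. The effective dimension is thus at most the rank of the head, uniformly in
  \<open>\<rho>\<close>, and the whole analysis takes place in an orthonormal basis of the head for
  \<open>E[h h'] + lam \<langle>w, w'\<rangle>\<close>. There the empirical Gram matrix and the noise vector concentrate by a
  Pinelis-type Bernstein inequality for vectors, while the source condition provides an approximation
  \<open>T u\<close> of the regression function with bias of order \<open>lam powr \<beta>\<close>.
  Altogether the error is \<open>O(\<tau>\<^sup>2 (lam powr \<beta> + log l ^ ((d - 1) * dstar) / l))\<close> as soon as
  \<open>l * lam\<close> is at least a constant times \<open>\<tau> * log l ^ ((d - 1) * dstar)\<close>; the three cases are choices of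
  \<open>lam\<close>.\<close>

section \<open>Concentration of sums of independent random vectors\<close>

text \<open>The obstacle is uniformity. The density of the marginal is bounded above but not below,
  so no asymptotics of the eigenvalues of \<open>T_op K \<nu>\<close> hold over the whole class; a
  rank does not depend on the measure, which is why it takes the place of eigenvalue decay. The
  truncation error is geometric in the order, so an order proportional to log l brings it down to
  any fixed power of \<open>1 / l\<close>. The kernel is controlled on the product of spheres only,
  because \<open>f1\<close> is given on the interval from -1 to 1. It is therefore set to zero
  elsewhere before anything is integrated. An element of the RKHS is handled through a linear
  functional on bounded functions that represents it, such as a sum of point evaluations minus an
  integral. Its values are the functional applied to the kernel once, and its squared norm is the
  functional applied twice. For kernels of finite rank these are explicit sums, and the inequalities
  survive uniform limits. All constants are fixed before \<open>\<beta>\<close> and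
  \<open>\<rho>\<close>; hence the estimates are made for free \<open>lam\<close> under a single
  lower bound on \<open>l * lam\<close>.\<close>

lemma cosh_sqrt_sums:
  fixes w :: real assumes "w \<ge> 0"
  shows "(\<lambda>k. w ^ k / fact (2 * k)) sums cosh (sqrt w)"
proof -
  let ?f = "\<lambda>n. if even n then sqrt w ^ n /\<^sub>R fact n else 0"
  have "(\<lambda>k. ?f (2 * k)) sums cosh (sqrt w)"
    by (subst sums_mono_reindex[where f = ?f and g = "\<lambda>k. 2 * k"])
      (auto simp: strict_mono_def cosh_converges elim!: evenE)
  moreover have "?f (2 * k) = w ^ k / fact (2 * k)" for k
    using assms by (simp add: power_mult divide_inverse)
  ultimately show ?thesis by simp
qed

lemma power_convex_nonneg:
  fixes a b w z :: real
  assumes "0 \<le> a" "0 \<le> b" "a + b = 1" "0 \<le> w" "0 \<le> z"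
  shows "(a * w + b * z) ^ k \<le> a * w ^ k + b * z ^ k"
proof (induction k)
  case (Suc k)
  \<comment> \<open>\<open>w\<close> and \<open>w ^ k\<close> are ordered alike (Chebyshev), and
    \<open>a * b\<close> times this product is exactly the defect of convexity in the induction
    step.\<close>
  have cheb: "0 \<le> (w - z) * (w ^ k - z ^ k)"
    by (metis (no_types, opaque_lifting) assms(4,5) diff_ge_0_iff_ge linorder_linear mult_nonneg_nonneg
        mult_nonpos_nonpos diff_le_0_iff_le power_mono)
  have "(a * w + b * z) ^ Suc k \<le> (a * w + b * z) * (a * w ^ k + b * z ^ k)"
    using Suc assms by (simp add: mult_left_mono)
  also have "\<dots> = a * w ^ Suc k + b * z ^ Suc k - a * b * ((w - z) * (w ^ k - z ^ k))"
  proof -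
    have b: "b = 1 - a" using assms by simp
    show ?thesis unfolding b by (simp add: algebra_simps)
  qed
  also have "\<dots> \<le> a * w ^ Suc k + b * z ^ Suc k"
    using cheb assms by simp
  finally show ?case .
qed (use assms in auto)

text \<open>As a power series in \<open>w\<close> the function has the coefficients
  \<open>1 / fact (2 * k)\<close>, all non-negative, so convexity on the half-line follows from that
  of each power \<open>w ^ k\<close>.\<close>

lemma cosh_sqrt_convex:
  fixes a b w z :: real
  assumes "0 \<le> a" "0 \<le> b" "a + b = 1" "0 \<le> w" "0 \<le> z"
  shows "cosh (sqrt (a * w + b * z)) \<le> a * cosh (sqrt w) + b * cosh (sqrt z)"
proof (rule sums_le)
  show "(\<lambda>k. (a * w + b * z) ^ k / fact (2 * k)) sums cosh (sqrt (a * w + b * z))"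
    using assms by (intro cosh_sqrt_sums) simp
  show "(\<lambda>k. a * (w ^ k / fact (2 * k)) + b * (z ^ k / fact (2 * k))) sums
      (a * cosh (sqrt w) + b * cosh (sqrt z))"
    using assms by (intro sums_add sums_mult cosh_sqrt_sums)
  fix k
  have "(a * w + b * z) ^ k / fact (2 * k) \<le> (a * w ^ k + b * z ^ k) / fact (2 * k)"
    using power_convex_nonneg[OF assms, of k] by (intro divide_right_mono) auto
  thus "(a * w + b * z) ^ k / fact (2 * k) \<le> a * (w ^ k / fact (2 * k)) + b * (z ^ k / fact (2 * k))"
    by (simp add: add_divide_distrib)
qed

lemma sinh_real_ge:
  fixes x :: real assumes "x \<ge> 0" shows "x \<le> sinh x"
proof -
  have "mono_on {0..} (\<lambda>x::real. sinh x - x)"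
  proof (rule monotone_onI)
    fix a b :: real assume ab: "a \<in> {0..}" "b \<in> {0..}" "a \<le> b"
    show "sinh a - a \<le> sinh b - b"
      by (rule DERIV_nonneg_imp_nondecreasing[OF ab(3)])
        (auto intro!: exI derivative_eq_intros simp: cosh_real_ge_1)
  qed
  from monotone_onD[OF this, of 0 x] assms show ?thesis by simp
qed

lemma sinh_le_cosh_real: "sinh (x::real) \<le> cosh x"
  by (simp add: sinh_def cosh_def)

lemma exp_eq_cosh_plus_sinh: "exp (x::real) = cosh x + sinh x"
  by (simp add: sinh_def cosh_def field_simps)

lemma L2_set_sq: "(L2_set f A)\<^sup>2 = (\<Sum>j\<in>A. (f j)\<^sup>2)"
  unfolding L2_set_def by (simp add: sum_nonneg)

lemma sum_mult_le_L2_set: "\<bar>\<Sum>j\<in>A. f j * g j\<bar> \<le> L2_set f A * L2_set g A"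
proof -
  have "\<bar>\<Sum>j\<in>A. f j * g j\<bar> \<le> (\<Sum>j\<in>A. \<bar>f j\<bar> * \<bar>g j\<bar>)"
    by (rule order_trans[OF sum_abs]) (simp add: abs_mult)
  thus ?thesis using L2_set_mult_ineq[of f g A] by linarith
qed

text \<open>Since \<^term>\<open>cosh \<circ> sqrt\<close> is convex, for fixed norms the left-hand side is convex in the inner
  product, so it suffices to compare with the affine right-hand side for parallel vectors.\<close>
lemma pinelis_pointwise:
  fixes x y :: "'j \<Rightarrow> real"
  assumes J: "finite J"
  shows "cosh (L2_set (\<lambda>j. x j + y j) J) \<le>
    cosh (L2_set x J) * (exp (L2_set y J) - L2_set y J)
      + sinh (L2_set x J) / L2_set x J * (\<Sum>j\<in>J. x j * y j)"
proof -
  define a b c where "a = L2_set x J" and "b = L2_set y J" and "c = (\<Sum>j\<in>J. x j * y j)"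
  have a0: "a \<ge> 0" and b0: "b \<ge> 0" unfolding a_def b_def by (auto simp: L2_set_nonneg)
  have nrm: "L2_set (\<lambda>j. x j + y j) J = sqrt (a\<^sup>2 + 2 * c + b\<^sup>2)"
  proof -
    have "(L2_set (\<lambda>j. x j + y j) J)\<^sup>2 = a\<^sup>2 + 2 * c + b\<^sup>2"
      unfolding a_def b_def c_def L2_set_sq
      by (simp add: power2_sum sum.distrib sum_distrib_left algebra_simps)
    thus ?thesis by (metis L2_set_nonneg real_sqrt_abs abs_of_nonneg)
  qed
  have c: "\<bar>c\<bar> \<le> a * b" unfolding a_def b_def c_def by (rule sum_mult_le_L2_set)
  have eb: "cosh b \<le> exp b - b" "sinh b \<ge> b" using sinh_real_ge[OF b0] by (auto simp: exp_eq_cosh_plus_sinh)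
  have "cosh (sqrt (a\<^sup>2 + 2 * c + b\<^sup>2)) \<le> cosh a * (exp b - b) + sinh a / a * c"
  proof (cases "a = 0 \<or> b = 0")
    case True
    hence "c = 0" using c by auto
    with True a0 b0 eb show ?thesis by auto
  next
    case False
    hence ab: "a * b > 0" using a0 b0 by (simp add: less_le)
    \<comment> \<open>\<open>q\<close> is the cosine of the angle between the two vectors. The
      weight \<open>\<alpha>\<close> makes the squared norm of the sum a convex combination of its
      extreme values \<open>(a + b)\<^sup>2\<close> and \<open>(a - b)\<^sup>2\<close>.\<close>
    define q where "q = c / (a * b)"
    define \<alpha> where "\<alpha> = (1 + q) / 2"
    have "\<bar>q\<bar> \<le> 1" unfolding q_def 
      using c ab by (simp only: abs_divide abs_of_pos divide_le_eq_1_pos)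
    hence al: "0 \<le> \<alpha>" "\<alpha> \<le> 1" unfolding \<alpha>_def by (simp_all add: abs_le_iff)
    have cab: "c = (2 * \<alpha> - 1) * (a * b)" 
    proof -
      have "2 * \<alpha> - 1 = q" by (simp add: \<alpha>_def field_simps)
      thus ?thesis using False by (simp add: q_def)
    qed
    have "a\<^sup>2 + 2 * c + b\<^sup>2 = \<alpha> * (a + b)\<^sup>2 + (1 - \<alpha>) * (a - b)\<^sup>2"
      unfolding cab by (simp add: power2_eq_square algebra_simps)
    hence "cosh (sqrt (a\<^sup>2 + 2 * c + b\<^sup>2)) \<le> \<alpha> * cosh (sqrt ((a + b)\<^sup>2)) + (1 - \<alpha>) * cosh (sqrt ((a - b)\<^sup>2))"
      using cosh_sqrt_convex[of \<alpha> "1 - \<alpha>" "(a + b)\<^sup>2" "(a - b)\<^sup>2"] al by simp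
    also have "\<dots> = \<alpha> * cosh (a + b) + (1 - \<alpha>) * cosh (a - b)"
      by (simp add: cosh_real_abs)
    also have "\<dots> = cosh a * cosh b + (2 * \<alpha> - 1) * (sinh a * sinh b)"
      by (simp add: cosh_add cosh_diff algebra_simps)
    \<comment> \<open>Linearizing \<open>sinh b\<close> in the odd term leaves
      \<open>sinh b - b\<close>, which the even term absorbs; this is how \<open>cosh b\<close>
      grows to \<open>exp b - b\<close>.\<close>
    also have "\<dots> \<le> cosh a * (exp b - b) + (2 * \<alpha> - 1) * (sinh a * b)"
    proof -
      have "(2 * \<alpha> - 1) * (sinh a * (sinh b - b)) \<le> 1 * (cosh a * (sinh b - b))"
        using al eb a0 sinh_le_cosh_real[of a] cosh_real_pos[of a]
        by (intro mult_mono mult_right_mono) auto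
      thus ?thesis by (simp add: exp_eq_cosh_plus_sinh algebra_simps)
    qed
    also have "(2 * \<alpha> - 1) * (sinh a * b) = sinh a / a * c"
      using False by (simp add: cab field_simps)
    finally show ?thesis .
  qed
  thus ?thesis by (simp add: nrm a_def b_def c_def)
qed

lemma nn_integral_le_integral:
  fixes f g :: "'a \<Rightarrow> real"
  assumes "integrable M g" "\<And>x. x \<in> space M \<Longrightarrow> 0 \<le> f x" "\<And>x. x \<in> space M \<Longrightarrow> f x \<le> g x"
  shows "(\<integral>\<^sup>+x. ennreal (f x) \<partial>M) \<le> ennreal (\<integral>x. g x \<partial>M)"
proof -
  have "(\<integral>\<^sup>+x. ennreal (f x) \<partial>M) \<le> (\<integral>\<^sup>+x. ennreal (g x) \<partial>M)"
    by (intro nn_integral_mono ennreal_leI assms)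
  also have "\<dots> = ennreal (\<integral>x. g x \<partial>M)"
    using assms by (intro nn_integral_eq_integral AE_I2) (auto intro: order_trans)
  finally show ?thesis .
qed

lemma abs_le_L2_set: "finite A \<Longrightarrow> j \<in> A \<Longrightarrow> \<bar>f j\<bar> \<le> L2_set f A"
  unfolding L2_set_def real_sqrt_abs[symmetric] by (intro real_sqrt_le_mono member_le_sum) auto

lemma borel_measurable_L2_set[measurable]:
  fixes f :: "'j \<Rightarrow> 'a \<Rightarrow> real"
  assumes "\<And>j. j \<in> J \<Longrightarrow> f j \<in> borel_measurable M"
  shows "(\<lambda>x. L2_set (\<lambda>j. f j x) J) \<in> borel_measurable M"
  unfolding L2_set_def using assms by measurable

lemma one_plus_le_exp: "1 + x \<le> exp (x::real)"
  by (rule exp_ge_add_one_self)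

text \<open>The newest sample is integrated first. The term of \<open>pinelis_pointwise\<close> that
  is linear in \<open>Y\<close> has mean zero, so each sample contributes one factor, the mean of
  \<open>exp t - t\<close> at the norm of \<open>Y\<close>; the number of coordinates never
  enters.\<close>

lemma nn_integral_cosh_sum_le:
  fixes Y :: "'j \<Rightarrow> 'a \<Rightarrow> real"
  assumes M: "prob_space M" and J: "finite J"
    and Y[measurable]: "\<And>j. j \<in> J \<Longrightarrow> Y j \<in> borel_measurable M"
    and int: "integrable M (\<lambda>x. exp (L2_set (\<lambda>j. Y j x) J))"
    and mean: "\<And>j. j \<in> J \<Longrightarrow> (\<integral>x. Y j x \<partial>M) = 0"
  shows "(\<integral>\<^sup>+z. ennreal (cosh (L2_set (\<lambda>j. \<Sum>i<l. Y j (z i)) J)) \<partial>(PiM {..<l::nat} (\<lambda>_. M)))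
    \<le> ennreal ((\<integral>x. exp (L2_set (\<lambda>j. Y j x) J) - L2_set (\<lambda>j. Y j x) J \<partial>M) ^ l)"
proof -
  interpret prob_space M by fact
  interpret product_sigma_finite "\<lambda>_::nat. M" by standard
  have intL: "integrable M (\<lambda>x. L2_set (\<lambda>j. Y j x) J)"
    using int by (rule Bochner_Integration.integrable_bound)
      (auto intro!: AE_I2 simp: L2_set_nonneg intro: order_trans[OF _ one_plus_le_exp])
  have intY: "integrable M (Y j)" if "j \<in> J" for j
    using intL by (rule Bochner_Integration.integrable_bound)
      (use that J in \<open>auto intro!: AE_I2 abs_le_L2_set simp: L2_set_nonneg\<close>)
  define \<phi> where "\<phi> = (\<integral>x. exp (L2_set (\<lambda>j. Y j x) J) - L2_set (\<lambda>j. Y j x) J \<partial>M)"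
  have "\<phi> \<ge> 0" unfolding \<phi>_def
    by (intro integral_nonneg_AE AE_I2) (use one_plus_le_exp in \<open>smt (verit)\<close>)
  have "(\<integral>\<^sup>+z. ennreal (cosh (L2_set (\<lambda>j. \<Sum>i<l. Y j (z i)) J)) \<partial>(PiM {..<l} (\<lambda>_. M))) \<le> ennreal (\<phi> ^ l)"
  proof (induction l)
    case 0
    show ?case by (simp add: PiM_empty nn_integral_count_space_finite L2_set_def)
  next
    case (Suc l)
    have meas: "(\<lambda>z. ennreal (cosh (L2_set (\<lambda>j. \<Sum>i<Suc l. Y j (z i)) J)))
        \<in> borel_measurable (PiM (insert l {..<l}) (\<lambda>_. M))"
    proof -
      have [measurable]: "(\<lambda>z. Y j (z i)) \<in> borel_measurable (PiM (insert l {..<l}) (\<lambda>_. M))"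
        if "j \<in> J" "i < Suc l" for i j
        using that by (intro measurable_compose[where f = "\<lambda>z. z i", OF _ Y] measurable_component_singleton) auto
      have [measurable]: "(\<lambda>x::real. cosh x) \<in> borel_measurable borel"
        by (intro borel_measurable_continuous_onI continuous_intros)
      show ?thesis by measurable
    qed
    have "(\<integral>\<^sup>+z. ennreal (cosh (L2_set (\<lambda>j. \<Sum>i<Suc l. Y j (z i)) J)) \<partial>(PiM {..<Suc l} (\<lambda>_. M)))
      = (\<integral>\<^sup>+z. (\<integral>\<^sup>+y. ennreal (cosh (L2_set (\<lambda>j. \<Sum>i<Suc l. Y j ((z(l := y)) i)) J)) \<partial>M) \<partial>(PiM {..<l} (\<lambda>_. M)))"
      unfolding lessThan_Suc[of l, symmetric]
      by (subst lessThan_Suc[of l], rule product_nn_integral_insert)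
        (use meas in \<open>auto simp: lessThan_Suc\<close>)
    also have "\<dots> = (\<integral>\<^sup>+z. (\<integral>\<^sup>+y. ennreal (cosh (L2_set (\<lambda>j. (\<Sum>i<l. Y j (z i)) + Y j y) J)) \<partial>M) \<partial>(PiM {..<l} (\<lambda>_. M)))"
      by simp
    also have "\<dots> \<le> (\<integral>\<^sup>+z. ennreal (cosh (L2_set (\<lambda>j. \<Sum>i<l. Y j (z i)) J)) * ennreal \<phi> \<partial>(PiM {..<l} (\<lambda>_. M)))"
    proof (rule nn_integral_mono)
      fix z assume "z \<in> space (PiM {..<l} (\<lambda>_. M))"
      define x where "x = (\<lambda>j. \<Sum>i<l. Y j (z i))"
      define g where "g = (\<lambda>y. cosh (L2_set x J) * (exp (L2_set (\<lambda>j. Y j y) J) - L2_set (\<lambda>j. Y j y) J)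
          + sinh (L2_set x J) / L2_set x J * (\<Sum>j\<in>J. x j * Y j y))"
      have "integrable M g" unfolding g_def using int intL intY by auto
      moreover have "(\<integral>y. g y \<partial>M) = cosh (L2_set x J) * \<phi>"
        unfolding g_def \<phi>_def using int intL intY mean
        by (simp add: Bochner_Integration.integral_add Bochner_Integration.integral_sum)
      ultimately have "(\<integral>\<^sup>+y. ennreal (cosh (L2_set (\<lambda>j. x j + Y j y) J)) \<partial>M) \<le> ennreal (cosh (L2_set x J) * \<phi>)"
        using nn_integral_le_integral[of M g "\<lambda>y. cosh (L2_set (\<lambda>j. x j + Y j y) J)"] pinelis_pointwise[OF J, of x]
        by (auto simp: g_def less_imp_le[OF cosh_real_pos])
      thus "(\<integral>\<^sup>+y. ennreal (cosh (L2_set (\<lambda>j. (\<Sum>i<l. Y j (z i)) + Y j y) J)) \<partial>M)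
          \<le> ennreal (cosh (L2_set (\<lambda>j. \<Sum>i<l. Y j (z i)) J)) * ennreal \<phi>"
        unfolding x_def using \<open>\<phi> \<ge> 0\<close> by (simp add: ennreal_mult less_imp_le[OF cosh_real_pos])
    qed
    also have "\<dots> = (\<integral>\<^sup>+z. ennreal (cosh (L2_set (\<lambda>j. \<Sum>i<l. Y j (z i)) J)) \<partial>(PiM {..<l} (\<lambda>_. M))) * ennreal \<phi>"
    proof (rule nn_integral_multc)
      have [measurable]: "(\<lambda>z. Y j (z i)) \<in> borel_measurable (PiM {..<l} (\<lambda>_. M))"
        if "j \<in> J" "i < l" for i j
        using that by (intro measurable_compose[where f = "\<lambda>z. z i", OF _ Y] measurable_component_singleton) auto
      have [measurable]: "(\<lambda>x::real. cosh x) \<in> borel_measurable borel"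
        by (intro borel_measurable_continuous_onI continuous_intros)
      show "(\<lambda>z. ennreal (cosh (L2_set (\<lambda>j. \<Sum>i<l. Y j (z i)) J))) \<in> borel_measurable (PiM {..<l} (\<lambda>_. M))"
        by measurable
    qed
    also have "\<dots> \<le> ennreal (\<phi> ^ l) * ennreal \<phi>"
      using Suc by (intro mult_right_mono) auto
    also have "\<dots> = ennreal (\<phi> ^ Suc l)" using \<open>\<phi> \<ge> 0\<close> by (simp add: ennreal_mult' mult.commute)
    finally show ?case .
  qed
  thus ?thesis by (simp add: \<phi>_def)
qed


text \<open>Convexity of the norm by duality: the vector of means is tested against itself.\<close>

lemma L2_set_integral_le:
  fixes X :: "'j \<Rightarrow> 'a \<Rightarrow> real"
  assumes J: "finite J" and X: "\<And>j. j \<in> J \<Longrightarrow> integrable M (X j)"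
    and int: "integrable M (\<lambda>x. L2_set (\<lambda>j. X j x) J)"
  shows "L2_set (\<lambda>j. \<integral>x. X j x \<partial>M) J \<le> (\<integral>x. L2_set (\<lambda>j. X j x) J \<partial>M)"
proof -
  define m where "m j = (\<integral>x. X j x \<partial>M)" for j
  have "(L2_set m J)\<^sup>2 = (\<Sum>j\<in>J. m j * (\<integral>x. X j x \<partial>M))"
    unfolding L2_set_sq by (simp add: m_def power2_eq_square)
  also have "\<dots> = (\<integral>x. (\<Sum>j\<in>J. m j * X j x) \<partial>M)"
    using X by (simp add: Bochner_Integration.integral_sum)
  also have "\<dots> \<le> (\<integral>x. L2_set m J * L2_set (\<lambda>j. X j x) J \<partial>M)"
    using X int sum_mult_le_L2_set[of m _ J] by (intro integral_mono) (auto simp: abs_le_iff)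
  also have "\<dots> = L2_set m J * (\<integral>x. L2_set (\<lambda>j. X j x) J \<partial>M)" by simp
  finally have le: "L2_set m J * L2_set m J \<le> L2_set m J * (\<integral>x. L2_set (\<lambda>j. X j x) J \<partial>M)"
    by (simp add: power2_eq_square)
  have "L2_set m J \<le> (\<integral>x. L2_set (\<lambda>j. X j x) J \<partial>M)"
  proof (cases "L2_set m J = 0")
    case True
    thus ?thesis by (simp add: L2_set_nonneg integral_nonneg_AE)
  next
    case False
    hence "L2_set m J > 0" by (simp add: less_le L2_set_nonneg)
    thus ?thesis using le by simp
  qed
  thus ?thesis by (simp add: m_def[abs_def])
qed

lemma exp_minus_id_mono:
  fixes a b :: real assumes "0 \<le> a" "a \<le> b" shows "exp a - a \<le> exp b - b"
proof -
  have "exp a * (1 + (b - a)) \<le> exp a * exp (b - a)"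
    by (intro mult_left_mono one_plus_le_exp) auto
  moreover have "1 * (b - a) \<le> exp a * (b - a)"
    using assms by (intro mult_right_mono) auto
  ultimately show ?thesis by (simp add: algebra_simps flip: exp_add)
qed

lemma exp_minus_id_midpoint:
  "exp (a + b) - (a + b) \<le> (exp (2 * a) - 2 * a) / 2 + (exp (2 * b) - 2 * b) / (2::real)"
proof -
  have "0 \<le> (exp a - exp b)\<^sup>2" by simp
  hence "2 * exp (a + b) \<le> exp (2 * a) + exp (2 * b)"
    by (simp add: power2_eq_square algebra_simps flip: exp_add)
  thus ?thesis by (simp add: field_simps)
qed

text \<open>The assumption concerns the remainder \<open>exp t - 1 - t\<close> of the uncentred norm
  at the doubled argument \<open>2 * s\<close>. The doubling pays for centring: the norm of
  \<open>X\<close> minus its mean is at most the norm of \<open>X\<close> plus the mean norm, and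
  midpoint convexity of \<open>exp t - t\<close> separates the two. The factor 2 in front is the
  loss in \<open>exp t \<le> 2 * cosh t\<close>.\<close>

lemma vector_bernstein:
  fixes X :: "'j \<Rightarrow> 'a \<Rightarrow> real"
  assumes M: "prob_space M" and J: "finite J"
    and X[measurable]: "\<And>j. j \<in> J \<Longrightarrow> X j \<in> borel_measurable M"
    and s: "s > 0"
    and int: "integrable M (\<lambda>x. exp (2 * s * L2_set (\<lambda>j. X j x) J))"
    and v: "(\<integral>x. exp (2 * s * L2_set (\<lambda>j. X j x) J) - 1 - 2 * s * L2_set (\<lambda>j. X j x) J \<partial>M) \<le> v"
    and l: "l > 0"
  shows "measure (PiM {..<l::nat} (\<lambda>_. M)) {z \<in> space (PiM {..<l} (\<lambda>_. M)).
      t \<le> L2_set (\<lambda>j. (\<Sum>i<l. X j (z i)) / real l - (\<integral>x. X j x \<partial>M)) J}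
    \<le> 2 * exp (real l * v - s * real l * t)"
proof -
  interpret prob_space M by fact
  interpret P: product_prob_space "\<lambda>_::nat. M" "{..<l}" by standard
  define n where "n x = L2_set (\<lambda>j. X j x) J" for x
  have n0: "n x \<ge> 0" for x by (simp add: n_def L2_set_nonneg)
  have [measurable]: "n \<in> borel_measurable M" unfolding n_def by measurable
  have int': "integrable M (\<lambda>x. exp (2 * s * n x))" using int by (simp add: n_def)
  have intn: "integrable M n"
  proof (rule Bochner_Integration.integrable_bound[OF integrable_mult_right[OF int', of "1 / (2 * s)"]])
    show "AE x in M. norm (n x) \<le> norm (1 / (2 * s) * exp (2 * s * n x))"
    proof (rule AE_I2)
      fix x
      have "2 * s * n x \<le> exp (2 * s * n x)" using one_plus_le_exp[of "2 * s * n x"] by linarith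
      thus "norm (n x) \<le> norm (1 / (2 * s) * exp (2 * s * n x))" using s n0[of x] by (simp add: field_simps)
    qed
  qed simp
  have intX: "integrable M (X j)" if "j \<in> J" for j
    using intn by (rule Bochner_Integration.integrable_bound)
      (use that J n0 in \<open>auto intro!: AE_I2 abs_le_L2_set simp: n_def\<close>)
  define m where "m j = (\<integral>x. X j x \<partial>M)" for j
  define e where "e = (\<integral>x. n x \<partial>M)"
  have me: "L2_set m J \<le> e"
    unfolding m_def e_def n_def by (rule L2_set_integral_le[OF J intX intn[unfolded n_def[abs_def]]])
  have e0: "e \<ge> 0" using me L2_set_nonneg[of m J] by linarith
  define Y where "Y j x = s * (X j x - m j)" for j x
  have [measurable]: "Y j \<in> borel_measurable M" if "j \<in> J" for j unfolding Y_def using that by measurable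
  have Yle: "L2_set (\<lambda>j. Y j x) J \<le> s * n x + s * e" for x
  proof -
    have "L2_set (\<lambda>j. Y j x) J = s * L2_set (\<lambda>j. X j x + - m j) J"
      unfolding Y_def using s by (subst L2_set_right_distrib) auto
    also have "\<dots> \<le> s * (n x + L2_set (\<lambda>j. - m j) J)"
      unfolding n_def using s by (intro mult_left_mono L2_set_triangle_ineq) auto
    also have "L2_set (\<lambda>j. - m j) J = L2_set m J" by (simp add: L2_set_def)
    finally show ?thesis using mult_left_mono[OF me less_imp_le[OF s]] unfolding distrib_left by linarith
  qed
  have intsn: "integrable M (\<lambda>x. exp (s * n x + s * e))"
  proof (rule Bochner_Integration.integrable_bound[OF integrable_mult_right[OF int', of "exp (s * e)"]])
    show "AE x in M. norm (exp (s * n x + s * e)) \<le> norm (exp (s * e) * exp (2 * s * n x))"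
      using s n0 by (intro AE_I2) (simp flip: exp_add)
  qed simp
  have intYe: "integrable M (\<lambda>x. exp (L2_set (\<lambda>j. Y j x) J))"
    by (rule Bochner_Integration.integrable_bound[OF intsn]) (auto simp: Yle)
  have intYl: "integrable M (\<lambda>x. L2_set (\<lambda>j. Y j x) J)"
    by (rule Bochner_Integration.integrable_bound[OF intYe])
      (auto intro!: AE_I2 simp: L2_set_nonneg intro: order_trans[OF _ one_plus_le_exp])
  have prob1: "(\<integral>x. 1 \<partial>M) = (1::real)" by (simp add: prob_space)
  define \<phi> where "\<phi> = (\<integral>x. exp (L2_set (\<lambda>j. Y j x) J) - L2_set (\<lambda>j. Y j x) J \<partial>M)"
  define h where "h = (\<integral>x. exp (2 * s * n x) - 2 * s * n x \<partial>M)"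
  have inth: "integrable M (\<lambda>x. exp (2 * s * n x) - 2 * s * n x)" using int' intn by auto
  have jensen: "exp (2 * s * e) - 2 * s * e \<le> h"
  proof -
    \<comment> \<open>Jensen's inequality: the integrand is the tangent of \<open>exp t - t\<close>
      at \<open>t = 2 * s * e\<close>, and its linear part has mean zero.\<close>
    have eq: "(\<integral>x. exp (2 * s * e) - 2 * s * e + (exp (2 * s * e) - 1) * (2 * s * n x - 2 * s * e) \<partial>M)
        = exp (2 * s * e) - 2 * s * e"
      using intn by (simp add: prob_space e_def)
    have "(\<integral>x. exp (2 * s * e) - 2 * s * e + (exp (2 * s * e) - 1) * (2 * s * n x - 2 * s * e) \<partial>M) \<le> h"
      unfolding h_def
    proof (intro integral_mono)
      fix x
      have "exp (2 * s * e) * (1 + (2 * s * n x - 2 * s * e)) \<le> exp (2 * s * e) * exp (2 * s * n x - 2 * s * e)"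
        by (intro mult_left_mono one_plus_le_exp) auto
      also have "\<dots> = exp (2 * s * n x)" by (simp flip: exp_add)
      finally show "exp (2 * s * e) - 2 * s * e + (exp (2 * s * e) - 1) * (2 * s * n x - 2 * s * e)
          \<le> exp (2 * s * n x) - 2 * s * n x" by (simp add: algebra_simps)
    qed (use intn inth in auto)
    thus ?thesis using eq by simp
  qed
  have "\<phi> \<le> (\<integral>x. (exp (2 * s * n x) - 2 * s * n x) / 2 + (exp (2 * s * e) - 2 * s * e) / 2 \<partial>M)"
    unfolding \<phi>_def
  proof (intro integral_mono)
    fix x
    have "exp (L2_set (\<lambda>j. Y j x) J) - L2_set (\<lambda>j. Y j x) J \<le> exp (s * n x + s * e) - (s * n x + s * e)"
      by (intro exp_minus_id_mono L2_set_nonneg Yle)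
    also have "\<dots> \<le> (exp (2 * s * n x) - 2 * s * n x) / 2 + (exp (2 * s * e) - 2 * s * e) / 2"
      using exp_minus_id_midpoint[of "s * n x" "s * e"] by (simp add: mult.assoc)
    finally show "exp (L2_set (\<lambda>j. Y j x) J) - L2_set (\<lambda>j. Y j x) J
      \<le> (exp (2 * s * n x) - 2 * s * n x) / 2 + (exp (2 * s * e) - 2 * s * e) / 2" .
  qed (use intYe intYl inth in auto)
  also have "\<dots> = h / 2 + (exp (2 * s * e) - 2 * s * e) / 2"
    unfolding h_def using inth by (subst Bochner_Integration.integral_add) (auto simp: prob_space)
  also have "\<dots> \<le> h" using jensen by (simp add: field_simps)
  also have "h \<le> 1 + v"
  proof -
    have "(\<integral>x. exp (2 * s * n x) - 1 - 2 * s * n x \<partial>M) = (\<integral>x. (exp (2 * s * n x) - 2 * s * n x) - 1 \<partial>M)"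
      by (rule Bochner_Integration.integral_cong) auto
    also have "\<dots> = h - 1" unfolding h_def using inth prob1 by (subst Bochner_Integration.integral_diff) auto
    finally show ?thesis using v unfolding n_def by linarith
  qed
  also have "\<dots> \<le> exp v" by (rule one_plus_le_exp)
  finally have phi: "\<phi> \<le> exp v" .
  have phi0: "\<phi> \<ge> 0" unfolding \<phi>_def
    by (intro integral_nonneg_AE AE_I2) (use one_plus_le_exp in \<open>smt (verit)\<close>)
  have "(\<integral>\<^sup>+z. ennreal (cosh (L2_set (\<lambda>j. \<Sum>i<l. Y j (z i)) J)) \<partial>(PiM {..<l} (\<lambda>_. M))) \<le> ennreal (\<phi> ^ l)"
    unfolding \<phi>_def
    by (rule nn_integral_cosh_sum_le[OF M J _ intYe])
       (use intX prob1 in \<open>auto simp: Y_def m_def prob_space\<close>)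
  also have "\<dots> \<le> ennreal (exp (real l * v))"
    using phi phi0 power_mono[OF phi phi0, of l] by (intro ennreal_leI) (simp add: exp_of_nat_mult)
  finally have cb: "(\<integral>\<^sup>+z. ennreal (cosh (L2_set (\<lambda>j. \<Sum>i<l. Y j (z i)) J)) \<partial>(PiM {..<l} (\<lambda>_. M)))
      \<le> ennreal (exp (real l * v))" .
  define E where "E = {z \<in> space (PiM {..<l} (\<lambda>_. M)).
      t \<le> L2_set (\<lambda>j. (\<Sum>i<l. X j (z i)) / real l - m j) J}"
  have [measurable]: "(\<lambda>z. X j (z i)) \<in> borel_measurable (PiM {..<l} (\<lambda>_. M))"
    if "j \<in> J" "i < l" for i j
    using that by (intro measurable_compose[where f = "\<lambda>z. z i", OF _ X] measurable_component_singleton) auto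
  have [measurable]: "E \<in> sets (PiM {..<l} (\<lambda>_. M))" unfolding E_def by measurable
  \<comment> \<open>Markov's inequality for the cosh of the norm.\<close>
  have "ennreal (exp (s * real l * t) / 2) * emeasure (PiM {..<l} (\<lambda>_. M)) E
      = (\<integral>\<^sup>+z. ennreal (exp (s * real l * t) / 2) * indicator E z \<partial>(PiM {..<l} (\<lambda>_. M)))"
    by (subst nn_integral_cmult_indicator) auto
  also have "\<dots> \<le> (\<integral>\<^sup>+z. ennreal (cosh (L2_set (\<lambda>j. \<Sum>i<l. Y j (z i)) J)) \<partial>(PiM {..<l} (\<lambda>_. M)))"
  proof (rule nn_integral_mono)
    fix z
    have "exp (s * real l * t) / 2 \<le> cosh (L2_set (\<lambda>j. \<Sum>i<l. Y j (z i)) J)" if "z \<in> E"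
    proof -
      have eq: "(\<Sum>i<l. Y j (z i)) = s * real l * ((\<Sum>i<l. X j (z i)) / real l - m j)" for j
        using l by (simp add: Y_def sum_subtractf sum_distrib_left[symmetric] field_simps)
      have "L2_set (\<lambda>j. \<Sum>i<l. Y j (z i)) J = s * real l * L2_set (\<lambda>j. (\<Sum>i<l. X j (z i)) / real l - m j) J"
        unfolding eq using s by (subst L2_set_right_distrib) auto
      hence "s * real l * t \<le> L2_set (\<lambda>j. \<Sum>i<l. Y j (z i)) J"
        using that s by (auto simp: E_def mult_left_mono)
      hence "exp (s * real l * t) \<le> exp (L2_set (\<lambda>j. \<Sum>i<l. Y j (z i)) J)" by simp
      also have "\<dots> \<le> 2 * cosh (L2_set (\<lambda>j. \<Sum>i<l. Y j (z i)) J)"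
        by (simp add: exp_eq_cosh_plus_sinh sinh_le_cosh_real)
      finally show ?thesis by simp
    qed
    thus "ennreal (exp (s * real l * t) / 2) * indicator E z \<le> ennreal (cosh (L2_set (\<lambda>j. \<Sum>i<l. Y j (z i)) J))"
      by (cases "z \<in> E") (auto intro: ennreal_leI)
  qed
  also note cb
  finally have le: "ennreal (exp (s * real l * t) / 2) * emeasure (PiM {..<l} (\<lambda>_. M)) E \<le> ennreal (exp (real l * v))" .
  have "ennreal (exp (s * real l * t) / 2 * measure (PiM {..<l} (\<lambda>_. M)) E)
      = ennreal (exp (s * real l * t) / 2) * emeasure (PiM {..<l} (\<lambda>_. M)) E"
    unfolding P.emeasure_eq_measure by (rule ennreal_mult) auto
  hence "ennreal (exp (s * real l * t) / 2 * measure (PiM {..<l} (\<lambda>_. M)) E) \<le> ennreal (exp (real l * v))"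
    using le by argo
  hence "exp (s * real l * t) / 2 * measure (PiM {..<l} (\<lambda>_. M)) E \<le> exp (real l * v)"
    by (rule ennreal_le_iff[THEN iffD1, rotated]) auto
  hence "measure (PiM {..<l} (\<lambda>_. M)) E \<le> 2 * exp (real l * v - s * real l * t)"
    by (simp add: exp_diff field_simps)
  thus ?thesis by (simp add: E_def m_def)
qed

section \<open>Gram--Schmidt and the representer theorem\<close>

text \<open>Vectors are sequences, so that the space of dimension \<open>m\<close> is the set of
  sequences vanishing from \<open>m\<close> on and induction on the dimension stays in one type. The
  instances are a regularized Gram matrix and a regularized L2 product.\<close>

locale sym_bilinear =
  fixes B :: "(nat \<Rightarrow> real) \<Rightarrow> (nat \<Rightarrow> real) \<Rightarrow> real"
  assumes sym: "B x y = B y x"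
    and lin: "B (\<lambda>a. x a + t * y a) z = B x z + t * B y z"
begin

lemma zero_left: "B (\<lambda>_. 0) z = 0"
  using lin[of "\<lambda>_. 0" 1 "\<lambda>_. 0" z] by simp

lemma scale_left: "B (\<lambda>a. t * y a) z = t * B y z"
  using lin[of "\<lambda>_. 0" t y z] by (simp add: zero_left)

lemma sum_left: "B (\<lambda>a. \<Sum>j<n. c j * w j a) z = (\<Sum>j<n::nat. c j * B (w j) z)"
proof (induction n)
  case (Suc n)
  show ?case using lin[of "\<lambda>a. \<Sum>j<n. c j * w j a" "c n" "w n" z] Suc by simp
qed (simp add: zero_left)

text \<open>The expansion in the last conjunct does the work of inverting a positive definite
  matrix. The induction step orthogonalizes the new unit vector against the basis found so
  far.\<close>

lemma gram_schmidt:
  assumes "\<And>x. \<lbrakk>\<forall>a\<ge>m. x a = 0; \<exists>a. x a \<noteq> 0\<rbrakk> \<Longrightarrow> B x x > 0"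
  shows "\<exists>w. (\<forall>j<m. \<forall>a\<ge>m. w j a = 0)
    \<and> (\<forall>j<m. \<forall>k<m. B (w j) (w k) = (if j = k then 1 else 0))
    \<and> (\<forall>x. (\<forall>a\<ge>m. x a = 0) \<longrightarrow> (\<forall>a. x a = (\<Sum>j<m. B x (w j) * w j a)))"
  using assms
proof (induction m)
  case (Suc m)
  have "B x x > 0" if "\<forall>a\<ge>m. x a = 0" "\<exists>a. x a \<noteq> 0" for x
    using Suc.prems[of x] that by auto
  from Suc.IH[OF this] obtain w where W: "(\<forall>j<m. \<forall>a\<ge>m. w j a = 0)
    \<and> (\<forall>j<m. \<forall>k<m. B (w j) (w k) = (if j = k then 1 else 0))
    \<and> (\<forall>x. (\<forall>a\<ge>m. x a = 0) \<longrightarrow> (\<forall>a. x a = (\<Sum>j<m. B x (w j) * w j a)))" by (rule exE)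
  note supp = W[THEN conjunct1, rule_format]
  note orth = W[THEN conjunct2, THEN conjunct1, rule_format]
  note exp = W[THEN conjunct2, THEN conjunct2, rule_format]
  define e :: "nat \<Rightarrow> real" where "e a = (if a = m then 1 else 0)" for a
  define u where "u a = e a + (- 1) * (\<Sum>j<m. B e (w j) * w j a)" for a
  have um: "u m = 1"
    using supp[of _ m] by (simp add: u_def e_def)
  have usupp: "u a = 0" if "a \<ge> Suc m" for a
    unfolding u_def e_def using supp that by simp
  have Bu: "B u (w k) = 0" if "k < m" for k
  proof -
    have "(\<Sum>j<m. B e (w j) * B (w j) (w k)) = (\<Sum>j<m. if j = k then B e (w j) else 0)"
      using orth that by (intro sum.cong) auto
    hence "B (\<lambda>a. \<Sum>j<m. B e (w j) * w j a) (w k) = B e (w k)"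
      unfolding sum_left using that by simp
    thus ?thesis unfolding u_def[abs_def] lin by simp
  qed
  define q where "q = B u u"
  have q: "q > 0" unfolding q_def using Suc.prems[of u] um usupp by (metis zero_neq_one)
  define w' where "w' = w(m := (\<lambda>a. (1 / sqrt q) * u a))"
  have w'm: "w' m = (\<lambda>a. (1 / sqrt q) * u a)" and w'j: "\<And>j. j < m \<Longrightarrow> w' j = w j"
    by (auto simp: w'_def)
  have Bw'm: "B (w' m) z = 1 / sqrt q * B u z" for z unfolding w'm by (rule scale_left)
  show ?case
  proof (intro exI[of _ w'] conjI allI impI)
    fix j a assume "j < Suc m" "a \<ge> Suc m"
    thus "w' j a = 0" using supp usupp by (cases "j = m") (auto simp: w'm w'j)
  next
    fix j k assume jk: "j < Suc m" "k < Suc m"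
    have "B (w' m) (w' m) = 1 / sqrt q * (1 / sqrt q * q)"
      using Bw'm[of "w' m"] Bw'm[of u] sym[of u "w' m"] by (simp add: q_def)
    hence "B (w' m) (w' m) = 1" using q by simp
    moreover have mk: "B (w' m) (w' k) = 0" if "k < m" for k
      using that by (simp add: Bw'm w'j Bu)
    moreover have "B (w' k) (w' m) = 0" if "k < m" for k
      using mk[OF that] sym[of "w' k" "w' m"] by simp
    ultimately show "B (w' j) (w' k) = (if j = k then 1 else 0)"
      using orth jk by (cases "j = m"; cases "k = m") (auto simp: w'j)
  next
    fix x :: "nat \<Rightarrow> real" and a assume x: "\<forall>a\<ge>Suc m. x a = 0"
    \<comment> \<open>\<open>u\<close> has coordinate 1 at \<open>m\<close>, so removing
      \<open>x m * u\<close> leaves a vector of the smaller span, to which the induction hypothesis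
      applies. That vector is orthogonal to \<open>u\<close>, whence
      \<open>B x u = x m * q\<close>.\<close>
    define y where "y a = x a + (- x m) * u a" for a
    have "y a = 0" if "a \<ge> m" for a
      using x usupp[of a] um that unfolding y_def by (cases "a = m") auto
    hence ey: "y a = (\<Sum>j<m. B y (w j) * w j a)" for a by (intro exp) simp
    have Byw: "B y (w j) = B x (w j)" if "j < m" for j
      unfolding y_def[abs_def] lin using Bu[OF that] by simp
    have "B y u = (\<Sum>j<m. B y (w j) * B (w j) u)"

    proof -
      have "(\<lambda>a. \<Sum>j<m. B y (w j) * w j a) = y" using ey by auto
      with sum_left[of "\<lambda>j. B y (w j)" w m u] show ?thesis by (simp only:)
    qed
    also have "\<dots> = 0" using Bu sym[of _ u] by (intro sum.neutral) auto
    finally have "B y u = 0" .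
    hence Bxu: "B x u = x m * q" unfolding y_def[abs_def] lin q_def by simp
    have "x a = y a + x m * u a" by (simp add: y_def)
    also have "y a = (\<Sum>j<m. B x (w' j) * w' j a)" using ey[of a] by (simp add: Byw w'j)
    also have "x m * u a = B x (w' m) * w' m a"
      using q Bw'm[of x] sym[of x "w' m"] sym[of u x] by (simp add: Bxu w'm)
    finally show "x a = (\<Sum>j<Suc m. B x (w' j) * w' j a)" by simp
  qed
qed auto

end

text \<open>The regularized matrix is positive definite. In an orthonormal basis for its form
  \<open>B\<close>, the solution is the Riesz representer of the pairing with
  \<open>y\<close>.\<close>

lemma ridge_system_solvable:
  fixes G :: "nat \<Rightarrow> nat \<Rightarrow> real"
  assumes sym: "\<And>i j. i < l \<Longrightarrow> j < l \<Longrightarrow> G i j = G j i"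
    and psd: "\<And>c. 0 \<le> (\<Sum>i<l. \<Sum>j<l. c i * c j * G i j)" and lam: "lam > 0"
  shows "\<exists>c. \<forall>i<l. (\<Sum>j<l. c j * G j i) + lam * c i = y i"
proof -
  define B where "B c z = (\<Sum>i<l. \<Sum>j<l. c i * z j * G i j) + lam * (\<Sum>i<l. c i * z i)" for c z
  interpret sym_bilinear B
  proof
    fix x y z :: "nat \<Rightarrow> real" and t
    have "(\<Sum>i<l. \<Sum>j<l. x i * y j * G i j) = (\<Sum>j<l. \<Sum>i<l. x i * y j * G i j)" by (rule sum.swap)
    also have "\<dots> = (\<Sum>j<l. \<Sum>i<l. y j * x i * G j i)" using sym by (intro sum.cong refl) auto
    finally show "B x y = B y x" unfolding B_def by (simp add: mult.commute)
    show "B (\<lambda>a. x a + t * y a) z = B x z + t * B y z"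
      unfolding B_def by (simp add: algebra_simps sum.distrib sum_distrib_left)
  qed
  have "B x x > 0" if x0: "\<forall>a\<ge>l. x a = 0" and x1: "\<exists>a. x a \<noteq> 0" for x
  proof -
    obtain a where "x a \<noteq> 0" using x1 by blast
    with x0 have a: "x a \<noteq> 0" "a < l" by (auto simp: not_le[symmetric])
    hence "(\<Sum>i<l. x i * x i) > 0" by (intro sum_pos2[of _ a]) (auto simp: zero_less_mult_iff)
    thus ?thesis unfolding B_def using psd[of x] lam by (simp add: add_nonneg_pos)
  qed
  from gram_schmidt[OF this] obtain w where W: "(\<forall>j<l. \<forall>a\<ge>l. w j a = 0)
    \<and> (\<forall>j<l. \<forall>k<l. B (w j) (w k) = (if j = k then 1 else 0))
    \<and> (\<forall>x. (\<forall>a\<ge>l. x a = 0) \<longrightarrow> (\<forall>a. x a = (\<Sum>j<l. B x (w j) * w j a)))" by (rule exE)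
  note exp = W[THEN conjunct2, THEN conjunct2, rule_format]
  define c where "c = (\<lambda>a. \<Sum>j<l. (\<Sum>b<l. y b * w j b) * w j a)"
  show ?thesis
  proof (intro exI[of _ c] allI impI)
    fix i assume i: "i < l"
    define e :: "nat \<Rightarrow> real" where "e a = (if a = i then 1 else 0)" for a
    have e: "e a = (\<Sum>j<l. B e (w j) * w j a)" for a by (rule exp) (use i in \<open>auto simp: e_def\<close>)
    have "B c e = (\<Sum>j<l. (\<Sum>b<l. y b * w j b) * B (w j) e)" unfolding c_def by (rule sum_left)
    also have "\<dots> = (\<Sum>j<l. \<Sum>b<l. y b * (B e (w j) * w j b))"
      by (simp add: sum_distrib_left sum_distrib_right sym[of e] algebra_simps)
    also have "\<dots> = (\<Sum>b<l. y b * (\<Sum>j<l. B e (w j) * w j b))"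
      by (subst sum.swap) (simp add: sum_distrib_left)
    also have "\<dots> = (\<Sum>b<l. y b * e b)" using e by simp
    also have "\<dots> = y i" unfolding e_def using i by (simp add: if_distrib cong: if_cong)
    also have "B c e = (\<Sum>j<l. c j * G j i) + lam * c i"
      unfolding B_def e_def using i by (simp add: if_distrib if_distribR cong: if_cong)
    finally show "(\<Sum>j<l. c j * G j i) + lam * c i = y i" by simp
  qed
qed

text \<open>Source of the Cauchy-Schwarz inequalities for energies and for integrals below. With
  \<open>c = 0\<close> it forces \<open>b = 0\<close>, which is how the uniqueness of the minimizer
  is concluded.\<close>

lemma quadratic_nonneg_discriminant:
  fixes a b c :: real
  assumes nn: "\<And>t. 0 \<le> t\<^sup>2 * a + 2 * t * b + c"
  shows "b\<^sup>2 \<le> a * c"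
proof (cases "a = 0")
  case True
  have "b = 0"
  proof (rule ccontr)
    assume "b \<noteq> 0"
    thus False using nn[of "- (c + 1) / (2 * b)"] True by (simp add: field_simps)
  qed
  thus ?thesis using True by simp
next
  case False
  have "a > 0"
  proof (rule ccontr)
    assume "\<not> a > 0"
    hence a: "a < 0" using False by simp
    define t where "t = (2 * \<bar>b\<bar> + \<bar>c\<bar> + 1) / (- a) + 1"
    have t1: "t \<ge> 1" unfolding t_def using a by (simp add: divide_nonneg_neg divide_nonpos_neg divide_le_0_iff)
    have "t * (- a) = 2 * \<bar>b\<bar> + \<bar>c\<bar> + 1 - a" unfolding t_def using a by (simp add: field_simps)
    hence ta: "t * (- a) > 2 * \<bar>b\<bar> + \<bar>c\<bar>" using a by linarith
    have "t * (t * (- a)) > t * (2 * \<bar>b\<bar> + \<bar>c\<bar>)" using mult_strict_left_mono[OF ta, of t] t1 by simp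
    moreover have "t * (2 * b) \<le> t * (2 * \<bar>b\<bar>)" "t * \<bar>c\<bar> \<ge> 1 * \<bar>c\<bar>"
      using t1 mult_right_mono[OF t1, of "\<bar>c\<bar>"] by (auto intro!: mult_left_mono)
    ultimately show False using nn[of t] by (simp add: power2_eq_square algebra_simps)
  qed
  thus ?thesis using nn[of "- b / a"] by (simp add: field_simps power2_eq_square)
qed

section \<open>Finitely supported signed measures and the RKHS norm by duality\<close>

lemma sum_lessThan_add: "(\<Sum>i<m + n::nat. g i) = (\<Sum>i<m. g i) + (\<Sum>i<n. g (m + i) :: real)"
  by (induction n) auto

text \<open>The integral of \<open>f\<close> against the signed measure with atoms \<open>xs\<close>
  and weights \<open>cs\<close>; \<open>quad_form\<close> is the energy of this measure. Lists match
  the quantification in \<open>rkhs_bound\<close>, and atoms may repeat.\<close>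

definition lin_fun :: "'a list \<Rightarrow> real list \<Rightarrow> ('a \<Rightarrow> real) \<Rightarrow> real" where
  "lin_fun xs cs f = (\<Sum>i<length xs. cs ! i * f (xs ! i))"

definition quad_form :: "('a \<Rightarrow> 'a \<Rightarrow> real) \<Rightarrow> 'a list \<Rightarrow> real list \<Rightarrow> real" where
  "quad_form K xs cs = (\<Sum>i<length xs. \<Sum>j<length xs. cs ! i * cs ! j * K (xs ! i) (xs ! j))"

definition psd_on :: "'a set \<Rightarrow> ('a \<Rightarrow> 'a \<Rightarrow> real) \<Rightarrow> bool" where
  "psd_on S K \<longleftrightarrow> (\<forall>x\<in>S. \<forall>y\<in>S. K x y = K y x) \<and>
     (\<forall>xs cs. set xs \<subseteq> S \<longrightarrow> length cs = length xs \<longrightarrow> 0 \<le> quad_form K xs cs)"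

lemma quad_form_eq: "quad_form K xs cs = lin_fun xs cs (\<lambda>y. lin_fun xs cs (\<lambda>x. K x y))"
  unfolding quad_form_def lin_fun_def
  by (subst sum.swap) (simp add: sum_distrib_left algebra_simps)

lemma lin_fun_append:
  "length cs = length xs \<Longrightarrow> lin_fun (xs @ ys) (cs @ ds) f = lin_fun xs cs f + lin_fun ys ds f"
  unfolding lin_fun_def by (simp add: sum_lessThan_add nth_append)

lemma lin_fun_add: "lin_fun xs cs (\<lambda>x. f x + g x) = lin_fun xs cs f + lin_fun xs cs g"
  unfolding lin_fun_def by (simp add: algebra_simps sum.distrib)

lemma lin_fun_scale: "length cs = length xs \<Longrightarrow> lin_fun xs (map ((*) t) cs) f = t * lin_fun xs cs f"
  unfolding lin_fun_def by (simp add: sum_distrib_left mult.assoc)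

lemma lin_fun_mult: "lin_fun xs cs (\<lambda>x. t * f x) = t * lin_fun xs cs f"
  unfolding lin_fun_def by (simp add: sum_distrib_left algebra_simps)

lemma lin_fun_cong: "(\<And>x. x \<in> set xs \<Longrightarrow> f x = g x) \<Longrightarrow> lin_fun xs cs f = lin_fun xs cs g"
  unfolding lin_fun_def by simp

lemma lin_fun_swap:
  assumes "psd_on S K" "set xs \<subseteq> S" "set ys \<subseteq> S"
  shows "lin_fun xs cs (\<lambda>x. lin_fun ys ds (\<lambda>y. K y x)) = lin_fun ys ds (\<lambda>x. lin_fun xs cs (\<lambda>y. K y x))"
proof -
  have "K (xs ! i) (ys ! j) = K (ys ! j) (xs ! i)" if "i < length xs" "j < length ys" for i j
    using assms that unfolding psd_on_def by (meson nth_mem subset_iff)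
  thus ?thesis
    unfolding lin_fun_def sum_distrib_left by (subst sum.swap) (auto intro!: sum.cong simp: algebra_simps)
qed

lemma quad_form_append:
  assumes "psd_on S K" "set xs \<subseteq> S" "set ys \<subseteq> S" "length cs = length xs" "length ds = length ys"
  shows "quad_form K (xs @ ys) (map ((*) t) cs @ ds)
    = t\<^sup>2 * quad_form K xs cs + 2 * t * lin_fun ys ds (\<lambda>x. lin_fun xs cs (\<lambda>y. K y x)) + quad_form K ys ds"
  unfolding quad_form_eq using assms lin_fun_swap[OF assms(1-3), of cs ds]
  by (simp add: lin_fun_append lin_fun_scale lin_fun_add lin_fun_mult power2_eq_square algebra_simps)

lemma psd_cauchy_schwarz:
  assumes "psd_on S K" "set xs \<subseteq> S" "set ys \<subseteq> S" "length cs = length xs" "length ds = length ys"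
  shows "(lin_fun ys ds (\<lambda>x. lin_fun xs cs (\<lambda>y. K y x)))\<^sup>2 \<le> quad_form K xs cs * quad_form K ys ds"
proof (rule quadratic_nonneg_discriminant)
  fix t
  have "0 \<le> quad_form K (xs @ ys) (map ((*) t) cs @ ds)"
    using assms unfolding psd_on_def by auto
  thus "0 \<le> t\<^sup>2 * quad_form K xs cs + 2 * t * lin_fun ys ds (\<lambda>x. lin_fun xs cs (\<lambda>y. K y x)) + quad_form K ys ds"
    by (simp add: quad_form_append[OF assms])
qed

lemma rkhs_bound_alt:
  "rkhs_bound K S f c \<longleftrightarrow> (\<forall>xs cs. set xs \<subseteq> S \<longrightarrow> length cs = length xs \<longrightarrow>
     (lin_fun xs cs f)\<^sup>2 \<le> c * quad_form K xs cs)"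
  unfolding rkhs_bound_def lin_fun_def quad_form_def ..

lemma two_mult_le_of_square_le:
  fixes a q c :: real
  assumes "a\<^sup>2 \<le> c * q" "0 \<le> q" "0 \<le> c" shows "2 * a \<le> c + q"
proof -
  have "(2 * a)\<^sup>2 \<le> (c + q)\<^sup>2"
    using assms(1) zero_le_power2[of "c - q"] by (simp add: power2_eq_square algebra_simps)
  thus ?thesis using assms by (intro power2_le_imp_le[of "2 * a"]) auto
qed

text \<open>Half of the dual description of the squared norm as the supremum of twice the value
  minus the energy. It follows from the defining inequality, since
  \<open>a\<^sup>2 \<le> c * q\<close> gives \<open>2 * a \<le> c + q\<close>. In this form the
  infimum is bounded below by an expression linear in \<open>f\<close>.\<close>

lemma rkhs_norm2_ge:
  assumes K: "psd_on S K" and f: "in_rkhs K S f" and xs: "set xs \<subseteq> S" "length cs = length xs"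
  shows "2 * lin_fun xs cs f - quad_form K xs cs \<le> rkhs_norm2 K S f"
  unfolding rkhs_norm2_def
proof (rule cInf_greatest)
  obtain c where c: "rkhs_bound K S f c" using f unfolding in_rkhs_def by blast
  \<comment> \<open>A bound \<open>c\<close> may be negative if all energies vanish, whereas the
    infimum runs over non-negative bounds.\<close>
  have "rkhs_bound K S f (max c 0)"
    unfolding rkhs_bound_alt
  proof (intro allI impI)
    fix xs and cs :: "real list" assume *: "set xs \<subseteq> S" "length cs = length xs"
    hence "0 \<le> quad_form K xs cs" using K unfolding psd_on_def by blast
    hence "c * quad_form K xs cs \<le> max c 0 * quad_form K xs cs" by (intro mult_right_mono) auto
    thus "(lin_fun xs cs f)\<^sup>2 \<le> max c 0 * quad_form K xs cs"
      using c * unfolding rkhs_bound_alt by (meson order_trans)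
  qed
  thus "{c. 0 \<le> c \<and> rkhs_bound K S f c} \<noteq> {}" by (metis (mono_tags) empty_iff max.cobounded2 mem_Collect_eq)
next
  fix c assume "c \<in> {c. 0 \<le> c \<and> rkhs_bound K S f c}"
  hence "0 \<le> c" "(lin_fun xs cs f)\<^sup>2 \<le> c * quad_form K xs cs" using xs unfolding rkhs_bound_alt by auto
  moreover have "0 \<le> quad_form K xs cs" using K xs unfolding psd_on_def by blast
  ultimately show "2 * lin_fun xs cs f - quad_form K xs cs \<le> c"
    using two_mult_le_of_square_le by fastforce
qed

text \<open>Representer theorem. The lower bound on the norm, tested on the atoms of the
  candidate, gives minimality; testing it with one more atom \<open>x\<close> pins down the value at \<open>x\<close>.\<close>
lemma rls_estimator_representer:
  fixes K :: "'a \<Rightarrow> 'a \<Rightarrow> real"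
  assumes K: "psd_on S K" and xs: "set xs \<subseteq> S" "xs \<noteq> []" and lam: "lam > 0"
  shows "\<exists>c. (\<forall>i<length xs. c i * (real (length xs) * lam)
          = ys ! i - (\<Sum>j<length xs. c j * K (xs ! j) (xs ! i)))
    \<and> rls_estimator K S xs ys lam = (\<lambda>x. if x \<in> S then (\<Sum>j<length xs. c j * K (xs ! j) x) else 0)"
proof -
  define l where "l = length xs"
  have l: "l > 0" using xs by (simp add: l_def)
  have xS: "xs ! i \<in> S" if "i < l" for i using xs that by (auto simp: l_def)
  have sym: "K x y = K y x" if "x \<in> S" "y \<in> S" for x y using K that unfolding psd_on_def by blast
  have "\<exists>c. \<forall>i<l. (\<Sum>j<l. c j * K (xs ! j) (xs ! i)) + (real l * lam) * c i = ys ! i"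
  proof (rule ridge_system_solvable)
    fix c :: "nat \<Rightarrow> real"
    have "0 \<le> quad_form K xs (map c [0..<l])" using K xs unfolding psd_on_def by (simp add: l_def)
    thus "0 \<le> (\<Sum>i<l. \<Sum>j<l. c i * c j * K (xs ! i) (xs ! j))" by (simp add: quad_form_def l_def)
  qed (use sym xS lam l in auto)
  then obtain c where c: "\<And>i. i < l \<Longrightarrow> (\<Sum>j<l. c j * K (xs ! j) (xs ! i)) + (real l * lam) * c i = ys ! i"
    by blast
  define cs where "cs = map c [0..<l]"
  have lcs: "length cs = length xs" by (simp add: cs_def l_def)
  have lf: "lin_fun xs cs g = (\<Sum>j<l. c j * g (xs ! j))" for g by (simp add: lin_fun_def cs_def l_def)
  define f where "f x = (if x \<in> S then (\<Sum>j<l. c j * K (xs ! j) x) else 0)" for x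
  define Q where "Q = quad_form K xs cs"
  have fS: "f x = lin_fun xs cs (\<lambda>y. K y x)" if "x \<in> S" for x using that by (simp add: f_def lf)
  have cf: "real l * lam * c i = ys ! i - f (xs ! i)" if "i < l" for i
    using c[OF that] xS[OF that] by (simp add: f_def algebra_simps)
  have Qf: "Q = lin_fun xs cs f"
    unfolding Q_def quad_form_eq using xs fS by (intro lin_fun_cong) auto
  have fb: "rkhs_bound K S f Q"
    unfolding rkhs_bound_alt Q_def
  proof (intro allI impI)
    fix zs and ds :: "real list" assume *: "set zs \<subseteq> S" "length ds = length zs"
    have "lin_fun zs ds f = lin_fun zs ds (\<lambda>x. lin_fun xs cs (\<lambda>y. K y x))"
      using * fS by (intro lin_fun_cong) auto
    thus "(lin_fun zs ds f)\<^sup>2 \<le> quad_form K xs cs * quad_form K zs ds"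
      using psd_cauchy_schwarz[OF K xs(1) *(1) lcs *(2)] by simp
  qed
  have Q0: "Q \<ge> 0" using K xs lcs unfolding Q_def psd_on_def by blast
  have fin: "in_rkhs K S f" unfolding in_rkhs_def using fb by (auto simp: f_def)
  have nf: "rkhs_norm2 K S f \<le> Q"
    unfolding rkhs_norm2_def using fb Q0 by (intro cInf_lower) auto
  define J where "J = rls_obj K S xs ys lam"
  \<comment> \<open>Expanding the square around \<open>f\<close>, the cross term is computed from
    the normal equations \<open>cf\<close> and merges with the norm. Both extra terms on the left
    are non-negative for \<open>g\<close> in the RKHS. For a second minimizer they vanish, which
    gives agreement on the sample and then the norm \<open>Q\<close>.\<close>
  have key: "J f + 1 / real l * (\<Sum>i<l. (g (xs ! i) - f (xs ! i))\<^sup>2)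
      + lam * (rkhs_norm2 K S g - (2 * lin_fun xs cs g - Q)) \<le> J g" for g
  proof -
    have sq: "(g (xs ! i) - ys ! i)\<^sup>2 = (f (xs ! i) - ys ! i)\<^sup>2 + (g (xs ! i) - f (xs ! i))\<^sup>2
        - 2 * (real l * lam) * (c i * (g (xs ! i) - f (xs ! i)))" if "i < l" for i
    proof -
      have "(g (xs ! i) - ys ! i)\<^sup>2 = (f (xs ! i) - ys ! i)\<^sup>2 + (g (xs ! i) - f (xs ! i))\<^sup>2
        - 2 * (ys ! i - f (xs ! i)) * (g (xs ! i) - f (xs ! i))" by (simp add: power2_eq_square algebra_simps)
      thus ?thesis by (simp add: cf[OF that, symmetric] algebra_simps)
    qed
    have "(\<Sum>i<l. (g (xs ! i) - ys ! i)\<^sup>2) = (\<Sum>i<l. (f (xs ! i) - ys ! i)\<^sup>2)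
        + (\<Sum>i<l. (g (xs ! i) - f (xs ! i))\<^sup>2) - 2 * (real l * lam) * (\<Sum>i<l. c i * (g (xs ! i) - f (xs ! i)))"
      by (simp add: sq sum.distrib sum_subtractf sum_distrib_left)
    also have "(\<Sum>i<l. c i * (g (xs ! i) - f (xs ! i))) = lin_fun xs cs g - Q"
      by (simp add: Qf lf algebra_simps sum_subtractf)
    finally have "J g = 1 / real l * (\<Sum>i<l. (f (xs ! i) - ys ! i)\<^sup>2)
        + 1 / real l * (\<Sum>i<l. (g (xs ! i) - f (xs ! i))\<^sup>2) - 2 * lam * (lin_fun xs cs g - Q)
        + lam * rkhs_norm2 K S g"
      unfolding J_def rls_obj_def l_def[symmetric] using l by (simp add: field_simps)
    moreover have "J f \<le> 1 / real l * (\<Sum>i<l. (f (xs ! i) - ys ! i)\<^sup>2) + lam * Q"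
      unfolding J_def rls_obj_def l_def[symmetric] using nf lam by simp
    ultimately show ?thesis by (simp add: algebra_simps)
  qed
  have ge: "2 * lin_fun xs cs g - Q \<le> rkhs_norm2 K S g" if "in_rkhs K S g" for g
    unfolding Q_def by (rule rkhs_norm2_ge[OF K that xs(1) lcs])
  have "rls_estimator K S xs ys lam = f"
    unfolding rls_estimator_def
  proof (rule the_equality)
    have "J f \<le> J g" if "in_rkhs K S g" for g
    proof -
      have "0 \<le> 1 / real l * (\<Sum>i<l. (g (xs ! i) - f (xs ! i))\<^sup>2)" by (simp add: sum_nonneg)
      moreover have "0 \<le> lam * (rkhs_norm2 K S g - (2 * lin_fun xs cs g - Q))" using ge[OF that] lam by simp
      ultimately show ?thesis using key[of g] by linarith
    qed
    thus "in_rkhs K S f \<and> (\<forall>g. in_rkhs K S g \<longrightarrow> rls_obj K S xs ys lam f \<le> rls_obj K S xs ys lam g)"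
      using fin by (simp add: J_def)
  next
    fix g assume g: "in_rkhs K S g \<and> (\<forall>h. in_rkhs K S h \<longrightarrow> rls_obj K S xs ys lam g \<le> rls_obj K S xs ys lam h)"
    hence gin: "in_rkhs K S g" and gJ: "J g \<le> J f" using fin by (auto simp: J_def)
    have n1: "0 \<le> 1 / real l * (\<Sum>i<l. (g (xs ! i) - f (xs ! i))\<^sup>2)" by (simp add: sum_nonneg)
    have n2: "0 \<le> lam * (rkhs_norm2 K S g - (2 * lin_fun xs cs g - Q))" using ge[OF gin] lam by simp
    have z1: "1 / real l * (\<Sum>i<l. (g (xs ! i) - f (xs ! i))\<^sup>2) = 0" and
         z2: "lam * (rkhs_norm2 K S g - (2 * lin_fun xs cs g - Q)) = 0"
      using key[of g] gJ n1 n2 by linarith+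
    have gi: "g (xs ! i) = f (xs ! i)" if "i < l" for i
    proof -
      have "(\<Sum>i<l. (g (xs ! i) - f (xs ! i))\<^sup>2) = 0" using z1 l by simp
      hence "(g (xs ! i) - f (xs ! i))\<^sup>2 = 0" using that by (subst (asm) sum_nonneg_eq_0_iff) auto
      thus ?thesis by simp
    qed
    hence "lin_fun xs cs g = Q" by (simp add: Qf lf)
    hence ng: "rkhs_norm2 K S g = Q" using z2 lam by simp
    show "g = f"
    proof
      fix x
      show "g x = f x"
      proof (cases "x \<in> S")
        case False
        thus ?thesis using gin by (simp add: in_rkhs_def f_def)
      next
        case True
        define k where "k = K x x"
        \<comment> \<open>Here \<open>t\<close> is the weight of the extra atom. The squared norm of
          \<open>g\<close> is already known to be \<open>Q\<close>, so the constant terms cancel,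
          and a non-negative quadratic without constant term has no linear term.\<close>
        have "0 \<le> t\<^sup>2 * k + 2 * t * (f x - g x) + 0" for t
        proof -
          have "quad_form K (xs @ [x]) (cs @ [t]) = quad_form K ([x] @ xs) (map ((*) t) [1] @ cs)"
          proof -
            have ap1: "lin_fun (xs @ [x]) (cs @ [t]) h = lin_fun xs cs h + lin_fun [x] [t] h" for h
              by (rule lin_fun_append[OF lcs])
            have ap2: "lin_fun ([x] @ xs) ([t] @ cs) h = lin_fun [x] [t] h + lin_fun xs cs h" for h
              by (rule lin_fun_append) simp
            have "quad_form K (xs @ [x]) (cs @ [t]) = quad_form K ([x] @ xs) ([t] @ cs)"
              unfolding quad_form_eq ap1 ap2 by (simp add: add.commute)
            thus ?thesis by simp
          qed
          also have "\<dots> = t\<^sup>2 * quad_form K [x] [1] + 2 * t * lin_fun xs cs (\<lambda>z. lin_fun [x] [1] (\<lambda>y. K y z)) + Q"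
            unfolding Q_def using True xs lcs by (intro quad_form_append[OF K]) auto
          also have "lin_fun xs cs (\<lambda>z. lin_fun [x] [1] (\<lambda>y. K y z)) = f x"
            unfolding fS[OF True] using sym[OF True xS] by (simp add: lin_fun_def l_def)
          also have "quad_form K [x] [1] = k" by (simp add: quad_form_def k_def)
          finally have qe: "quad_form K (xs @ [x]) (cs @ [t]) = t\<^sup>2 * k + 2 * t * f x + Q" .
          have "lin_fun (xs @ [x]) (cs @ [t]) g = Q + t * g x"
            using \<open>lin_fun xs cs g = Q\<close> by (simp add: lin_fun_append lcs) (simp add: lin_fun_def)
          thus ?thesis
            using rkhs_norm2_ge[OF K gin, of "xs @ [x]" "cs @ [t]"] True xs lcs ng qe by (simp add: algebra_simps)
        qed
        from quadratic_nonneg_discriminant[OF this] show ?thesis by simp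
      qed
    qed
  qed
  hence "rls_estimator K S xs ys lam = (\<lambda>x. if x \<in> S then (\<Sum>j<length xs. c j * K (xs ! j) x) else 0)"
    by (simp only: f_def[abs_def] l_def)
  moreover have "\<forall>i<length xs. c i * (real (length xs) * lam)
      = ys ! i - (\<Sum>j<length xs. c j * K (xs ! j) (xs ! i))"
    using c unfolding l_def by (auto simp: algebra_simps)
  ultimately show ?thesis by (intro exI[of _ c] conjI)
qed

section \<open>Kernels as uniform limits of finite-rank kernels\<close>

definition bfun :: "'a measure \<Rightarrow> ('a \<Rightarrow> real) set" where
  "bfun M = {f. f \<in> borel_measurable M \<and> (\<exists>b. \<forall>x. \<bar>f x\<bar> \<le> b)}"

lemma bfunI: "f \<in> borel_measurable M \<Longrightarrow> (\<And>x. \<bar>f x\<bar> \<le> b) \<Longrightarrow> f \<in> bfun M"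
  unfolding bfun_def by blast

lemma bfun_measurable: "f \<in> bfun M \<Longrightarrow> f \<in> borel_measurable M"
  unfolding bfun_def by blast

lemma bfun_bound:
  assumes "f \<in> bfun M" shows "\<exists>b>0. \<forall>x. \<bar>f x\<bar> \<le> b"
proof -
  obtain b where b: "\<And>x. \<bar>f x\<bar> \<le> b" using assms unfolding bfun_def by blast
  have "\<bar>f x\<bar> \<le> \<bar>b\<bar> + 1" for x using b[of x] by linarith
  thus ?thesis by (intro exI[of _ "\<bar>b\<bar> + 1"]) auto
qed

lemma bfun_const: "(\<lambda>_. c) \<in> bfun M"
  by (rule bfunI[of _ _ "\<bar>c\<bar>"]) auto

lemma bfun_add: "f \<in> bfun M \<Longrightarrow> g \<in> bfun M \<Longrightarrow> (\<lambda>x. f x + g x) \<in> bfun M"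
proof -
  assume f: "f \<in> bfun M" and g: "g \<in> bfun M"
  obtain b where b: "\<And>x. \<bar>f x\<bar> \<le> b" using bfun_bound[OF f] by blast
  obtain c where c: "\<And>x. \<bar>g x\<bar> \<le> c" using bfun_bound[OF g] by blast
  show ?thesis
    by (rule bfunI[of _ _ "b + c"])
      (use bfun_measurable[OF f] bfun_measurable[OF g] in \<open>auto intro: order_trans[OF abs_triangle_ineq add_mono[OF b c]]\<close>)
qed

lemma bfun_mult: "f \<in> bfun M \<Longrightarrow> g \<in> bfun M \<Longrightarrow> (\<lambda>x. f x * g x) \<in> bfun M"
proof -
  assume f: "f \<in> bfun M" and g: "g \<in> bfun M"
  obtain b where b: "b > 0" "\<And>x. \<bar>f x\<bar> \<le> b" using bfun_bound[OF f] by blast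
  obtain c where c: "c > 0" "\<And>x. \<bar>g x\<bar> \<le> c" using bfun_bound[OF g] by blast
  show ?thesis
    by (rule bfunI[of _ _ "b * c"])
      (use b c bfun_measurable[OF f] bfun_measurable[OF g] in \<open>auto simp: abs_mult intro!: mult_mono intro: less_imp_le\<close>)
qed

lemma bfun_cmult: "f \<in> bfun M \<Longrightarrow> (\<lambda>x. c * f x) \<in> bfun M"
  by (intro bfun_mult bfun_const)

lemma bfun_diff: "f \<in> bfun M \<Longrightarrow> g \<in> bfun M \<Longrightarrow> (\<lambda>x. f x - g x) \<in> bfun M"
  using bfun_add[of f M "\<lambda>x. - 1 * g x"] bfun_cmult[of g M "- 1"] by simp

lemma bfun_sum: "(\<And>k. k < (n::nat) \<Longrightarrow> f k \<in> bfun M) \<Longrightarrow> (\<lambda>x. \<Sum>k<n. f k x) \<in> bfun M"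
  by (induction n) (auto intro: bfun_const bfun_add)

lemma bfun_uniform_limit:
  assumes "\<And>n::nat. g n \<in> bfun M" "\<And>n x. \<bar>f x - g n x\<bar> \<le> inverse (real (Suc n))"
  shows "f \<in> bfun M"
proof -
  have lim: "(\<lambda>n. g n x) \<longlonglongrightarrow> f x" for x
  proof (rule LIMSEQ_I)
    fix e :: real assume "e > 0"
    then obtain N where N: "inverse (real (Suc N)) < e" using reals_Archimedean by blast
    have "norm (g n x - f x) < e" if "n \<ge> N" for n
    proof -
      have "inverse (real (Suc n)) \<le> inverse (real (Suc N))" using that by simp
      thus ?thesis using assms(2)[of x n] N unfolding real_norm_def abs_minus_commute[of "g n x"] by linarith
    qed
    thus "\<exists>N. \<forall>n\<ge>N. norm (g n x - f x) < e" by blast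
  qed
  have meas: "f \<in> borel_measurable M"
    by (rule borel_measurable_LIMSEQ_real[of M g f]) (use lim assms(1) in \<open>auto dest: bfun_measurable\<close>)
  obtain b where b: "\<And>x. \<bar>g 0 x\<bar> \<le> b" using bfun_bound[OF assms(1)[of 0]] by blast
  show ?thesis
  proof (rule bfunI[OF meas, of "b + 1"])
    fix x show "\<bar>f x\<bar> \<le> b + 1" using assms(2)[of x 0] b[of x] by simp
  qed
qed

text \<open>Stand-in for a signed measure: it covers point evaluations as well as integration
  against an integrable density. Because evaluations are included, the bound in \<open>bfun\<close>
  holds everywhere and not just almost everywhere.\<close>

definition bfunctional :: "'a measure \<Rightarrow> (('a \<Rightarrow> real) \<Rightarrow> real) \<Rightarrow> bool" where
  "bfunctional M L \<longleftrightarrow> (\<forall>f\<in>bfun M. \<forall>g\<in>bfun M. L (\<lambda>x. f x + g x) = L f + L g) \<and>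
     (\<forall>c. \<forall>f\<in>bfun M. L (\<lambda>x. c * f x) = c * L f) \<and>
     (\<exists>C\<ge>0. \<forall>f\<in>bfun M. \<forall>b. (\<forall>x. \<bar>f x\<bar> \<le> b) \<longrightarrow> \<bar>L f\<bar> \<le> C * b)"

lemma bfunctional_add:
  "bfunctional M L \<Longrightarrow> f \<in> bfun M \<Longrightarrow> g \<in> bfun M \<Longrightarrow> L (\<lambda>x. f x + g x) = L f + L g"
  unfolding bfunctional_def by blast

lemma bfunctional_cmult: "bfunctional M L \<Longrightarrow> f \<in> bfun M \<Longrightarrow> L (\<lambda>x. c * f x) = c * L f"
  unfolding bfunctional_def by blast

lemma bfunctional_diff:
  "bfunctional M L \<Longrightarrow> f \<in> bfun M \<Longrightarrow> g \<in> bfun M \<Longrightarrow> L (\<lambda>x. f x - g x) = L f - L g"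
  using bfunctional_add[of M L f "\<lambda>x. - 1 * g x"] bfunctional_cmult[of M L g "- 1"] bfun_cmult[of g M "- 1"]
  by simp

lemma bfunctional_sum:
  assumes L: "bfunctional M L" and "\<And>k. k < (n::nat) \<Longrightarrow> f k \<in> bfun M"
  shows "L (\<lambda>x. \<Sum>k<n. c k * f k x) = (\<Sum>k<n. c k * L (f k))"
  using assms(2)
proof (induction n)
  case 0
  show ?case using bfunctional_cmult[OF L bfun_const[of 0 M], of 0] by simp
next
  case (Suc n)
  thus ?case
    by (simp add: bfunctional_add[OF L] bfunctional_cmult[OF L] bfun_sum bfun_cmult)
qed

lemma bfunctional_bound:
  assumes "bfunctional M L"
  shows "\<exists>C. 0 \<le> C \<and> (\<forall>f\<in>bfun M. \<forall>b. (\<forall>x. \<bar>f x\<bar> \<le> b) \<longrightarrow> \<bar>L f\<bar> \<le> C * b)"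
  using assms unfolding bfunctional_def by blast

lemma bfunctional_lin_fun: "bfunctional M (lin_fun xs cs)"
  unfolding bfunctional_def
proof (intro conjI ballI allI exI[of _ "\<Sum>i<length xs. \<bar>cs ! i\<bar>"] impI)
  fix f :: "'a \<Rightarrow> real" and b assume "\<forall>x. \<bar>f x\<bar> \<le> b"
  thus "\<bar>lin_fun xs cs f\<bar> \<le> (\<Sum>i<length xs. \<bar>cs ! i\<bar>) * b"
    unfolding lin_fun_def sum_distrib_right
    by (intro order_trans[OF sum_abs] sum_mono) (auto simp: abs_mult intro: mult_left_mono)
qed (auto simp: lin_fun_add lin_fun_mult sum_nonneg)

lemma integrable_mult_bfun:
  fixes u :: "'a \<Rightarrow> real"
  assumes "integrable M u" "f \<in> bfun M" shows "integrable M (\<lambda>x. u x * f x)"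
proof -
  obtain b where b: "b > 0" "\<And>x. \<bar>f x\<bar> \<le> b" using bfun_bound[OF assms(2)] by blast
  have [measurable]: "f \<in> borel_measurable M" "u \<in> borel_measurable M" using assms by (auto dest: bfun_measurable)
  show ?thesis
    by (rule Bochner_Integration.integrable_bound[OF integrable_mult_right[OF assms(1), of b]])
      (use b in \<open>auto simp: abs_mult mult.commute[of b] intro!: AE_I2 mult_left_mono\<close>)
qed

lemma integrable_bfun: "finite_measure M \<Longrightarrow> f \<in> bfun M \<Longrightarrow> integrable M f"
  using integrable_mult_bfun[of M "\<lambda>_. 1" f] by (simp add: finite_measure.integrable_const)

lemma bfunctional_integral:
  fixes u :: "'a \<Rightarrow> real"
  assumes u: "integrable M u" shows "bfunctional M (\<lambda>f. \<integral>x. u x * f x \<partial>M)"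
  unfolding bfunctional_def
proof (intro conjI ballI allI exI[of _ "\<integral>x. \<bar>u x\<bar> \<partial>M"] impI)
  fix f b assume f: "f \<in> bfun M" and b: "\<forall>x. \<bar>f x\<bar> \<le> (b::real)"
  have "\<bar>\<integral>x. u x * f x \<partial>M\<bar> \<le> (\<integral>x. \<bar>u x * f x\<bar> \<partial>M)" by (rule integral_abs_bound)
  also have "\<dots> \<le> (\<integral>x. \<bar>u x\<bar> * b \<partial>M)"
    using u b integrable_abs[OF integrable_mult_bfun[OF u f]]
    by (intro integral_mono) (auto simp: abs_mult intro!: mult_left_mono)
  finally show "\<bar>\<integral>x. u x * f x \<partial>M\<bar> \<le> (\<integral>x. \<bar>u x\<bar> \<partial>M) * b" by simp
qed (use integrable_mult_bfun[OF u] in \<open>auto simp: distrib_left mult.left_commute\<close>)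

lemma bfunctional_minus:
  assumes "bfunctional M L1" "bfunctional M L2" shows "bfunctional M (\<lambda>f. L1 f - L2 f)"
proof -
  obtain C1 where "0 \<le> C1 \<and> (\<forall>f\<in>bfun M. \<forall>b. (\<forall>x. \<bar>f x\<bar> \<le> b) \<longrightarrow> \<bar>L1 f\<bar> \<le> C1 * b)"
      using bfunctional_bound[OF assms(1)] by (elim exE)
    hence C1: "0 \<le> C1" "\<And>f b. f \<in> bfun M \<Longrightarrow> (\<And>x. \<bar>f x\<bar> \<le> b) \<Longrightarrow> \<bar>L1 f\<bar> \<le> C1 * b"
      by simp_all
  obtain C2 where "0 \<le> C2 \<and> (\<forall>f\<in>bfun M. \<forall>b. (\<forall>x. \<bar>f x\<bar> \<le> b) \<longrightarrow> \<bar>L2 f\<bar> \<le> C2 * b)"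
      using bfunctional_bound[OF assms(2)] by (elim exE)
    hence C2: "0 \<le> C2" "\<And>f b. f \<in> bfun M \<Longrightarrow> (\<And>x. \<bar>f x\<bar> \<le> b) \<Longrightarrow> \<bar>L2 f\<bar> \<le> C2 * b"
      by simp_all
  show ?thesis unfolding bfunctional_def
  proof (intro conjI ballI allI exI[of _ "C1 + C2"] impI)
    fix f b assume "f \<in> bfun M" "\<forall>x. \<bar>f x\<bar> \<le> b"
    hence "\<bar>L1 f\<bar> \<le> C1 * b" "\<bar>L2 f\<bar> \<le> C2 * b" using C1(2)[of f b] C2(2)[of f b] by auto
    thus "\<bar>L1 f - L2 f\<bar> \<le> (C1 + C2) * b" by (simp add: distrib_right)
  qed (use assms C1 C2 in \<open>auto simp: bfunctional_add bfunctional_cmult algebra_simps\<close>)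
qed

section \<open>Finite-rank kernels, their uniform limits and the reduction of rank\<close>

definition fin_kernel :: "'a set \<Rightarrow> ('a \<Rightarrow> real) set \<Rightarrow> ('a \<Rightarrow> 'a \<Rightarrow> real) \<Rightarrow> bool" where
  "fin_kernel S F H \<longleftrightarrow> (\<exists>q \<phi>. (\<forall>k<q::nat. \<phi> k \<in> F) \<and>
     (\<forall>x\<in>S. \<forall>y\<in>S. H x y = (\<Sum>k<q. \<phi> k x * \<phi> k y)))"

text \<open>Positivity and the Cauchy-Schwarz inequality for a pair of functionals are elementary
  for finite sums of squares and pass to uniform limits. The approximants also make
  \<open>\<lambda>x. L (\<lambda>y. H y x)\<close> measurable for every bounded functional
  \<open>L\<close>, integrals included.\<close>

definition lim_kernel :: "'a measure \<Rightarrow> ('a \<Rightarrow> 'a \<Rightarrow> real) \<Rightarrow> bool" where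
  "lim_kernel M H \<longleftrightarrow> (\<forall>e>0. \<exists>H'. fin_kernel UNIV (bfun M) H' \<and> (\<forall>x y. \<bar>H x y - H' x y\<bar> \<le> e))"

lemma lim_kernel_seq:
  assumes "lim_kernel M H"
  shows "\<exists>H' q \<phi>. \<forall>n. (\<forall>k<q n::nat. \<phi> n k \<in> bfun M) \<and>
      (\<forall>x y. H' n x y = (\<Sum>k<q n. \<phi> n k x * \<phi> n k y)) \<and>
      (\<forall>x y. \<bar>H x y - H' n x y\<bar> \<le> inverse (real (Suc n)))"
proof -
  have "\<forall>n. \<exists>H' q \<phi>. (\<forall>k<q::nat. \<phi> k \<in> bfun M) \<and> (\<forall>x y. H' x y = (\<Sum>k<q. \<phi> k x * \<phi> k y))
      \<and> (\<forall>x y. \<bar>H x y - H' x y\<bar> \<le> inverse (real (Suc n)))"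
    (is "\<forall>n. ?P n")
  proof
    fix n
    have "inverse (real (Suc n)) > 0" by simp
    with assms obtain H' where H': "fin_kernel UNIV (bfun M) H'" "\<forall>x y. \<bar>H x y - H' x y\<bar> \<le> inverse (real (Suc n))"
      unfolding lim_kernel_def by blast
    from H'(1) obtain q \<phi> where "\<forall>k<q::nat. \<phi> k \<in> bfun M" "\<forall>x y. H' x y = (\<Sum>k<q. \<phi> k x * \<phi> k y)"
      unfolding fin_kernel_def by (elim exE conjE) simp
    with H'(2) show "?P n" by (intro exI[of _ H'] exI[of _ q] exI[of _ \<phi>] conjI)
  qed
  hence "\<exists>H' q \<phi>. \<forall>n. (\<forall>k<q n::nat. \<phi> n k \<in> bfun M) \<and>
      (\<forall>x y. H' n x y = (\<Sum>k<q n. \<phi> n k x * \<phi> n k y)) \<and>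
      (\<forall>x y. \<bar>H x y - H' n x y\<bar> \<le> inverse (real (Suc n)))" unfolding choice_iff .
  thus ?thesis .
qed

lemma tendsto_of_inverse_Suc_bound:
  fixes f :: "nat \<Rightarrow> real"
  assumes "\<And>n. \<bar>a - f n\<bar> \<le> C * inverse (real (Suc n))" shows "f \<longlonglongrightarrow> a"
proof -
  have "(\<lambda>n. C * inverse (real (Suc n))) \<longlonglongrightarrow> 0"
    using tendsto_mult[OF tendsto_const LIMSEQ_inverse_real_of_nat, of C] by simp
  hence "(\<lambda>n. a - f n) \<longlonglongrightarrow> 0"
  proof (rule Lim_null_comparison[rotated])
    show "\<forall>\<^sub>F n in sequentially. norm (a - f n) \<le> C * inverse (real (Suc n))"
      unfolding real_norm_def by (intro always_eventually allI assms)
  qed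
  hence "(\<lambda>n. a - (a - f n)) \<longlonglongrightarrow> a - 0" by (intro tendsto_diff tendsto_const)
  thus ?thesis by simp
qed

lemma lim_kernel_sym:
  assumes "lim_kernel M H" shows "H x y = H y x"
proof -
  obtain H' q \<phi> where "\<forall>n. (\<forall>k<q n::nat. \<phi> n k \<in> bfun M) \<and>
      (\<forall>x y. H' n x y = (\<Sum>k<q n. \<phi> n k x * \<phi> n k y)) \<and>
      (\<forall>x y. \<bar>H x y - H' n x y\<bar> \<le> inverse (real (Suc n)))"
    using lim_kernel_seq[OF assms] by (elim exE)
  hence H0: "\<And>n k. k < q n \<Longrightarrow> \<phi> n k \<in> bfun M"
    "\<And>n x y. H' n x y = (\<Sum>k<q n. \<phi> n k x * \<phi> n k y)"
    "\<And>n x y. \<bar>H x y - H' n x y\<bar> \<le> inverse (real (Suc n))" by blast+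
  have lim: "(\<lambda>n. H' n x y) \<longlonglongrightarrow> H x y" for x y
    by (rule tendsto_of_inverse_Suc_bound[of _ _ 1]) (use H0(3) in simp)
  have "H' n x y = H' n y x" for n unfolding H0(2) by (simp add: mult.commute)
  hence "(\<lambda>n. H' n x y) \<longlonglongrightarrow> H y x" using lim[of y x] by simp
  with lim[of x y] show ?thesis by (rule LIMSEQ_unique)
qed

lemma lim_kernel_section:
  assumes "lim_kernel M H" shows "(\<lambda>y. H y x) \<in> bfun M"
proof -
  obtain H' q \<phi> where "\<forall>n. (\<forall>k<q n::nat. \<phi> n k \<in> bfun M) \<and>
      (\<forall>x y. H' n x y = (\<Sum>k<q n. \<phi> n k x * \<phi> n k y)) \<and>
      (\<forall>x y. \<bar>H x y - H' n x y\<bar> \<le> inverse (real (Suc n)))"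
    using lim_kernel_seq[OF assms] by (elim exE)
  hence H: "\<And>n k. k < q n \<Longrightarrow> \<phi> n k \<in> bfun M"
    "\<And>n x y. H' n x y = (\<Sum>k<q n. \<phi> n k x * \<phi> n k y)"
    "\<And>n x y. \<bar>H x y - H' n x y\<bar> \<le> inverse (real (Suc n))" by blast+
  show ?thesis
  proof (rule bfun_uniform_limit[of "\<lambda>n y. H' n y x"])
    show "(\<lambda>y. H' n y x) \<in> bfun M" for n
      unfolding H(2) by (intro bfun_sum bfun_mult bfun_const H(1))
  qed (rule H(3))
qed

text \<open>Reproducing-kernel calculus: \<open>\<lambda>x. L1 (\<lambda>y. H y x)\<close> plays the
  element represented by \<open>L1\<close>, its squared norm is \<open>L1\<close> applied twice, and
  the last claim is Cauchy-Schwarz for two such elements. With an evaluation for \<open>L2\<close>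
  it bounds the values of the element by its norm and the diagonal of \<open>H\<close>.\<close>

lemma lim_kernel_functional:
  assumes H: "lim_kernel M H" and L1: "bfunctional M L1" and L2: "bfunctional M L2"
  shows "(\<lambda>x. L1 (\<lambda>y. H y x)) \<in> bfun M"
    and "0 \<le> L1 (\<lambda>x. L1 (\<lambda>y. H y x))"
    and "(L2 (\<lambda>x. L1 (\<lambda>y. H y x)))\<^sup>2 \<le> L1 (\<lambda>x. L1 (\<lambda>y. H y x)) * L2 (\<lambda>x. L2 (\<lambda>y. H y x))"
proof -
  obtain H' q \<phi> where "\<forall>n. (\<forall>k<q n::nat. \<phi> n k \<in> bfun M) \<and>
      (\<forall>x y. H' n x y = (\<Sum>k<q n. \<phi> n k x * \<phi> n k y)) \<and>
      (\<forall>x y. \<bar>H x y - H' n x y\<bar> \<le> inverse (real (Suc n)))"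
    using lim_kernel_seq[OF H] by (elim exE)
  hence H': "\<And>n k. k < q n \<Longrightarrow> \<phi> n k \<in> bfun M"
    "\<And>n x y. H' n x y = (\<Sum>k<q n. \<phi> n k x * \<phi> n k y)"
    "\<And>n x y. \<bar>H x y - H' n x y\<bar> \<le> inverse (real (Suc n))" by blast+
  have sec': "(\<lambda>y. H' n y x) \<in> bfun M" for n x
    unfolding H'(2) by (intro bfun_sum bfun_mult bfun_const H'(1))
  have row': "L (\<lambda>y. H' n y x) = (\<Sum>k<q n. \<phi> n k x * L (\<phi> n k))" if L: "bfunctional M L" for L n x
    unfolding H'(2) using bfunctional_sum[OF L, of "q n" "\<phi> n" "\<lambda>k. \<phi> n k x"] H'(1)[of _ n] by (simp add: mult.commute)
  have row'b: "(\<lambda>x. L (\<lambda>y. H' n y x)) \<in> bfun M" if L: "bfunctional M L" for L n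
    unfolding row'[OF L] by (intro bfun_sum bfun_mult bfun_const H'(1))
  have dbl': "K (\<lambda>x. L (\<lambda>y. H' n y x)) = (\<Sum>k<q n. L (\<phi> n k) * K (\<phi> n k))"
    if L: "bfunctional M L" and K: "bfunctional M K" for L K n
    unfolding row'[OF L] using bfunctional_sum[OF K, of "q n" "\<phi> n" "\<lambda>k. L (\<phi> n k)"] H'(1)[of _ n] by (simp add: mult.commute)
  have rowd: "\<exists>C\<ge>0. \<forall>n x. \<bar>L (\<lambda>y. H y x) - L (\<lambda>y. H' n y x)\<bar> \<le> C * inverse (real (Suc n))"
    if L: "bfunctional M L" for L
  proof -
    obtain C where "0 \<le> C \<and> (\<forall>f\<in>bfun M. \<forall>b. (\<forall>x. \<bar>f x\<bar> \<le> b) \<longrightarrow> \<bar>L f\<bar> \<le> C * b)"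
      using bfunctional_bound[OF L] by (elim exE)
    hence C: "0 \<le> C" "\<And>f b. f \<in> bfun M \<Longrightarrow> (\<And>x. \<bar>f x\<bar> \<le> b) \<Longrightarrow> \<bar>L f\<bar> \<le> C * b"
      by simp_all
    have "\<bar>L (\<lambda>y. H y x - H' n y x)\<bar> \<le> C * inverse (real (Suc n))" for n x
      by (intro C(2) bfun_diff sec' lim_kernel_section[OF H] H'(3))
    thus ?thesis using C(1) by (auto simp: bfunctional_diff[OF L lim_kernel_section[OF H] sec'])
  qed
  have row: "(\<lambda>x. L (\<lambda>y. H y x)) \<in> bfun M" if L: "bfunctional M L" for L
  proof -
    obtain C where C: "C \<ge> 0" "\<And>n x. \<bar>L (\<lambda>y. H y x) - L (\<lambda>y. H' n y x)\<bar> \<le> C * inverse (real (Suc n))"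
      using rowd[OF L] by blast
    \<comment> \<open>\<open>bfun_uniform_limit\<close> expects the error
      \<open>inverse (real (Suc n))\<close>; division by \<open>C + 1\<close> scales the error down
      to it, also when \<open>C = 0\<close>.\<close>
    have "(\<lambda>x. inverse (C + 1) * L (\<lambda>y. H y x)) \<in> bfun M"
    proof (rule bfun_uniform_limit[of "\<lambda>n x. inverse (C + 1) * L (\<lambda>y. H' n y x)"])
      fix n x
      have "\<bar>inverse (C + 1) * L (\<lambda>y. H y x) - inverse (C + 1) * L (\<lambda>y. H' n y x)\<bar>
          = inverse (C + 1) * \<bar>L (\<lambda>y. H y x) - L (\<lambda>y. H' n y x)\<bar>"
        using C(1) by (simp add: abs_mult flip: right_diff_distrib)
      also have "\<dots> \<le> inverse (C + 1) * (C * inverse (real (Suc n)))"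
        using C by (intro mult_left_mono) auto
      also have "\<dots> = (C / (C + 1)) * inverse (real (Suc n))" by (simp add: divide_inverse)
      also have "\<dots> \<le> 1 * inverse (real (Suc n))" using C(1) by (intro mult_right_mono) auto
      finally show "\<bar>inverse (C + 1) * L (\<lambda>y. H y x) - inverse (C + 1) * L (\<lambda>y. H' n y x)\<bar>
          \<le> inverse (real (Suc n))" by simp
    qed (intro bfun_cmult row'b L)
    from bfun_cmult[OF this, of "C + 1"] show ?thesis using C(1) by (simp add: mult.assoc[symmetric])
  qed
  have lim: "(\<lambda>n. \<Sum>k<q n. L (\<phi> n k) * K (\<phi> n k)) \<longlonglongrightarrow> K (\<lambda>x. L (\<lambda>y. H y x))"
    if L: "bfunctional M L" and K: "bfunctional M K" for L K
  proof -
    obtain C where C: "C \<ge> 0" "\<And>n x. \<bar>L (\<lambda>y. H y x) - L (\<lambda>y. H' n y x)\<bar> \<le> C * inverse (real (Suc n))"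
      using rowd[OF L] by blast
    obtain D where "0 \<le> D \<and> (\<forall>f\<in>bfun M. \<forall>b. (\<forall>x. \<bar>f x\<bar> \<le> b) \<longrightarrow> \<bar>K f\<bar> \<le> D * b)"
      using bfunctional_bound[OF K] by (elim exE)
    hence D: "0 \<le> D" "\<And>f b. f \<in> bfun M \<Longrightarrow> (\<And>x. \<bar>f x\<bar> \<le> b) \<Longrightarrow> \<bar>K f\<bar> \<le> D * b"
      by simp_all
    have "\<bar>K (\<lambda>x. L (\<lambda>y. H y x) - L (\<lambda>y. H' n y x))\<bar> \<le> D * (C * inverse (real (Suc n)))" for n
      by (intro D(2) bfun_diff row row'b L C(2))
    thus ?thesis
      by (intro tendsto_of_inverse_Suc_bound[of _ _ "D * C"])
        (simp add: bfunctional_diff[OF K row[OF L] row'b[OF L]] dbl'[OF L K] mult.assoc)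
  qed
  show "(\<lambda>x. L1 (\<lambda>y. H y x)) \<in> bfun M" by (rule row[OF L1])
  show "0 \<le> L1 (\<lambda>x. L1 (\<lambda>y. H y x))"
    by (rule LIMSEQ_le_const[OF lim[OF L1 L1]]) (auto intro!: sum_nonneg)
  show "(L2 (\<lambda>x. L1 (\<lambda>y. H y x)))\<^sup>2 \<le> L1 (\<lambda>x. L1 (\<lambda>y. H y x)) * L2 (\<lambda>x. L2 (\<lambda>y. H y x))"
  proof (rule LIMSEQ_le)
    show "(\<lambda>n. (\<Sum>k<q n. L1 (\<phi> n k) * L2 (\<phi> n k))\<^sup>2) \<longlonglongrightarrow> (L2 (\<lambda>x. L1 (\<lambda>y. H y x)))\<^sup>2"
      by (intro tendsto_power lim L1 L2)
    show "(\<lambda>n. (\<Sum>k<q n. L1 (\<phi> n k) * L1 (\<phi> n k)) * (\<Sum>k<q n. L2 (\<phi> n k) * L2 (\<phi> n k)))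
      \<longlonglongrightarrow> L1 (\<lambda>x. L1 (\<lambda>y. H y x)) * L2 (\<lambda>x. L2 (\<lambda>y. H y x))"
      by (intro tendsto_mult lim L1 L2)
    show "\<exists>N. \<forall>n\<ge>N. (\<Sum>k<q n. L1 (\<phi> n k) * L2 (\<phi> n k))\<^sup>2
        \<le> (\<Sum>k<q n. L1 (\<phi> n k) * L1 (\<phi> n k)) * (\<Sum>k<q n. L2 (\<phi> n k) * L2 (\<phi> n k))"
      by (intro exI[of _ 0] allI impI, unfold power2_eq_square[symmetric], rule Cauchy_Schwarz_ineq_sum)
  qed
qed

lemma bfunctional_eval: "bfunctional M (\<lambda>f. f x)"
  using bfunctional_lin_fun[of M "[x]" "[1]"] by (simp add: lin_fun_def[abs_def])

lemma lim_kernel_functional_eval: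
  assumes H: "lim_kernel M H" and L: "bfunctional M L"
  shows "(L (\<lambda>y. H y x))\<^sup>2 \<le> L (\<lambda>x. L (\<lambda>y. H y x)) * H x x"
  using lim_kernel_functional(3)[OF H L bfunctional_eval] .

lemma lim_kernel_diag_nonneg: "lim_kernel M H \<Longrightarrow> 0 \<le> H x x"
  using lim_kernel_functional(2)[OF _ bfunctional_eval[of _ x] bfunctional_eval[of _ x]] .

text \<open>Link to the estimator, which is defined with the kernel itself and the set
  \<open>S\<close> rather than with the kernel cut off to \<open>S\<close>.\<close>

lemma lim_kernel_psd_on:
  assumes "lim_kernel M (\<lambda>x y. if x \<in> S \<and> y \<in> S then K x y else 0)"
  shows "psd_on S K"
proof -
  let ?H = "\<lambda>x y. if x \<in> S \<and> y \<in> S then K x y else 0"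
  have "0 \<le> quad_form K xs cs" if "set xs \<subseteq> S" "length cs = length xs" for xs cs
  proof -
    have "lin_fun xs cs (\<lambda>y. lin_fun xs cs (\<lambda>x. K x y)) = lin_fun xs cs (\<lambda>y. lin_fun xs cs (\<lambda>x. ?H x y))"
      using that by (intro lin_fun_cong) auto
    thus ?thesis using lim_kernel_functional(2)[OF assms bfunctional_lin_fun[of _ xs cs] bfunctional_lin_fun[of _ xs cs]]
      by (simp add: quad_form_eq)
  qed
  thus ?thesis unfolding psd_on_def using lim_kernel_sym[OF assms] by metis
qed

text \<open>Peeling off the direction of the coefficient of the last spanning function lowers the rank by one.\<close>
lemma reduce_features:
  fixes \<phi> :: "nat \<Rightarrow> 'a \<Rightarrow> real"
  assumes "\<And>k x. k < q \<Longrightarrow> x \<in> S \<Longrightarrow> \<phi> k x = (\<Sum>a<m::nat. C k a * \<psi> a x)"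
  shows "\<exists>\<eta>. (\<forall>a<m. \<exists>d. \<forall>x. \<eta> a x = (\<Sum>k<q::nat. d k * \<phi> k x)) \<and>
    (\<forall>x\<in>S. \<forall>y\<in>S. (\<Sum>k<q. \<phi> k x * \<phi> k y) = (\<Sum>a<m. \<eta> a x * \<eta> a y))"
  using assms
proof (induction m arbitrary: \<phi> C)
  case (Suc m)
  define \<alpha> where "\<alpha> k = C k m" for k
  define n where "n = (\<Sum>k<q. (\<alpha> k)\<^sup>2)"
  define X where "X x = (\<Sum>k<q. \<alpha> k * \<phi> k x)" for x
  \<comment> \<open>Orthogonal projection, in the index \<open>k\<close>, away from the coefficient
    vector \<open>\<alpha>\<close> of \<open>\<psi> m\<close>. Since \<open>X\<close> contains
    \<open>n * \<psi> m\<close>, the last spanning function drops out. If \<open>n = 0\<close> then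
    \<open>\<alpha>\<close> vanishes and division by zero leaves \<open>\<phi>\<close>
    unchanged.\<close>
  define \<phi>' where "\<phi>' k x = \<phi> k x - \<alpha> k * X x / n" for k x
  have n0: "n = 0 \<Longrightarrow> k < q \<Longrightarrow> \<alpha> k = 0" for k
    unfolding n_def by (subst (asm) sum_nonneg_eq_0_iff) auto
  have "n \<ge> 0" unfolding n_def by (simp add: sum_nonneg)
  define A where "A a = (\<Sum>j<q. \<alpha> j * C j a)" for a
  have ph: "\<phi>' k x = (\<Sum>a<m. (C k a - \<alpha> k * A a / n) * \<psi> a x)" if "k < q" "x \<in> S" for k x
  proof -
    have "X x = (\<Sum>j<q. \<Sum>a<Suc m. \<alpha> j * C j a * \<psi> a x)"
      unfolding X_def using Suc.prems that by (simp add: sum_distrib_left mult.assoc distrib_left)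
    also have "\<dots> = (\<Sum>a<Suc m. A a * \<psi> a x)"
      by (subst sum.swap) (simp add: sum_distrib_right A_def)
    also have "\<dots> = (\<Sum>a<m. A a * \<psi> a x) + n * \<psi> m x"
      by (simp add: n_def \<alpha>_def power2_eq_square A_def)
    finally have X: "X x = (\<Sum>a<m. A a * \<psi> a x) + n * \<psi> m x" .
    have "\<alpha> k * X x / n = \<alpha> k * (\<Sum>a<m. A a * \<psi> a x) / n + \<alpha> k * \<psi> m x"
      using n0[OF _ that(1)] by (cases "n = 0") (auto simp: X field_simps)
    hence "\<phi>' k x = (\<Sum>a<m. C k a * \<psi> a x) - \<alpha> k * (\<Sum>a<m. A a * \<psi> a x) / n"
      unfolding \<phi>'_def using Suc.prems[OF that] by (simp add: \<alpha>_def)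
    thus ?thesis
      by (simp add: left_diff_distrib sum_subtractf sum_distrib_left sum_divide_distrib mult.assoc)
  qed
  have IH: "\<exists>\<eta>. (\<forall>a<m. \<exists>d. \<forall>x. \<eta> a x = (\<Sum>k<q. d k * \<phi>' k x)) \<and>
      (\<forall>x\<in>S. \<forall>y\<in>S. (\<Sum>k<q. \<phi>' k x * \<phi>' k y) = (\<Sum>a<m. \<eta> a x * \<eta> a y))"
    by (rule Suc.IH[of \<phi>' "\<lambda>k a. C k a - \<alpha> k * A a / n"]) (rule ph)
  obtain \<eta> where "(\<forall>a<m. \<exists>d. \<forall>x. \<eta> a x = (\<Sum>k<q. d k * \<phi>' k x)) \<and>
      (\<forall>x\<in>S. \<forall>y\<in>S. (\<Sum>k<q. \<phi>' k x * \<phi>' k y) = (\<Sum>a<m. \<eta> a x * \<eta> a y))"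
    using IH by (elim exE)
  note chi = this[THEN conjunct1] and eq = this[THEN conjunct2]
  define \<eta>' where "\<eta>' = \<eta>(m := (\<lambda>x. X x / sqrt n))"
  have "\<exists>d. \<forall>x. \<eta>' a x = (\<Sum>k<q. d k * \<phi> k x)" if "a < Suc m" for a
  proof (cases "a = m")
    case True
    show ?thesis
      by (rule exI[of _ "\<lambda>k. \<alpha> k / sqrt n"]) (simp add: \<eta>'_def True X_def sum_divide_distrib)
  next
    case False
    hence "a < m" using that by simp
    then obtain d where d: "\<And>x. \<eta> a x = (\<Sum>k<q. d k * \<phi>' k x)" using chi by blast
    show ?thesis
    proof (intro exI allI)
      fix x
      have "\<eta>' a x = (\<Sum>k<q. d k * \<phi> k x) - (\<Sum>k<q. d k * \<alpha> k) / n * X x"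
        using False by (simp add: \<eta>'_def d \<phi>'_def right_diff_distrib sum_subtractf sum_distrib_right sum_divide_distrib mult.assoc)
      also have "\<dots> = (\<Sum>k<q. (d k - (\<Sum>k<q. d k * \<alpha> k) / n * \<alpha> k) * \<phi> k x)"
        by (simp add: X_def left_diff_distrib sum_subtractf sum_distrib_left mult.assoc)
      finally show "\<eta>' a x = (\<Sum>k<q. (d k - (\<Sum>k<q. d k * \<alpha> k) / n * \<alpha> k) * \<phi> k x)" .
    qed
  qed
  moreover have "(\<Sum>k<q. \<phi> k x * \<phi> k y) = (\<Sum>a<Suc m. \<eta>' a x * \<eta>' a y)" if "x \<in> S" "y \<in> S" for x y
  proof -
    have "(\<Sum>k<q. \<phi>' k x * \<phi>' k y) = (\<Sum>k<q. \<phi> k x * \<phi> k y - Y' / n * (\<alpha> k * \<phi> k x)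
        - X' / n * (\<alpha> k * \<phi> k y) + X' * Y' / n\<^sup>2 * (\<alpha> k)\<^sup>2)" if "X' = X x" "Y' = X y" for X' Y'
      unfolding \<phi>'_def that by (rule sum.cong) (auto simp: power2_eq_square algebra_simps)
    hence "(\<Sum>k<q. \<phi>' k x * \<phi>' k y) = (\<Sum>k<q. \<phi> k x * \<phi> k y) - X y / n * X x - X x / n * X y + X x * X y / n\<^sup>2 * n"
      by (simp add: sum.distrib sum_subtractf X_def n_def sum_distrib_left)
    also have "\<dots> = (\<Sum>k<q. \<phi> k x * \<phi> k y) - X x * X y / n"
      by (cases "n = 0") (auto simp: power2_eq_square)
    also have "X x * X y / n = \<eta>' m x * \<eta>' m y"
      using \<open>n \<ge> 0\<close> by (simp add: \<eta>'_def)
    finally have "(\<Sum>k<q. \<phi> k x * \<phi> k y) = (\<Sum>k<q. \<phi>' k x * \<phi>' k y) + \<eta>' m x * \<eta>' m y" by simp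
    also have "(\<Sum>k<q. \<phi>' k x * \<phi>' k y) = (\<Sum>a<m. \<eta>' a x * \<eta>' a y)"
      using eq that by (simp add: \<eta>'_def)
    finally show ?thesis by simp
  qed
  ultimately show ?case by (intro exI[of _ \<eta>']) blast
qed auto

section \<open>Whitening and source conditions\<close>

text \<open>The functions \<open>v\<close> are an orthonormal basis of the span of the features with respect to
  \<open>E[h h'] + lam \<langle>w, w'\<rangle>\<close>.\<close>
lemma whitening:
  fixes \<phi> :: "nat \<Rightarrow> 'a \<Rightarrow> real"
  assumes M: "prob_space M" and phi: "\<And>a. a < m \<Longrightarrow> \<phi> a \<in> bfun M" and lam: "lam > 0"
    and kap: "\<And>x. (\<Sum>a<m. (\<phi> a x)\<^sup>2) \<le> kap"
  shows "\<exists>v. (\<forall>j<m. v j \<in> bfun M) \<and>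
    (\<forall>w. \<exists>\<beta>. (\<forall>x. (\<Sum>a<m. w a * \<phi> a x) = (\<Sum>j<m. \<beta> j * v j x)) \<and>
       (\<Sum>j<m. (\<beta> j)\<^sup>2) = (\<integral>x. (\<Sum>a<m. w a * \<phi> a x)\<^sup>2 \<partial>M) + lam * (\<Sum>a<m. (w a)\<^sup>2)) \<and>
    (\<forall>x. (\<Sum>j<m. (v j x)\<^sup>2) \<le> kap / lam) \<and>
    (\<forall>\<beta>. (\<integral>x. (\<Sum>j<m. \<beta> j * v j x)\<^sup>2 \<partial>M) \<le> (\<Sum>j<m. (\<beta> j)\<^sup>2))"
proof -
  interpret prob_space M by fact
  define h where "h w x = (\<Sum>a<m. w a * \<phi> a x)" for w x
  have hb: "h w \<in> bfun M" for w unfolding h_def by (intro bfun_sum bfun_cmult phi)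
  have hh: "integrable M (\<lambda>x. h w x * h z x)" for w z
    by (intro integrable_bfun bfun_mult hb) unfold_locales
  have hlin: "h (\<lambda>a. w a + t * z a) x = h w x + t * h z x" for w z t x
    by (simp add: h_def distrib_right sum.distrib sum_distrib_left mult.assoc)
  have hsum: "h (\<lambda>a. \<Sum>j<n. c j * w j a) x = (\<Sum>j<n. c j * h (w j) x)" for n :: nat and c w x
    unfolding h_def by (simp add: sum_distrib_left sum_distrib_right mult.assoc) (rule sum.swap)
  define B where "B w z = (\<integral>x. h w x * h z x \<partial>M) + lam * (\<Sum>a<m. w a * z a)" for w z
  interpret sym_bilinear B
  proof
    fix w z y t
    show "B w z = B z w" by (simp add: B_def mult.commute)
    show "B (\<lambda>a. w a + t * z a) y = B w y + t * B z y"
      using hh by (simp add: B_def hlin distrib_right sum.distrib sum_distrib_left mult.assoc algebra_simps)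
  qed
  have Bq: "B w w = (\<integral>x. (h w x)\<^sup>2 \<partial>M) + lam * (\<Sum>a<m. (w a)\<^sup>2)" for w
    by (simp add: B_def power2_eq_square)
  have Bge1: "(\<integral>x. (h w x)\<^sup>2 \<partial>M) \<le> B w w" for w using lam by (simp add: Bq sum_nonneg)
  have Bge2: "lam * (\<Sum>a<m. (w a)\<^sup>2) \<le> B w w" for w by (simp add: Bq)
  have "B x x > 0" if x0: "\<forall>a\<ge>m. x a = 0" and x1: "\<exists>a. x a \<noteq> 0" for x
  proof -
    obtain a where "x a \<noteq> 0" using x1 by blast
    with x0 have a: "x a \<noteq> 0" "a < m" by (auto simp: not_le[symmetric])
    hence "(\<Sum>i<m. (x i)\<^sup>2) > 0" by (intro sum_pos2[of _ a]) auto
    hence "lam * (\<Sum>i<m. (x i)\<^sup>2) > 0" using lam by simp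
    thus ?thesis using Bge2[of x] by linarith
  qed
  from gram_schmidt[OF this] obtain w where W: "(\<forall>j<m. \<forall>a\<ge>m. w j a = 0)
    \<and> (\<forall>j<m. \<forall>k<m. B (w j) (w k) = (if j = k then 1 else 0))
    \<and> (\<forall>x. (\<forall>a\<ge>m. x a = 0) \<longrightarrow> (\<forall>a. x a = (\<Sum>j<m. B x (w j) * w j a)))" by (rule exE)
  note orth = W[THEN conjunct2, THEN conjunct1, rule_format]
  note exp = W[THEN conjunct2, THEN conjunct2, rule_format]
  define v where "v j = h (w j)" for j
  define c where "c \<beta> = (\<lambda>a. \<Sum>j<m. \<beta> j * w j a)" for \<beta>
  have hc: "h (c \<beta>) x = (\<Sum>j<m. \<beta> j * v j x)" for \<beta> x unfolding c_def v_def by (rule hsum)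
  have Bc: "B (c \<beta>) (c \<beta>) = (\<Sum>j<m. (\<beta> j)\<^sup>2)" for \<beta>
  proof -
    have "B (c \<beta>) (w j) = \<beta> j" if "j < m" for j
    proof -
      have "B (c \<beta>) (w j) = (\<Sum>i<m. \<beta> i * B (w i) (w j))" unfolding c_def by (rule sum_left)
      also have "\<dots> = (\<Sum>i<m. if i = j then \<beta> i else 0)" using orth that by (intro sum.cong) auto
      finally show ?thesis using that by simp
    qed
    hence "B (w j) (c \<beta>) = \<beta> j" if "j < m" for j using that sym by metis
    hence "(\<Sum>j<m. \<beta> j * B (w j) (c \<beta>)) = (\<Sum>j<m. (\<beta> j)\<^sup>2)" by (simp add: power2_eq_square)
    thus ?thesis using sum_left[of \<beta> w m "c \<beta>"] unfolding c_def by simp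
  qed
  show ?thesis
  proof (intro exI[of _ v] conjI allI impI)
    fix z :: "nat \<Rightarrow> real"
    define z' where "z' a = (if a < m then z a else 0)" for a
    define \<beta> where "\<beta> j = B z' (w j)" for j
    have hz: "h z' = h z" by (rule ext) (simp add: h_def z'_def)
    have "z' a = c \<beta> a" for a unfolding c_def \<beta>_def by (rule exp) (simp add: z'_def)
    hence zc: "z' = c \<beta>" by (rule ext)
    have "(\<Sum>j<m. (\<beta> j)\<^sup>2) = B z' z'" unfolding zc by (rule Bc[symmetric])
    also have "\<dots> = (\<integral>x. (h z x)\<^sup>2 \<partial>M) + lam * (\<Sum>a<m. (z a)\<^sup>2)" unfolding Bq hz by (simp add: z'_def)
    finally have e: "(\<Sum>j<m. (\<beta> j)\<^sup>2) = (\<integral>x. (h z x)\<^sup>2 \<partial>M) + lam * (\<Sum>a<m. (z a)\<^sup>2)" .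
    have "h z x = (\<Sum>j<m. \<beta> j * v j x)" for x unfolding hz[symmetric] zc by (rule hc)
    with e show "\<exists>\<beta>. (\<forall>x. (\<Sum>a<m. z a * \<phi> a x) = (\<Sum>j<m. \<beta> j * v j x)) \<and>
       (\<Sum>j<m. (\<beta> j)\<^sup>2) = (\<integral>x. (\<Sum>a<m. z a * \<phi> a x)\<^sup>2 \<partial>M) + lam * (\<Sum>a<m. (z a)\<^sup>2)"
      unfolding h_def by (intro exI[of _ \<beta>]) simp
  next
    fix x
    define s where "s = (\<Sum>j<m. (v j x)\<^sup>2)"
    have s0: "s \<ge> 0" by (simp add: s_def sum_nonneg)
    \<comment> \<open>The representer of the evaluation at \<open>x\<close>: its value at
      \<open>x\<close> and its energy both equal \<open>s\<close>. Cauchy-Schwarz in the original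
      features then bounds \<open>lam * s\<^sup>2\<close> by \<open>s * kap\<close>.\<close>
    define z where "z = c (\<lambda>j. v j x)"
    have hz: "h z x = s" unfolding z_def hc by (simp add: s_def power2_eq_square)
    have Bz: "B z z = s" unfolding z_def Bc s_def ..
    have "s\<^sup>2 \<le> (\<Sum>a<m. (z a)\<^sup>2) * (\<Sum>a<m. (\<phi> a x)\<^sup>2)"
      unfolding hz[symmetric] h_def by (rule Cauchy_Schwarz_ineq_sum)
    also have "\<dots> \<le> (\<Sum>a<m. (z a)\<^sup>2) * kap" by (intro mult_left_mono kap sum_nonneg) auto
    finally have "lam * s\<^sup>2 \<le> (lam * (\<Sum>a<m. (z a)\<^sup>2)) * kap" using lam by simp
    also have "\<dots> \<le> s * kap"
    proof (rule mult_right_mono)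
      show "lam * (\<Sum>a<m. (z a)\<^sup>2) \<le> s" using Bge2[of z] Bz by simp
      show "0 \<le> kap" using kap[of x] sum_nonneg[of "{..<m}" "\<lambda>a. (\<phi> a x)\<^sup>2"] by simp
    qed
    finally have le: "s * (lam * s) \<le> s * kap" by (simp add: power2_eq_square algebra_simps)
    have "lam * s \<le> kap"
    proof (cases "s = 0")
      case True
      thus ?thesis using kap[of x] sum_nonneg[of "{..<m}" "\<lambda>a. (\<phi> a x)\<^sup>2"] by simp
    next
      case False
      thus ?thesis using le s0 by simp
    qed
    thus "(\<Sum>j<m. (v j x)\<^sup>2) \<le> kap / lam" using lam by (simp add: s_def field_simps)
  next
    fix \<beta> :: "nat \<Rightarrow> real"
    show "(\<integral>x. (\<Sum>j<m. \<beta> j * v j x)\<^sup>2 \<partial>M) \<le> (\<Sum>j<m. (\<beta> j)\<^sup>2)"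
      using Bge1[of "c \<beta>"] unfolding hc Bc .
  qed (auto simp: v_def hb)
qed

section \<open>Orthonormal systems in L2 and approximation by spectral cut-off\<close>

lemma L2_mem_integrable_mult:
  assumes "L2_mem M f" "L2_mem M g" shows "integrable M (\<lambda>x. f x * g x)"
proof (rule Bochner_Integration.integrable_bound)
  show "integrable M (\<lambda>x. (f x)\<^sup>2 + (g x)\<^sup>2)" using assms by (auto simp: L2_mem_def)
  show "(\<lambda>x. f x * g x) \<in> borel_measurable M" using assms by (auto simp: L2_mem_def)
  have "\<bar>a * b\<bar> \<le> a\<^sup>2 + b\<^sup>2" for a b :: real
  proof -
    have "2 * \<bar>a * b\<bar> \<le> a\<^sup>2 + b\<^sup>2"
      using zero_le_power2[of "\<bar>a\<bar> - \<bar>b\<bar>"] by (simp add: power2_diff abs_mult)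
    thus ?thesis by (smt (verit) abs_ge_zero)
  qed
  thus "AE x in M. norm (f x * g x) \<le> norm ((f x)\<^sup>2 + (g x)\<^sup>2)" by (intro AE_I2) simp
qed

lemma (in prob_space) L2_mem_const: "L2_mem M (\<lambda>_. c)"
  by (simp add: L2_mem_def)

lemma (in prob_space) L2_mem_integrable: "L2_mem M f \<Longrightarrow> integrable M f"
  using L2_mem_integrable_mult[OF _ L2_mem_const, of f 1] by simp

lemma L2_mem_add: "L2_mem M f \<Longrightarrow> L2_mem M g \<Longrightarrow> L2_mem M (\<lambda>x. f x + g x)"
  using L2_mem_integrable_mult[of M f g] by (auto simp: L2_mem_def power2_sum mult.assoc)

lemma L2_mem_cmult: "L2_mem M f \<Longrightarrow> L2_mem M (\<lambda>x. c * f x)"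
  by (auto simp: L2_mem_def power_mult_distrib)

lemma (in prob_space) L2_mem_sum: "(\<And>k. L2_mem M (e k)) \<Longrightarrow> L2_mem M (\<lambda>x. \<Sum>k<n::nat. a k * e k x)"
  by (induction n) (simp_all add: L2_mem_const L2_mem_add L2_mem_cmult)

context
  fixes M :: "'a measure" and e :: "nat \<Rightarrow> 'a \<Rightarrow> real"
  assumes M: "prob_space M" and mem: "\<And>k. L2_mem M (e k)"
    and orth: "\<And>k j. L2_inner M (e k) (e j) = (if k = j then 1 else 0)"
begin

interpretation prob_space M by (rule M)

lemma orthonormal_integral_mult:
  assumes "L2_mem M g"
  shows "(\<integral>x. g x * (\<Sum>k<n. b k * e k x) \<partial>M) = (\<Sum>k<n. b k * L2_inner M g (e k))"
proof -
  have "(\<integral>x. g x * (\<Sum>k<n. b k * e k x) \<partial>M) = (\<integral>x. (\<Sum>k<n. b k * (g x * e k x)) \<partial>M)"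
    by (simp add: sum_distrib_left algebra_simps)
  also have "\<dots> = (\<Sum>k<n. b k * L2_inner M g (e k))"
    using L2_mem_integrable_mult[OF assms mem]
    by (simp add: Bochner_Integration.integral_sum L2_inner_def)
  finally show ?thesis .
qed

lemma orthonormal_integral_sums:
  "(\<integral>x. (\<Sum>k<n. a k * e k x) * (\<Sum>k<n. b k * e k x) \<partial>M) = (\<Sum>k<n. a k * b k)"
proof -
  have "L2_inner M (\<lambda>x. \<Sum>k<n. a k * e k x) (e j) = a j" if "j < n" for j
  proof -
    have "L2_inner M (\<lambda>x. \<Sum>k<n. a k * e k x) (e j) = (\<integral>x. e j x * (\<Sum>k<n. a k * e k x) \<partial>M)"
      by (simp add: L2_inner_def mult.commute)
    also have "\<dots> = (\<Sum>k<n. if k = j then a k else 0)"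
      unfolding orthonormal_integral_mult[OF mem] by (intro sum.cong) (auto simp: orth)
    finally show ?thesis using that by simp
  qed
  thus ?thesis
    by (simp add: orthonormal_integral_mult[OF L2_mem_sum[OF mem]] mult.commute)
qed

lemma orthonormal_bessel:
  assumes g: "L2_mem M g" shows "(\<Sum>k<n. (L2_inner M g (e k))\<^sup>2) \<le> (\<integral>x. (g x)\<^sup>2 \<partial>M)"
proof -
  define s where "s x = (\<Sum>k<n. L2_inner M g (e k) * e k x)" for x
  have sm: "L2_mem M s" unfolding s_def[abs_def] by (intro L2_mem_sum mem)
  have gs: "(\<integral>x. g x * s x \<partial>M) = (\<Sum>k<n. (L2_inner M g (e k))\<^sup>2)"
    unfolding s_def orthonormal_integral_mult[OF g] by (simp add: power2_eq_square)
  have ss: "(\<integral>x. s x * s x \<partial>M) = (\<Sum>k<n. (L2_inner M g (e k))\<^sup>2)"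
    unfolding s_def orthonormal_integral_sums by (simp add: power2_eq_square)
  have "0 \<le> (\<integral>x. (g x - s x)\<^sup>2 \<partial>M)" by (intro integral_nonneg_AE) auto
  also have "\<dots> = (\<integral>x. (g x)\<^sup>2 - 2 * (g x * s x) + s x * s x \<partial>M)"
    by (simp add: power2_eq_square algebra_simps)
  also have "\<dots> = (\<integral>x. (g x)\<^sup>2 \<partial>M) - 2 * (\<integral>x. g x * s x \<partial>M) + (\<integral>x. s x * s x \<partial>M)"
    using g L2_mem_integrable_mult[OF g sm] L2_mem_integrable_mult[OF sm sm] by (simp add: L2_mem_def)
  finally show ?thesis by (simp add: gs ss)
qed

end

text \<open>The truncation to \<open>S\<close> matters because \<open>K\<close> need not be measurable off \<open>S\<close>.\<close>
lemma source_approximation: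
  fixes K :: "'a \<Rightarrow> 'a \<Rightarrow> real" and f g :: "'a \<Rightarrow> real" and S :: "'a set"
  defines "H \<equiv> \<lambda>x y. if x \<in> S \<and> y \<in> S then K x y else 0"
  assumes M: "prob_space M" and S: "S \<in> sets M" "AE x in M. x \<in> S"
    and H: "lim_kernel M H" and kap: "\<And>x. H x x \<le> kap"
    and pow: "is_op_power M (T_op K M) (\<beta> / 2) g f" and g: "L2_mem M g" "(\<integral>x. (g x)\<^sup>2 \<partial>M) \<le> B"
    and f[measurable]: "f \<in> borel_measurable M" and \<beta>: "0 < \<beta>" "\<beta> \<le> 2" and lam: "lam > 0"
  shows "\<exists>u. L2_mem M u
    \<and> (\<integral>\<^sup>+x. ennreal (((\<integral>y. u y * H y x \<partial>M) - f x)\<^sup>2) \<partial>M) \<le> ennreal (2 * (1 + B) * lam powr \<beta>)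
    \<and> lam\<^sup>2 * (\<integral>x. (u x)\<^sup>2 \<partial>M) \<le> B * lam powr \<beta>
    \<and> (\<forall>x. (\<integral>y. u y * H y x \<partial>M)\<^sup>2 \<le> kap * (B * (1 + kap + lam powr (\<beta> - 1))))"
proof -
  interpret prob_space M by fact
  define T0 where "T0 u x = (\<integral>y. u y * H y x \<partial>M)" for u x
  obtain e \<mu> where spec: "spectral_decomp M (T_op K M) e \<mu>" and
    conv: "L2_conv M (\<lambda>n x. \<Sum>k<n. \<mu> k powr (\<beta> / 2) * L2_inner M g (e k) * e k x) f"
    using pow unfolding is_op_power_def by blast
  have mem: "L2_mem M (e k)" for k using spec unfolding spectral_decomp_def by blast
  have [measurable]: "e k \<in> borel_measurable M" for k using mem[of k] by (simp add: L2_mem_def)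
  have orth: "L2_inner M (e k) (e j) = (if k = j then 1 else 0)" for k j
    using spec unfolding spectral_decomp_def by blast
  have mu0: "0 \<le> \<mu> k" for k using spec unfolding spectral_decomp_def by blast
  have T0b: "T0 u \<in> bfun M" if "integrable M u" for u
    unfolding T0_def[abs_def]
    by (rule lim_kernel_functional(1)[OF H bfunctional_integral[OF that] bfunctional_eval[of _ undefined]])
  have kap0: "kap \<ge> 0"
    using lim_kernel_diag_nonneg[OF H, of undefined]
      kap[of undefined] by simp
  have Hkap: "\<bar>H x y\<bar> \<le> kap" for x y
  proof -
    have "(H x y)\<^sup>2 \<le> H x x * H y y"
      using lim_kernel_functional_eval[OF H bfunctional_eval, of x y] by simp
    also have "\<dots> \<le> kap * kap"
      using kap[of x] kap[of y] lim_kernel_diag_nonneg[OF H, of y] kap0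
      by (intro mult_mono) auto
    finally have "\<bar>H x y\<bar>\<^sup>2 \<le> kap\<^sup>2" by (simp add: power2_eq_square)
    thus ?thesis using kap0 by (rule power2_le_imp_le)
  qed
  have eig: "AE x in M. T0 (e k) x = \<mu> k * e k x" for k
  proof -
    \<comment> \<open>The indicator changes \<open>e k\<close> only on a null set, but makes the
      operator see \<open>K\<close> on \<open>S\<close> alone. Beyond index \<open>k\<close> the
      partial sums of the spectral expansion of the image are constant, so their limit identifies
      the image as \<open>\<mu> k * e k\<close>.\<close>
    define h where "h x = e k x * indicator S x" for x
    have heq: "AE x in M. h x = e k x" using S(2) by eventually_elim (simp add: h_def)
    have [measurable]: "h \<in> borel_measurable M" unfolding h_def[abs_def] using S(1) by measurable
    have hL2: "L2_mem M h"
    proof -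
      have "integrable M (\<lambda>x. (h x)\<^sup>2) \<longleftrightarrow> integrable M (\<lambda>x. (e k x)\<^sup>2)"
        by (rule integrable_cong_AE) (use heq in auto)
      thus ?thesis using mem[of k] by (simp add: L2_mem_def)
    qed
    have hin: "L2_inner M h (e j) = (if k = j then 1 else 0)" for j
    proof -
      have "L2_inner M h (e j) = L2_inner M (e k) (e j)" unfolding L2_inner_def
        by (rule integral_cong_AE) (use heq in auto)
      thus ?thesis by (simp add: orth)
    qed
    have Th: "T_op K M h x = T0 (e k) x" if "x \<in> S" for x
      unfolding T_op_def T0_def by (rule Bochner_Integration.integral_cong) (auto simp: h_def H_def that indicator_def)
    have "(\<lambda>n. \<integral>\<^sup>+x. ennreal (((\<Sum>j<n. \<mu> j * L2_inner M h (e j) * e j x) - T_op K M h x)\<^sup>2) \<partial>M) \<longlonglongrightarrow> 0"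
      using spec hL2 unfolding spectral_decomp_def L2_conv_def by blast
    moreover have "(\<integral>\<^sup>+x. ennreal (((\<Sum>j<n. \<mu> j * L2_inner M h (e j) * e j x) - T_op K M h x)\<^sup>2) \<partial>M)
        = (\<integral>\<^sup>+x. ennreal ((\<mu> k * e k x - T0 (e k) x)\<^sup>2) \<partial>M)" if "n \<ge> Suc k" for n
    proof (rule nn_integral_cong_AE)
      have "(\<Sum>j<n. \<mu> j * L2_inner M h (e j) * e j x) = (\<Sum>j<n. if j = k then \<mu> j * e j x else 0)" for x
        by (rule sum.cong) (auto simp: hin)
      hence hs: "(\<Sum>j<n. \<mu> j * L2_inner M h (e j) * e j x) = \<mu> k * e k x" for x using that by simp
      show "AE x in M. ennreal (((\<Sum>j<n. \<mu> j * L2_inner M h (e j) * e j x) - T_op K M h x)\<^sup>2)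
          = ennreal ((\<mu> k * e k x - T0 (e k) x)\<^sup>2)"
        using S(2) by eventually_elim (simp add: hs Th)
    qed
    ultimately have "(\<lambda>n. \<integral>\<^sup>+x. ennreal ((\<mu> k * e k x - T0 (e k) x)\<^sup>2) \<partial>M) \<longlonglongrightarrow> (0::ennreal)"
      by (rule Lim_transform_eventually[rotated, OF eventually_sequentiallyI[of "Suc k"], rotated])
    hence z: "(\<integral>\<^sup>+x. ennreal ((\<mu> k * e k x - T0 (e k) x)\<^sup>2) \<partial>M) = 0"
      by (simp add: LIMSEQ_const_iff)
    have [measurable]: "T0 (e k) \<in> borel_measurable M"
      using T0b[OF L2_mem_integrable[OF mem]] by (rule bfun_measurable)
    have "AE x in M. ennreal ((\<mu> k * e k x - T0 (e k) x)\<^sup>2) = 0"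
      using z by (subst (asm) nn_integral_0_iff_AE) auto
    thus ?thesis by eventually_elim simp
  qed
  \<comment> \<open>\<open>\<mu> k\<close> is the L2 norm of the image of \<open>e k\<close>. That
    image is at most \<open>kap\<close> everywhere, since the kernel is and \<open>e k\<close> has
    L1 norm at most 1.\<close>
  have mukap: "\<mu> k \<le> kap" for k
  proof -
    have ie: "integrable M (e k)" by (rule L2_mem_integrable[OF mem])
    have ie2: "integrable M (\<lambda>x. (e k x)\<^sup>2)" "(\<integral>x. (e k x)\<^sup>2 \<partial>M) = 1"
      using mem[of k] orth[of k k] by (simp_all add: L2_mem_def L2_inner_def power2_eq_square)
    have "(\<integral>x. \<bar>e k x\<bar> \<partial>M) \<le> (\<integral>x. (1 + (e k x)\<^sup>2) / 2 \<partial>M)"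
    proof (rule integral_mono)
      fix x
      have "0 \<le> (\<bar>e k x\<bar> - 1)\<^sup>2" by simp
      thus "\<bar>e k x\<bar> \<le> (1 + (e k x)\<^sup>2) / 2" by (simp add: power2_diff)
    qed (use ie ie2 in auto)
    also have "\<dots> = 1" using ie2 by (simp add: prob_space)
    finally have e1: "(\<integral>x. \<bar>e k x\<bar> \<partial>M) \<le> 1" .
    have Tb: "\<bar>T0 (e k) x\<bar> \<le> kap" for x
    proof -
      have int: "integrable M (\<lambda>y. e k y * H y x)"
        by (intro integrable_mult_bfun ie lim_kernel_section[OF H])
      have "\<bar>T0 (e k) x\<bar> \<le> (\<integral>y. \<bar>e k y * H y x\<bar> \<partial>M)" unfolding T0_def by (rule integral_abs_bound)
      also have "\<dots> \<le> (\<integral>y. \<bar>e k y\<bar> * kap \<partial>M)"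
        using ie integrable_abs[OF int] by (intro integral_mono) (auto simp: abs_mult intro!: mult_left_mono Hkap)
      also have "\<dots> \<le> 1 * kap" using e1 kap0 by (simp add: mult_left_le_one_le mult_right_mono)
      finally show ?thesis by simp
    qed
    have "(\<mu> k)\<^sup>2 = (\<integral>x. (\<mu> k * e k x)\<^sup>2 \<partial>M)" using ie2 by (simp add: power_mult_distrib)
    also have "\<dots> = (\<integral>x. (T0 (e k) x)\<^sup>2 \<partial>M)"
      by (rule integral_cong_AE) (use eig[of k] bfun_measurable[OF T0b[OF ie]] in auto)
    also have "\<dots> \<le> (\<integral>x. kap\<^sup>2 \<partial>M)"
    proof (rule integral_mono)
      show "integrable M (\<lambda>x. (T0 (e k) x)\<^sup>2)"
        unfolding power2_eq_square by (intro integrable_bfun bfun_mult T0b ie) unfold_locales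
      show "(T0 (e k) x)\<^sup>2 \<le> kap\<^sup>2" for x using Tb[of x] kap0 by (simp add: abs_le_square_iff[symmetric])
    qed simp
    also have "\<dots> = kap\<^sup>2" by (simp add: prob_space)
    finally show ?thesis using kap0 by (rule power2_le_imp_le)
  qed
  define G where "G k = L2_inner M g (e k)" for k
  have GB: "(\<Sum>k<n. (G k)\<^sup>2) \<le> B" for n
    unfolding G_def using orthonormal_bessel[OF M mem orth g(1), of n] g(2) by linarith
  have B0: "B \<ge> 0" using GB[of 0] by simp
  define F where "F n x = (\<Sum>k<n. (\<mu> k powr (\<beta> / 2) * G k) * e k x)" for n x
  have "(\<lambda>n. \<integral>\<^sup>+x. ennreal ((F n x - f x)\<^sup>2) \<partial>M) \<longlonglongrightarrow> 0"
    using conv unfolding L2_conv_def F_def G_def .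
  hence "\<forall>\<^sub>F n in sequentially. (\<integral>\<^sup>+x. ennreal ((F n x - f x)\<^sup>2) \<partial>M) < ennreal (lam powr \<beta>)"
    by (rule order_tendstoD) (use lam in simp)
  \<comment> \<open>Stopping the series at finite \<open>n\<close> keeps \<open>u\<close> a finite
    combination of eigenfunctions; the error \<open>lam powr \<beta>\<close> made here is the 1 in
    \<open>1 + B\<close>.\<close>
  then obtain n where n: "(\<integral>\<^sup>+x. ennreal ((F n x - f x)\<^sup>2) \<partial>M) < ennreal (lam powr \<beta>)"
    by (auto simp: eventually_sequentially)
  \<comment> \<open>Spectral cut-off: on eigenvalues at least \<open>lam\<close> the operator is
    inverted exactly, the others are dropped. Because \<open>\<beta> \<le> 2\<close>, the inverse
    powers of the retained eigenvalues are largest at the threshold \<open>lam\<close>, which bounds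
    \<open>u\<close> in L2.\<close>
  define a where "a k = (if \<mu> k \<ge> lam then \<mu> k powr (\<beta> / 2 - 1) * G k else 0)" for k
  define u where "u x = (\<Sum>k<n. a k * e k x)" for x
  have uL2: "L2_mem M u" unfolding u_def[abs_def] by (intro L2_mem_sum mem)
  have u1: "integrable M u" by (rule L2_mem_integrable[OF uL2])
  have [measurable]: "T0 u \<in> borel_measurable M" using T0b[OF u1] by (rule bfun_measurable)
  have [measurable]: "F n \<in> borel_measurable M" unfolding F_def[abs_def] by measurable
  have T0u: "AE x in M. T0 u x = (\<Sum>k<n. (a k * \<mu> k) * e k x)"
  proof -
    have "T0 u x = (\<Sum>k<n. a k * T0 (e k) x)" for x
    proof -
      have int: "integrable M (\<lambda>y. e k y * H y x)" for k
        by (intro integrable_mult_bfun L2_mem_integrable[OF mem] lim_kernel_section[OF H])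
      have "T0 u x = (\<integral>y. (\<Sum>k<n. a k * (e k y * H y x)) \<partial>M)"
        unfolding T0_def u_def by (simp add: sum_distrib_right mult.assoc)
      thus ?thesis unfolding T0_def using int by (simp add: Bochner_Integration.integral_sum)
    qed
    moreover have "AE x in M. \<forall>k. T0 (e k) x = \<mu> k * e k x" using eig by (simp add: AE_all_countable)
    ultimately show ?thesis by (auto elim!: eventually_mono simp: mult.assoc)
  qed
  have usq: "(\<integral>x. (u x)\<^sup>2 \<partial>M) = (\<Sum>k<n. (a k)\<^sup>2)"
    unfolding u_def power2_eq_square by (rule orthonormal_integral_sums[OF M mem orth])
  have uTu: "(\<integral>x. u x * T0 u x \<partial>M) = (\<Sum>k<n. a k * (a k * \<mu> k))"
  proof -
    have "(\<integral>x. u x * T0 u x \<partial>M) = (\<integral>x. u x * (\<Sum>k<n. (a k * \<mu> k) * e k x) \<partial>M)"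
      by (rule integral_cong_AE) (use T0u uL2 in \<open>auto simp: L2_mem_def\<close>)
    also have "\<dots> = (\<Sum>k<n. a k * (a k * \<mu> k))"
      unfolding u_def by (rule orthonormal_integral_sums[OF M mem orth])
    finally show ?thesis .
  qed
  have amu: "a k * \<mu> k = (if \<mu> k \<ge> lam then \<mu> k powr (\<beta> / 2) * G k else 0)" for k
    using lam by (auto simp: a_def powr_diff)
  have asq: "(a k)\<^sup>2 \<le> lam powr (\<beta> - 2) * (G k)\<^sup>2" for k
  proof (cases "\<mu> k \<ge> lam")
    case True
    have e: "\<beta> / 2 - 1 + (\<beta> / 2 - 1) = \<beta> - 2" by (simp add: field_simps)
    have "(\<mu> k powr (\<beta> / 2 - 1))\<^sup>2 = \<mu> k powr (\<beta> - 2)"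
      unfolding power2_eq_square powr_add[symmetric] e ..
    hence "(a k)\<^sup>2 = \<mu> k powr (\<beta> - 2) * (G k)\<^sup>2"
      using True by (simp add: a_def power_mult_distrib)
    also have "\<dots> \<le> lam powr (\<beta> - 2) * (G k)\<^sup>2"
      using True lam \<beta> by (intro mult_right_mono powr_mono2') auto
    finally show ?thesis .
  qed (simp add: a_def)
  have "(\<integral>x. (u x)\<^sup>2 \<partial>M) \<le> (\<Sum>k<n. lam powr (\<beta> - 2) * (G k)\<^sup>2)"
    unfolding usq by (intro sum_mono asq)
  also have "\<dots> \<le> lam powr (\<beta> - 2) * B"
    unfolding sum_distrib_left[symmetric] by (intro mult_left_mono GB) auto
  finally have "lam\<^sup>2 * (\<integral>x. (u x)\<^sup>2 \<partial>M) \<le> lam\<^sup>2 * (lam powr (\<beta> - 2) * B)" by (intro mult_left_mono) auto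
  also have "\<dots> = B * lam powr \<beta>"
    using lam by (simp add: powr_diff powr_numeral)
  finally have r2: "lam\<^sup>2 * (\<integral>x. (u x)\<^sup>2 \<partial>M) \<le> B * lam powr \<beta>" .
  \<comment> \<open>The energy of the element represented by \<open>u\<close> is a sum with weights
    \<open>\<mu> k powr (\<beta> - 1)\<close>. They are bounded through the largest eigenvalue if
    \<open>\<beta> \<ge> 1\<close> and through the threshold \<open>lam\<close> if
    \<open>\<beta> < 1\<close>; the bound adds both.\<close>
  have summand: "a k * (a k * \<mu> k) \<le> (1 + kap + lam powr (\<beta> - 1)) * (G k)\<^sup>2" for k
  proof (cases "\<mu> k \<ge> lam")
    case True
    hence mu: "\<mu> k > 0" using lam by simp
    have e: "\<beta> / 2 - 1 + \<beta> / 2 = \<beta> - 1" by (simp add: field_simps)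
    have eq: "a k * (a k * \<mu> k) = \<mu> k powr (\<beta> - 1) * (G k)\<^sup>2"
      unfolding amu e[symmetric] powr_add using True by (simp add: a_def power2_eq_square)
    have "\<mu> k powr (\<beta> - 1) \<le> 1 + kap + lam powr (\<beta> - 1)"
    proof (cases "\<beta> \<ge> 1")
      case b: True
      show ?thesis
      proof (cases "\<mu> k \<ge> 1")
        case True
        hence "\<mu> k powr (\<beta> - 1) \<le> \<mu> k powr 1" using \<beta> by (intro powr_mono) auto
        thus ?thesis using mu mukap[of k] by (smt (verit) powr_ge_zero powr_one)
      next
        case False
        hence "\<mu> k powr (\<beta> - 1) \<le> 1 powr (\<beta> - 1)" using b mu by (intro powr_mono2) auto
        thus ?thesis using kap0 by (smt (verit) powr_ge_zero powr_one_eq_one)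
      qed
    next
      case False
      hence "\<mu> k powr (\<beta> - 1) \<le> lam powr (\<beta> - 1)" using True lam by (intro powr_mono2') auto
      thus ?thesis using kap0 by simp
    qed
    thus ?thesis unfolding eq by (intro mult_right_mono) auto
  qed (use kap0 in \<open>simp add: a_def\<close>)
  have "(\<integral>x. u x * T0 u x \<partial>M) \<le> (\<Sum>k<n. (1 + kap + lam powr (\<beta> - 1)) * (G k)\<^sup>2)"
    unfolding uTu by (intro sum_mono summand)
  also have "\<dots> \<le> (1 + kap + lam powr (\<beta> - 1)) * B"
    unfolding sum_distrib_left[symmetric] using kap0 by (intro mult_left_mono GB) (auto intro!: add_nonneg_nonneg)
  finally have uTuB: "(\<integral>x. u x * T0 u x \<partial>M) \<le> B * (1 + kap + lam powr (\<beta> - 1))" by (simp add: mult.commute)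
  have r3: "(T0 u x)\<^sup>2 \<le> kap * (B * (1 + kap + lam powr (\<beta> - 1)))" for x
  proof -
    have "(T0 u x)\<^sup>2 \<le> (\<integral>x. u x * T0 u x \<partial>M) * H x x"
      using lim_kernel_functional_eval[OF H bfunctional_integral[OF u1], of x] by (simp add: T0_def)
    also have "\<dots> \<le> (B * (1 + kap + lam powr (\<beta> - 1))) * kap"
      using uTuB kap lim_kernel_diag_nonneg[OF H, of x] kap0 B0
      by (intro mult_mono) (auto intro!: mult_nonneg_nonneg add_nonneg_nonneg)
    finally show ?thesis by (simp add: mult.commute)
  qed
  have r1: "(\<integral>\<^sup>+x. ennreal ((T0 u x - f x)\<^sup>2) \<partial>M) \<le> ennreal (2 * (1 + B) * lam powr \<beta>)"
  proof -
    define d where "d k = (if \<mu> k \<ge> lam then 0 else - (\<mu> k powr (\<beta> / 2) * G k))" for k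
    define D where "D x = (\<Sum>k<n. d k * e k x)" for x
    have DL2: "L2_mem M D" unfolding D_def[abs_def] by (intro L2_mem_sum mem)
    hence [measurable]: "D \<in> borel_measurable M" by (simp add: L2_mem_def)
    have TD: "AE x in M. T0 u x - F n x = D x"
      using T0u
    proof eventually_elim
      case (elim x)
      show ?case unfolding elim F_def D_def sum_subtractf[symmetric] amu
        by (rule sum.cong) (auto simp: d_def algebra_simps)
    qed
    have "(\<integral>x. (D x)\<^sup>2 \<partial>M) = (\<Sum>k<n. d k * d k)"
      unfolding D_def power2_eq_square by (rule orthonormal_integral_sums[OF M mem orth])
    also have "\<dots> \<le> (\<Sum>k<n. lam powr \<beta> * (G k)\<^sup>2)"
    proof (rule sum_mono)
      fix k
      show "d k * d k \<le> lam powr \<beta> * (G k)\<^sup>2"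
      proof (cases "\<mu> k \<ge> lam")
        case False
        have "d k * d k = \<mu> k powr (\<beta> / 2 + \<beta> / 2) * (G k)\<^sup>2"
          unfolding powr_add using False by (simp add: d_def power2_eq_square)
        also have "\<dots> \<le> lam powr \<beta> * (G k)\<^sup>2"
          using False mu0[of k] \<beta> by (intro mult_right_mono) (auto intro!: powr_mono2)
        finally show ?thesis .
      qed (simp add: d_def)
    qed
    also have "\<dots> \<le> lam powr \<beta> * B"
      unfolding sum_distrib_left[symmetric] by (intro mult_left_mono GB) auto
    finally have DB: "(\<integral>x. (D x)\<^sup>2 \<partial>M) \<le> lam powr \<beta> * B" .
    have "(\<integral>\<^sup>+x. ennreal ((T0 u x - f x)\<^sup>2) \<partial>M)
        \<le> (\<integral>\<^sup>+x. ennreal (2 * (D x)\<^sup>2) + ennreal (2 * (F n x - f x)\<^sup>2) \<partial>M)"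
    proof (rule nn_integral_mono_AE)
      show "AE x in M. ennreal ((T0 u x - f x)\<^sup>2) \<le> ennreal (2 * (D x)\<^sup>2) + ennreal (2 * (F n x - f x)\<^sup>2)"
        using TD
      proof eventually_elim
        case (elim x)
        have sq: "(D x + (F n x - f x))\<^sup>2 \<le> 2 * (D x)\<^sup>2 + 2 * (F n x - f x)\<^sup>2"
          using zero_le_power2[of "D x - (F n x - f x)"] by (simp add: power2_eq_square algebra_simps)
        have e: "T0 u x - f x = D x + (F n x - f x)" using elim by simp
        have "(T0 u x - f x)\<^sup>2 \<le> 2 * (D x)\<^sup>2 + 2 * (F n x - f x)\<^sup>2"
          unfolding e by (rule sq)
        thus ?case by (simp flip: ennreal_plus)
      qed
    qed
    also have "\<dots> = (\<integral>\<^sup>+x. ennreal (2 * (D x)\<^sup>2) \<partial>M) + (\<integral>\<^sup>+x. ennreal (2 * (F n x - f x)\<^sup>2) \<partial>M)"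
      by (rule nn_integral_add) auto
    also have "(\<integral>\<^sup>+x. ennreal (2 * (D x)\<^sup>2) \<partial>M) = ennreal (2 * (\<integral>x. (D x)\<^sup>2 \<partial>M))"
      using DL2 by (subst nn_integral_eq_integral) (auto simp: L2_mem_def)
    also have "(\<integral>\<^sup>+x. ennreal (2 * (F n x - f x)\<^sup>2) \<partial>M) = 2 * (\<integral>\<^sup>+x. ennreal ((F n x - f x)\<^sup>2) \<partial>M)"
      by (subst nn_integral_cmult[symmetric]) (auto simp: ennreal_mult)
    also have "ennreal (2 * (\<integral>x. (D x)\<^sup>2 \<partial>M)) + 2 * (\<integral>\<^sup>+x. ennreal ((F n x - f x)\<^sup>2) \<partial>M)
        \<le> ennreal (2 * (lam powr \<beta> * B)) + 2 * ennreal (lam powr \<beta>)"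
      using n DB by (intro add_mono ennreal_leI mult_left_mono) auto
    also have "\<dots> = ennreal (2 * (1 + B) * lam powr \<beta>)"
      using B0 by (subst ennreal_numeral[symmetric], subst ennreal_mult[symmetric])
        (auto simp: algebra_simps simp flip: ennreal_plus)
    finally show ?thesis .
  qed
  show ?thesis using uL2 r1 r2 r3 unfolding T0_def by blast
qed

section \<open>Polynomial kernels on products of spheres\<close>

lemma fin_kernelI:
  assumes A: "finite A" and F: "\<And>a. a \<in> A \<Longrightarrow> f a \<in> F"
    and H: "\<And>x y. x \<in> S \<Longrightarrow> y \<in> S \<Longrightarrow> H x y = (\<Sum>a\<in>A. f a x * f a y)"
  shows "fin_kernel S F H"
proof -
  obtain h where h: "bij_betw h {0..<card A} A" using ex_bij_betw_nat_finite[OF A] by blast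
  have "(\<Sum>a\<in>A. f a x * f a y) = (\<Sum>k<card A. f (h k) x * f (h k) y)" for x y
    using sum.reindex_bij_betw[OF h, of "\<lambda>a. f a x * f a y"] by (simp add: lessThan_atLeast0)
  moreover have "f (h k) \<in> F" if "k < card A" for k
    using h that by (intro F) (auto simp: bij_betw_def)
  ultimately show ?thesis unfolding fin_kernel_def
    by (intro exI[of _ "card A"] exI[of _ "\<lambda>k. f (h k)"]) (auto simp: H)
qed

lemma fin_kernel_zero: "fin_kernel S F (\<lambda>_ _. 0)"
  by (rule fin_kernelI[of "{}" undefined]) auto

lemma fin_kernel_subset: "fin_kernel S F H \<Longrightarrow> F \<subseteq> G \<Longrightarrow> fin_kernel S G H"
  unfolding fin_kernel_def by (meson subsetD)

lemma fin_kernel_add: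
  assumes "fin_kernel S F H" "fin_kernel S F G" shows "fin_kernel S F (\<lambda>x y. H x y + G x y)"
proof -
  obtain q \<phi> where 1: "\<forall>k<q::nat. \<phi> k \<in> F" "\<forall>x\<in>S. \<forall>y\<in>S. H x y = (\<Sum>k<q. \<phi> k x * \<phi> k y)"
    using assms(1) unfolding fin_kernel_def by (elim exE conjE) simp
  obtain r \<psi> where 2: "\<forall>k<r::nat. \<psi> k \<in> F" "\<forall>x\<in>S. \<forall>y\<in>S. G x y = (\<Sum>k<r. \<psi> k x * \<psi> k y)"
    using assms(2) unfolding fin_kernel_def by (elim exE conjE) simp
  show ?thesis unfolding fin_kernel_def
    by (rule exI[of _ "q + r"], rule exI[of _ "\<lambda>k. if k < q then \<phi> k else \<psi> (k - q)"])
      (use 1 2 in \<open>auto simp: sum_lessThan_add\<close>)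
qed

lemma fin_kernel_mult:
  assumes "fin_kernel S F H" "fin_kernel S G K" and FG: "\<And>f g. f \<in> F \<Longrightarrow> g \<in> G \<Longrightarrow> (\<lambda>x. f x * g x) \<in> E"
  shows "fin_kernel S E (\<lambda>x y. H x y * K x y)"
proof -
  obtain q \<phi> where 1: "\<forall>k<q::nat. \<phi> k \<in> F" "\<forall>x\<in>S. \<forall>y\<in>S. H x y = (\<Sum>k<q. \<phi> k x * \<phi> k y)"
    using assms(1) unfolding fin_kernel_def by (elim exE conjE) simp
  obtain r \<psi> where 2: "\<forall>k<r::nat. \<psi> k \<in> G" "\<forall>x\<in>S. \<forall>y\<in>S. K x y = (\<Sum>k<r. \<psi> k x * \<psi> k y)"
    using assms(2) unfolding fin_kernel_def by (elim exE conjE) simp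
  show ?thesis
  proof (rule fin_kernelI[of "{..<q} \<times> {..<r}" "\<lambda>(i, j) x. \<phi> i x * \<psi> j x"])
    fix x y assume "x \<in> S" "y \<in> S"
    thus "H x y * K x y = (\<Sum>a\<in>{..<q} \<times> {..<r}. (case a of (i, j) \<Rightarrow> \<lambda>x. \<phi> i x * \<psi> j x) x
        * (case a of (i, j) \<Rightarrow> \<lambda>x. \<phi> i x * \<psi> j x) y)"
      using 1 2 by (simp add: sum_product sum.cartesian_product case_prod_unfold mult_ac)
  qed (use 1 2 FG in auto)
qed

lemma fin_kernel_cmult:
  assumes "fin_kernel S F H" "c \<ge> 0" and F: "\<And>f c. f \<in> F \<Longrightarrow> (\<lambda>x. c * f x) \<in> F"
  shows "fin_kernel S F (\<lambda>x y. c * H x y)"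
proof -
  obtain q \<phi> where 1: "\<forall>k<q::nat. \<phi> k \<in> F" "\<forall>x\<in>S. \<forall>y\<in>S. H x y = (\<Sum>k<q. \<phi> k x * \<phi> k y)"
    using assms(1) unfolding fin_kernel_def by (elim exE conjE) simp
  have sq: "sqrt c * a * (sqrt c * b) = c * (a * b)" for a b
  proof -
    have "sqrt c * a * (sqrt c * b) = (sqrt c * sqrt c) * (a * b)" by (simp add: mult_ac)
    thus ?thesis using assms(2) by simp
  qed
  show ?thesis unfolding fin_kernel_def
  proof (rule exI[of _ q], rule exI[of _ "\<lambda>k x. sqrt c * \<phi> k x"], intro conjI ballI)
    fix x y assume "x \<in> S" "y \<in> S"
    thus "c * H x y = (\<Sum>k<q. sqrt c * \<phi> k x * (sqrt c * \<phi> k y))"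
      using 1(2) unfolding sq sum_distrib_left[symmetric] by simp
  qed (use 1(1) F in blast)
qed

lemma fin_kernel_sum:
  assumes "\<And>a. a \<in> A \<Longrightarrow> fin_kernel S F (H a)"
  shows "fin_kernel S F (\<lambda>x y. \<Sum>a\<in>A. H a x y)"
  using assms by (induction A rule: infinite_finite_induct) (auto intro: fin_kernel_zero fin_kernel_add)

lemma fin_kernel_cong:
  assumes "fin_kernel S F H" and eq: "\<And>x y. x \<in> S \<Longrightarrow> y \<in> S \<Longrightarrow> H x y = G x y"
  shows "fin_kernel S F G"
proof -
  obtain q \<phi> where 1: "\<forall>k<q::nat. \<phi> k \<in> F" "\<forall>x\<in>S. \<forall>y\<in>S. H x y = (\<Sum>k<q. \<phi> k x * \<phi> k y)"
    using assms(1) unfolding fin_kernel_def by (elim exE conjE) simp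
  have "G x y = (\<Sum>k<q. \<phi> k x * \<phi> k y)" if "x \<in> S" "y \<in> S" for x y
    unfolding eq[OF that, symmetric] using 1(2) that by blast
  with 1(1) show ?thesis unfolding fin_kernel_def by blast
qed

section \<open>Monomials in the coordinates of the blocks as features\<close>

definition mono_fun :: "('n::finite \<Rightarrow> 'd::finite \<Rightarrow> nat) \<Rightarrow> ('n \<Rightarrow> real^'d) \<Rightarrow> real" where
  "mono_fun e x = (\<Prod>i\<in>UNIV. \<Prod>c\<in>UNIV. (x i $ c) ^ e i c)"

definition delta_exp :: "'n \<Rightarrow> 'd \<Rightarrow> nat \<Rightarrow> 'n \<Rightarrow> 'd \<Rightarrow> nat" where
  "delta_exp i c k j a = (if j = i \<and> a = c then k else 0)"

text \<open>Two separate budgets: the number of blocks that occur determines the power of the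
  logarithm in the rates, while the degree within a block determines only its base.\<close>

definition exps_deg :: "nat \<Rightarrow> nat \<Rightarrow> ('n::finite \<Rightarrow> 'd::finite \<Rightarrow> nat) set" where
  "exps_deg s M = {e. card {i. \<exists>c. e i c \<noteq> 0} \<le> s \<and> (\<forall>i. (\<Sum>c\<in>UNIV. e i c) \<le> M)}"

text \<open>Scalar multiples are included so that the square root of a kernel coefficient can be
  absorbed into the feature.\<close>

definition mono_feats :: "('n::finite \<Rightarrow> 'd::finite \<Rightarrow> nat) set \<Rightarrow> (('n \<Rightarrow> real^'d) \<Rightarrow> real) set" where
  "mono_feats E = {f. \<exists>c. \<exists>e\<in>E. f = (\<lambda>x. c * mono_fun e x)}"

lemma mono_fun_add: "mono_fun (\<lambda>i c. e i c + f i c) x = mono_fun e x * mono_fun f x"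
  by (simp add: mono_fun_def power_add prod.distrib)

lemma mono_fun_zero: "mono_fun (\<lambda>_ _. 0) x = 1"
  by (simp add: mono_fun_def)

lemma mono_fun_delta: "mono_fun (delta_exp i c k) x = (x i $ c) ^ k"
proof -
  have "(\<Prod>a\<in>UNIV. (x j $ a) ^ delta_exp i c k j a) = (if j = i then (x i $ c) ^ k else 1)" for j
  proof -
    have "(\<Prod>a\<in>UNIV. (x j $ a) ^ delta_exp i c k j a)
        = (\<Prod>a\<in>UNIV. if a = c then (if j = i then (x j $ a) ^ k else 1) else 1)"
      by (rule prod.cong) (auto simp: delta_exp_def)
    thus ?thesis by simp
  qed
  thus ?thesis unfolding mono_fun_def by simp
qed

lemma mono_feats_cmult: "f \<in> mono_feats E \<Longrightarrow> (\<lambda>x. c * f x) \<in> mono_feats E"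
proof -
  assume "f \<in> mono_feats E"
  then obtain d e where "e \<in> E" "f = (\<lambda>x. d * mono_fun e x)" unfolding mono_feats_def by blast
  hence "(\<lambda>x. c * f x) = (\<lambda>x. (c * d) * mono_fun e x)" by (simp add: mult.assoc)
  with \<open>e \<in> E\<close> show ?thesis unfolding mono_feats_def by blast
qed

lemma mono_feats_mult:
  assumes "f \<in> mono_feats E" "g \<in> mono_feats F"
    and "\<And>e f. e \<in> E \<Longrightarrow> f \<in> F \<Longrightarrow> (\<lambda>i c. e i c + f i c) \<in> G"
  shows "(\<lambda>x. f x * g x) \<in> mono_feats G"
proof -
  obtain c e d h where "e \<in> E" "f = (\<lambda>x. c * mono_fun e x)" "h \<in> F" "g = (\<lambda>x. d * mono_fun h x)"
    using assms(1,2) unfolding mono_feats_def by blast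
  hence "(\<lambda>x. f x * g x) = (\<lambda>x. (c * d) * mono_fun (\<lambda>i a. e i a + h i a) x)" "(\<lambda>i a. e i a + h i a) \<in> G"
    using assms(3) by (auto simp: mono_fun_add mult_ac)
  thus ?thesis unfolding mono_feats_def by blast
qed

lemma mono_feats_mono: "E \<subseteq> F \<Longrightarrow> mono_feats E \<subseteq> mono_feats F"
  unfolding mono_feats_def by blast

lemma exps_deg_mono: "s \<le> s' \<Longrightarrow> M \<le> M' \<Longrightarrow> exps_deg s M \<subseteq> exps_deg s' M'"
  unfolding exps_deg_def by (auto intro: order_trans)

lemma exps_deg_add:
  assumes "e \<in> exps_deg s M" "f \<in> exps_deg s' M'"
  shows "(\<lambda>i c. e i c + f i c) \<in> exps_deg (s + s') (M + M')"
proof -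
  have "card {i. \<exists>c. e i c + f i c \<noteq> 0} \<le> card ({i. \<exists>c. e i c \<noteq> 0} \<union> {i. \<exists>c. f i c \<noteq> 0})"
    by (intro card_mono) auto
  also have "\<dots> \<le> card {i. \<exists>c. e i c \<noteq> 0} + card {i. \<exists>c. f i c \<noteq> 0}" by (rule card_Un_le)
  finally show ?thesis using assms by (auto simp: exps_deg_def sum.distrib intro: add_mono order_trans)
qed

lemma fin_kernel_power:
  assumes H: "fin_kernel S (mono_feats (exps_deg s M)) H"
  shows "fin_kernel S (mono_feats (exps_deg (j * s) (j * M))) (\<lambda>x y. H x y ^ j)"
proof (induction j)
  case 0
  have "fin_kernel S (mono_feats (exps_deg 0 0)) (\<lambda>x y. 1)"
  proof (rule fin_kernelI[of "{()}" "\<lambda>_ x. 1 * mono_fun (\<lambda>_ _. 0) x"])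
    show "(\<lambda>x. 1 * mono_fun (\<lambda>_ _. 0) x) \<in> mono_feats (exps_deg 0 0)"
      unfolding mono_feats_def by (auto intro!: exI[of _ 1] bexI[of _ "\<lambda>_ _. 0"] simp: exps_deg_def)
  qed (auto simp: mono_fun_zero)
  thus ?case by simp
next
  case (Suc j)
  show ?case unfolding power_Suc
    by (rule fin_kernel_mult[OF H Suc]) (auto intro!: mono_feats_mult exps_deg_add)
qed

text \<open>All powers of one block involve that block only, hence the separate exponent set.\<close>
lemma fin_kernel_inner_power:
  fixes i :: "'n::finite"
  shows "fin_kernel S (mono_feats {e. (\<forall>j. j \<noteq> i \<longrightarrow> e j = (\<lambda>_. 0)) \<and> (\<Sum>c\<in>UNIV. e i c) \<le> m})
    (\<lambda>x y. ((x i :: real^'d::finite) \<bullet> y i) ^ m)"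
proof (induction m)
  case 0
  show ?case
  proof (rule fin_kernelI[of "{()}" "\<lambda>_ x. 1 * mono_fun (\<lambda>_ _. 0) x"])
    show "(\<lambda>x. 1 * mono_fun (\<lambda>_ _. 0) x)
        \<in> mono_feats {e. (\<forall>j. j \<noteq> i \<longrightarrow> e j = (\<lambda>_. 0)) \<and> (\<Sum>c\<in>UNIV. e i c) \<le> 0}"
      unfolding mono_feats_def by (auto intro!: exI[of _ 1] bexI[of _ "\<lambda>_ _. 0"])
  qed (auto simp: mono_fun_zero)
next
  case (Suc m)
  have inn: "fin_kernel S (mono_feats (range (\<lambda>c. delta_exp i c 1))) (\<lambda>x y. (x i :: real^'d) \<bullet> y i)"
  proof (rule fin_kernelI[of UNIV "\<lambda>c x. 1 * mono_fun (delta_exp i c 1) x"])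
    fix c show "(\<lambda>x. 1 * mono_fun (delta_exp i c 1) x) \<in> mono_feats (range (\<lambda>c. delta_exp i c 1))"
      unfolding mono_feats_def by blast
  qed (auto simp: mono_fun_delta inner_vec_def)
  show ?case unfolding power_Suc
  proof (rule fin_kernel_mult[OF inn Suc], rule mono_feats_mult, assumption, assumption)
    fix e f :: "'n \<Rightarrow> 'd \<Rightarrow> nat" assume "e \<in> range (\<lambda>c. delta_exp i c (1::nat) :: 'n \<Rightarrow> 'd \<Rightarrow> nat)"
      and f: "f \<in> {e. (\<forall>j. j \<noteq> i \<longrightarrow> e j = (\<lambda>_. 0)) \<and> (\<Sum>c\<in>UNIV. e i c) \<le> m}"
    then obtain c where e: "e = delta_exp i c 1" by blast
    have "(\<Sum>a\<in>UNIV. delta_exp i c 1 i a) = 1" by (simp add: delta_exp_def)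
    thus "(\<lambda>i c. e i c + f i c) \<in> {e. (\<forall>j. j \<noteq> i \<longrightarrow> e j = (\<lambda>_. 0)) \<and> (\<Sum>c\<in>UNIV. e i c) \<le> Suc m}"
      using f by (auto simp: e sum.distrib) (auto simp: delta_exp_def fun_eq_iff)
  qed
qed

definition trunc_sum :: "(nat \<Rightarrow> real) \<Rightarrow> nat \<Rightarrow> ('n::finite \<Rightarrow> real^'d::finite) \<Rightarrow> ('n \<Rightarrow> real^'d) \<Rightarrow> real" where
  "trunc_sum b M x y = (\<Sum>i\<in>UNIV. \<Sum>m<M. b m * (x i \<bullet> y i) ^ m)"

text \<open>The free lower end \<open>K\<close> serves two purposes: \<open>K = 0\<close> gives the
  head, and a positive \<open>K\<close> the increment between two truncation orders.\<close>

lemma fin_kernel_trunc_block: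
  fixes b :: "nat \<Rightarrow> real"
  assumes "\<And>m. b m \<ge> 0"
  shows "fin_kernel S (mono_feats (exps_deg 1 M)) (\<lambda>x y :: 'n::finite \<Rightarrow> real^'d::finite. \<Sum>m\<in>{K..<M}. \<Sum>i\<in>UNIV. b m * (x i \<bullet> y i) ^ m)"
proof (intro fin_kernel_sum fin_kernel_cmult assms)
  fix i :: 'n and m assume m: "m \<in> {K..<M}"
  show "fin_kernel S (mono_feats (exps_deg 1 M)) (\<lambda>x y :: 'n::finite \<Rightarrow> real^'d::finite. (x i \<bullet> y i) ^ m)"
  proof (rule fin_kernel_subset[OF fin_kernel_inner_power], rule mono_feats_mono, rule subsetI)
    fix e :: "'n \<Rightarrow> 'd \<Rightarrow> nat"
    assume "e \<in> {e. (\<forall>j. j \<noteq> i \<longrightarrow> e j = (\<lambda>_. 0)) \<and> (\<Sum>c\<in>UNIV. e i c) \<le> m}"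
    hence e: "\<And>j. j \<noteq> i \<Longrightarrow> e j = (\<lambda>_. 0)" "(\<Sum>c\<in>UNIV. e i c) \<le> m" by auto
    have "{j. \<exists>c. e j c \<noteq> 0} \<subseteq> {i}"
    proof
      fix j assume "j \<in> {j. \<exists>c. e j c \<noteq> 0}"
      then obtain c where "e j c \<noteq> 0" by blast
      thus "j \<in> {i}" using e(1)[of j] by (cases "j = i") simp_all
    qed
    hence "card {j. \<exists>c. e j c \<noteq> 0} \<le> card {i}" by (rule card_mono[rotated]) simp
    hence "card {j. \<exists>c. e j c \<noteq> 0} \<le> 1" by simp
    moreover have "(\<Sum>c\<in>UNIV. e j c) \<le> M" for j using e m by (cases "j = i") auto
    ultimately show "e \<in> exps_deg 1 M" by (simp add: exps_deg_def)
  qed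
qed (rule mono_feats_cmult)

lemma fin_kernel_trunc_sum:
  assumes "\<And>m. b m \<ge> 0"
  shows "fin_kernel S (mono_feats (exps_deg 1 M)) (trunc_sum b M)"
  by (rule fin_kernel_cong[OF fin_kernel_trunc_block[OF assms, where K = 0]])
    (simp add: trunc_sum_def lessThan_atLeast0, rule sum.swap)

text \<open>The powers of the truncated sum expand into products of at most \<open>degree p\<close>
  monomials of one block each. This is where the degree enters \<open>dstar\<close>.\<close>

lemma fin_kernel_poly_trunc:
  assumes b: "\<And>m. b m \<ge> 0" and p: "\<And>i. coeff p i \<ge> 0"
  shows "fin_kernel S (mono_feats (exps_deg (degree p) (degree p * M))) (\<lambda>x y. poly p (trunc_sum b M x y))"
  unfolding poly_altdef
proof (intro fin_kernel_sum fin_kernel_cmult p)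
  fix j assume "j \<in> {..degree p}"
  thus "fin_kernel S (mono_feats (exps_deg (degree p) (degree p * M))) (\<lambda>x y. trunc_sum b M x y ^ j)"
    by (intro fin_kernel_subset[OF fin_kernel_power[OF fin_kernel_trunc_sum[OF b]]] mono_feats_mono exps_deg_mono)
      auto
qed (rule mono_feats_cmult)

text \<open>To become a sum of squares, the difference has to be written with positive terms only.
  The recursion \<open>(A + E) ^ Suc j - A ^ Suc j = (A + E) ^ j * E + ((A + E) ^ j - A ^ j) *
  A\<close> does this.\<close>

lemma fin_kernel_power_diff:
  fixes A E :: "('n::finite \<Rightarrow> real^'d::finite) \<Rightarrow> ('n \<Rightarrow> real^'d) \<Rightarrow> real"
  assumes A: "fin_kernel S (mono_feats UNIV) A" and E: "fin_kernel S (mono_feats UNIV) E"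
  shows "fin_kernel S (mono_feats UNIV) (\<lambda>x y. (A x y + E x y) ^ j)"
    and "fin_kernel S (mono_feats UNIV) (\<lambda>x y. (A x y + E x y) ^ j - A x y ^ j)"
proof -
  have mult: "fin_kernel S (mono_feats UNIV) (\<lambda>x y. H x y * G x y)"
    if "fin_kernel S (mono_feats UNIV) H" "fin_kernel S (mono_feats UNIV) G"
    for H G :: "('n \<Rightarrow> real^'d) \<Rightarrow> ('n \<Rightarrow> real^'d) \<Rightarrow> real"
    by (rule fin_kernel_mult[OF that]) (auto intro: mono_feats_mult)
  have one: "fin_kernel S (mono_feats UNIV) (\<lambda>x y :: 'n \<Rightarrow> real^'d. 1)"
    by (rule fin_kernelI[of "{()}" "\<lambda>_ x. 1 * mono_fun (\<lambda>_ _. 0) x"])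
      (auto simp: mono_fun_zero mono_feats_def intro!: exI[of _ 1] exI[of _ "\<lambda>_ _. 0"])
  show pw: "fin_kernel S (mono_feats UNIV) (\<lambda>x y. (A x y + E x y) ^ j)" for j
  proof (induction j)
    case (Suc j)
    show ?case unfolding power_Suc by (intro mult fin_kernel_add A E Suc)
  qed (simp add: one)
  show "fin_kernel S (mono_feats UNIV) (\<lambda>x y. (A x y + E x y) ^ j - A x y ^ j)"
  proof (induction j)
    case (Suc j)
    have "fin_kernel S (mono_feats UNIV)
        (\<lambda>x y. (A x y + E x y) ^ j * E x y + ((A x y + E x y) ^ j - A x y ^ j) * A x y)"
      by (intro fin_kernel_add mult pw E Suc A)
    thus ?case by (rule fin_kernel_cong) (simp add: algebra_simps)
  qed (simp add: fin_kernel_zero)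
qed

text \<open>As \<open>M'\<close> grows, these kernels converge uniformly to the tail of the kernel
  beyond order \<open>M\<close>, which is how the tail is seen to be positive semidefinite.\<close>

lemma fin_kernel_poly_trunc_diff:
  assumes b: "\<And>m. b m \<ge> 0" and p: "\<And>i. coeff p i \<ge> 0" and "M \<le> M'"
  shows "fin_kernel S (mono_feats UNIV) (\<lambda>x y. poly p (trunc_sum b M' x y) - poly p (trunc_sum b M x y))"
proof -
  define E where "E x y = (\<Sum>m\<in>{M..<M'}. \<Sum>i\<in>UNIV. b m * (x i \<bullet> y i) ^ m)" for x y :: "'a \<Rightarrow> real^'b"
  have un: "fin_kernel S (mono_feats UNIV) H" if "fin_kernel S (mono_feats F) H" for F and H :: "('a \<Rightarrow> real^'b) \<Rightarrow> ('a \<Rightarrow> real^'b) \<Rightarrow> real"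
    by (rule fin_kernel_subset[OF that mono_feats_mono]) simp
  have eq: "trunc_sum b M' x y = trunc_sum b M x y + E x y" for x y
  proof -
    have "E x y = (\<Sum>i\<in>UNIV. \<Sum>m\<in>{M..<M'}. b m * (x i \<bullet> y i) ^ m)" unfolding E_def by (rule sum.swap)
    thus ?thesis using assms(3) unfolding trunc_sum_def
      by (simp add: sum.distrib[symmetric] lessThan_atLeast0 sum.atLeastLessThan_concat)
  qed
  have Ek: "fin_kernel S (mono_feats (exps_deg 1 M')) E"
    unfolding E_def[abs_def] by (rule fin_kernel_trunc_block[OF b])
  have "fin_kernel S (mono_feats UNIV)
      (\<lambda>x y. \<Sum>j\<le>degree p. coeff p j * ((trunc_sum b M x y + E x y) ^ j - trunc_sum b M x y ^ j))"
    by (intro fin_kernel_sum fin_kernel_cmult p fin_kernel_power_diff mono_feats_cmult un[OF fin_kernel_trunc_sum[OF b]] un[OF Ek])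
  thus ?thesis
    by (rule fin_kernel_cong) (simp add: poly_altdef eq right_diff_distrib sum_subtractf)
qed

text \<open>The Lipschitz constant of \<open>x * poly p x\<close> involves a bound on
  \<open>p\<close>, so the two claims are proved by one induction.\<close>

lemma poly_lipschitz_bounded:
  fixes p :: "real poly"
  shows "\<exists>L B. 0 \<le> L \<and> (\<forall>x y. \<bar>x\<bar> \<le> R \<longrightarrow> \<bar>y\<bar> \<le> R \<longrightarrow> \<bar>poly p x - poly p y\<bar> \<le> L * \<bar>x - y\<bar>)
    \<and> (\<forall>x. \<bar>x\<bar> \<le> R \<longrightarrow> \<bar>poly p x\<bar> \<le> B)"
proof (induction p)
  case (pCons a p)
  obtain L B where L: "0 \<le> L" "\<And>x y. \<bar>x\<bar> \<le> R \<Longrightarrow> \<bar>y\<bar> \<le> R \<Longrightarrow> \<bar>poly p x - poly p y\<bar> \<le> L * \<bar>x - y\<bar>"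
    and B: "\<And>x. \<bar>x\<bar> \<le> R \<Longrightarrow> \<bar>poly p x\<bar> \<le> B" using pCons.IH by auto
  show ?case
  proof (rule exI[of _ "\<bar>R\<bar> * L + \<bar>B\<bar>"], rule exI[of _ "\<bar>a\<bar> + \<bar>R\<bar> * \<bar>B\<bar>"], intro conjI allI impI)
    fix x y assume xy: "\<bar>x\<bar> \<le> R" "\<bar>y\<bar> \<le> R"
    have "poly (pCons a p) x - poly (pCons a p) y = x * (poly p x - poly p y) + (x - y) * poly p y"
      by (simp add: algebra_simps)
    hence "\<bar>poly (pCons a p) x - poly (pCons a p) y\<bar> \<le> \<bar>x\<bar> * \<bar>poly p x - poly p y\<bar> + \<bar>x - y\<bar> * \<bar>poly p y\<bar>"
      by (metis abs_mult abs_triangle_ineq)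
    also have "\<dots> \<le> \<bar>R\<bar> * (L * \<bar>x - y\<bar>) + \<bar>x - y\<bar> * \<bar>B\<bar>"
      using xy L(2)[OF xy] B[OF xy(2)] L(1) by (intro add_mono mult_mono) auto
    finally show "\<bar>poly (pCons a p) x - poly (pCons a p) y\<bar> \<le> (\<bar>R\<bar> * L + \<bar>B\<bar>) * \<bar>x - y\<bar>"
      by (simp add: algebra_simps)
  next
    fix x assume x: "\<bar>x\<bar> \<le> R"
    have "\<bar>poly (pCons a p) x\<bar> \<le> \<bar>a\<bar> + \<bar>x\<bar> * \<bar>poly p x\<bar>" by (simp add: abs_mult[symmetric] abs_triangle_ineq)
    also have "\<dots> \<le> \<bar>a\<bar> + \<bar>R\<bar> * \<bar>B\<bar>" using x B[OF x] by (intro add_left_mono mult_mono) auto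
    finally show "\<bar>poly (pCons a p) x\<bar> \<le> \<bar>a\<bar> + \<bar>R\<bar> * \<bar>B\<bar>" .
  qed (use L in auto)
qed (auto intro: exI[of _ 0])

section \<open>Counting monomials modulo the equation of the sphere\<close>

definition reduced_exps :: "'d \<Rightarrow> nat \<Rightarrow> nat \<Rightarrow> ('n::finite \<Rightarrow> 'd::finite \<Rightarrow> nat) set" where
  "reduced_exps c0 s M = {e. card {i. \<exists>c. e i c \<noteq> 0} \<le> s \<and> (\<forall>i. e i c0 \<le> 1 \<and> (\<forall>c. e i c \<le> M))}"

text \<open>There are at most \<open>2 ^ CARD('n)\<close> sets of active blocks. In an active block
  the coordinate \<open>c0\<close> admits two exponents and each of the other
  \<open>CARD('d) - 1\<close> coordinates \<open>M + 1\<close>. Bounding every exponent separately,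
  and not the degree, turns this into a product count.\<close>

lemma card_reduced_exps:
  fixes c0 :: "'d::finite"
  shows "finite (reduced_exps c0 s M :: ('n::finite \<Rightarrow> 'd \<Rightarrow> nat) set)"
    and "card (reduced_exps c0 s M :: ('n::finite \<Rightarrow> 'd \<Rightarrow> nat) set)
      \<le> 2 ^ CARD('n) * (2 * (M + 1) ^ (CARD('d) - 1)) ^ s"
proof -
  define A where "A = (PiE UNIV (\<lambda>c. if c = c0 then {..1} else {..M}) :: ('d \<Rightarrow> nat) set)"
  have finA: "finite A" unfolding A_def by (intro finite_PiE) auto
  have cardA: "card A = 2 * (M + 1) ^ (CARD('d) - 1)"
  proof -
    have "card A = (\<Prod>c\<in>UNIV. card (if c = c0 then {..1} else {..M}))" unfolding A_def by (simp add: card_PiE)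
    also have "\<dots> = card {..(1::nat)} * (\<Prod>c\<in>UNIV - {c0}. card (if c = c0 then {..1} else {..M}))"
      by (subst prod.remove[of _ c0]) auto
    also have "(\<Prod>c\<in>UNIV - {c0}. card (if c = c0 then {..1} else {..M})) = (\<Prod>c\<in>UNIV - {c0}. M + 1)"
      by (rule prod.cong) auto
    finally show ?thesis by (simp add: card_Diff_singleton)
  qed
  define Q where "Q T = {e :: 'n \<Rightarrow> 'd \<Rightarrow> nat. (\<forall>i. i \<notin> T \<longrightarrow> e i = (\<lambda>_. 0)) \<and> (\<forall>i\<in>T. e i \<in> A)}" for T
  have inj: "inj_on (\<lambda>e. restrict e T) (Q T)" for T
  proof (rule inj_onI)
    fix e f assume ef: "e \<in> Q T" "f \<in> Q T" "restrict e T = restrict f T"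
    show "e = f"
    proof
      fix i show "e i = f i"
        using ef restrict_apply'[of i T e] restrict_apply'[of i T f] by (cases "i \<in> T") (auto simp: Q_def)
    qed
  qed
  have img: "(\<lambda>e. restrict e T) ` Q T \<subseteq> PiE T (\<lambda>_. A)" for T by (auto simp: Q_def)
  have finP: "finite (PiE T (\<lambda>_. A))" for T :: "'n set" using finA by (intro finite_PiE) auto
  have finQ: "finite (Q T)" for T by (rule inj_on_finite[OF inj img finP])
  have cardQ: "card (Q T) \<le> (2 * (M + 1) ^ (CARD('d) - 1)) ^ s" if "card T \<le> s" for T
  proof -
    have "card (Q T) \<le> card (PiE T (\<lambda>_. A))" by (rule card_inj_on_le[OF inj img finP])
    also have "\<dots> = (2 * (M + 1) ^ (CARD('d) - 1)) ^ card T" by (simp add: card_PiE cardA)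
    also have "\<dots> \<le> (2 * (M + 1) ^ (CARD('d) - 1)) ^ s" using that by (intro power_increasing) auto
    finally show ?thesis .
  qed
  define \<T> where "\<T> = {T :: 'n set. card T \<le> s}"
  have sub: "reduced_exps c0 s M \<subseteq> (\<Union>T\<in>\<T>. Q T)"
  proof
    fix e :: "'n \<Rightarrow> 'd \<Rightarrow> nat" assume e: "e \<in> reduced_exps c0 s M"
    have "e \<in> Q {i. \<exists>c. e i c \<noteq> 0}" using e by (auto simp: Q_def A_def reduced_exps_def)
    moreover have "{i. \<exists>c. e i c \<noteq> 0} \<in> \<T>" using e by (simp add: \<T>_def reduced_exps_def)
    ultimately show "e \<in> (\<Union>T\<in>\<T>. Q T)" by blast
  qed
  have finU: "finite (\<Union>T\<in>\<T>. Q T)" using finQ by auto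
  show "finite (reduced_exps c0 s M :: ('n::finite \<Rightarrow> 'd \<Rightarrow> nat) set)" by (rule finite_subset[OF sub finU])
  have "card (reduced_exps c0 s M :: ('n::finite \<Rightarrow> 'd \<Rightarrow> nat) set) \<le> card (\<Union>T\<in>\<T>. Q T)"
    by (rule card_mono[OF finU sub])
  also have "\<dots> \<le> (\<Sum>T\<in>\<T>. card (Q T))" by (rule card_UN_le) simp
  also have "\<dots> \<le> (\<Sum>T\<in>\<T>. (2 * (M + 1) ^ (CARD('d) - 1)) ^ s)"
  proof (rule sum_mono)
    fix T assume "T \<in> \<T>"
    thus "card (Q T) \<le> (2 * (M + 1) ^ (CARD('d) - 1)) ^ s" by (intro cardQ) (simp add: \<T>_def)
  qed
  also have "\<dots> = card \<T> * (2 * (M + 1) ^ (CARD('d) - 1)) ^ s" by simp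
  also have "\<dots> \<le> 2 ^ CARD('n) * (2 * (M + 1) ^ (CARD('d) - 1)) ^ s"
  proof (rule mult_right_mono)
    have "card \<T> \<le> card (Pow (UNIV :: 'n set))" by (intro card_mono) auto
    thus "card \<T> \<le> 2 ^ CARD('n)" by (simp add: card_Pow)
  qed simp
  finally show "card (reduced_exps c0 s M :: ('n::finite \<Rightarrow> 'd \<Rightarrow> nat) set)
      \<le> 2 ^ CARD('n) * (2 * (M + 1) ^ (CARD('d) - 1)) ^ s" .
qed

text \<open>On the sphere the square of the coordinate \<open>c0\<close> is one minus the other squares.\<close>
lemma mono_fun_reduced:
  fixes c0 :: "'d::finite" and e :: "'n::finite \<Rightarrow> 'd \<Rightarrow> nat"
  assumes "e \<in> exps_deg s M"
  shows "\<exists>C. \<forall>x\<in>I_set. mono_fun e x = (\<Sum>f\<in>reduced_exps c0 s M. C f * mono_fun f x)"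
  using assms
proof (induction "\<Sum>i\<in>UNIV. e i c0" arbitrary: e rule: less_induct)
  case less
  note fin = card_reduced_exps(1)[of c0 s M, where 'n = 'n]
  have le: "e i c \<le> M" for i c
    using less.prems member_le_sum[of c UNIV "e i"] by (auto simp: exps_deg_def intro: order_trans)
  show ?case
  proof (cases "\<forall>i. e i c0 \<le> 1")
    case True
    hence eR: "e \<in> reduced_exps c0 s M" using le less.prems by (auto simp: reduced_exps_def exps_deg_def)
    show ?thesis
    proof (intro exI[of _ "\<lambda>f. if f = e then 1 else 0"] ballI)
      fix x :: "'n \<Rightarrow> real^'d"
      have "(\<Sum>f\<in>reduced_exps c0 s M. (if f = e then 1 else 0) * mono_fun f x)
          = (\<Sum>f\<in>reduced_exps c0 s M. if f = e then mono_fun f x else 0)" by (rule sum.cong) auto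
      thus "mono_fun e x = (\<Sum>f\<in>reduced_exps c0 s M. (if f = e then 1 else 0) * mono_fun f x)"
        using fin eR by simp
    qed
  next
    case False
    then obtain i where "\<not> e i c0 \<le> 1" by blast
    hence i: "e i c0 \<ge> 2" by simp
    \<comment> \<open>\<open>g\<close> is \<open>e\<close> with two powers of coordinate
      \<open>c0\<close> of block \<open>i\<close> removed, and \<open>h c\<close> puts them on
      coordinate \<open>c\<close>. The total exponent of \<open>c0\<close> falls by two for
      \<open>g\<close> and for \<open>h c\<close> with \<open>c\<close> other than
      \<open>c0\<close>. No block degree grows and no new block appears, so the recursion stays in
      \<open>exps_deg s M\<close>.\<close>
    define g where "g j a = e j a - delta_exp i c0 2 j a" for j a
    have eg: "e j a = g j a + delta_exp i c0 2 j a" for j a using i by (auto simp: g_def delta_exp_def)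
    define h where "h c j a = g j a + delta_exp i c 2 j a" for c j a
    have sume: "(\<Sum>a\<in>UNIV. e i a) = (\<Sum>a\<in>UNIV. g i a) + 2"
      unfolding eg sum.distrib by (simp add: delta_exp_def)
    have sumj: "(\<Sum>a\<in>UNIV. e j a) = (\<Sum>a\<in>UNIV. g j a)" if "j \<noteq> i" for j
      unfolding eg sum.distrib using that by (simp add: delta_exp_def)
    have sumc: "(\<Sum>j\<in>UNIV. e j c0) = (\<Sum>j\<in>UNIV. g j c0) + 2"
      unfolding eg sum.distrib by (simp add: delta_exp_def)
    have gE: "g \<in> exps_deg s M"
    proof -
      have "card {i. \<exists>c. g i c \<noteq> 0} \<le> card {i. \<exists>c. e i c \<noteq> 0}" by (intro card_mono) (auto simp: eg)
      moreover have "(\<Sum>c\<in>UNIV. g j c) \<le> (\<Sum>c\<in>UNIV. e j c)" for j by (intro sum_mono) (simp add: eg)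
      ultimately show ?thesis using less.prems by (auto simp: exps_deg_def intro: order_trans)
    qed
    have hE: "h c \<in> exps_deg s M" for c
    proof -
      have "card {i. \<exists>a. h c i a \<noteq> 0} \<le> card {i. \<exists>a. e i a \<noteq> 0}"
      proof (intro card_mono subsetI, simp)
        fix j assume "j \<in> {j. \<exists>a. h c j a \<noteq> 0}"
        thus "j \<in> {j. \<exists>a. e j a \<noteq> 0}" using i by (cases "j = i") (auto simp: h_def eg delta_exp_def)
      qed
      moreover have "(\<Sum>a\<in>UNIV. h c j a) \<le> M" for j
      proof -
        have "(\<Sum>a\<in>UNIV. h c j a) = (\<Sum>a\<in>UNIV. e j a)"
          using sume sumj by (cases "j = i") (auto simp: h_def sum.distrib delta_exp_def)
        thus ?thesis using less.prems by (simp add: exps_deg_def)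
      qed
      ultimately show ?thesis using less.prems by (auto simp: exps_deg_def)
    qed
    have hc0: "(\<Sum>j\<in>UNIV. h c j c0) = (\<Sum>j\<in>UNIV. g j c0)" if "c \<noteq> c0" for c
      using that by (simp add: h_def delta_exp_def)
    obtain C where C: "\<And>x. x \<in> I_set \<Longrightarrow> mono_fun g x = (\<Sum>f\<in>reduced_exps c0 s M. C f * mono_fun f x)"
      using less.hyps[OF _ gE] sumc by auto
    have "\<forall>c. \<exists>C. c \<noteq> c0 \<longrightarrow> (\<forall>x\<in>I_set. mono_fun (h c) x = (\<Sum>f\<in>reduced_exps c0 s M. C f * mono_fun f x))"
    proof
      fix c
      show "\<exists>C. c \<noteq> c0 \<longrightarrow> (\<forall>x\<in>I_set. mono_fun (h c) x = (\<Sum>f\<in>reduced_exps c0 s M. C f * mono_fun f x))"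
        using less.hyps[OF _ hE[of c]] sumc hc0[of c] by (cases "c = c0") auto
    qed
    then obtain D where D: "\<And>c x. c \<noteq> c0 \<Longrightarrow> x \<in> I_set \<Longrightarrow>
        mono_fun (h c) x = (\<Sum>f\<in>reduced_exps c0 s M. D c f * mono_fun f x)" by metis
    show ?thesis
    proof (intro exI[of _ "\<lambda>f. C f - (\<Sum>c\<in>UNIV - {c0}. D c f)"] ballI)
      fix x :: "'n \<Rightarrow> real^'d" assume x: "x \<in> I_set"
      have "1 = x i \<bullet> x i" using x by (simp add: I_set_def dot_square_norm)
      also have "\<dots> = (\<Sum>c\<in>UNIV. (x i $ c)\<^sup>2)" by (simp add: inner_vec_def power2_eq_square)
      also have "\<dots> = (x i $ c0)\<^sup>2 + (\<Sum>c\<in>UNIV - {c0}. (x i $ c)\<^sup>2)" by (rule sum.remove) auto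
      finally have sq: "(x i $ c0)\<^sup>2 = 1 - (\<Sum>c\<in>UNIV - {c0}. (x i $ c)\<^sup>2)" by simp
      have "mono_fun e x = mono_fun g x * (x i $ c0)\<^sup>2"
        unfolding mono_fun_delta[symmetric] mono_fun_add[symmetric] using eg by presburger
      also have "\<dots> = mono_fun g x - (\<Sum>c\<in>UNIV - {c0}. mono_fun (h c) x)"
        unfolding sq by (simp add: right_diff_distrib sum_distrib_left h_def[abs_def] mono_fun_add mono_fun_delta)
      also have "(\<Sum>c\<in>UNIV - {c0}. mono_fun (h c) x)
          = (\<Sum>c\<in>UNIV - {c0}. \<Sum>f\<in>reduced_exps c0 s M. D c f * mono_fun f x)"
        by (rule sum.cong) (use x in \<open>auto simp: D\<close>)
      also have "\<dots> = (\<Sum>f\<in>reduced_exps c0 s M. (\<Sum>c\<in>UNIV - {c0}. D c f) * mono_fun f x)"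
        by (subst sum.swap) (simp add: sum_distrib_right)
      finally show "mono_fun e x
          = (\<Sum>f\<in>reduced_exps c0 s M. (C f - (\<Sum>c\<in>UNIV - {c0}. D c f)) * mono_fun f x)"
        by (simp add: C[OF x] left_diff_distrib sum_subtractf)
    qed
  qed
qed

section \<open>The kernel on the product of spheres and its split into head and tail\<close>

definition cut_off :: "'a set \<Rightarrow> ('a \<Rightarrow> 'a \<Rightarrow> real) \<Rightarrow> 'a \<Rightarrow> 'a \<Rightarrow> real" where
  "cut_off S H x y = (if x \<in> S \<and> y \<in> S then H x y else 0)"

lemma space_I_meas: "space I_meas = UNIV"
  by (simp add: I_meas_def space_PiM)

lemma measurable_mono_fun: "(mono_fun e :: ('n::finite \<Rightarrow> real^'d::finite) \<Rightarrow> real) \<in> borel_measurable I_meas"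
proof -
  have [measurable]: "(\<lambda>x :: 'n \<Rightarrow> real^'d. x i $ c) \<in> borel_measurable I_meas" for i c
  proof (rule measurable_compose[where f = "\<lambda>x. x i"])
    show "(\<lambda>x :: 'n \<Rightarrow> real^'d. x i) \<in> I_meas \<rightarrow>\<^sub>M borel"
      unfolding I_meas_def by (rule measurable_component_singleton) simp
    show "(\<lambda>v :: real^'d. v $ c) \<in> borel_measurable borel"
      by (intro borel_measurable_continuous_onI continuous_intros)
  qed
  show ?thesis unfolding mono_fun_def[abs_def] by measurable
qed

lemma sets_I_set: "(I_set :: ('n::finite \<Rightarrow> real^'d::finite) set) \<in> sets I_meas"
proof -
  have [measurable]: "(\<lambda>x :: 'n \<Rightarrow> real^'d. x i) \<in> I_meas \<rightarrow>\<^sub>M borel" for i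
    unfolding I_meas_def by (rule measurable_component_singleton) simp
  have "{x \<in> space (I_meas :: ('n \<Rightarrow> real^'d) measure). \<forall>i. norm (x i) = 1} \<in> sets I_meas" by measurable
  thus ?thesis by (simp add: I_set_def space_I_meas)
qed

text \<open>Coordinates of unit vectors are at most 1 in absolute value, so a monomial is bounded by
  its scalar factor.\<close>

lemma mono_feats_cut_off:
  assumes f: "f \<in> mono_feats E" and \<mu>: "sets \<mu> = sets (I_meas :: ('n::finite \<Rightarrow> real^'d::finite) measure)"
  shows "(\<lambda>x. if x \<in> I_set then f x else 0) \<in> bfun \<mu>"
proof -
  obtain c e where f: "f = (\<lambda>x. c * mono_fun e x)" using f unfolding mono_feats_def by blast
  have [measurable]: "mono_fun e \<in> borel_measurable \<mu>"
    using measurable_mono_fun \<mu> measurable_cong_sets by blast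
  have [measurable]: "I_set \<in> sets \<mu>" unfolding \<mu> by (rule sets_I_set)
  show ?thesis
  proof (rule bfunI[of _ _ "\<bar>c\<bar>"])
    show "(\<lambda>x. if x \<in> I_set then f x else 0) \<in> borel_measurable \<mu>" unfolding f by measurable
    fix x
    have "\<bar>mono_fun e x\<bar> \<le> 1" if "x \<in> I_set"
    proof -
      have "\<bar>x i $ c\<bar> \<le> 1" for i c
        using that component_le_norm_cart[of "x i" c] by (simp add: I_set_def)
      hence "\<bar>x i $ c\<bar> ^ e i c \<le> 1" for i c by (intro power_le_one) auto
      thus ?thesis unfolding mono_fun_def abs_prod power_abs by (intro prod_le_1 conjI prod_nonneg) auto
    qed
    thus "\<bar>if x \<in> I_set then f x else 0\<bar> \<le> \<bar>c\<bar>"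
      unfolding f by (auto simp: abs_mult intro: mult_left_le)
  qed
qed

lemma fin_kernel_cut_off:
  assumes H: "fin_kernel I_set (mono_feats E) H" and \<mu>: "sets \<mu> = sets (I_meas :: ('n::finite \<Rightarrow> real^'d::finite) measure)"
  shows "fin_kernel UNIV (bfun \<mu>) (cut_off I_set H)"
proof -
  obtain q \<phi> where 1: "\<forall>k<q::nat. \<phi> k \<in> mono_feats E" "\<forall>x\<in>I_set. \<forall>y\<in>I_set. H x y = (\<Sum>k<q. \<phi> k x * \<phi> k y)"
    using H unfolding fin_kernel_def by (elim exE conjE) simp
  show ?thesis
    by (rule fin_kernelI[of "{..<q}" "\<lambda>k x. if x \<in> I_set then \<phi> k x else 0"])
      (use 1 mono_feats_cut_off[OF _ \<mu>] in \<open>auto simp: cut_off_def\<close>)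
qed

lemma power_series_tail_bound:
  fixes b :: "nat \<Rightarrow> real"
  assumes r: "0 < r" "r < 1" and b: "\<And>m. 0 \<le> b m \<and> b m \<le> c * r ^ m"
    and f: "(\<lambda>m. b m * t ^ m) sums s" and t: "\<bar>t\<bar> \<le> 1"
  shows "\<bar>s - (\<Sum>m<M. b m * t ^ m)\<bar> \<le> c / (1 - r) * r ^ M"
proof -
  let ?g = "\<lambda>m. b (m + M) * t ^ (m + M)"
  have g: "?g sums (s - (\<Sum>m<M. b m * t ^ m))" using f by (rule sums_split_initial_segment)
  have h: "(\<lambda>m. c * r ^ M * r ^ m) sums (c * r ^ M * (1 / (1 - r)))"
    using r by (intro sums_mult geometric_sums) auto
  have gh: "\<bar>?g m\<bar> \<le> c * r ^ M * r ^ m" for m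
  proof -
    have "\<bar>?g m\<bar> = b (m + M) * \<bar>t\<bar> ^ (m + M)" using b by (simp add: abs_mult power_abs)
    also have "\<dots> \<le> b (m + M) * 1" using b t by (intro mult_left_mono power_le_one) auto
    also have "\<dots> \<le> c * r ^ (m + M)" using b by simp
    finally show ?thesis by (simp add: power_add mult_ac)
  qed
  have "s - (\<Sum>m<M. b m * t ^ m) \<le> c * r ^ M * (1 / (1 - r))"
    by (rule sums_le[OF _ g h]) (use gh in \<open>simp add: abs_le_iff\<close>)
  moreover have "- (s - (\<Sum>m<M. b m * t ^ m)) \<le> c * r ^ M * (1 / (1 - r))"
    by (rule sums_le[OF _ sums_minus[OF g] h]) (use gh in \<open>simp add: abs_le_iff\<close>)
  ultimately show ?thesis by (simp add: abs_le_iff)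
qed

lemma I_set_inner_le: "x \<in> I_set \<Longrightarrow> y \<in> I_set \<Longrightarrow> \<bar>x i \<bullet> y i\<bar> \<le> 1"
  using Cauchy_Schwarz_ineq2[of "x i" "y i"] by (simp add: I_set_def)

lemma kernel_trunc_error:
  fixes b :: "nat \<Rightarrow> real" and p :: "real poly"
  assumes r: "0 < r" "r < 1" and b: "\<And>m. 0 \<le> b m \<and> b m \<le> c1 * r ^ m"
    and f1: "\<forall>t\<in>{-1..1}. (\<lambda>m. b m * t ^ m) sums f1 t" and comp: "compose_fs fs N = poly p"
  shows "\<exists>C>0. \<forall>M. \<forall>x\<in>I_set. \<forall>y\<in>I_set.
    \<bar>kerN f1 fs N (x :: 'n::finite \<Rightarrow> real^'d::finite) y - poly p (trunc_sum b M x y)\<bar> \<le> C * r ^ M"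
proof -
  define n where "n = real CARD('n)"
  \<comment> \<open>\<open>c1 / (1 - r)\<close> bounds \<open>f1\<close> on the interval, being the
    tail at order 0, and twice that bounds every partial sum. All arguments of \<open>p\<close> thus
    lie in one interval, and the Lipschitz constant does not depend on \<open>M\<close>.\<close>
  define R where "R = n * (2 * (c1 / (1 - r)))"
  obtain L where L: "0 \<le> L" "\<forall>x y. \<bar>x\<bar> \<le> R \<longrightarrow> \<bar>y\<bar> \<le> R \<longrightarrow> \<bar>poly p x - poly p y\<bar> \<le> L * \<bar>x - y\<bar>"
    using poly_lipschitz_bounded[of R p] by blast
  have c1: "c1 \<ge> 0" using b[of 0] by auto
  define c where "c = c1 / (1 - r)"
  have c0: "c \<ge> 0" using c1 r by (simp add: c_def)
  have "\<bar>kerN f1 fs N x y - poly p (trunc_sum b M x y)\<bar> \<le> (L * (n * c) + 1) * r ^ M"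
    if xy: "x \<in> I_set" "y \<in> I_set" for M and x y :: "'n \<Rightarrow> real^'d"
  proof -
    have tail: "\<bar>f1 (x i \<bullet> y i) - (\<Sum>m<M. b m * (x i \<bullet> y i) ^ m)\<bar> \<le> c * r ^ M" for i M
      unfolding c_def using I_set_inner_le[OF xy, of i] f1
      by (intro power_series_tail_bound r b) (auto simp: abs_le_iff)
    have f1b: "\<bar>f1 (x i \<bullet> y i)\<bar> \<le> c" for i using tail[of i 0] by simp
    have tb: "\<bar>\<Sum>m<M. b m * (x i \<bullet> y i) ^ m\<bar> \<le> 2 * c" for i
    proof -
      have "c * r ^ M \<le> c * 1" using r c0 by (intro mult_left_mono power_le_one) auto
      thus ?thesis using tail[of i M] f1b[of i] by linarith
    qed
    have R1: "\<bar>\<Sum>i\<in>UNIV. f1 (x i \<bullet> y i)\<bar> \<le> R"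
    proof -
      have "\<bar>\<Sum>i\<in>UNIV. f1 (x i \<bullet> y i)\<bar> \<le> (\<Sum>i\<in>(UNIV::'n set). 2 * c)"
        using f1b c0 by (intro order_trans[OF sum_abs] sum_mono) (smt (verit))
      thus ?thesis by (simp add: R_def n_def c_def)
    qed
    have R2: "\<bar>trunc_sum b M x y\<bar> \<le> R"
    proof -
      have "\<bar>trunc_sum b M x y\<bar> \<le> (\<Sum>i\<in>(UNIV::'n set). 2 * c)"
        unfolding trunc_sum_def by (rule order_trans[OF sum_abs], rule sum_mono, rule tb)
      thus ?thesis by (simp add: R_def n_def c_def)
    qed
    have diff: "\<bar>(\<Sum>i\<in>UNIV. f1 (x i \<bullet> y i)) - trunc_sum b M x y\<bar> \<le> n * c * r ^ M"
    proof -
      have "\<bar>(\<Sum>i\<in>UNIV. f1 (x i \<bullet> y i)) - trunc_sum b M x y\<bar> \<le> (\<Sum>i\<in>(UNIV::'n set). c * r ^ M)"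
        unfolding trunc_sum_def sum_subtractf[symmetric] by (rule order_trans[OF sum_abs], rule sum_mono, rule tail)
      thus ?thesis by (simp add: n_def)
    qed
    have "\<bar>kerN f1 fs N x y - poly p (trunc_sum b M x y)\<bar> \<le> L * \<bar>(\<Sum>i\<in>UNIV. f1 (x i \<bullet> y i)) - trunc_sum b M x y\<bar>"
      unfolding kerN_def comp using L R1 R2 by blast
    also have "\<dots> \<le> L * (n * c * r ^ M)" using diff L by (intro mult_left_mono) auto
    also have "\<dots> \<le> (L * (n * c) + 1) * r ^ M" using r by (simp add: algebra_simps)
    finally show ?thesis .
  qed
  moreover have "L * (n * c) + 1 > 0" using L c0 by (simp add: n_def add_nonneg_pos)
  ultimately show ?thesis by blast
qed

lemma exists_power_le:
  fixes r :: real assumes "0 < r" "r < 1" "C > 0" "e > 0"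
  shows "\<exists>M\<ge>K. C * r ^ M \<le> e"
proof -
  obtain M where M: "r ^ M < e / C" using real_arch_pow_inv[of "e / C" r] assms by auto
  have "C * r ^ (max M K) \<le> C * r ^ M" using assms by (intro mult_left_mono power_decreasing) auto
  also have "\<dots> \<le> e" using M assms by (simp add: field_simps)
  finally show ?thesis by (intro exI[of _ "max M K"]) auto
qed

text \<open>The three constants precede the measure \<open>\<mu>\<close>, which makes the later
  bounds uniform over the marginals. The expansion of the head may have many more terms than there
  are reduced monomials; \<open>reduce_features\<close> brings the number of features down to the
  latter.\<close>

lemma kernel_decomposition:
  fixes b :: "nat \<Rightarrow> real" and p :: "real poly" and f1 :: "real \<Rightarrow> real" and fs :: "nat \<Rightarrow> real \<Rightarrow> real" and N :: nat
  defines "K \<equiv> (kerN f1 fs N :: ('n::finite \<Rightarrow> real^'d::finite) \<Rightarrow> _)"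
    and "dd \<equiv> (CARD('d) - 1) * min (degree p) CARD('n)"
  assumes r: "0 < r" "r < 1" and b: "\<And>m. 0 \<le> b m \<and> b m \<le> c1 * r ^ m"
    and f1: "\<forall>t\<in>{-1..1}. (\<lambda>m. b m * t ^ m) sums f1 t" and comp: "compose_fs fs N = poly p"
    and p: "\<And>i. coeff p i \<ge> 0" "degree p \<ge> 1"
  shows "\<exists>kap>0. \<exists>Cm>0. \<exists>Ct>0. \<forall>\<mu>. sets \<mu> = sets (I_meas :: ('n \<Rightarrow> real^'d) measure) \<longrightarrow>
    lim_kernel \<mu> (cut_off I_set K) \<and> (\<forall>x. cut_off I_set K x x \<le> kap) \<and>
    (\<forall>M. \<exists>m \<eta>. real m \<le> Cm * real (M + 1) ^ dd \<and> (\<forall>a<m. \<eta> a \<in> bfun \<mu>) \<and>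
      lim_kernel \<mu> (\<lambda>x y. cut_off I_set K x y - (\<Sum>a<m. \<eta> a x * \<eta> a y)) \<and>
      (\<forall>x. cut_off I_set K x x - (\<Sum>a<m. \<eta> a x * \<eta> a x) \<le> Ct * r ^ M))"
proof -
  define s where "s = min (degree p) CARD('n)"
  obtain C where C: "C > 0" "\<And>M x y. x \<in> I_set \<Longrightarrow> y \<in> I_set \<Longrightarrow>
      \<bar>K x y - poly p (trunc_sum b M x y)\<bar> \<le> C * r ^ M"
    using kernel_trunc_error[OF r b f1 comp] unfolding K_def by blast
  have b0: "\<And>m. b m \<ge> 0" using b by blast
  define KM where "KM M = cut_off I_set (\<lambda>x y :: 'n \<Rightarrow> real^'d. poly p (trunc_sum b M x y))" for M
  have KC: "\<bar>cut_off I_set K x y - KM M x y\<bar> \<le> C * r ^ M" for x y M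
    using C r by (auto simp: KM_def cut_off_def)
  \<comment> \<open>At truncation order 0 the sum is empty, so on the spheres the diagonal differs
    from \<open>poly p 0\<close> by at most \<open>C\<close>.\<close>
  define kap where "kap = C + \<bar>poly p 0\<bar>"
  have diag: "cut_off I_set K x x \<le> kap" for x
  proof -
    have "cut_off I_set K x x \<le> KM 0 x x + C" using KC[of x x 0] by simp
    also have "KM 0 x x \<le> \<bar>poly p 0\<bar>" by (simp add: KM_def cut_off_def trunc_sum_def abs_ge_self)
    finally show ?thesis by (simp add: kap_def)
  qed
  define D where "D = degree p"
  \<comment> \<open>The head of order \<open>M\<close> has block degree at most
    \<open>D * M\<close>, and \<open>D * M + 1 \<le> D * (M + 1)\<close>. The factors 2 come from
    the exponents of \<open>c0\<close> and from the choice of the active blocks.\<close>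
  define Cm where "Cm = 2 ^ CARD('n) * 2 ^ s * real D ^ dd"
  have "Cm > 0" using p(2) by (simp add: Cm_def D_def)
  have "lim_kernel \<mu> (cut_off I_set K) \<and> (\<forall>x. cut_off I_set K x x \<le> kap) \<and>
    (\<forall>M. \<exists>m \<eta>. real m \<le> Cm * real (M + 1) ^ dd \<and> (\<forall>a<m. \<eta> a \<in> bfun \<mu>) \<and>
      lim_kernel \<mu> (\<lambda>x y. cut_off I_set K x y - (\<Sum>a<m. \<eta> a x * \<eta> a y)) \<and>
      (\<forall>x. cut_off I_set K x x - (\<Sum>a<m. \<eta> a x * \<eta> a x) \<le> C * r ^ M))"
    if \<mu>: "sets \<mu> = sets (I_meas :: ('n \<Rightarrow> real^'d) measure)" for \<mu>
  proof (intro conjI allI diag)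
    show "lim_kernel \<mu> (cut_off I_set K)"
      unfolding lim_kernel_def
    proof (intro allI impI)
      fix e :: real assume "e > 0"
      then obtain M where M: "C * r ^ M \<le> e" using exists_power_le[OF r C(1)] by blast
      have "fin_kernel UNIV (bfun \<mu>) (KM M)" unfolding KM_def
        by (rule fin_kernel_cut_off[OF fin_kernel_poly_trunc[where b = b and p = p, OF b0 p(1)] \<mu>])
      thus "\<exists>H'. fin_kernel UNIV (bfun \<mu>) H' \<and> (\<forall>x y. \<bar>cut_off I_set K x y - H' x y\<bar> \<le> e)"
        using KC[of _ _ M] M by (meson order_trans)
    qed
    fix M
    obtain q \<phi> where q: "\<forall>k<q::nat. \<phi> k \<in> mono_feats (exps_deg D (D * M))"
      "\<forall>x\<in>I_set. \<forall>y\<in>I_set. poly p (trunc_sum b M x y) = (\<Sum>k<q. \<phi> k x * \<phi> k (y :: 'n \<Rightarrow> real^'d))"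
      using fin_kernel_poly_trunc[where b = b and p = p, OF b0 p(1), of I_set M] unfolding fin_kernel_def D_def[symmetric] by (elim exE conjE) (rule that)
    define c0 :: 'd where "c0 = undefined"
    define R where "R = (reduced_exps c0 s (D * M) :: ('n \<Rightarrow> 'd \<Rightarrow> nat) set)"
    have finR: "finite R" unfolding R_def by (rule card_reduced_exps)
    obtain h where h: "bij_betw h {0..<card R} R" using ex_bij_betw_nat_finite[OF finR] by blast
    have "\<exists>C. \<forall>x\<in>I_set. \<phi> k x = (\<Sum>a<card R. C a * mono_fun (h a) x)" if k: "k < q" for k
    proof -
      obtain c e where e: "e \<in> exps_deg D (D * M)" "\<phi> k = (\<lambda>x. c * mono_fun e x)"
        using q(1) k unfolding mono_feats_def by blast
      have "card {i. \<exists>c. e i c \<noteq> 0} \<le> CARD('n)" by (intro card_mono) auto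
      hence "e \<in> exps_deg s (D * M)" using e(1) by (simp add: exps_deg_def s_def D_def)
      from mono_fun_reduced[OF this, of c0] obtain C where
        C: "\<And>x. x \<in> I_set \<Longrightarrow> mono_fun e x = (\<Sum>f\<in>R. C f * mono_fun f x)" unfolding R_def by blast
      show ?thesis
      proof (intro exI[of _ "\<lambda>a. c * C (h a)"] ballI)
        fix x :: "'n \<Rightarrow> real^'d" assume x: "x \<in> I_set"
        have "(\<Sum>f\<in>R. C f * mono_fun f x) = (\<Sum>a<card R. C (h a) * mono_fun (h a) x)"
          using sum.reindex_bij_betw[OF h, of "\<lambda>f. C f * mono_fun f x"] by (simp add: lessThan_atLeast0)
        thus "\<phi> k x = (\<Sum>a<card R. c * C (h a) * mono_fun (h a) x)"
          by (simp add: e(2) C[OF x] sum_distrib_left mult.assoc)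
      qed
    qed
    then obtain Cf where Cf: "\<And>k x. k < q \<Longrightarrow> x \<in> I_set \<Longrightarrow> \<phi> k x = (\<Sum>a<card R. Cf k a * mono_fun (h a) x)"
      by metis
    have "\<exists>\<eta>. (\<forall>a<card R. \<exists>d. \<forall>x. \<eta> a x = (\<Sum>k<q. d k * \<phi> k x)) \<and>
        (\<forall>x\<in>I_set. \<forall>y\<in>I_set. (\<Sum>k<q. \<phi> k x * \<phi> k y) = (\<Sum>a<card R. \<eta> a x * \<eta> a y))"
      by (rule reduce_features[where C = Cf and \<psi> = "\<lambda>a. mono_fun (h a)"]) (rule Cf)
    then obtain \<eta> where \<eta>: "(\<forall>a<card R. \<exists>d. \<forall>x. \<eta> a x = (\<Sum>k<q. d k * \<phi> k x)) \<and>
        (\<forall>x\<in>I_set. \<forall>y\<in>I_set. (\<Sum>k<q. \<phi> k x * \<phi> k y) = (\<Sum>a<card R. \<eta> a x * \<eta> a y))"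
      by (elim exE)
    define \<eta>' where "\<eta>' a x = (if x \<in> I_set then \<eta> a x else 0)" for a x
    have bf: "\<eta>' a \<in> bfun \<mu>" if a: "a < card R" for a
    proof -
      obtain d where d: "\<And>x. \<eta> a x = (\<Sum>k<q. d k * \<phi> k x)" using \<eta> a by blast
      have "\<eta>' a = (\<lambda>x. \<Sum>k<q. d k * (if x \<in> I_set then \<phi> k x else 0))"
        by (rule ext) (simp add: \<eta>'_def d)
      moreover have "(\<lambda>x. if x \<in> I_set then \<phi> k x else 0) \<in> bfun \<mu>" if "k < q" for k
        using q(1) that by (intro mono_feats_cut_off[OF _ \<mu>]) blast
      ultimately show ?thesis by (simp only:) (intro bfun_sum bfun_cmult)
    qed
    have head: "KM M x y = (\<Sum>a<card R. \<eta>' a x * \<eta>' a y)" for x y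
    proof (cases "x \<in> I_set \<and> y \<in> I_set")
      case True
      thus ?thesis using q(2) \<eta> by (simp add: KM_def cut_off_def \<eta>'_def)
    next
      case False
      hence "\<eta>' a x * \<eta>' a y = 0" for a by (auto simp: \<eta>'_def)
      hence "(\<Sum>a<card R. \<eta>' a x * \<eta>' a y) = 0" by (intro sum.neutral ballI)
      thus ?thesis using False by (auto simp: KM_def cut_off_def)
    qed
    have "real (card R) \<le> Cm * real (M + 1) ^ dd"
    proof -
      have "card R \<le> 2 ^ CARD('n) * (2 * (D * M + 1) ^ (CARD('d) - 1)) ^ s"
        unfolding R_def by (rule card_reduced_exps)
      also have "\<dots> \<le> 2 ^ CARD('n) * (2 * (D * (M + 1)) ^ (CARD('d) - 1)) ^ s"
        using p(2) by (intro mult_left_mono power_mono) (auto simp: D_def)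
      also have "\<dots> = 2 ^ CARD('n) * 2 ^ s * D ^ dd * (M + 1) ^ dd"
        unfolding power_mult_distrib power_mult[symmetric] dd_def s_def by (simp only: mult.assoc)
      finally have "real (card R) \<le> real (2 ^ CARD('n) * 2 ^ s * D ^ dd * (M + 1) ^ dd)" by (rule of_nat_mono)
      thus ?thesis by (simp add: Cm_def)
    qed
    moreover have "lim_kernel \<mu> (\<lambda>x y. cut_off I_set K x y - (\<Sum>a<card R. \<eta>' a x * \<eta>' a y))"
      unfolding lim_kernel_def
    proof (intro allI impI)
      fix e :: real assume "e > 0"
      then obtain M' where M': "M' \<ge> M" "C * r ^ M' \<le> e" using exists_power_le[OF r C(1)] by blast
      have "fin_kernel UNIV (bfun \<mu>)
          (cut_off I_set (\<lambda>x y. poly p (trunc_sum b M' x y) - poly p (trunc_sum b M x y)))"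
        by (rule fin_kernel_cut_off[OF fin_kernel_poly_trunc_diff[where b = b and p = p, OF b0 p(1) M'(1)] \<mu>])
      moreover have "\<bar>(cut_off I_set K x y - (\<Sum>a<card R. \<eta>' a x * \<eta>' a y))
          - cut_off I_set (\<lambda>x y. poly p (trunc_sum b M' x y) - poly p (trunc_sum b M x y)) x y\<bar> \<le> e" for x y
      proof -
        \<comment> \<open>The head of order \<open>M\<close> cancels, and only the truncation error
          of order \<open>M'\<close> is left.\<close>
        have "(cut_off I_set K x y - (\<Sum>a<card R. \<eta>' a x * \<eta>' a y))
          - cut_off I_set (\<lambda>x y. poly p (trunc_sum b M' x y) - poly p (trunc_sum b M x y)) x y
          = cut_off I_set K x y - KM M' x y"
          unfolding head[symmetric] by (simp add: KM_def cut_off_def)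
        thus ?thesis using KC[of x y M'] M'(2) by simp
      qed
      ultimately show "\<exists>H'. fin_kernel UNIV (bfun \<mu>) H' \<and>
          (\<forall>x y. \<bar>cut_off I_set K x y - (\<Sum>a<card R. \<eta>' a x * \<eta>' a y) - H' x y\<bar> \<le> e)" by blast
    qed
    moreover have "cut_off I_set K x x - (\<Sum>a<card R. \<eta>' a x * \<eta>' a x) \<le> C * r ^ M" for x
      using KC[of x x M] by (simp add: head abs_le_iff)
    ultimately show "\<exists>m \<eta>. real m \<le> Cm * real (M + 1) ^ dd \<and> (\<forall>a<m. \<eta> a \<in> bfun \<mu>) \<and>
      lim_kernel \<mu> (\<lambda>x y. cut_off I_set K x y - (\<Sum>a<m. \<eta> a x * \<eta> a y)) \<and>
      (\<forall>x. cut_off I_set K x x - (\<Sum>a<m. \<eta> a x * \<eta> a x) \<le> C * r ^ M)"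
      using bf by (intro exI[of _ "card R"] exI[of _ \<eta>'] conjI allI impI)
  qed
  moreover have "kap > 0" using C(1) by (simp add: kap_def add_pos_nonneg)
  ultimately show ?thesis using \<open>Cm > 0\<close> C(1) by blast
qed

section \<open>The regression model\<close>

lemma exp_remainder_le_square:
  fixes t :: real assumes "0 \<le> t" "t \<le> 1" shows "exp t - 1 - t \<le> t\<^sup>2"
  using exp_bound[of t] assms by simp

lemma exp_remainder_ge:
  fixes t :: real assumes "0 \<le> t" shows "t\<^sup>2 / 2 \<le> exp t - 1 - t"
  using exp_lower_Taylor_quadratic[OF assms] by simp

lemma exp_remainder_mono:
  fixes a b :: real assumes "0 \<le> a" "a \<le> b" shows "exp a - 1 - a \<le> exp b - 1 - b"
  using exp_minus_id_mono[OF assms] by simp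

lemma exp_remainder_midpoint:
  "exp (a + b) - 1 - (a + b) \<le> (exp (2 * a) - 1 - 2 * a) / 2 + (exp (2 * b) - 1 - 2 * b) / (2::real)"
  using exp_minus_id_midpoint[of a b] by (simp add: field_simps)

text \<open>Turns a finite integral of the remainder into integrability of the exponential
  itself.\<close>

lemma exp_le_remainder: "0 \<le> t \<Longrightarrow> exp t \<le> 2 * (exp t - 1 - t) + (2::real)"
proof -
  assume t: "0 \<le> t"
  have "2 * t \<le> 1 + t\<^sup>2" using zero_le_power2[of "t - 1"] by (simp add: power2_eq_square algebra_simps)
  moreover have "t\<^sup>2 \<le> 2 * (exp t - 1 - t)" using exp_remainder_ge[OF t] by simp
  ultimately show ?thesis by (simp add: algebra_simps)
qed

lemma exp_remainder_sums:
  fixes t :: real shows "(\<lambda>k. t ^ (k + 2) / fact (k + 2)) sums (exp t - 1 - t)"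
proof -
  have "(\<lambda>k. t ^ k / fact k) sums exp t" using exp_converges[of t] by (simp add: divide_inverse mult.commute)
  from sums_split_initial_segment[OF this, of 2] show ?thesis by (simp add: numeral_2_eq_2 algebra_simps)
qed

text \<open>The series of the remainder has non-negative terms and is integrated termwise in
  \<open>ennreal\<close>. The Bernstein moments leave a geometric series in \<open>c * L\<close>, at
  most \<open>1 / 2\<close>; its sum 2 cancels the factor \<open>1 / 2\<close> of the moment
  condition.\<close>

lemma nn_integral_exp_remainder_le:
  fixes \<sigma> L c :: real and g :: "'a \<Rightarrow> real"
  assumes g[measurable]: "g \<in> borel_measurable M" "\<And>x. 0 \<le> g x" and c: "0 \<le> c" "c * L \<le> 1 / 2" and L: "L > 0"
    and mom: "\<And>m::nat. 2 \<le> m \<Longrightarrow> (\<integral>\<^sup>+x. ennreal (g x ^ m) \<partial>M) \<le> ennreal (fact m * \<sigma>\<^sup>2 * L ^ (m - 2) / 2)"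
  shows "(\<integral>\<^sup>+x. ennreal (exp (c * g x) - 1 - c * g x) \<partial>M) \<le> ennreal (\<sigma>\<^sup>2 * c\<^sup>2)"
proof -
  have "(\<integral>\<^sup>+x. ennreal (exp (c * g x) - 1 - c * g x) \<partial>M)
      = (\<integral>\<^sup>+x. (\<Sum>k. ennreal ((c * g x) ^ (k + 2) / fact (k + 2))) \<partial>M)"
  proof (rule nn_integral_cong)
    fix x
    note s = exp_remainder_sums[of "c * g x"]
    show "ennreal (exp (c * g x) - 1 - c * g x) = (\<Sum>k. ennreal ((c * g x) ^ (k + 2) / fact (k + 2)))"
      by (subst suminf_ennreal2[OF _ sums_summable[OF s]])
        (use g(2) c(1) in \<open>auto intro!: divide_nonneg_pos simp only: sums_unique[OF s, symmetric] mult_nonneg_nonneg zero_le_power fact_gt_zero\<close>)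
  qed
  also have "\<dots> = (\<Sum>k. \<integral>\<^sup>+x. ennreal ((c * g x) ^ (k + 2) / fact (k + 2)) \<partial>M)"
    by (rule nn_integral_suminf) measurable
  also have "\<dots> \<le> (\<Sum>k. ennreal (\<sigma>\<^sup>2 * c\<^sup>2 / 2 * (1 / 2) ^ k))"
  proof (rule suminf_le)
    fix k :: nat
    have "(\<integral>\<^sup>+x. ennreal ((c * g x) ^ (k + 2) / fact (k + 2)) \<partial>M)
        = (\<integral>\<^sup>+x. ennreal (c ^ (k + 2) / fact (k + 2)) * ennreal (g x ^ (k + 2)) \<partial>M)"
      using c g(2) by (intro nn_integral_cong) (simp add: ennreal_mult[symmetric] power_mult_distrib)
    also have "\<dots> = ennreal (c ^ (k + 2) / fact (k + 2)) * (\<integral>\<^sup>+x. ennreal (g x ^ (k + 2)) \<partial>M)"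
      by (rule nn_integral_cmult) measurable
    also have "\<dots> \<le> ennreal (c ^ (k + 2) / fact (k + 2)) * ennreal (fact (k + 2) * \<sigma>\<^sup>2 * L ^ k / 2)"
      using mom[of "k + 2"] by (intro mult_left_mono) auto
    also have "\<dots> = ennreal (c ^ (k + 2) / fact (k + 2) * (fact (k + 2) * \<sigma>\<^sup>2 * L ^ k / 2))"
      using c L by (intro ennreal_mult[symmetric]) (auto intro!: divide_nonneg_pos)
    also have "c ^ (k + 2) / fact (k + 2) * (fact (k + 2) * \<sigma>\<^sup>2 * L ^ k / 2) = \<sigma>\<^sup>2 * c\<^sup>2 / 2 * (c * L) ^ k"
      by (simp add: power_add power_mult_distrib power2_eq_square del: fact_Suc)
    also have "ennreal (\<sigma>\<^sup>2 * c\<^sup>2 / 2 * (c * L) ^ k) \<le> ennreal (\<sigma>\<^sup>2 * c\<^sup>2 / 2 * (1 / 2) ^ k)"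
      using c L by (intro ennreal_leI mult_left_mono power_mono) auto
    finally show "(\<integral>\<^sup>+x. ennreal ((c * g x) ^ (k + 2) / fact (k + 2)) \<partial>M)
        \<le> ennreal (\<sigma>\<^sup>2 * c\<^sup>2 / 2 * (1 / 2) ^ k)" .
  qed auto
  also have "\<dots> = ennreal (\<sigma>\<^sup>2 * c\<^sup>2)"
  proof -
    have s: "(\<lambda>k. \<sigma>\<^sup>2 * c\<^sup>2 / 2 * (1 / 2) ^ k) sums (\<sigma>\<^sup>2 * c\<^sup>2 / 2 * (1 / (1 - 1 / 2)))"
      by (intro sums_mult geometric_sums) simp
    have "(\<Sum>k. \<sigma>\<^sup>2 * c\<^sup>2 / 2 * (1 / 2) ^ k) = \<sigma>\<^sup>2 * c\<^sup>2" using sums_unique[OF s] by simp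
    thus ?thesis by (subst suminf_ennreal2[OF _ sums_summable[OF s]]) (auto simp only: intro!: mult_nonneg_nonneg divide_nonneg_pos zero_le_power zero_le_power2 zero_le_divide_1_iff[THEN iffD2] zero_le_numeral zero_less_numeral)
  qed
  finally show ?thesis .
qed

text \<open>Disintegration will be proved for non-negative integrands; in this form a vanishing mean
  can be carried through it.\<close>

lemma nn_integral_pos_eq_neg:
  fixes Z :: "'a \<Rightarrow> real"
  assumes "integrable M Z"
  shows "(\<integral>x. Z x \<partial>M) = 0 \<longleftrightarrow> (\<integral>\<^sup>+x. ennreal (Z x) \<partial>M) = (\<integral>\<^sup>+x. ennreal (- Z x) \<partial>M)"
proof -
  have fin: "(\<integral>\<^sup>+x. ennreal (Z x) \<partial>M) \<noteq> \<infinity>" "(\<integral>\<^sup>+x. ennreal (- Z x) \<partial>M) \<noteq> \<infinity>"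
    using assms unfolding real_integrable_def by auto
  have "(\<integral>x. Z x \<partial>M) = enn2real (\<integral>\<^sup>+x. ennreal (Z x) \<partial>M) - enn2real (\<integral>\<^sup>+x. ennreal (- Z x) \<partial>M)"
    by (rule real_lebesgue_integral_def[OF assms])
  thus ?thesis using fin by (metis diff_self ennreal_enn2real eq_iff_diff_eq_0 infinity_ennreal_def less_top)
qed

section \<open>The sampling law apart from its density bound and source condition: disintegration
  and noise\<close>

locale regression_model =
  fixes \<rho> :: "(('n::finite \<Rightarrow> real^'d::finite) \<times> real) measure" and \<kappa> :: "('n \<Rightarrow> real^'d) \<Rightarrow> real measure"
    and \<sigma> L Binf :: real
  assumes prob: "prob_space \<rho>" and sets_rho: "sets \<rho> = sets (I_meas \<Otimes>\<^sub>M (borel :: real measure))"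
    and square: "integrable \<rho> (\<lambda>z. (snd z)\<^sup>2)" and kernel: "cond_kernel \<rho> \<kappa>"
    and regr_bound: "AE x in marg \<rho>. (regr \<kappa> x)\<^sup>2 \<le> Binf"
    and moments: "\<And>m::nat. m \<ge> 2 \<Longrightarrow> AE x in marg \<rho>.
        (\<integral>\<^sup>+y. ennreal (\<bar>y - regr \<kappa> x\<bar> ^ m) \<partial>\<kappa> x) \<le> ennreal (fact m * \<sigma>\<^sup>2 * L ^ (m - 2) / 2)"
    and L: "L > 0"
begin

sublocale prob_space \<rho> by (rule prob)

abbreviation "\<nu> \<equiv> marg \<rho>"
abbreviation "f \<equiv> regr \<kappa>"

lemma measurable_rho: "measurable \<rho> M = measurable (I_meas \<Otimes>\<^sub>M borel) M"
  by (rule measurable_cong_sets[OF sets_rho refl])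

lemma measurable_fst_rho[measurable]: "fst \<in> \<rho> \<rightarrow>\<^sub>M I_meas"
  unfolding measurable_rho by measurable

lemma measurable_snd_rho[measurable]: "snd \<in> borel_measurable \<rho>"
  unfolding measurable_rho by measurable

lemma sets_nu: "sets \<nu> = sets I_meas"
  by (simp add: marg_def)

lemma measurable_nu: "measurable \<nu> M = measurable I_meas M"
  by (rule measurable_cong_sets[OF sets_nu refl])

lemma prob_space_nu: "prob_space \<nu>"
  unfolding marg_def by (rule prob_space_distr) measurable

lemma bfun_fst: "h \<in> bfun \<nu> \<Longrightarrow> (\<lambda>z. h (fst z)) \<in> bfun \<rho>"
  unfolding bfun_def measurable_nu
  by (auto intro: measurable_compose[OF measurable_fst_rho])

lemma integral_nu:
  fixes h :: "_ \<Rightarrow> real"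
  assumes "h \<in> borel_measurable \<nu>" shows "(\<integral>z. h (fst z) \<partial>\<rho>) = (\<integral>x. h x \<partial>\<nu>)"
  unfolding marg_def by (rule integral_distr[symmetric]) (use assms in \<open>auto simp: measurable_nu\<close>)

lemma integrable_nu:
  fixes h :: "_ \<Rightarrow> real"
  assumes "h \<in> borel_measurable \<nu>" shows "integrable \<rho> (\<lambda>z. h (fst z)) \<longleftrightarrow> integrable \<nu> h"
  unfolding marg_def by (rule integrable_distr_eq[symmetric]) (use assms in \<open>auto simp: measurable_nu\<close>)

lemma AE_nu: "AE x in \<nu>. P x \<Longrightarrow> AE z in \<rho>. P (fst z)"
  unfolding marg_def by (rule AE_distrD[OF measurable_fst_rho])

lemma kappa_prob: "prob_space (\<kappa> x)" and kappa_sets: "sets (\<kappa> x) = sets borel"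
  using kernel unfolding cond_kernel_def by auto

lemma kappa_measurable: "\<kappa> \<in> I_meas \<rightarrow>\<^sub>M subprob_algebra borel"
  by (rule measurable_subprob_algebra)
    (use kernel in \<open>auto simp: cond_kernel_def intro: prob_space_imp_subprob_space\<close>)

lemma measurable_kappa: "measurable (\<kappa> x) M = measurable borel M"
  by (rule measurable_cong_sets[OF kappa_sets refl])

lemma regr_measurable[measurable]: "f \<in> borel_measurable I_meas"
  unfolding regr_def
  by (rule measurable_compose[OF kappa_measurable integral_measurable_subprob_algebra]) simp

text \<open>\<open>cond_kernel\<close> speaks of rectangles only; these are closed under
  intersection and generate the product sigma-algebra.\<close>

lemma rho_eq_bind: "\<rho> = \<nu> \<bind> (\<lambda>x. distr (\<kappa> x) (I_meas \<Otimes>\<^sub>M borel) (Pair x))"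
  (is "_ = ?R")
proof -
  have K: "(\<lambda>x. distr (\<kappa> x) (I_meas \<Otimes>\<^sub>M borel) (Pair x)) \<in> \<nu> \<rightarrow>\<^sub>M subprob_algebra (I_meas \<Otimes>\<^sub>M borel)"
    unfolding measurable_nu by (rule measurable_distr2[OF _ kappa_measurable]) (simp add: case_prod_Pair_iden)
  have ne: "space \<nu> \<noteq> {}" by (simp add: marg_def space_I_meas)
  have setsR: "sets ?R = sets (I_meas \<Otimes>\<^sub>M borel)"
    by (rule sets_bind) (use ne in auto)
  have rect: "emeasure \<rho> (A \<times> B) = emeasure ?R (A \<times> B)" if A: "A \<in> sets I_meas" and B: "B \<in> sets borel" for A B
  proof -
    have "emeasure ?R (A \<times> B) = (\<integral>\<^sup>+x. emeasure (distr (\<kappa> x) (I_meas \<Otimes>\<^sub>M borel) (Pair x)) (A \<times> B) \<partial>\<nu>)"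
      by (rule emeasure_bind[OF ne K]) (use A B in auto)
    also have "\<dots> = (\<integral>\<^sup>+x. emeasure (\<kappa> x) B * indicator A x \<partial>\<nu>)"
    proof (rule nn_integral_cong)
      fix x
      have m: "Pair x \<in> \<kappa> x \<rightarrow>\<^sub>M I_meas \<Otimes>\<^sub>M borel"
        unfolding measurable_kappa by (rule measurable_Pair1') (simp add: space_I_meas)
      have "Pair x -` (A \<times> B) \<inter> space (\<kappa> x) = (if x \<in> A then B else {})"
        using sets.sets_into_space[OF B] sets_eq_imp_space_eq[OF kappa_sets[of x]] by auto
      thus "emeasure (distr (\<kappa> x) (I_meas \<Otimes>\<^sub>M borel) (Pair x)) (A \<times> B) = emeasure (\<kappa> x) B * indicator A x"
        using A B by (subst emeasure_distr[OF m]) (auto simp: indicator_def)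
    qed
    finally show ?thesis using kernel A B unfolding cond_kernel_def by simp
  qed
  show ?thesis
  proof (rule measure_eqI_generator_eq[OF Int_stable_pair_measure_generator pair_measure_closed,
        where A = "\<lambda>_::nat. space I_meas \<times> space borel"])
    fix X assume "X \<in> {a \<times> b |a b. a \<in> sets (I_meas :: ('n \<Rightarrow> real^'d) measure) \<and> b \<in> sets (borel :: real measure)}"
    thus "emeasure \<rho> X = emeasure ?R X" using rect by auto
  next
    show "range (\<lambda>_::nat. space I_meas \<times> space borel)
        \<subseteq> {a \<times> b |a b. a \<in> sets (I_meas :: ('n \<Rightarrow> real^'d) measure) \<and> b \<in> sets (borel :: real measure)}" by blast
  next
    show "emeasure \<rho> (space I_meas \<times> space borel) \<noteq> \<infinity>" by (simp add: emeasure_eq_measure)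
  qed (auto simp: sets_rho setsR sets_pair_measure space_I_meas)
qed

lemma nn_integral_rho:
  assumes g: "g \<in> borel_measurable (I_meas \<Otimes>\<^sub>M borel)"
  shows "(\<integral>\<^sup>+z. g z \<partial>\<rho>) = (\<integral>\<^sup>+x. \<integral>\<^sup>+y. g (x, y) \<partial>\<kappa> x \<partial>\<nu>)"
proof -
  have K: "(\<lambda>x. distr (\<kappa> x) (I_meas \<Otimes>\<^sub>M borel) (Pair x)) \<in> \<nu> \<rightarrow>\<^sub>M subprob_algebra (I_meas \<Otimes>\<^sub>M borel)"
    unfolding measurable_nu by (rule measurable_distr2[OF _ kappa_measurable]) (simp add: case_prod_Pair_iden)
  have m: "Pair x \<in> \<kappa> x \<rightarrow>\<^sub>M I_meas \<Otimes>\<^sub>M borel" for x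
    unfolding measurable_kappa by (rule measurable_Pair1') (simp add: space_I_meas)
  have "(\<integral>\<^sup>+z. g z \<partial>\<rho>) = (\<integral>\<^sup>+x. \<integral>\<^sup>+z. g z \<partial>distr (\<kappa> x) (I_meas \<Otimes>\<^sub>M borel) (Pair x) \<partial>\<nu>)"
    by (subst rho_eq_bind) (rule nn_integral_bind[OF g K])
  also have "\<dots> = (\<integral>\<^sup>+x. \<integral>\<^sup>+y. g (x, y) \<partial>\<kappa> x \<partial>\<nu>)"
    by (intro nn_integral_cong, subst nn_integral_distr[OF m]) (simp_all add: g)
  finally show ?thesis .
qed

text \<open>Where \<open>y\<close> is not integrable, \<open>regr\<close> is the default value 0 of
  the Bochner integral and no conditional mean. The finite second moment excludes this almost
  everywhere.\<close>

lemma AE_integrable_kappa: "AE x in \<nu>. integrable (\<kappa> x) (\<lambda>y. y)"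
proof -
  have m: "(\<lambda>z. ennreal ((snd z)\<^sup>2)) \<in> borel_measurable (I_meas \<Otimes>\<^sub>M borel)" by measurable
  have "(\<integral>\<^sup>+z. ennreal ((snd z)\<^sup>2) \<partial>\<rho>) < \<infinity>" using square by (simp add: integrable_iff_bounded)
  hence "(\<integral>\<^sup>+x. \<integral>\<^sup>+y. ennreal (y\<^sup>2) \<partial>\<kappa> x \<partial>\<nu>) \<noteq> \<infinity>" using nn_integral_rho[OF m] by simp
  moreover have "(\<lambda>x. \<integral>\<^sup>+y. ennreal (y\<^sup>2) \<partial>\<kappa> x) \<in> borel_measurable \<nu>"
    unfolding measurable_nu
    by (rule measurable_compose[OF kappa_measurable nn_integral_measurable_subprob_algebra]) measurable
  ultimately have "AE x in \<nu>. (\<integral>\<^sup>+y. ennreal (y\<^sup>2) \<partial>\<kappa> x) \<noteq> \<infinity>" by (intro nn_integral_PInf_AE)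
  thus ?thesis
  proof eventually_elim
    case (elim x)
    interpret k: prob_space "\<kappa> x" by (rule kappa_prob)
    have [measurable]: "(\<lambda>y. y) \<in> borel_measurable (\<kappa> x)" by (simp add: measurable_kappa)
    have "L2_mem (\<kappa> x) (\<lambda>y. y)" unfolding L2_mem_def using elim
      by (auto simp: integrable_iff_bounded less_top)
    thus ?case by (rule k.L2_mem_integrable)
  qed
qed

lemma integrable_snd: "integrable \<rho> snd"
  by (rule L2_mem_integrable) (use square in \<open>auto simp: L2_mem_def\<close>)

lemma L2_regr: "L2_mem \<nu> f"
proof -
  interpret N: prob_space \<nu> by (rule prob_space_nu)
  have [measurable]: "f \<in> borel_measurable \<nu>" by (simp add: measurable_nu)
  have "integrable \<nu> (\<lambda>x. (f x)\<^sup>2)"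
    by (rule Bochner_Integration.integrable_bound[OF N.integrable_const[of Binf]])
      (use regr_bound in \<open>auto elim!: eventually_mono\<close>)
  thus ?thesis by (simp add: L2_mem_def)
qed

lemma integrable_regr: "integrable \<nu> f"
  by (rule prob_space.L2_mem_integrable[OF prob_space_nu L2_regr])

text \<open>Given the input, \<open>h\<close> is constant and the residual has conditional mean
  zero.\<close>

lemma noise_orthogonal:
  assumes h: "h \<in> bfun \<nu>"
  shows "integrable \<rho> (\<lambda>z. (snd z - f (fst z)) * h (fst z))"
    and "(\<integral>z. (snd z - f (fst z)) * h (fst z) \<partial>\<rho>) = 0"
proof -
  have [measurable]: "f \<in> borel_measurable \<nu>" "h \<in> borel_measurable \<nu>"
    using h by (simp_all add: measurable_nu bfun_def)
  have hm[measurable]: "h \<in> borel_measurable I_meas" using h by (simp add: measurable_nu bfun_def)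
  have intf: "integrable \<rho> (\<lambda>z. f (fst z))" using integrable_regr integrable_nu[of f] by simp
  show int: "integrable \<rho> (\<lambda>z. (snd z - f (fst z)) * h (fst z))"
    by (intro integrable_mult_bfun bfun_fst h Bochner_Integration.integrable_diff integrable_snd intf)
  let ?Z = "\<lambda>x y. (y - f x) * h x"
  have m: "(\<lambda>z. ennreal ((snd z - f (fst z)) * h (fst z))) \<in> borel_measurable (I_meas \<Otimes>\<^sub>M borel)"
    "(\<lambda>z. ennreal (- ((snd z - f (fst z)) * h (fst z)))) \<in> borel_measurable (I_meas \<Otimes>\<^sub>M borel)"
    by measurable
  have "(\<integral>\<^sup>+x. \<integral>\<^sup>+y. ennreal (?Z x y) \<partial>\<kappa> x \<partial>\<nu>) = (\<integral>\<^sup>+x. \<integral>\<^sup>+y. ennreal (- ?Z x y) \<partial>\<kappa> x \<partial>\<nu>)"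
  proof (rule nn_integral_cong_AE)
    show "AE x in \<nu>. (\<integral>\<^sup>+y. ennreal (?Z x y) \<partial>\<kappa> x) = (\<integral>\<^sup>+y. ennreal (- ?Z x y) \<partial>\<kappa> x)"
      using AE_integrable_kappa
    proof eventually_elim
      case (elim x)
      interpret k: prob_space "\<kappa> x" by (rule kappa_prob)
      have "integrable (\<kappa> x) (?Z x)" using elim by auto
      moreover have "(\<integral>y. ?Z x y \<partial>\<kappa> x) = 0" using elim by (simp add: regr_def k.prob_space)
      ultimately show ?case using nn_integral_pos_eq_neg by blast
    qed
  qed
  hence "(\<integral>\<^sup>+z. ennreal ((snd z - f (fst z)) * h (fst z)) \<partial>\<rho>)
      = (\<integral>\<^sup>+z. ennreal (- ((snd z - f (fst z)) * h (fst z))) \<partial>\<rho>)"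
    using nn_integral_rho[OF m(1)] nn_integral_rho[OF m(2)] by simp
  thus "(\<integral>z. (snd z - f (fst z)) * h (fst z) \<partial>\<rho>) = 0"
    using nn_integral_pos_eq_neg[OF int] by blast
qed

text \<open>The weight may vary with the input; it will be a multiple of
  \<open>sqrt (1 + (\<Sum>j<m. (v j x)\<^sup>2))\<close>. The countably many moment conditions are
  first gathered outside one null set.\<close>

lemma noise_moment:
  assumes c: "c \<in> borel_measurable I_meas" "\<And>x. 0 \<le> c x" "\<And>x. c x * L \<le> 1 / 2"
  shows "(\<integral>\<^sup>+z. ennreal (exp (c (fst z) * \<bar>snd z - f (fst z)\<bar>) - 1 - c (fst z) * \<bar>snd z - f (fst z)\<bar>) \<partial>\<rho>)
    \<le> (\<integral>\<^sup>+x. ennreal (\<sigma>\<^sup>2 * (c x)\<^sup>2) \<partial>\<nu>)"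
proof -
  have [measurable]: "c \<in> borel_measurable I_meas" by fact
  have m: "(\<lambda>z. ennreal (exp (c (fst z) * \<bar>snd z - f (fst z)\<bar>) - 1 - c (fst z) * \<bar>snd z - f (fst z)\<bar>))
      \<in> borel_measurable (I_meas \<Otimes>\<^sub>M borel)" by measurable
  have "AE x in \<nu>. \<forall>m\<ge>2. (\<integral>\<^sup>+y. ennreal (\<bar>y - f x\<bar> ^ m) \<partial>\<kappa> x) \<le> ennreal (fact m * \<sigma>\<^sup>2 * L ^ (m - 2) / 2)"
    unfolding AE_all_countable using moments by auto
  hence "AE x in \<nu>. (\<integral>\<^sup>+y. ennreal (exp (c x * \<bar>y - f x\<bar>) - 1 - c x * \<bar>y - f x\<bar>) \<partial>\<kappa> x)
      \<le> ennreal (\<sigma>\<^sup>2 * (c x)\<^sup>2)"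
  proof eventually_elim
    case (elim x)
    show ?case
      by (rule nn_integral_exp_remainder_le[where L = L]) (use elim c L in \<open>auto simp: measurable_kappa\<close>)
  qed
  thus ?thesis unfolding nn_integral_rho[OF m] by (intro nn_integral_mono_AE) simp
qed

end

section \<open>Concentration of the Gram matrix, as a vector indexed by pairs with the Frobenius
  norm, and of the noise\<close>

lemma L2_set_outer_product:
  fixes a :: "nat \<Rightarrow> real"
  shows "L2_set (\<lambda>p. a (fst p) * a (snd p)) ({..<m} \<times> {..<m}) = (\<Sum>j<m. (a j)\<^sup>2)"
proof -
  have "(\<Sum>p\<in>{..<m} \<times> {..<m}. (a (fst p) * a (snd p))\<^sup>2) = (\<Sum>i<m. \<Sum>j<m. (a i)\<^sup>2 * (a j)\<^sup>2)"
    by (simp add: sum.cartesian_product case_prod_unfold power_mult_distrib)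
  also have "\<dots> = (\<Sum>j<m. (a j)\<^sup>2) * (\<Sum>j<m. (a j)\<^sup>2)" by (simp add: sum_product)
  finally show ?thesis by (simp add: L2_set_def sum_nonneg)
qed

lemma ennreal_mult_plus_mult:
  assumes "0 \<le> a" "0 \<le> b" "0 \<le> c" "0 \<le> d"
  shows "ennreal a * ennreal b + ennreal c * ennreal d = ennreal (a * b + c * d)"
proof -
  have "ennreal (a * b + c * d) = ennreal (a * b) + ennreal (c * d)"
    using assms by (intro ennreal_plus) auto
  also have "\<dots> = ennreal a * ennreal b + ennreal c * ennreal d"
    using assms by (simp only: ennreal_mult)
  finally show ?thesis ..
qed

text \<open>The extra coordinate \<open>m\<close> averages the absolute residual. It controls the
  interaction of the noise with the tail of the kernel, for which there is no finite set of
  coordinates.\<close>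

definition noise_vec where
  "noise_vec fc v m j z = (if j < (m::nat) then (snd z - fc (fst z)) * v j (fst z) else \<bar>snd z - fc (fst z)\<bar> :: real)"

lemma L2_set_noise_vec:
  "L2_set (\<lambda>j. noise_vec fc v m j z) {..m} = \<bar>snd z - fc (fst z)\<bar> * sqrt (1 + (\<Sum>j<m. (v j (fst z))\<^sup>2))"
proof -
  have "(\<Sum>j\<in>{..m}. (noise_vec fc v m j z)\<^sup>2) = (\<Sum>j<m. (noise_vec fc v m j z)\<^sup>2) + (noise_vec fc v m m z)\<^sup>2"
    by (simp flip: lessThan_Suc_atMost)
  also have "\<dots> = (snd z - fc (fst z))\<^sup>2 * (1 + (\<Sum>j<m. (v j (fst z))\<^sup>2))"
    by (simp add: noise_vec_def power_mult_distrib sum_distrib_left distrib_left)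
  finally show ?thesis by (simp add: L2_set_def real_sqrt_mult)
qed

context regression_model
begin

text \<open>Let \<open>n\<close> be the squared norm of the whitened features. It is also the
  Frobenius norm of one summand, and its square, at most \<open>W * n\<close>, has mean at most
  \<open>W * real m\<close>. So one factor of the variance is the mean \<open>m\<close> instead of
  the supremum \<open>W\<close>.\<close>

lemma gram_concentration:
  fixes v :: "nat \<Rightarrow> ('n \<Rightarrow> real^'d) \<Rightarrow> real"
  assumes v: "\<And>j. j < m \<Longrightarrow> v j \<in> bfun \<nu>" and W: "\<And>x. (\<Sum>j<m. (v j x)\<^sup>2) \<le> W"
    and one: "\<And>j. j < m \<Longrightarrow> (\<integral>x. (v j x)\<^sup>2 \<partial>\<nu>) \<le> 1" and s: "s > 0" "2 * s * W \<le> 1" and l: "l > 0"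
  shows "measure (PiM {..<l::nat} (\<lambda>_. \<rho>)) {z \<in> space (PiM {..<l} (\<lambda>_. \<rho>)).
      t \<le> L2_set (\<lambda>p. (\<Sum>i<l. v (fst p) (fst (z i)) * v (snd p) (fst (z i))) / real l
        - (\<integral>z. v (fst p) (fst z) * v (snd p) (fst z) \<partial>\<rho>)) ({..<m} \<times> {..<m})}
    \<le> 2 * exp (real l * (4 * s\<^sup>2 * W * real m) - s * real l * t)"
proof -
  define n where "n x = (\<Sum>j<m. (v j x)\<^sup>2)" for x
  have n0: "0 \<le> n x" for x by (simp add: n_def sum_nonneg)
  have nW: "n x \<le> W" for x using W by (simp add: n_def)
  have nb: "n \<in> bfun \<nu>" unfolding n_def[abs_def] power2_eq_square by (intro bfun_sum bfun_mult v)
  have neq: "L2_set (\<lambda>p. v (fst p) (fst z) * v (snd p) (fst z)) ({..<m} \<times> {..<m}) = n (fst z)" for z :: "('n \<Rightarrow> real^'d) \<times> real"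
    unfolding n_def by (rule L2_set_outer_product)
  have sn: "2 * s * n x \<le> 1" for x using mult_left_mono[OF nW, of "2 * s" x] s by linarith
  have eb: "(\<lambda>z. exp (2 * s * n (fst z))) \<in> bfun \<rho>"
  proof (rule bfunI)
    show "(\<lambda>z. exp (2 * s * n (fst z))) \<in> borel_measurable \<rho>"
      using bfun_measurable[OF bfun_fst[OF nb]] by measurable
    show "\<bar>exp (2 * s * n (fst z))\<bar> \<le> exp 1" for z :: "('n \<Rightarrow> real^'d) \<times> real" using sn[of "fst z"] by simp
  qed
  have fin: "finite_measure \<rho>" by unfold_locales
  have nr: "(\<lambda>z. n (fst z)) \<in> bfun \<rho>" by (rule bfun_fst[OF nb])
  show ?thesis
  proof (rule vector_bernstein[OF prob, where X = "\<lambda>p z. v (fst p) (fst z) * v (snd p) (fst z)"])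
    show "(\<lambda>z. v (fst p) (fst z) * v (snd p) (fst z)) \<in> borel_measurable \<rho>" if "p \<in> {..<m} \<times> {..<m}" for p
      using that by (intro bfun_measurable[OF bfun_mult] bfun_fst v) auto
    show "integrable \<rho> (\<lambda>x. exp (2 * s * L2_set (\<lambda>p. v (fst p) (fst x) * v (snd p) (fst x)) ({..<m} \<times> {..<m})))"
      unfolding neq by (rule integrable_bfun[OF fin eb])
    have "(\<integral>z. exp (2 * s * n (fst z)) - 1 - 2 * s * n (fst z) \<partial>\<rho>) \<le> (\<integral>z. 4 * s\<^sup>2 * W * n (fst z) \<partial>\<rho>)"
    proof (rule integral_mono)
      fix z :: "('n \<Rightarrow> real^'d) \<times> real"
      have "exp (2 * s * n (fst z)) - 1 - 2 * s * n (fst z) \<le> (2 * s * n (fst z))\<^sup>2"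
        using s n0 sn by (intro exp_remainder_le_square) auto
      also have "\<dots> = 4 * s\<^sup>2 * (n (fst z) * n (fst z))" by (simp add: power2_eq_square)
      also have "\<dots> \<le> 4 * s\<^sup>2 * (W * n (fst z))" using nW n0 by (intro mult_left_mono mult_right_mono) auto
      finally show "exp (2 * s * n (fst z)) - 1 - 2 * s * n (fst z) \<le> 4 * s\<^sup>2 * W * n (fst z)" by (simp add: mult_ac)
    qed (use integrable_bfun[OF fin nr] integrable_bfun[OF fin eb] in auto)
    also have "\<dots> = 4 * s\<^sup>2 * W * (\<integral>x. n x \<partial>\<nu>)" using integral_nu[OF bfun_measurable[OF nb]] by simp
    also have "\<dots> \<le> 4 * s\<^sup>2 * W * real m"
    proof (rule mult_left_mono)
      have "integrable \<nu> (\<lambda>x. (v j x)\<^sup>2)" if "j < m" for j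
        unfolding power2_eq_square
        by (rule integrable_bfun[OF prob_space.finite_measure[OF prob_space_nu]]) (intro bfun_mult v that)
      hence "(\<integral>x. n x \<partial>\<nu>) = (\<Sum>j<m. \<integral>x. (v j x)\<^sup>2 \<partial>\<nu>)"
        unfolding n_def by (intro Bochner_Integration.integral_sum) auto
      also have "\<dots> \<le> (\<Sum>j<m. 1)" by (intro sum_mono one) auto
      finally show "(\<integral>x. n x \<partial>\<nu>) \<le> real m" by simp
      show "0 \<le> 4 * s\<^sup>2 * W" using n0[of undefined] nW[of undefined] by (intro mult_nonneg_nonneg) auto
    qed
    finally show "(\<integral>x. exp (2 * s * L2_set (\<lambda>p. v (fst p) (fst x) * v (snd p) (fst x)) ({..<m} \<times> {..<m})) - 1
        - 2 * s * L2_set (\<lambda>p. v (fst p) (fst x) * v (snd p) (fst x)) ({..<m} \<times> {..<m}) \<partial>\<rho>)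
        \<le> 4 * s\<^sup>2 * W * real m" unfolding neq .
  qed (use s l in auto)
qed

lemma measurable_noise_vec:
  assumes "\<And>j. j < m \<Longrightarrow> v j \<in> bfun \<nu>" "fc \<in> bfun \<nu>"
  shows "noise_vec fc v m j \<in> borel_measurable \<rho>"
proof -
  have [measurable]: "(\<lambda>z. fc (fst z)) \<in> borel_measurable \<rho>" by (rule bfun_measurable[OF bfun_fst[OF assms(2)]])
  have "(\<lambda>z. v j (fst z)) \<in> borel_measurable \<rho>" if "j < m" by (rule bfun_measurable[OF bfun_fst[OF assms(1)[OF that]]])
  thus ?thesis unfolding noise_vec_def[abs_def] by (cases "j < m") simp_all
qed

text \<open>The residual is noise plus the bias of \<open>fc\<close>. The moment condition controls
  the noise. For the bias, the almost sure bound \<open>F\<close> only keeps the exponent in the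
  range where the remainder is quadratic; the contribution to the variance is the mean square
  \<open>dl\<close>, which may be much smaller.\<close>

lemma noise_concentration:
  fixes v :: "nat \<Rightarrow> ('n \<Rightarrow> real^'d) \<Rightarrow> real"
  assumes v: "\<And>j. j < m \<Longrightarrow> v j \<in> bfun \<nu>" and W: "\<And>x. (\<Sum>j<m. (v j x)\<^sup>2) \<le> W"
    and one: "\<And>j. j < m \<Longrightarrow> (\<integral>x. (v j x)\<^sup>2 \<partial>\<nu>) \<le> 1"
    and fc: "fc \<in> bfun \<nu>" and dl: "(\<integral>\<^sup>+x. ennreal ((fc x - f x)\<^sup>2) \<partial>\<nu>) \<le> ennreal dl" "0 \<le> dl"
    and F: "AE x in \<nu>. (fc x - f x)\<^sup>2 \<le> F"
    and s: "s > 0" "s\<^sup>2 * (1 + W) * F \<le> 1 / 16" "4 * s * sqrt (1 + W) * L \<le> 1 / 2" and l: "l > 0"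
  shows "measure (PiM {..<l::nat} (\<lambda>_. \<rho>)) {z \<in> space (PiM {..<l} (\<lambda>_. \<rho>)).
      t \<le> L2_set (\<lambda>j. (\<Sum>i<l. noise_vec fc v m j (z i)) / real l - (\<integral>z. noise_vec fc v m j z \<partial>\<rho>)) {..m}}
    \<le> 2 * exp (real l * (8 * s\<^sup>2 * (\<sigma>\<^sup>2 * (1 + real m) + (1 + W) * dl)) - s * real l * t)"
proof -
  define w where "w x = sqrt (1 + (\<Sum>j<m. (v j x)\<^sup>2))" for x
  have w2: "(w x)\<^sup>2 = 1 + (\<Sum>j<m. (v j x)\<^sup>2)" for x unfolding w_def by (simp add: sum_nonneg add_nonneg_nonneg)
  have w0: "0 \<le> w x" for x unfolding w_def by (simp add: sum_nonneg add_nonneg_nonneg)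
  have w2W: "(w x)\<^sup>2 \<le> 1 + W" for x using W by (simp add: w2)
  have wW: "w x \<le> sqrt (1 + W)" for x unfolding w_def using W by simp
  have W0: "0 \<le> W" using W[of undefined] sum_nonneg[of "{..<m}" "\<lambda>j. (v j undefined)\<^sup>2"] by simp
  have vm[measurable]: "v j \<in> borel_measurable I_meas" if "j < m" for j using v[OF that] by (simp add: bfun_def measurable_nu)
  have [measurable]: "w \<in> borel_measurable I_meas" unfolding w_def[abs_def] by measurable
  have [measurable]: "fc \<in> borel_measurable I_meas" using fc by (simp add: bfun_def measurable_nu)
  define n where "n z = \<bar>snd z - fc (fst z)\<bar> * w (fst z)" for z
  have neq: "L2_set (\<lambda>j. noise_vec fc v m j z) {..m} = n z" for z
    unfolding n_def w_def by (rule L2_set_noise_vec)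
  have n0: "0 \<le> n z" for z by (simp add: n_def w0)
  have nm[measurable]: "n \<in> borel_measurable \<rho>" unfolding n_def[abs_def] by measurable
  define \<psi> where "\<psi> t = exp t - 1 - t" for t :: real
  have \<psi>0: "0 \<le> \<psi> t" for t unfolding \<psi>_def using one_plus_le_exp[of t] by linarith
  have [measurable]: "\<psi> \<in> borel_measurable borel" unfolding \<psi>_def[abs_def] by measurable
  \<comment> \<open>The midpoint inequality doubles the argument \<open>2 * s\<close>; hence the
    factor 4 here and in the condition on \<open>L\<close>.\<close>
  define g where "g z = 4 * s * w (fst z) * \<bar>snd z - f (fst z)\<bar>" for z
  have [measurable]: "g \<in> borel_measurable \<rho>" unfolding g_def[abs_def] by measurable
  have pw: "AE z in \<rho>. \<psi> (2 * s * n z) \<le> \<psi> (g z) / 2 + 8 * s\<^sup>2 * (1 + W) * (fc (fst z) - f (fst z))\<^sup>2"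
    using AE_nu[OF F]
  proof eventually_elim
    case (elim z)
    define q where "q = \<bar>fc (fst z) - f (fst z)\<bar>"
    define a where "a = 2 * s * w (fst z) * \<bar>snd z - f (fst z)\<bar>"
    define b where "b = 2 * s * w (fst z) * q"
    have ab: "0 \<le> a" "0 \<le> b" unfolding a_def b_def q_def using s w0 by auto
    have "2 * s * n z \<le> 2 * s * ((\<bar>snd z - f (fst z)\<bar> + q) * w (fst z))"
      unfolding n_def q_def using s w0 by (intro mult_left_mono mult_right_mono) auto
    also have "\<dots> = a + b" by (simp add: a_def b_def algebra_simps)
    finally have "\<psi> (2 * s * n z) \<le> \<psi> (a + b)"
      unfolding \<psi>_def using s n0[of z] by (intro exp_remainder_mono) auto
    also have "\<dots> \<le> \<psi> (2 * a) / 2 + \<psi> (2 * b) / 2" unfolding \<psi>_def by (rule exp_remainder_midpoint)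
    also have "2 * a = g z" by (simp add: a_def g_def)
    \<comment> \<open>\<open>2 * b\<close> is \<open>4 * s\<close> times the weight times the bias,
      so \<open>2 * b \<le> 1\<close> is what the constant \<open>1 / 16\<close> in the hypothesis
      provides.\<close>
    also have "\<psi> (2 * b) \<le> (2 * b)\<^sup>2"
    proof -
      have sq: "(2 * b)\<^sup>2 = 16 * (s\<^sup>2 * (w (fst z))\<^sup>2 * q\<^sup>2)" by (simp add: b_def power2_eq_square)
      also have "\<dots> \<le> 16 * (s\<^sup>2 * (1 + W) * F)"
        using elim w2W W0 by (intro mult_left_mono mult_mono) (auto simp: q_def)
      also have "\<dots> \<le> 1" using s by simp
      finally have "(2 * b)\<^sup>2 \<le> 1\<^sup>2" by simp
      hence "2 * b \<le> 1" by (rule power2_le_imp_le) simp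
      thus ?thesis unfolding \<psi>_def using ab by (intro exp_remainder_le_square) auto
    qed
    also have "(2 * b)\<^sup>2 \<le> 16 * s\<^sup>2 * (1 + W) * q\<^sup>2"
    proof -
      have "(2 * b)\<^sup>2 = 16 * s\<^sup>2 * (w (fst z))\<^sup>2 * q\<^sup>2" by (simp add: b_def power2_eq_square)
      also have "\<dots> \<le> 16 * s\<^sup>2 * (1 + W) * q\<^sup>2" using w2W by (intro mult_left_mono mult_right_mono) auto
      finally show ?thesis .
    qed
    finally show ?case by (simp add: q_def mult_ac)
  qed
  have bound: "(\<integral>\<^sup>+z. ennreal (\<psi> (2 * s * n z)) \<partial>\<rho>) \<le> ennreal (8 * s\<^sup>2 * (\<sigma>\<^sup>2 * (1 + real m) + (1 + W) * dl))"
  proof -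
    have "(\<integral>\<^sup>+z. ennreal (\<psi> (g z)) \<partial>\<rho>) \<le> (\<integral>\<^sup>+x. ennreal (\<sigma>\<^sup>2 * (4 * s * w x)\<^sup>2) \<partial>\<nu>)"
      unfolding \<psi>_def g_def
    proof (rule noise_moment)
      fix x
      have "4 * s * w x * L \<le> 4 * s * sqrt (1 + W) * L" using wW s L by (intro mult_right_mono mult_left_mono) auto
      thus "4 * s * w x * L \<le> 1 / 2" using s by linarith
    qed (use s w0 in auto)
    also have "\<dots> \<le> ennreal (16 * s\<^sup>2 * \<sigma>\<^sup>2 * (1 + real m))"
    proof -
      have fin: "finite_measure \<nu>" by (rule prob_space.finite_measure[OF prob_space_nu])
      have int: "integrable \<nu> (\<lambda>x. (v j x)\<^sup>2)" if "j < m" for j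
        unfolding power2_eq_square by (rule integrable_bfun[OF fin]) (intro bfun_mult v that)
      have int1: "integrable \<nu> (\<lambda>x. 1 :: real)" by (rule finite_measure.integrable_const[OF fin])
      have intw: "integrable \<nu> (\<lambda>x. (w x)\<^sup>2)" unfolding w2
        by (intro Bochner_Integration.integrable_add int1 Bochner_Integration.integrable_sum int) simp
      have "(\<integral>x. (w x)\<^sup>2 \<partial>\<nu>) = 1 + (\<Sum>j<m. \<integral>x. (v j x)\<^sup>2 \<partial>\<nu>)"
      proof -
        have "(\<integral>x. (w x)\<^sup>2 \<partial>\<nu>) = (\<integral>x. 1 \<partial>\<nu>) + (\<integral>x. (\<Sum>j<m. (v j x)\<^sup>2) \<partial>\<nu>)"
          unfolding w2
          by (intro Bochner_Integration.integral_add int1 Bochner_Integration.integrable_sum int) simp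
        also have "(\<integral>x. (\<Sum>j<m. (v j x)\<^sup>2) \<partial>\<nu>) = (\<Sum>j<m. \<integral>x. (v j x)\<^sup>2 \<partial>\<nu>)"
          by (intro Bochner_Integration.integral_sum int) simp
        finally show ?thesis using prob_space.prob_space[OF prob_space_nu] by simp
      qed
      also have "\<dots> \<le> 1 + (\<Sum>j<m. 1)" by (intro add_left_mono sum_mono one) auto
      finally have w2m: "(\<integral>x. (w x)\<^sup>2 \<partial>\<nu>) \<le> 1 + real m" by simp
      have "(\<integral>\<^sup>+x. ennreal (\<sigma>\<^sup>2 * (4 * s * w x)\<^sup>2) \<partial>\<nu>) = (\<integral>\<^sup>+x. ennreal (16 * s\<^sup>2 * \<sigma>\<^sup>2 * (w x)\<^sup>2) \<partial>\<nu>)"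
        by (simp add: power_mult_distrib mult_ac)
      also have "\<dots> = ennreal (\<integral>x. 16 * s\<^sup>2 * \<sigma>\<^sup>2 * (w x)\<^sup>2 \<partial>\<nu>)"
        by (rule nn_integral_eq_integral) (use intw in auto)
      also have "\<dots> \<le> ennreal (16 * s\<^sup>2 * \<sigma>\<^sup>2 * (1 + real m))"
        unfolding integral_mult_right_zero by (intro ennreal_leI mult_left_mono w2m) auto
      finally show ?thesis .
    qed
    finally have psig: "(\<integral>\<^sup>+z. ennreal (\<psi> (g z)) \<partial>\<rho>) \<le> ennreal (16 * s\<^sup>2 * \<sigma>\<^sup>2 * (1 + real m))" .
    have "(\<integral>\<^sup>+z. ennreal (\<psi> (2 * s * n z)) \<partial>\<rho>)
        \<le> (\<integral>\<^sup>+z. ennreal (1 / 2) * ennreal (\<psi> (g z)) + ennreal (8 * s\<^sup>2 * (1 + W)) * ennreal ((fc (fst z) - f (fst z))\<^sup>2) \<partial>\<rho>)"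
    proof (rule nn_integral_mono_AE)
      show "AE z in \<rho>. ennreal (\<psi> (2 * s * n z))
          \<le> ennreal (1 / 2) * ennreal (\<psi> (g z)) + ennreal (8 * s\<^sup>2 * (1 + W)) * ennreal ((fc (fst z) - f (fst z))\<^sup>2)"
        using pw
      proof eventually_elim
        case (elim z)
        have "ennreal (1 / 2) * ennreal (\<psi> (g z)) + ennreal (8 * s\<^sup>2 * (1 + W)) * ennreal ((fc (fst z) - f (fst z))\<^sup>2)
          = ennreal (1 / 2 * \<psi> (g z) + 8 * s\<^sup>2 * (1 + W) * (fc (fst z) - f (fst z))\<^sup>2)"
          using \<psi>0 W0 by (intro ennreal_mult_plus_mult) auto
        thus ?case using elim by (auto intro: ennreal_leI)
      qed
    qed
    also have "\<dots> = ennreal (1 / 2) * (\<integral>\<^sup>+z. ennreal (\<psi> (g z)) \<partial>\<rho>)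
        + ennreal (8 * s\<^sup>2 * (1 + W)) * (\<integral>\<^sup>+z. ennreal ((fc (fst z) - f (fst z))\<^sup>2) \<partial>\<rho>)"
      by (subst nn_integral_add) (auto simp: nn_integral_cmult)
    also have "(\<integral>\<^sup>+z. ennreal ((fc (fst z) - f (fst z))\<^sup>2) \<partial>\<rho>) = (\<integral>\<^sup>+x. ennreal ((fc x - f x)\<^sup>2) \<partial>\<nu>)"
      unfolding marg_def by (subst nn_integral_distr) auto
    also have "ennreal (1 / 2) * (\<integral>\<^sup>+z. ennreal (\<psi> (g z)) \<partial>\<rho>)
        + ennreal (8 * s\<^sup>2 * (1 + W)) * (\<integral>\<^sup>+x. ennreal ((fc x - f x)\<^sup>2) \<partial>\<nu>)
      \<le> ennreal (1 / 2) * ennreal (16 * s\<^sup>2 * \<sigma>\<^sup>2 * (1 + real m)) + ennreal (8 * s\<^sup>2 * (1 + W)) * ennreal dl"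
      by (intro add_mono mult_left_mono psig dl(1)) auto
    also have "ennreal (1 / 2) * ennreal (16 * s\<^sup>2 * \<sigma>\<^sup>2 * (1 + real m)) + ennreal (8 * s\<^sup>2 * (1 + W)) * ennreal dl
        = ennreal (1 / 2 * (16 * s\<^sup>2 * \<sigma>\<^sup>2 * (1 + real m)) + 8 * s\<^sup>2 * (1 + W) * dl)"
      using W0 dl(2) by (intro ennreal_mult_plus_mult) auto
    also have "1 / 2 * (16 * s\<^sup>2 * \<sigma>\<^sup>2 * (1 + real m)) + 8 * s\<^sup>2 * (1 + W) * dl
        = 8 * s\<^sup>2 * (\<sigma>\<^sup>2 * (1 + real m) + (1 + W) * dl)" by (simp add: algebra_simps)
    finally show ?thesis .
  qed
  have intpsi: "integrable \<rho> (\<lambda>z. \<psi> (2 * s * n z))"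
    using bound \<psi>0 by (intro integrableI_bounded) (auto simp: top_unique less_top[symmetric])
  have intexp: "integrable \<rho> (\<lambda>z. exp (2 * s * n z))"
  proof (rule Bochner_Integration.integrable_bound)
    show "integrable \<rho> (\<lambda>z. 2 * \<psi> (2 * s * n z) + 2)" using intpsi by auto
    show "AE z in \<rho>. norm (exp (2 * s * n z)) \<le> norm (2 * \<psi> (2 * s * n z) + 2)"
    proof (rule AE_I2)
      fix z
      have "exp (2 * s * n z) \<le> 2 * \<psi> (2 * s * n z) + 2"
        unfolding \<psi>_def by (rule exp_le_remainder) (use s n0 in auto)
      thus "norm (exp (2 * s * n z)) \<le> norm (2 * \<psi> (2 * s * n z) + 2)" using \<psi>0[of "2 * s * n z"] by simp
    qed
  qed simp
  have ibound: "(\<integral>z. \<psi> (2 * s * n z) \<partial>\<rho>) \<le> 8 * s\<^sup>2 * (\<sigma>\<^sup>2 * (1 + real m) + (1 + W) * dl)"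
  proof -
    have "ennreal (\<integral>z. \<psi> (2 * s * n z) \<partial>\<rho>) = (\<integral>\<^sup>+z. ennreal (\<psi> (2 * s * n z)) \<partial>\<rho>)"
      by (rule nn_integral_eq_integral[symmetric, OF intpsi]) (simp add: \<psi>0)
    also note bound
    finally show ?thesis
      by (rule ennreal_le_iff[THEN iffD1, rotated]) (use W0 dl(2) in \<open>auto intro!: mult_nonneg_nonneg add_nonneg_nonneg\<close>)
  qed
  show ?thesis
    by (rule vector_bernstein[OF prob]) (use measurable_noise_vec[OF v fc] s l intexp ibound in \<open>auto simp: neq \<psi>_def\<close>)
qed

end

section \<open>The error on the good event\<close>

lemma integral_cauchy_schwarz:
  assumes "L2_mem M f" "L2_mem M g"
  shows "\<bar>\<integral>x. f x * g x \<partial>M\<bar> \<le> sqrt (\<integral>x. (f x)\<^sup>2 \<partial>M) * sqrt (\<integral>x. (g x)\<^sup>2 \<partial>M)"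
proof -
  have fg: "integrable M (\<lambda>x. f x * g x)" by (rule L2_mem_integrable_mult[OF assms])
  have ff: "integrable M (\<lambda>x. (f x)\<^sup>2)" "integrable M (\<lambda>x. (g x)\<^sup>2)" using assms by (auto simp: L2_mem_def)
  have "(\<integral>x. f x * g x \<partial>M)\<^sup>2 \<le> (\<integral>x. (f x)\<^sup>2 \<partial>M) * (\<integral>x. (g x)\<^sup>2 \<partial>M)"
  proof (rule quadratic_nonneg_discriminant)
    fix t :: real
    have "0 \<le> (\<integral>x. (t * f x + g x)\<^sup>2 \<partial>M)" by (intro integral_nonneg_AE) auto
    also have "\<dots> = (\<integral>x. t\<^sup>2 * (f x)\<^sup>2 + 2 * t * (f x * g x) + (g x)\<^sup>2 \<partial>M)"
      by (simp add: power2_eq_square algebra_simps)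
    also have "\<dots> = t\<^sup>2 * (\<integral>x. (f x)\<^sup>2 \<partial>M) + 2 * t * (\<integral>x. f x * g x \<partial>M) + (\<integral>x. (g x)\<^sup>2 \<partial>M)"
      using fg ff by simp
    finally show "0 \<le> t\<^sup>2 * (\<integral>x. (f x)\<^sup>2 \<partial>M) + 2 * t * (\<integral>x. f x * g x \<partial>M) + (\<integral>x. (g x)\<^sup>2 \<partial>M)" .
  qed
  from real_sqrt_le_mono[OF this] show ?thesis by (simp add: real_sqrt_mult)
qed

text \<open>\<open>N\<close> is the norm of the head in whitened coordinates, \<open>q\<close> the
  RKHS norm of the tail part and \<open>e\<^sup>2\<close> the size of the tail kernel. Young's
  inequality moves \<open>N\<^sup>2 / 8\<close> and \<open>lam * q\<^sup>2 / 4\<close> to the left.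
  Together with the \<open>N\<^sup>2 / 8\<close> already lost to the Gram matrix this still leaves a
  quarter of \<open>Eh\<close>, since \<open>N\<^sup>2 = Eh + lam * Wh\<close>.\<close>

lemma quadratic_inequality_solve:
  fixes a b e lam N q Eh Wh :: real
  assumes lam: "lam > 0" and e: "e\<^sup>2 \<le> lam / 2" and nn: "0 \<le> Eh" "0 \<le> Wh"
    and N: "N\<^sup>2 = Eh + lam * Wh"
    and main: "(Eh - N\<^sup>2 / 4) / 2 - q\<^sup>2 * e\<^sup>2 + lam * (Wh + q\<^sup>2) \<le> N * a + q * e * b"
  shows "2 * Eh + 2 * (e\<^sup>2 * q\<^sup>2) \<le> 16 * a\<^sup>2 + 8 * (e\<^sup>2 / lam * b\<^sup>2)"
proof -
  define s where "s = sqrt lam"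
  have s: "s > 0" "s\<^sup>2 = lam" using lam by (simp_all add: s_def)
  have young1: "N * a \<le> N\<^sup>2 / 8 + 2 * a\<^sup>2"
    using zero_le_power2[of "N - 4 * a"] by (simp add: power2_eq_square field_simps)
  have young2: "q * e * b \<le> lam * q\<^sup>2 / 4 + e\<^sup>2 / lam * b\<^sup>2"
  proof -
    have "0 \<le> (s * q / 2 - e * b / s)\<^sup>2" by simp
    also have "\<dots> = s\<^sup>2 * q\<^sup>2 / 4 - q * e * b + e\<^sup>2 / s\<^sup>2 * b\<^sup>2"
      using s(1) by (simp add: power2_eq_square field_simps)
    finally show ?thesis by (simp add: s(2))
  qed
  have q2: "e\<^sup>2 * q\<^sup>2 \<le> lam * q\<^sup>2 / 2" using mult_right_mono[OF e, of "q\<^sup>2"] by simp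
  have lw: "0 \<le> lam * Wh" using lam nn by simp
  define X Y where "X = lam * q\<^sup>2" and "Y = e\<^sup>2 / lam * b\<^sup>2"
  have m2: "(Eh - N\<^sup>2 / 4) / 2 - q\<^sup>2 * e\<^sup>2 + lam * Wh + X \<le> N\<^sup>2 / 8 + 2 * a\<^sup>2 + X / 4 + Y"
    using main young1 young2 unfolding X_def Y_def distrib_left by linarith
  have "q\<^sup>2 * e\<^sup>2 \<le> X / 2" using q2 by (simp add: X_def mult.commute)
  with m2 have "Eh / 2 - N\<^sup>2 / 8 + lam * Wh + X / 2 \<le> N\<^sup>2 / 8 + 2 * a\<^sup>2 + X / 4 + Y"
    by (simp add: field_simps)
  hence "4 * Eh - 2 * N\<^sup>2 + 8 * (lam * Wh) + 2 * X \<le> 16 * a\<^sup>2 + 8 * Y"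
    by (simp add: field_simps)
  hence "2 * Eh + 6 * (lam * Wh) + 2 * X \<le> 16 * a\<^sup>2 + 8 * Y" using N by linarith
  moreover have "2 * (e\<^sup>2 * q\<^sup>2) \<le> X" using q2 by (simp add: X_def)
  moreover have "0 \<le> X" using lam by (simp add: X_def)
  ultimately have "2 * Eh + 2 * (e\<^sup>2 * q\<^sup>2) \<le> 16 * a\<^sup>2 + 8 * Y" using lw by linarith
  thus ?thesis by (simp add: Y_def)
qed

context regression_model
begin

lemma L2_bfun: "h \<in> bfun \<nu> \<Longrightarrow> L2_mem \<nu> h"
  unfolding L2_mem_def power2_eq_square
  by (auto intro: bfun_measurable integrable_bfun[OF prob_space.finite_measure[OF prob_space_nu]] bfun_mult)

text \<open>The noise averages out by \<open>noise_orthogonal\<close>, and only the bias against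
  \<open>fc\<close> is left.\<close>

lemma mean_noise_vec:
  assumes v: "v j \<in> bfun \<nu>" and fc: "fc \<in> bfun \<nu>" and j: "j < m"
  shows "(\<integral>z. noise_vec fc v m j z \<partial>\<rho>) = (\<integral>x. (f x - fc x) * v j x \<partial>\<nu>)"
proof -
  have [measurable]: "f \<in> borel_measurable \<nu>" "v j \<in> borel_measurable \<nu>" "fc \<in> borel_measurable \<nu>"
    using v fc by (auto simp: measurable_nu bfun_def)
  have int: "integrable \<nu> (\<lambda>x. (f x - fc x) * v j x)"
    by (intro integrable_mult_bfun v Bochner_Integration.integrable_diff integrable_regr
        integrable_bfun[OF prob_space.finite_measure[OF prob_space_nu] fc])
  have m: "(\<lambda>x. (f x - fc x) * v j x) \<in> borel_measurable \<nu>" by measurable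
  have "(\<integral>z. noise_vec fc v m j z \<partial>\<rho>)
      = (\<integral>z. (snd z - f (fst z)) * v j (fst z) + (f (fst z) - fc (fst z)) * v j (fst z) \<partial>\<rho>)"
    using j by (intro Bochner_Integration.integral_cong) (auto simp: noise_vec_def algebra_simps)
  also have "\<dots> = (\<integral>z. (snd z - f (fst z)) * v j (fst z) \<partial>\<rho>) + (\<integral>z. (f (fst z) - fc (fst z)) * v j (fst z) \<partial>\<rho>)"
    using noise_orthogonal(1)[OF v] int integrable_nu[OF m] by (intro Bochner_Integration.integral_add) auto
  also have "\<dots> = (\<integral>x. (f x - fc x) * v j x \<partial>\<nu>)"
    using noise_orthogonal(2)[OF v] integral_nu[OF m] by simp
  finally show ?thesis .
qed

text \<open>On the good event the estimator is compared with the approximation \<open>fc\<close> in the finite-dimensional head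
  of the feature space, while the tail is negligible. The difference \<open>D\<close> is represented by the signed measure
  \<open>(\<Sum>i. c i * \<delta> (x i)) - u d\<nu>\<close>, and testing the normal equations against \<open>D\<close> gives the basic identity
  \<open>emp (D\<^sup>2) + lam Q = emp ((y - fc) D) - lam \<integral> u D\<close> with \<open>Q\<close> its squared RKHS norm.\<close>
lemma deterministic_bound:
  fixes K :: "('n \<Rightarrow> real^'d) \<Rightarrow> ('n \<Rightarrow> real^'d) \<Rightarrow> real" and z :: "nat \<Rightarrow> ('n \<Rightarrow> real^'d) \<times> real"
    and u :: "('n \<Rightarrow> real^'d) \<Rightarrow> real" and \<eta> v :: "nat \<Rightarrow> ('n \<Rightarrow> real^'d) \<Rightarrow> real"
  defines "H \<equiv> cut_off I_set K"
  defines "fc \<equiv> (\<lambda>x. \<integral>y. u y * H y x \<partial>\<nu>)"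
  assumes H: "lim_kernel \<nu> H" and eta: "\<And>a. a < m \<Longrightarrow> \<eta> a \<in> bfun \<nu>"
    and tail: "lim_kernel \<nu> (\<lambda>x y. H x y - (\<Sum>a<m. \<eta> a x * \<eta> a y))"
    and eps: "\<And>x. H x x - (\<Sum>a<m. \<eta> a x * \<eta> a x) \<le> eps" "eps \<le> lam / 2" and lam: "lam > 0"
    and v: "\<And>j. j < m \<Longrightarrow> v j \<in> bfun \<nu>"
    and rep: "\<And>w. \<exists>\<beta>. (\<forall>x. (\<Sum>a<m. w a * \<eta> a x) = (\<Sum>j<m. \<beta> j * v j x)) \<and>
       (\<Sum>j<m. (\<beta> j)\<^sup>2) = (\<integral>x. (\<Sum>a<m. w a * \<eta> a x)\<^sup>2 \<partial>\<nu>) + lam * (\<Sum>a<m. (w a)\<^sup>2)"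
    and u: "L2_mem \<nu> u" and dl: "(\<integral>\<^sup>+x. ennreal ((fc x - f x)\<^sup>2) \<partial>\<nu>) \<le> ennreal dl" "0 \<le> dl"
    and U: "lam\<^sup>2 * (\<integral>x. (u x)\<^sup>2 \<partial>\<nu>) \<le> U\<^sup>2" "0 \<le> U"
    and l: "l > 0" and zS: "\<And>i. i < l \<Longrightarrow> fst (z i) \<in> I_set"
    and E1: "L2_set (\<lambda>p. (\<Sum>i<l. v (fst p) (fst (z i)) * v (snd p) (fst (z i))) / real l
        - (\<integral>z. v (fst p) (fst z) * v (snd p) (fst z) \<partial>\<rho>)) ({..<m} \<times> {..<m}) \<le> 1 / 4"
    and E2: "L2_set (\<lambda>j. (\<Sum>i<l. noise_vec fc v m j (z i)) / real l - (\<integral>z. noise_vec fc v m j z \<partial>\<rho>)) {..m} \<le> t"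
    and A: "(\<integral>z. \<bar>snd z - fc (fst z)\<bar> \<partial>\<rho>) \<le> A"
  shows "err \<rho> \<kappa> (sample_est K I_set l z lam)
    \<le> ennreal (32 * (t + sqrt dl + U)\<^sup>2 + 16 * (eps / lam * (A + t + U)\<^sup>2) + 2 * dl)"
proof -
  interpret N: prob_space \<nu> by (rule prob_space_nu)
  define X where "X i = fst (z i)" for i
  define Y where "Y i = snd (z i)" for i
  define xs where "xs = map (\<lambda>i. fst (z i)) [0..<l]"
  define ys where "ys = map (\<lambda>i. snd (z i)) [0..<l]"
  have xl: "length xs = l" "\<And>i. i < l \<Longrightarrow> xs ! i = X i" "\<And>i. i < l \<Longrightarrow> ys ! i = Y i"
    by (simp_all add: xs_def ys_def X_def Y_def)
  have XS: "X i \<in> I_set" if "i < l" for i using zS[OF that] by (simp add: X_def)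
  have psd: "psd_on I_set K"
    by (rule lim_kernel_psd_on) (use H in \<open>simp add: H_def cut_off_def[abs_def]\<close>)
  have "set xs \<subseteq> I_set" "xs \<noteq> []" using XS l by (auto simp: xs_def X_def)
  from rls_estimator_representer[OF psd this lam, of ys, unfolded xl(1)] obtain c where
    c: "\<forall>i<l. c i * (real l * lam) = ys ! i - (\<Sum>j<l. c j * K (xs ! j) (xs ! i))" and
    est: "rls_estimator K I_set xs ys lam = (\<lambda>x. if x \<in> I_set then \<Sum>j<l. c j * K (xs ! j) x else 0)"
    by blast
  define fh where "fh x = (\<Sum>j<l. c j * H (X j) x)" for x
  have estfh: "sample_est K I_set l z lam = fh"
    unfolding sample_est_def xs_def[symmetric] ys_def[symmetric] est fh_def[abs_def]
    by (rule ext) (simp add: H_def cut_off_def xl XS)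
  have cfh: "c i * (real l * lam) = Y i - fh (X i)" if "i < l" for i
    using c that XS by (simp add: fh_def H_def cut_off_def xl)
  define \<Lambda> where "\<Lambda> g = (\<Sum>i<l. c i * g (X i)) - (\<integral>x. u x * g x \<partial>\<nu>)" for g
  have u1: "integrable \<nu> u" by (rule N.L2_mem_integrable[OF u])
  have \<Lambda>: "bfunctional \<nu> \<Lambda>"
  proof -
    have "\<Lambda> = (\<lambda>g. lin_fun xs (map c [0..<l]) g - (\<integral>x. u x * g x \<partial>\<nu>))"
      by (rule ext) (simp add: \<Lambda>_def lin_fun_def xl)
    thus ?thesis by (simp only: bfunctional_minus[OF bfunctional_lin_fun bfunctional_integral[OF u1]])
  qed
  define Ht where "Ht x y = H x y - (\<Sum>a<m. \<eta> a x * \<eta> a y)" for x y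
  have Ht: "lim_kernel \<nu> Ht" using tail by (simp add: Ht_def[abs_def])
  define w where "w a = \<Lambda> (\<eta> a)" for a
  define Dh where "Dh x = (\<Sum>a<m. w a * \<eta> a x)" for x
  define Dt where "Dt x = \<Lambda> (\<lambda>y. Ht y x)" for x
  define D where "D x = Dh x + Dt x" for x
  have Dhb: "Dh \<in> bfun \<nu>" unfolding Dh_def[abs_def] by (intro bfun_sum bfun_cmult eta)
  have Dtb: "Dt \<in> bfun \<nu>" unfolding Dt_def[abs_def] by (rule lim_kernel_functional(1)[OF Ht \<Lambda> \<Lambda>])
  have Db: "D \<in> bfun \<nu>" unfolding D_def[abs_def] by (rule bfun_add[OF Dhb Dtb])
  have Deq: "D x = fh x - fc x" for x
  proof -
    have hb: "(\<lambda>y. \<Sum>a<m. \<eta> a x * \<eta> a y) \<in> bfun \<nu>" by (intro bfun_sum bfun_cmult eta)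
    have "fh x - fc x = \<Lambda> (\<lambda>y. H y x)" by (simp add: \<Lambda>_def fh_def fc_def)
    also have "(\<lambda>y. H y x) = (\<lambda>y. (\<Sum>a<m. \<eta> a x * \<eta> a y) + Ht y x)" by (rule ext) (simp add: Ht_def mult.commute)
    also have "\<Lambda> \<dots> = \<Lambda> (\<lambda>y. \<Sum>a<m. \<eta> a x * \<eta> a y) + Dt x"
      unfolding Dt_def by (rule bfunctional_add[OF \<Lambda> hb lim_kernel_section[OF Ht]])
    also have "\<Lambda> (\<lambda>y. \<Sum>a<m. \<eta> a x * \<eta> a y) = (\<Sum>a<m. \<eta> a x * w a)"
      unfolding w_def by (rule bfunctional_sum[OF \<Lambda> eta])
    finally show ?thesis by (simp add: D_def Dh_def mult.commute)
  qed
  \<comment> \<open>The energies of the head and of the tail part of \<open>D\<close>; their sum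
    \<open>\<Lambda> D\<close> is the squared RKHS norm of \<open>D\<close>.\<close>
  define Wh where "Wh = (\<Sum>a<m. (w a)\<^sup>2)"
  define Qt where "Qt = \<Lambda> Dt"
  have Wh0: "0 \<le> Wh" by (simp add: Wh_def sum_nonneg)
  have Qt0: "0 \<le> Qt" unfolding Qt_def Dt_def[abs_def] by (rule lim_kernel_functional(2)[OF Ht \<Lambda> \<Lambda>])
  have \<Lambda>D: "\<Lambda> D = Wh + Qt"
  proof -
    have "\<Lambda> D = \<Lambda> Dh + \<Lambda> Dt" unfolding D_def[abs_def] by (rule bfunctional_add[OF \<Lambda> Dhb Dtb])
    also have "\<Lambda> Dh = (\<Sum>a<m. w a * w a)"
      unfolding Dh_def[abs_def] w_def by (rule bfunctional_sum[OF \<Lambda> eta])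
    finally show ?thesis by (simp add: Wh_def Qt_def power2_eq_square)
  qed
  have eps0: "0 \<le> eps" using lim_kernel_diag_nonneg[OF Ht, of undefined] eps(1)[of undefined] by (simp add: Ht_def)
  define e where "e = sqrt eps"
  define q where "q = sqrt Qt"
  have e2: "e\<^sup>2 = eps" "e \<ge> 0" and q2: "q\<^sup>2 = Qt" "q \<ge> 0" using eps0 Qt0 by (simp_all add: e_def q_def)
  have Dt2: "(Dt x)\<^sup>2 \<le> e\<^sup>2 * q\<^sup>2" for x
  proof -
    have "(Dt x)\<^sup>2 \<le> Qt * Ht x x"
      using lim_kernel_functional_eval[OF Ht \<Lambda>, of x] by (simp add: Dt_def[abs_def] Qt_def)
    also have "\<dots> \<le> Qt * eps" using eps(1)[of x] Qt0 by (intro mult_left_mono) (auto simp: Ht_def)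
    finally show ?thesis by (simp add: e2 q2 mult.commute)
  qed
  have Dt1: "\<bar>Dt x\<bar> \<le> q * e" for x
  proof (rule power2_le_imp_le)
    show "\<bar>Dt x\<bar>\<^sup>2 \<le> (q * e)\<^sup>2" using Dt2[of x] by (simp add: power_mult_distrib mult.commute)
  qed (use e2 q2 in simp)
  define Eh where "Eh = (\<integral>x. (Dh x)\<^sup>2 \<partial>\<nu>)"
  have Eh0: "0 \<le> Eh" unfolding Eh_def by (intro integral_nonneg_AE) auto
  \<comment> \<open>Whitened coordinates of the head. Their norm \<open>n\<close> dominates both the
    L2 norm of the head and \<open>sqrt lam\<close> times its RKHS norm.\<close>
  obtain \<beta> where \<beta>: "\<And>x. Dh x = (\<Sum>j<m. \<beta> j * v j x)" "(\<Sum>j<m. (\<beta> j)\<^sup>2) = Eh + lam * Wh"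
    using rep[of w] unfolding Dh_def Eh_def Wh_def by blast
  define n where "n = L2_set \<beta> {..<m}"
  have n0: "n \<ge> 0" by (simp add: n_def L2_set_nonneg)
  have n2: "n\<^sup>2 = Eh + lam * Wh" unfolding n_def L2_set_sq by (rule \<beta>(2))
  have Ehn: "sqrt Eh \<le> n"
  proof -
    have "sqrt Eh \<le> sqrt (n\<^sup>2)" using lam Wh0 by (intro real_sqrt_le_mono) (simp add: n2)
    thus ?thesis using n0 by simp
  qed
  define emp where "emp g = (\<Sum>i<l. g i) / real l" for g :: "nat \<Rightarrow> real"
  have emp_add: "emp (\<lambda>i. g i + h i) = emp g + emp h" for g h by (simp add: emp_def sum.distrib add_divide_distrib)
  have emp_mono: "emp g \<le> emp h" if "\<And>i. i < l \<Longrightarrow> g i \<le> h i" for g h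
    unfolding emp_def using that l by (intro divide_right_mono sum_mono) auto
  have emp_cmult: "emp (\<lambda>i. g i * k) = emp g * k" for g k by (simp add: emp_def sum_distrib_right)
  have emp_const: "emp (\<lambda>_. k) = k" for k using l by (simp add: emp_def)
  have emp_sum: "emp (\<lambda>i. \<Sum>j\<in>J. b j * g j i) = (\<Sum>j\<in>J. b j * emp (g j))" for J :: "'j set" and b g
    unfolding emp_def sum_distrib_left sum_divide_distrib times_divide_eq_right by (rule sum.swap)
  have ident: "emp (\<lambda>i. (D (X i))\<^sup>2) + lam * (Wh + Qt)
      = emp (\<lambda>i. (Y i - fc (X i)) * D (X i)) - lam * (\<integral>x. u x * D x \<partial>\<nu>)"
  proof -
    have t: "lam * c i * g = (Y i - fc (X i)) * g / real l - D (X i) * g / real l" if "i < l" for i g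
    proof -
      have "lam * c i = (Y i - fh (X i)) / real l" using cfh[OF that, symmetric] l by (simp add: field_simps)
      thus ?thesis by (simp add: Deq diff_divide_distrib left_diff_distrib)
    qed
    have "lam * (\<Sum>i<l. c i * D (X i)) = (\<Sum>i<l. (Y i - fc (X i)) * D (X i) / real l - D (X i) * D (X i) / real l)"
      unfolding sum_distrib_left by (rule sum.cong) (auto simp: t mult.assoc[symmetric])
    also have "\<dots> = emp (\<lambda>i. (Y i - fc (X i)) * D (X i)) - emp (\<lambda>i. (D (X i))\<^sup>2)"
      by (simp add: emp_def sum_subtractf sum_divide_distrib power2_eq_square)
    finally show ?thesis unfolding \<Lambda>D[symmetric] \<Lambda>_def by (simp add: right_diff_distrib)
  qed
  have fcb: "fc \<in> bfun \<nu>"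
    unfolding fc_def by (rule lim_kernel_functional(1)[OF H bfunctional_integral[OF u1] bfunctional_eval[of _ undefined]])
  define P where "P j = emp (\<lambda>i. noise_vec fc v m j (z i))" for j
  define E where "E j = (\<integral>z. noise_vec fc v m j z \<partial>\<rho>)" for j
  have PE: "L2_set (\<lambda>j. P j - E j) {..m} \<le> t" using E2 by (simp add: P_def E_def emp_def)
  have t0: "0 \<le> t" using PE L2_set_nonneg[of "\<lambda>j. P j - E j" "{..m}"] by linarith
  have h1: "emp (\<lambda>i. (Y i - fc (X i)) * Dh (X i)) \<le> n * (t + sqrt dl)"
  proof -
    have "emp (\<lambda>i. (Y i - fc (X i)) * Dh (X i)) = emp (\<lambda>i. \<Sum>j<m. \<beta> j * noise_vec fc v m j (z i))"
      unfolding \<beta>(1) sum_distrib_left by (intro arg_cong[where f = emp] ext sum.cong) (auto simp: noise_vec_def X_def Y_def)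
    also have "\<dots> = (\<Sum>j<m. \<beta> j * (P j - E j)) + (\<Sum>j<m. \<beta> j * E j)"
      unfolding emp_sum P_def by (simp add: right_diff_distrib sum_subtractf)
    also have "(\<Sum>j<m. \<beta> j * (P j - E j)) \<le> n * t"
    proof -
      have "(\<Sum>j<m. \<beta> j * (P j - E j)) \<le> n * L2_set (\<lambda>j. P j - E j) {..<m}"
        using sum_mult_le_L2_set[of \<beta> "\<lambda>j. P j - E j" "{..<m}"] by (simp add: n_def)
      also have "L2_set (\<lambda>j. P j - E j) {..<m} \<le> L2_set (\<lambda>j. P j - E j) {..m}"
        unfolding L2_set_def by (intro real_sqrt_le_mono sum_mono2) auto
      hence "n * L2_set (\<lambda>j. P j - E j) {..<m} \<le> n * t" using PE n0 by (intro mult_left_mono) auto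
      finally show ?thesis .
    qed
    also have "(\<Sum>j<m. \<beta> j * E j) \<le> n * sqrt dl"
    proof -
      have fL: "L2_mem \<nu> (\<lambda>x. f x - fc x)"
        using L2_mem_add[OF L2_regr L2_bfun[OF bfun_cmult[OF fcb, of "-1"]]] by simp
      have "(\<Sum>j<m. \<beta> j * E j) = (\<Sum>j<m. \<beta> j * (\<integral>x. (f x - fc x) * v j x \<partial>\<nu>))"
        by (rule sum.cong) (auto simp: E_def mean_noise_vec[OF v fcb])
      also have "\<dots> = (\<integral>x. (\<Sum>j<m. \<beta> j * ((f x - fc x) * v j x)) \<partial>\<nu>)"
        using L2_mem_integrable_mult[OF fL L2_bfun[OF v]] by (subst Bochner_Integration.integral_sum) auto
      also have "\<dots> = (\<integral>x. (f x - fc x) * Dh x \<partial>\<nu>)"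
        unfolding \<beta>(1) by (simp add: sum_distrib_left mult_ac)
      also have "\<dots> \<le> sqrt (\<integral>x. (f x - fc x)\<^sup>2 \<partial>\<nu>) * sqrt Eh"
        using integral_cauchy_schwarz[OF fL L2_bfun[OF Dhb]] by (simp add: Eh_def)
      also have "\<dots> \<le> sqrt dl * n"
      proof (intro mult_mono Ehn real_sqrt_le_mono)
        have "ennreal (\<integral>x. (f x - fc x)\<^sup>2 \<partial>\<nu>) = (\<integral>\<^sup>+x. ennreal ((f x - fc x)\<^sup>2) \<partial>\<nu>)"
          using fL by (intro nn_integral_eq_integral[symmetric]) (auto simp: L2_mem_def)
        also have "\<dots> \<le> ennreal dl" using dl(1) by (simp add: power2_commute)
        finally show "(\<integral>x. (f x - fc x)\<^sup>2 \<partial>\<nu>) \<le> dl" using dl(2) by simp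
      qed (use Eh0 dl in auto)
      finally show ?thesis by (simp add: mult.commute)
    qed
    finally show ?thesis by (simp add: distrib_left)
  qed
  \<comment> \<open>The tail part is only known to be at most \<open>q * e\<close> in absolute
    value, so it meets the residual through the mean absolute residual, the coordinate
    \<open>m\<close> of \<open>noise_vec\<close>.\<close>
  have h2: "emp (\<lambda>i. (Y i - fc (X i)) * Dt (X i)) \<le> q * e * (A + t)"
  proof -
    have "emp (\<lambda>i. (Y i - fc (X i)) * Dt (X i)) \<le> emp (\<lambda>i. noise_vec fc v m m (z i) * (q * e))"
    proof (rule emp_mono)
      fix i
      have "(Y i - fc (X i)) * Dt (X i) \<le> \<bar>Y i - fc (X i)\<bar> * \<bar>Dt (X i)\<bar>" by (simp flip: abs_mult)
      also have "\<dots> \<le> \<bar>Y i - fc (X i)\<bar> * (q * e)" by (intro mult_left_mono Dt1) auto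
      finally show "(Y i - fc (X i)) * Dt (X i) \<le> noise_vec fc v m m (z i) * (q * e)"
        by (simp add: noise_vec_def X_def Y_def)
    qed
    also have "\<dots> = P m * (q * e)" unfolding P_def by (rule emp_cmult)
    also have "\<dots> \<le> (A + t) * (q * e)"
    proof (rule mult_right_mono)
      have "\<bar>P m - E m\<bar> \<le> L2_set (\<lambda>j. P j - E j) {..m}" by (rule abs_le_L2_set) auto
      moreover have "E m \<le> A" using A by (simp add: E_def noise_vec_def)
      ultimately show "P m \<le> A + t" using PE by linarith
    qed (use e2 q2 in simp)
    finally show ?thesis by (simp add: mult.commute)
  qed
  have Us: "lam * sqrt (\<integral>x. (u x)\<^sup>2 \<partial>\<nu>) \<le> U"
  proof -
    have "sqrt (lam\<^sup>2 * (\<integral>x. (u x)\<^sup>2 \<partial>\<nu>)) \<le> sqrt (U\<^sup>2)" using U(1) by (rule real_sqrt_le_mono)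
    thus ?thesis using lam U(2) by (simp add: real_sqrt_mult)
  qed
  have h3: "- lam * (\<integral>x. u x * D x \<partial>\<nu>) \<le> n * U + q * e * U"
  proof -
    have "(\<integral>x. u x * D x \<partial>\<nu>) = (\<integral>x. u x * Dh x + u x * Dt x \<partial>\<nu>)" by (simp add: D_def distrib_left)
    also have "\<dots> = (\<integral>x. u x * Dh x \<partial>\<nu>) + (\<integral>x. u x * Dt x \<partial>\<nu>)"
      by (intro Bochner_Integration.integral_add integrable_mult_bfun u1 Dhb Dtb)
    finally have eq: "(\<integral>x. u x * D x \<partial>\<nu>) = (\<integral>x. u x * Dh x \<partial>\<nu>) + (\<integral>x. u x * Dt x \<partial>\<nu>)" .
    define u2 where "u2 = sqrt (\<integral>x. (u x)\<^sup>2 \<partial>\<nu>)"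
    have "\<bar>\<integral>x. u x * Dh x \<partial>\<nu>\<bar> \<le> u2 * sqrt Eh"
      unfolding u2_def Eh_def by (rule integral_cauchy_schwarz[OF u L2_bfun[OF Dhb]])
    also have "\<dots> \<le> u2 * n" using Ehn by (intro mult_left_mono) (auto simp: u2_def)
    finally have b1: "\<bar>\<integral>x. u x * Dh x \<partial>\<nu>\<bar> \<le> u2 * n" .
    have "\<bar>\<integral>x. u x * Dt x \<partial>\<nu>\<bar> \<le> u2 * sqrt (\<integral>x. (Dt x)\<^sup>2 \<partial>\<nu>)"
      unfolding u2_def by (rule integral_cauchy_schwarz[OF u L2_bfun[OF Dtb]])
    also have "\<dots> \<le> u2 * sqrt (e\<^sup>2 * q\<^sup>2)"
    proof (intro mult_left_mono real_sqrt_le_mono)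
      have "(\<integral>x. (Dt x)\<^sup>2 \<partial>\<nu>) \<le> (\<integral>x. e\<^sup>2 * q\<^sup>2 \<partial>\<nu>)"
        using L2_bfun[OF Dtb] Dt2 by (intro integral_mono) (auto simp: L2_mem_def)
      thus "(\<integral>x. (Dt x)\<^sup>2 \<partial>\<nu>) \<le> e\<^sup>2 * q\<^sup>2" by (simp add: N.prob_space)
    qed (simp add: u2_def)
    also have "\<dots> = u2 * (q * e)" using e2(2) q2(2) by (simp add: real_sqrt_mult mult.commute)
    finally have b2: "\<bar>\<integral>x. u x * Dt x \<partial>\<nu>\<bar> \<le> u2 * (q * e)" .
    have "- lam * (\<integral>x. u x * D x \<partial>\<nu>) \<le> lam * (u2 * n + u2 * (q * e))"
    proof -
      have "- (\<integral>x. u x * D x \<partial>\<nu>) \<le> u2 * n + u2 * (q * e)" using b1 b2 eq by linarith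
      from mult_left_mono[OF this less_imp_le[OF lam]] show ?thesis by simp
    qed
    also have "\<dots> = lam * u2 * (n + q * e)" by (simp add: algebra_simps)
    also have "\<dots> \<le> U * (n + q * e)"
      using Us n0 e2 q2 by (intro mult_right_mono) (auto simp: u2_def)
    finally show ?thesis by (simp add: algebra_simps)
  qed
  \<comment> \<open>The empirical square of the head differs from \<open>Eh\<close> by a quadratic
    form in \<open>\<beta>\<close>, at most the Frobenius deviation \<open>1 / 4\<close> times
    \<open>n\<^sup>2\<close>. Passing from the head to \<open>D\<close> costs a factor 2 and the
    square of the tail part.\<close>
  have h4: "(Eh - n\<^sup>2 / 4) / 2 - q\<^sup>2 * e\<^sup>2 \<le> emp (\<lambda>i. (D (X i))\<^sup>2)"
  proof -
    define G where "G p = emp (\<lambda>i. v (fst p) (X i) * v (snd p) (X i))" for p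
    define M where "M p = (\<integral>z. v (fst p) (fst z) * v (snd p) (fst z) \<partial>\<rho>)" for p
    let ?J = "{..<m} \<times> {..<m}"
    have GM: "L2_set (\<lambda>p. G p - M p) ?J \<le> 1 / 4" using E1 by (simp add: G_def M_def emp_def X_def)
    have sq: "(Dh x)\<^sup>2 = (\<Sum>p\<in>?J. (\<beta> (fst p) * \<beta> (snd p)) * (v (fst p) x * v (snd p) x))" for x
      unfolding \<beta>(1) power2_eq_square sum_product by (simp add: sum.cartesian_product case_prod_unfold mult_ac)
    have e1: "emp (\<lambda>i. (Dh (X i))\<^sup>2) = (\<Sum>p\<in>?J. (\<beta> (fst p) * \<beta> (snd p)) * G p)"
      unfolding sq G_def by (rule emp_sum)
    have e2': "Eh = (\<Sum>p\<in>?J. (\<beta> (fst p) * \<beta> (snd p)) * M p)"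
    proof -
      have b: "(\<lambda>x. v (fst p) x * v (snd p) x) \<in> bfun \<nu>" if "p \<in> ?J" for p using that by (intro bfun_mult v) auto
      have Meq: "M p = (\<integral>x. v (fst p) x * v (snd p) x \<partial>\<nu>)" if "p \<in> ?J" for p
        unfolding M_def by (rule integral_nu[OF bfun_measurable[OF b[OF that]]])
      have "Eh = (\<Sum>p\<in>?J. (\<integral>x. (\<beta> (fst p) * \<beta> (snd p)) * (v (fst p) x * v (snd p) x) \<partial>\<nu>))"
        unfolding Eh_def sq by (intro Bochner_Integration.integral_sum integrable_mult_right
            integrable_bfun[OF prob_space.finite_measure[OF prob_space_nu]] b)
      thus ?thesis using Meq by simp
    qed
    have "Eh - emp (\<lambda>i. (Dh (X i))\<^sup>2) = - (\<Sum>p\<in>?J. (\<beta> (fst p) * \<beta> (snd p)) * (G p - M p))"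
      unfolding e1 by (subst e2') (simp add: right_diff_distrib sum_subtractf)
    also have "\<dots> \<le> L2_set (\<lambda>p. \<beta> (fst p) * \<beta> (snd p)) ?J * L2_set (\<lambda>p. G p - M p) ?J"
      using sum_mult_le_L2_set[of "\<lambda>p. \<beta> (fst p) * \<beta> (snd p)" "\<lambda>p. G p - M p" ?J] by linarith
    also have "\<dots> \<le> n\<^sup>2 * (1 / 4)"
      unfolding L2_set_outer_product using GM \<beta>(2) n2 Eh0 Wh0 lam by (intro mult_mono) (auto simp: L2_set_nonneg)
    finally have "Eh - n\<^sup>2 / 4 \<le> emp (\<lambda>i. (Dh (X i))\<^sup>2)" by simp
    hence "(Eh - n\<^sup>2 / 4) / 2 - q\<^sup>2 * e\<^sup>2 \<le> emp (\<lambda>i. (Dh (X i))\<^sup>2) * (1 / 2) + (- (q\<^sup>2 * e\<^sup>2))" by simp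
    also have "\<dots> = emp (\<lambda>i. (Dh (X i))\<^sup>2 * (1 / 2) + (- (q\<^sup>2 * e\<^sup>2)))"
      unfolding emp_add emp_cmult emp_const ..
    also have "\<dots> \<le> emp (\<lambda>i. (D (X i))\<^sup>2)"
    proof (rule emp_mono)
      fix i
      have "(Dh (X i))\<^sup>2 * (1 / 2) - (Dt (X i))\<^sup>2 \<le> (D (X i))\<^sup>2"
        using zero_le_power2[of "Dh (X i) + 2 * Dt (X i)"] by (simp add: D_def power2_eq_square algebra_simps)
      thus "(Dh (X i))\<^sup>2 * (1 / 2) + (- (q\<^sup>2 * e\<^sup>2)) \<le> (D (X i))\<^sup>2" using Dt2[of "X i"] by (simp add: mult.commute)
    qed
    finally show ?thesis .
  qed
  have main: "(Eh - n\<^sup>2 / 4) / 2 - q\<^sup>2 * e\<^sup>2 + lam * (Wh + q\<^sup>2) \<le> n * (t + sqrt dl + U) + q * e * (A + t + U)"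
  proof -
    have "emp (\<lambda>i. (Y i - fc (X i)) * D (X i)) = emp (\<lambda>i. (Y i - fc (X i)) * Dh (X i)) + emp (\<lambda>i. (Y i - fc (X i)) * Dt (X i))"
      unfolding D_def distrib_left by (rule emp_add)
    thus ?thesis using ident h1 h2 h3 h4 unfolding q2(1) distrib_left by linarith
  qed
  have fin: "2 * Eh + 2 * (e\<^sup>2 * q\<^sup>2) \<le> 16 * (t + sqrt dl + U)\<^sup>2 + 8 * (e\<^sup>2 / lam * (A + t + U)\<^sup>2)"
    by (rule quadratic_inequality_solve[OF lam _ Eh0 Wh0 n2 main]) (use eps(2) in \<open>simp add: e2(1)\<close>)
  have DL: "(\<integral>x. (D x)\<^sup>2 \<partial>\<nu>) \<le> 2 * Eh + 2 * (e\<^sup>2 * q\<^sup>2)"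
  proof -
    have "(\<integral>x. (D x)\<^sup>2 \<partial>\<nu>) \<le> (\<integral>x. 2 * (Dh x)\<^sup>2 + 2 * (e\<^sup>2 * q\<^sup>2) \<partial>\<nu>)"
    proof (rule integral_mono)
      fix x
      have "(D x)\<^sup>2 \<le> 2 * (Dh x)\<^sup>2 + 2 * (Dt x)\<^sup>2"
        using zero_le_power2[of "Dh x - Dt x"] by (simp add: D_def power2_eq_square algebra_simps)
      thus "(D x)\<^sup>2 \<le> 2 * (Dh x)\<^sup>2 + 2 * (e\<^sup>2 * q\<^sup>2)" using Dt2[of x] by linarith
    qed (use L2_bfun[OF Db] L2_bfun[OF Dhb] in \<open>auto simp: L2_mem_def\<close>)
    also have "\<dots> = 2 * Eh + 2 * (e\<^sup>2 * q\<^sup>2)"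
      using L2_bfun[OF Dhb] by (simp add: Eh_def L2_mem_def N.prob_space)
    finally show ?thesis .
  qed
  have [measurable]: "D \<in> borel_measurable \<nu>" "fc \<in> borel_measurable \<nu>" "f \<in> borel_measurable \<nu>"
    using Db fcb by (auto simp: bfun_def measurable_nu)
  have "err \<rho> \<kappa> (sample_est K I_set l z lam) = (\<integral>\<^sup>+x. ennreal ((fh x - f x)\<^sup>2) \<partial>\<nu>)"
    unfolding err_def estfh ..
  also have "\<dots> \<le> (\<integral>\<^sup>+x. ennreal 2 * ennreal ((D x)\<^sup>2) + ennreal 2 * ennreal ((fc x - f x)\<^sup>2) \<partial>\<nu>)"
  proof (rule nn_integral_mono)
    fix x
    have "(fh x - f x)\<^sup>2 \<le> 2 * (D x)\<^sup>2 + 2 * (fc x - f x)\<^sup>2"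
      using zero_le_power2[of "D x - (fc x - f x)"] by (simp add: Deq power2_eq_square algebra_simps)
    hence "ennreal ((fh x - f x)\<^sup>2) \<le> ennreal (2 * (D x)\<^sup>2 + 2 * (fc x - f x)\<^sup>2)" by (rule ennreal_leI)
    also have "\<dots> = ennreal 2 * ennreal ((D x)\<^sup>2) + ennreal 2 * ennreal ((fc x - f x)\<^sup>2)"
      by (rule ennreal_mult_plus_mult[symmetric]) auto
    finally show "ennreal ((fh x - f x)\<^sup>2) \<le> ennreal 2 * ennreal ((D x)\<^sup>2) + ennreal 2 * ennreal ((fc x - f x)\<^sup>2)" .
  qed
  also have "\<dots> = ennreal 2 * (\<integral>\<^sup>+x. ennreal ((D x)\<^sup>2) \<partial>\<nu>) + ennreal 2 * (\<integral>\<^sup>+x. ennreal ((fc x - f x)\<^sup>2) \<partial>\<nu>)"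
    by (subst nn_integral_add) (auto simp: nn_integral_cmult)
  also have "(\<integral>\<^sup>+x. ennreal ((D x)\<^sup>2) \<partial>\<nu>) = ennreal (\<integral>x. (D x)\<^sup>2 \<partial>\<nu>)"
    by (rule nn_integral_eq_integral) (use L2_bfun[OF Db] in \<open>auto simp: L2_mem_def\<close>)
  also have "ennreal 2 * ennreal (\<integral>x. (D x)\<^sup>2 \<partial>\<nu>) + ennreal 2 * (\<integral>\<^sup>+x. ennreal ((fc x - f x)\<^sup>2) \<partial>\<nu>)
      \<le> ennreal 2 * ennreal (2 * Eh + 2 * (e\<^sup>2 * q\<^sup>2)) + ennreal 2 * ennreal dl"
    using DL dl(1) by (intro add_mono mult_left_mono ennreal_leI) auto
  also have "\<dots> = ennreal (2 * (2 * Eh + 2 * (e\<^sup>2 * q\<^sup>2)) + 2 * dl)"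
    by (rule ennreal_mult_plus_mult) (use Eh0 dl in auto)
  also have "\<dots> \<le> ennreal (32 * (t + sqrt dl + U)\<^sup>2 + 16 * (eps / lam * (A + t + U)\<^sup>2) + 2 * dl)"
    using fin by (intro ennreal_leI) (simp add: e2(1))
  finally show ?thesis .
qed

end

section \<open>Learning rates\<close>

lemma sph_meas_finite: "finite_measure (sph_meas :: (real^'d::finite) measure)"
  and sets_sph_meas: "sets (sph_meas :: (real^'d::finite) measure) = sets borel"
  and sph_meas_off_sphere: "emeasure (sph_meas :: (real^'d::finite) measure) (- sphere 0 1) = 0"
proof -
  let ?B = "restrict_space lborel (ball 0 1) :: (real^'d) measure"
  let ?\<pi> = "\<lambda>x :: real^'d. x /\<^sub>R norm x"
  have m: "?\<pi> \<in> ?B \<rightarrow>\<^sub>M borel" by (rule measurable_restrict_space1) measurable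
  show s: "sets (sph_meas :: (real^'d::finite) measure) = sets borel" by (simp add: sph_meas_def)
  have fin: "emeasure ?B (space ?B) < \<infinity>"
    using emeasure_lborel_ball_finite[of "0 :: real^'d" 1] by (simp add: space_restrict_space emeasure_restrict_space)
  have "emeasure (sph_meas :: (real^'d) measure) (space sph_meas) = of_nat CARD('d) * emeasure ?B (space ?B)"
    by (simp add: sph_meas_def space_scale_measure emeasure_distr[OF m])
  also have "\<dots> \<noteq> \<infinity>" using fin by (simp add: ennreal_mult_eq_top_iff)
  finally show "finite_measure (sph_meas :: (real^'d::finite) measure)" by (intro finite_measureI)
  \<comment> \<open>At the origin the normalization gives 0, because \<open>inverse 0 = 0\<close>;
    exactly this one null point is sent off the sphere.\<close>
  have "?\<pi> x \<in> sphere 0 1" if "x \<noteq> 0" for x using that by simp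
  hence "?\<pi> -` (- sphere 0 1) \<inter> space ?B \<subseteq> {0}" by blast
  hence "?\<pi> -` (- sphere 0 1) \<inter> space ?B = {0}" by (auto simp: space_restrict_space)
  hence "emeasure (distr ?B borel ?\<pi>) (- sphere 0 1) = emeasure ?B {0}"
    by (subst emeasure_distr[OF m]) auto
  also have "\<dots> = 0" by (subst emeasure_restrict_space) auto
  finally show "emeasure (sph_meas :: (real^'d) measure) (- sphere 0 1) = 0" by (simp add: sph_meas_def)
qed

lemma AE_P_meas_I_set: "AE X in (P_meas :: ('n::finite \<Rightarrow> real^'d::finite) measure). X \<in> I_set"
proof -
  interpret finite_measure "sph_meas :: (real^'d) measure" by (rule sph_meas_finite)
  interpret product_sigma_finite "\<lambda>_::'n. sph_meas :: (real^'d) measure" by standard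
  have sp: "space (sph_meas :: (real^'d) measure) = UNIV" using sets_eq_imp_space_eq[OF sets_sph_meas] by simp
  have "AE X in (P_meas :: ('n \<Rightarrow> real^'d) measure). X i \<in> sphere 0 1" for i
  proof -
    define A where "A j = (if j = i then - sphere 0 1 else UNIV :: (real^'d) set)" for j
    have As: "A j \<in> sets sph_meas" for j by (auto simp: A_def sets_sph_meas intro: borel_open)
    have "emeasure P_meas (PiE UNIV A) = (\<Prod>j\<in>UNIV. emeasure sph_meas (A j))"
      unfolding P_meas_def by (rule emeasure_PiM) (use As in auto)
    also have "\<dots> = 0" by (intro prod_zero bexI[of _ i]) (auto simp: A_def sph_meas_off_sphere)
    finally have "emeasure P_meas (PiE UNIV A) = 0" .
    moreover have "PiE UNIV A \<in> sets P_meas" unfolding P_meas_def by (rule sets_PiM_I_finite) (use As in auto)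
    ultimately have "PiE UNIV A \<in> null_sets P_meas" by auto
    thus ?thesis by (rule AE_I') (auto simp: A_def PiE_def Pi_def extensional_def)
  qed
  hence "AE X in (P_meas :: ('n \<Rightarrow> real^'d) measure). \<forall>i\<in>UNIV. X i \<in> sphere 0 1"
    by (intro AE_finite_allI) auto
  thus ?thesis by (simp add: I_set_def)
qed

lemma W_omega_AE_I_set:
  assumes "W_omega \<omega> \<mu>" shows "AE X in \<mu>. X \<in> I_set"
proof -
  obtain h where h: "h \<in> borel_measurable P_meas" "\<mu> = density P_meas h" using assms unfolding W_omega_def by blast
  show ?thesis unfolding h(2) using AE_P_meas_I_set by (subst AE_density[OF h(1)]) (auto elim: eventually_mono)
qed

context regression_model
begin

text \<open>A crude constant suffices, because in \<open>deterministic_bound\<close> this mean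
  carries the factor \<open>eps / lam\<close>.\<close>

lemma mean_abs_residual:
  assumes fc: "fc \<in> bfun \<nu>" and dl: "(\<integral>\<^sup>+x. ennreal ((fc x - f x)\<^sup>2) \<partial>\<nu>) \<le> ennreal dl" "0 \<le> dl"
  shows "(\<integral>z. \<bar>snd z - fc (fst z)\<bar> \<partial>\<rho>) \<le> 2 + \<sigma>\<^sup>2 + dl"
proof -
  have [measurable]: "fc \<in> borel_measurable I_meas" using fc by (simp add: bfun_def measurable_nu)
  have m: "(\<lambda>z. ennreal (\<bar>snd z - f (fst z)\<bar> ^ 2)) \<in> borel_measurable (I_meas \<Otimes>\<^sub>M borel)" by measurable
  have "(\<integral>\<^sup>+z. ennreal (\<bar>snd z - f (fst z)\<bar> ^ 2) \<partial>\<rho>) = (\<integral>\<^sup>+x. \<integral>\<^sup>+y. ennreal (\<bar>y - f x\<bar> ^ 2) \<partial>\<kappa> x \<partial>\<nu>)"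
    unfolding nn_integral_rho[OF m] by simp
  also have "\<dots> \<le> (\<integral>\<^sup>+x. ennreal (\<sigma>\<^sup>2) \<partial>\<nu>)"
  proof (rule nn_integral_mono_AE)
    show "AE x in \<nu>. (\<integral>\<^sup>+y. ennreal (\<bar>y - f x\<bar> ^ 2) \<partial>\<kappa> x) \<le> ennreal (\<sigma>\<^sup>2)"
      using moments[of 2] by (simp add: fact_2)
  qed
  also have "\<dots> = ennreal (\<sigma>\<^sup>2)" by (simp add: prob_space.emeasure_space_1[OF prob_space_nu])
  finally have v: "(\<integral>\<^sup>+z. ennreal (\<bar>snd z - f (fst z)\<bar> ^ 2) \<partial>\<rho>) \<le> ennreal (\<sigma>\<^sup>2)" .
  have d: "(\<integral>\<^sup>+z. ennreal ((fc (fst z) - f (fst z))\<^sup>2) \<partial>\<rho>) \<le> ennreal dl"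
  proof -
    have "(\<integral>\<^sup>+z. ennreal ((fc (fst z) - f (fst z))\<^sup>2) \<partial>\<rho>) = (\<integral>\<^sup>+x. ennreal ((fc x - f x)\<^sup>2) \<partial>\<nu>)"
      unfolding marg_def by (subst nn_integral_distr) auto
    thus ?thesis using dl(1) by simp
  qed
  have int: "integrable \<rho> (\<lambda>z. \<bar>snd z - fc (fst z)\<bar>)"
    by (intro integrable_abs Bochner_Integration.integrable_diff integrable_snd
        integrable_bfun[OF _ bfun_fst[OF fc]]) unfold_locales
  have "ennreal (\<integral>z. \<bar>snd z - fc (fst z)\<bar> \<partial>\<rho>) = (\<integral>\<^sup>+z. ennreal \<bar>snd z - fc (fst z)\<bar> \<partial>\<rho>)"
    by (rule nn_integral_eq_integral[symmetric, OF int]) simp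
  also have "\<dots> \<le> (\<integral>\<^sup>+z. ennreal 2 + (ennreal (\<bar>snd z - f (fst z)\<bar> ^ 2) + ennreal ((fc (fst z) - f (fst z))\<^sup>2)) \<partial>\<rho>)"
  proof (rule nn_integral_mono)
    fix z
    have plus: "ennreal (2 + (\<bar>a\<bar> ^ 2 + b\<^sup>2)) = ennreal 2 + (ennreal (\<bar>a\<bar> ^ 2) + ennreal (b\<^sup>2))" for a b :: real
      by (subst ennreal_plus, simp, simp, subst ennreal_plus) auto
    have le: "\<bar>a\<bar> \<le> 1 + a\<^sup>2" for a :: real
    proof -
      have "2 * \<bar>a\<bar> \<le> 1 + a\<^sup>2" using zero_le_power2[of "\<bar>a\<bar> - 1"] by (simp add: power2_diff)
      thus ?thesis by (smt (verit) abs_ge_zero)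
    qed
    have "\<bar>snd z - fc (fst z)\<bar> \<le> \<bar>snd z - f (fst z)\<bar> + \<bar>fc (fst z) - f (fst z)\<bar>" by linarith
    also have "\<dots> \<le> 2 + (\<bar>snd z - f (fst z)\<bar> ^ 2 + (fc (fst z) - f (fst z))\<^sup>2)"
      using le[of "snd z - f (fst z)"] le[of "fc (fst z) - f (fst z)"] by simp
    finally have "ennreal \<bar>snd z - fc (fst z)\<bar> \<le> ennreal (2 + (\<bar>snd z - f (fst z)\<bar> ^ 2 + (fc (fst z) - f (fst z))\<^sup>2))"
      by (rule ennreal_leI)
    thus "ennreal \<bar>snd z - fc (fst z)\<bar>
        \<le> ennreal 2 + (ennreal (\<bar>snd z - f (fst z)\<bar> ^ 2) + ennreal ((fc (fst z) - f (fst z))\<^sup>2))"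
      by (simp only: plus)
  qed
  also have "\<dots> = ennreal 2 + ((\<integral>\<^sup>+z. ennreal (\<bar>snd z - f (fst z)\<bar> ^ 2) \<partial>\<rho>)
      + (\<integral>\<^sup>+z. ennreal ((fc (fst z) - f (fst z))\<^sup>2) \<partial>\<rho>))"
    by (subst nn_integral_add, simp, measurable, subst nn_integral_add) (auto simp: emeasure_space_1)
  also have "\<dots> \<le> ennreal 2 + (ennreal (\<sigma>\<^sup>2) + ennreal dl)" by (intro add_mono v d) auto
  also have "\<dots> = ennreal (2 + \<sigma>\<^sup>2 + dl)" 
  proof -
    have "ennreal (2 + (\<sigma>\<^sup>2 + dl)) = ennreal 2 + ennreal (\<sigma>\<^sup>2 + dl)" using dl(2) by (intro ennreal_plus) auto
    moreover have "ennreal (\<sigma>\<^sup>2 + dl) = ennreal (\<sigma>\<^sup>2) + ennreal dl" using dl(2) by (intro ennreal_plus) auto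
    ultimately show ?thesis by (simp only: add.assoc)
  qed
  finally show ?thesis using dl(2) by (subst (asm) ennreal_le_iff) auto
qed

text \<open>The Laplace parameters are \<open>s = c / (R l)\<close> for the noise vector, with \<open>R\<^sup>2 = lam\<^sup>\<beta> + Lg / l\<close>,
  and \<open>c3 lam / Lg\<close> for the Gram matrix; \<open>Lg\<close> dominates the dimension \<open>m\<close> of the head.\<close>
lemma core_bound:
  fixes K :: "('n \<Rightarrow> real^'d) \<Rightarrow> ('n \<Rightarrow> real^'d) \<Rightarrow> real" and \<eta> :: "nat \<Rightarrow> ('n \<Rightarrow> real^'d) \<Rightarrow> real"
    and kap Cm B c c3 C1 A0 F0 Lg \<tau> lam \<beta> :: real and l m :: nat
  defines "H \<equiv> cut_off I_set K"
  assumes S: "AE x in \<nu>. x \<in> I_set"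
    and H: "lim_kernel \<nu> H" and kap: "\<And>x. H x x \<le> kap" "kap > 0"
    and eta: "\<And>a. a < m \<Longrightarrow> \<eta> a \<in> bfun \<nu>"
    and tail: "lim_kernel \<nu> (\<lambda>x y. H x y - (\<Sum>a<m. \<eta> a x * \<eta> a y))"
    and eps: "\<And>x. H x x - (\<Sum>a<m. \<eta> a x * \<eta> a x) \<le> 1 / real l ^ 3"
    and m: "real m \<le> Cm * Lg" and Lg: "Lg \<ge> 1" and Cm: "Cm > 0"
    and pow: "is_op_power \<nu> (T_op K \<nu>) (\<beta> / 2) g f" and g: "L2_mem \<nu> g" "(\<integral>x. (g x)\<^sup>2 \<partial>\<nu>) \<le> B"
    and \<beta>: "0 < \<beta>" "\<beta> \<le> 2" and lam: "0 < lam" "lam \<le> 1" and l: "l \<ge> 3" and \<tau>: "\<tau> \<ge> 1"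
    and F0: "F0 = 2 * kap * B * (1 + kap) + 2 * Binf"
    and c3: "c3 > 0" "32 * c3 * kap * Cm \<le> 1" "2 * c3 * kap \<le> 1" and A0: "A0 \<ge> 1" "A0 * c3 \<ge> 48"
    and c: "c > 0" "8 * c * sqrt (1 + kap) * L \<le> 1" "32 * c\<^sup>2 * (1 + kap) * F0 \<le> 1"
      "8 * c\<^sup>2 * (\<sigma>\<^sup>2 * (1 + Cm) + 2 * (1 + B) * (1 + kap)) \<le> 1" and C1: "c * C1 \<ge> 7"
    and ll: "real l * lam \<ge> A0 * \<tau> * Lg" and B: "B > 0" and Binf: "Binf > 0"
  shows "prob_at_least (PiM {..<l} (\<lambda>_. \<rho>))
    (\<lambda>z. err \<rho> \<kappa> (sample_est K I_set l z lam) \<le> ennreal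
      ((32 * (C1 + sqrt (2 * (1 + B)) + sqrt B)\<^sup>2 + 16 * (2 + \<sigma>\<^sup>2 + 2 * (1 + B) + 2 * C1 + sqrt B)\<^sup>2 + 4 * (1 + B))
        * \<tau>\<^sup>2 * (lam powr \<beta> + Lg / real l)))
    (1 - exp (- 4 * \<tau>))"
proof -
  interpret N: prob_space \<nu> by (rule prob_space_nu)
  interpret PP: prob_space "PiM {..<l} (\<lambda>_. \<rho>)" by (intro prob_space_PiM prob)
  have l0: "real l > 0" using l by simp
  have Heq: "H = (\<lambda>x y. if x \<in> I_set \<and> y \<in> I_set then K x y else 0)" by (simp add: H_def cut_off_def[abs_def])
  have Im: "I_set \<in> sets \<nu>" unfolding sets_nu by (rule sets_I_set)
  have fm: "f \<in> borel_measurable \<nu>" by (simp add: measurable_nu)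
  have "\<exists>u. L2_mem \<nu> u
    \<and> (\<integral>\<^sup>+x. ennreal (((\<integral>y. u y * H y x \<partial>\<nu>) - f x)\<^sup>2) \<partial>\<nu>) \<le> ennreal (2 * (1 + B) * lam powr \<beta>)
    \<and> lam\<^sup>2 * (\<integral>x. (u x)\<^sup>2 \<partial>\<nu>) \<le> B * lam powr \<beta>
    \<and> (\<forall>x. (\<integral>y. u y * H y x \<partial>\<nu>)\<^sup>2 \<le> kap * (B * (1 + kap + lam powr (\<beta> - 1))))"
    unfolding Heq
    by (rule source_approximation[OF N.prob_space_axioms Im S H[unfolded Heq] kap(1)[unfolded Heq] pow g fm \<beta> lam(1)])
  then obtain u where u: "L2_mem \<nu> u"
    "(\<integral>\<^sup>+x. ennreal (((\<integral>y. u y * H y x \<partial>\<nu>) - f x)\<^sup>2) \<partial>\<nu>) \<le> ennreal (2 * (1 + B) * lam powr \<beta>)"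
    "lam\<^sup>2 * (\<integral>x. (u x)\<^sup>2 \<partial>\<nu>) \<le> B * lam powr \<beta>"
    "\<And>x. (\<integral>y. u y * H y x \<partial>\<nu>)\<^sup>2 \<le> kap * (B * (1 + kap + lam powr (\<beta> - 1)))"
    by blast
  define fc where "fc = (\<lambda>x. \<integral>y. u y * H y x \<partial>\<nu>)"
  have u1: "integrable \<nu> u" by (rule N.L2_mem_integrable[OF u(1)])
  have fcb: "fc \<in> bfun \<nu>"
    unfolding fc_def by (rule lim_kernel_functional(1)[OF H bfunctional_integral[OF u1] bfunctional_eval[of _ undefined]])
  define dl where "dl = 2 * (1 + B) * lam powr \<beta>"
  have dl: "(\<integral>\<^sup>+x. ennreal ((fc x - f x)\<^sup>2) \<partial>\<nu>) \<le> ennreal dl" "0 \<le> dl"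
    using u(2) B by (simp_all add: dl_def fc_def)
  have lb1: "lam powr \<beta> \<le> 1" using lam \<beta> by (intro powr_le1) auto
  have llg: "real l * lam \<ge> Lg"
  proof -
    have "1 * 1 * Lg \<le> A0 * \<tau> * Lg" using A0 \<tau> Lg by (intro mult_right_mono mult_mono) auto
    thus ?thesis using ll by simp
  qed
  have ll1: "real l * lam \<ge> 1" using llg Lg by linarith
  define R where "R = sqrt (lam powr \<beta> + Lg / real l)"
  have R2: "R\<^sup>2 = lam powr \<beta> + Lg / real l" using Lg l0 by (simp add: R_def)
  have Rpos: "R > 0" unfolding R_def using Lg l0 lam by (intro real_sqrt_gt_zero add_pos_pos) auto
  have R2a: "lam powr \<beta> \<le> R\<^sup>2" and R2b: "Lg \<le> R\<^sup>2 * real l" using Lg l0 by (simp_all add: R2 field_simps)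
  have R2l: "R\<^sup>2 * real l \<ge> 1" using R2b Lg by linarith
  have Rle: "R \<le> 2"
  proof -
    have "Lg / real l \<le> 1"
    proof -
      have "Lg \<le> real l * 1" using llg mult_left_mono[OF lam(2), of "real l"] by linarith
      thus ?thesis using l0 by simp
    qed
    hence "R\<^sup>2 \<le> 2\<^sup>2" using lb1 by (simp add: R2)
    thus ?thesis by (rule power2_le_imp_le) simp
  qed
  define W where "W = kap / lam"
  have W0: "0 \<le> W" using kap(2) lam by (simp add: W_def)
  have W1: "(1 + W) * lam \<le> 1 + kap" using lam by (simp add: W_def field_simps)
  have eta2: "(\<Sum>a<m. (\<eta> a x)\<^sup>2) \<le> kap" for x
    using lim_kernel_diag_nonneg[OF tail, of x] kap(1)[of x] by (simp add: power2_eq_square)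
  have "\<exists>v. (\<forall>j<m. v j \<in> bfun \<nu>) \<and>
    (\<forall>w. \<exists>\<beta>. (\<forall>x. (\<Sum>a<m. w a * \<eta> a x) = (\<Sum>j<m. \<beta> j * v j x)) \<and>
       (\<Sum>j<m. (\<beta> j)\<^sup>2) = (\<integral>x. (\<Sum>a<m. w a * \<eta> a x)\<^sup>2 \<partial>\<nu>) + lam * (\<Sum>a<m. (w a)\<^sup>2)) \<and>
    (\<forall>x. (\<Sum>j<m. (v j x)\<^sup>2) \<le> kap / lam) \<and>
    (\<forall>\<beta>. (\<integral>x. (\<Sum>j<m. \<beta> j * v j x)\<^sup>2 \<partial>\<nu>) \<le> (\<Sum>j<m. (\<beta> j)\<^sup>2))"
    by (rule whitening[OF N.prob_space_axioms eta lam(1) eta2])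
  then obtain v where v: "(\<forall>j<m. v j \<in> bfun \<nu>) \<and>
    (\<forall>w. \<exists>\<beta>. (\<forall>x. (\<Sum>a<m. w a * \<eta> a x) = (\<Sum>j<m. \<beta> j * v j x)) \<and>
       (\<Sum>j<m. (\<beta> j)\<^sup>2) = (\<integral>x. (\<Sum>a<m. w a * \<eta> a x)\<^sup>2 \<partial>\<nu>) + lam * (\<Sum>a<m. (w a)\<^sup>2)) \<and>
    (\<forall>x. (\<Sum>j<m. (v j x)\<^sup>2) \<le> kap / lam) \<and>
    (\<forall>\<beta>. (\<integral>x. (\<Sum>j<m. \<beta> j * v j x)\<^sup>2 \<partial>\<nu>) \<le> (\<Sum>j<m. (\<beta> j)\<^sup>2))"
    by (elim exE)
  have vb: "v j \<in> bfun \<nu>" if "j < m" for j using v that by blast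
  have vrep: "\<exists>\<beta>. (\<forall>x. (\<Sum>a<m. w a * \<eta> a x) = (\<Sum>j<m. \<beta> j * v j x)) \<and>
       (\<Sum>j<m. (\<beta> j)\<^sup>2) = (\<integral>x. (\<Sum>a<m. w a * \<eta> a x)\<^sup>2 \<partial>\<nu>) + lam * (\<Sum>a<m. (w a)\<^sup>2)" for w
    by (rule v[THEN conjunct2, THEN conjunct1, rule_format])
  have vW: "(\<Sum>j<m. (v j x)\<^sup>2) \<le> W" for x
    unfolding W_def by (rule v[THEN conjunct2, THEN conjunct2, THEN conjunct1, rule_format])
  have v1: "(\<integral>x. (v j x)\<^sup>2 \<partial>\<nu>) \<le> 1" if j: "j < m" for j
  proof -
    note * = v[THEN conjunct2, THEN conjunct2, THEN conjunct2, rule_format, of "\<lambda>i. if i = j then 1 else 0"]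
    have "(\<Sum>i<m. (if i = j then 1 else 0) * v i x) = (\<Sum>i<m. if i = j then v i x else 0)" for x by (rule sum.cong) auto
    hence 1: "(\<Sum>i<m. (if i = j then 1 else 0) * v i x) = v j x" for x using j by simp
    have "(\<Sum>i<m. (if i = j then 1 else 0)\<^sup>2) = (\<Sum>i<m. if i = j then 1 else (0::real))" by (rule sum.cong) auto
    hence 2: "(\<Sum>i<m. (if i = j then 1 else (0::real))\<^sup>2) = 1" using j by simp
    show ?thesis using * unfolding 1 2 .
  qed
  \<comment> \<open>For \<open>\<beta> < 1\<close> the bound on the approximation grows like
    \<open>lam powr (\<beta> - 1)\<close>; \<open>sWp\<close> shows that the Laplace parameter
    \<open>s\<close> can afford this factor.\<close>
  define F where "F = F0 * (1 + lam powr (\<beta> - 1))"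
  have F00: "F0 > 0" unfolding F0 using kap B Binf by (intro add_nonneg_pos) auto
  have F: "AE x in \<nu>. (fc x - f x)\<^sup>2 \<le> F"
    using regr_bound
  proof eventually_elim
    case (elim x)
    have "(fc x - f x)\<^sup>2 \<le> 2 * (fc x)\<^sup>2 + 2 * (f x)\<^sup>2"
      using zero_le_power2[of "fc x + f x"] by (simp add: power2_eq_square algebra_simps)
    also have "\<dots> \<le> 2 * (kap * (B * (1 + kap + lam powr (\<beta> - 1)))) + 2 * Binf"
      using u(4)[of x] elim by (intro add_mono mult_left_mono) (auto simp: fc_def)
    also have "\<dots> \<le> F"
    proof -
      define p where "p = lam powr (\<beta> - 1)"
      have p: "p \<ge> 0" by (simp add: p_def)
      have "F - (2 * (kap * (B * (1 + kap + p))) + 2 * Binf) = (2 * kap * B * kap + 2 * Binf) * p"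
        unfolding F_def F0 p_def[symmetric] by (simp add: algebra_simps)
      moreover have "0 \<le> (2 * kap * B * kap + 2 * Binf) * p" using p kap B Binf by (intro mult_nonneg_nonneg add_nonneg_nonneg) auto
      ultimately show ?thesis unfolding p_def by linarith
    qed
    finally show ?case .
  qed
  define s where "s = c / (R * real l)"
  have s0: "s > 0" using c Rpos l0 by (simp add: s_def)
  have s2: "s\<^sup>2 * (R\<^sup>2 * real l) * real l = c\<^sup>2" using Rpos l0 by (simp add: s_def power_divide power_mult_distrib power2_eq_square)
  have sls: "s\<^sup>2 * real l * (R\<^sup>2 * real l) = c\<^sup>2" using s2 by (simp add: mult_ac)
  have sW: "s\<^sup>2 * (1 + W) \<le> c\<^sup>2 * (1 + kap)"
  proof -
    have "s\<^sup>2 * (1 + W) * 1 \<le> s\<^sup>2 * (1 + W) * ((R\<^sup>2 * real l) * (real l * lam))"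
      using W0 mult_mono[OF R2l ll1] l0 by (intro mult_left_mono) auto
    also have "\<dots> = c\<^sup>2 * ((1 + W) * lam)" unfolding s2[symmetric] by (simp add: mult_ac)
    also have "\<dots> \<le> c\<^sup>2 * (1 + kap)" by (intro mult_left_mono W1) auto
    finally show ?thesis by simp
  qed
  \<comment> \<open>\<open>l * lam \<ge> 1\<close> is spent twice: one \<open>lam\<close> turns
    \<open>lam powr (\<beta> - 1)\<close> into \<open>lam powr \<beta> \<le> R\<^sup>2\<close>, the
    other offsets \<open>1 + W\<close>, which is of order \<open>1 / lam\<close>.\<close>
  have sWp: "s\<^sup>2 * (1 + W) * lam powr (\<beta> - 1) \<le> c\<^sup>2 * (1 + kap)"
  proof -
    have "lam powr (\<beta> - 1) * 1 \<le> lam powr (\<beta> - 1) * ((real l * lam) * (real l * lam))"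
      using mult_mono[OF ll1 ll1] l0 lam by (intro mult_left_mono) auto
    also have "\<dots> = (lam powr (\<beta> - 1) * lam) * (real l * real l * lam)" by (simp add: mult_ac)
    also have "lam powr (\<beta> - 1) * lam = lam powr \<beta>" using lam by (simp add: powr_diff)
    also have "lam powr \<beta> * (real l * real l * lam) \<le> R\<^sup>2 * (real l * real l * lam)"
      using R2a lam by (intro mult_right_mono) auto
    finally have "s\<^sup>2 * (1 + W) * (lam powr (\<beta> - 1) * 1) \<le> s\<^sup>2 * (1 + W) * (R\<^sup>2 * (real l * real l * lam))"
      using W0 by (intro mult_left_mono) auto
    also have "\<dots> = c\<^sup>2 * ((1 + W) * lam)" unfolding s2[symmetric] by (simp add: mult_ac)
    also have "\<dots> \<le> c\<^sup>2 * (1 + kap)" by (intro mult_left_mono W1) auto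
    finally show ?thesis by simp
  qed
  have cond1: "s\<^sup>2 * (1 + W) * F \<le> 1 / 16"
  proof -
    have "s\<^sup>2 * (1 + W) * F = F0 * (s\<^sup>2 * (1 + W) + s\<^sup>2 * (1 + W) * lam powr (\<beta> - 1))" by (simp add: F_def algebra_simps)
    also have "\<dots> \<le> F0 * (c\<^sup>2 * (1 + kap) + c\<^sup>2 * (1 + kap))" using F00 by (intro mult_left_mono add_mono sW sWp) auto
    also have "\<dots> = (32 * c\<^sup>2 * (1 + kap) * F0) / 16" by simp
    also have "\<dots> \<le> 1 / 16" using c(3) by (intro divide_right_mono) auto
    finally show ?thesis .
  qed
  have cond2: "4 * s * sqrt (1 + W) * L \<le> 1 / 2"
  proof -
    have "sqrt (s\<^sup>2 * (1 + W)) \<le> sqrt (c\<^sup>2 * (1 + kap))" by (rule real_sqrt_le_mono[OF sW])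
    hence "s * sqrt (1 + W) \<le> c * sqrt (1 + kap)" using s0 c by (simp add: real_sqrt_mult)
    hence "s * sqrt (1 + W) * (8 * L) \<le> c * sqrt (1 + kap) * (8 * L)"
      by (rule mult_right_mono) (use L in simp)
    thus ?thesis using c(2) by (simp add: mult_ac)
  qed
  define t where "t = C1 * \<tau> * R"
  \<comment> \<open>Of \<open>7 * \<tau>\<close> one unit pays for the variance term
    \<open>lv\<close>, and at least \<open>6 * \<tau>\<close> remains. Two events of probability at
    most \<open>2 * exp (- 6 * \<tau>)\<close> fit into \<open>exp (- 4 * \<tau>)\<close> because
    \<open>exp (2 * \<tau>) \<ge> 4\<close>.\<close>
  have slt: "s * real l * t \<ge> 7 * \<tau>"
  proof -
    have "s * real l * t = (c * C1) * \<tau>" using Rpos l0 by (simp add: s_def t_def)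
    thus ?thesis using C1 \<tau> mult_right_mono[OF C1, of \<tau>] by simp
  qed
  have lv: "real l * (8 * s\<^sup>2 * (\<sigma>\<^sup>2 * (1 + real m) + (1 + W) * dl)) \<le> 1"
  proof -
    have p1: "s\<^sup>2 * real l * (1 + real m) \<le> c\<^sup>2 * (1 + Cm)"
    proof -
      have "1 + real m \<le> (1 + Cm) * Lg" using m Lg by (simp add: distrib_right)
      also have "\<dots> \<le> (1 + Cm) * (R\<^sup>2 * real l)" using R2b Cm by (intro mult_left_mono) auto
      finally have "s\<^sup>2 * real l * (1 + real m) \<le> s\<^sup>2 * real l * ((1 + Cm) * (R\<^sup>2 * real l))"
        by (intro mult_left_mono) auto
      also have "\<dots> = c\<^sup>2 * (1 + Cm)" unfolding sls[symmetric] by (simp add: mult_ac)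
      finally show ?thesis .
    qed
    have p2: "s\<^sup>2 * real l * ((1 + W) * dl) \<le> c\<^sup>2 * (2 * (1 + B) * (1 + kap))"
    proof -
      have "(1 + W) * dl \<le> (1 + W) * dl * (real l * lam)" using mult_left_mono[OF ll1, of "(1 + W) * dl"] W0 dl(2) by simp
      also have "\<dots> = (1 + W) * lam * (2 * (1 + B)) * (lam powr \<beta> * real l)" by (simp add: dl_def mult_ac)
      also have "\<dots> \<le> (1 + kap) * (2 * (1 + B)) * (R\<^sup>2 * real l)"
        using W1 R2a B kap lam W0 by (intro mult_mono) auto
      finally have "s\<^sup>2 * real l * ((1 + W) * dl) \<le> s\<^sup>2 * real l * ((1 + kap) * (2 * (1 + B)) * (R\<^sup>2 * real l))"
        by (intro mult_left_mono) auto
      also have "\<dots> = c\<^sup>2 * (2 * (1 + B) * (1 + kap))" unfolding sls[symmetric] by (simp add: mult_ac)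
      finally show ?thesis .
    qed
    have "real l * (8 * s\<^sup>2 * (\<sigma>\<^sup>2 * (1 + real m) + (1 + W) * dl))
        = 8 * (\<sigma>\<^sup>2 * (s\<^sup>2 * real l * (1 + real m)) + s\<^sup>2 * real l * ((1 + W) * dl))" by (simp add: algebra_simps)
    also have "\<dots> \<le> 8 * (\<sigma>\<^sup>2 * (c\<^sup>2 * (1 + Cm)) + c\<^sup>2 * (2 * (1 + B) * (1 + kap)))"
      by (intro mult_left_mono add_mono p1 p2) auto
    also have "\<dots> = 8 * c\<^sup>2 * (\<sigma>\<^sup>2 * (1 + Cm) + 2 * (1 + B) * (1 + kap))" by (simp add: algebra_simps)
    finally show ?thesis using c(4) by linarith
  qed
  let ?P = "PiM {..<l} (\<lambda>_. \<rho>)"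
  define b1 where "b1 = {z \<in> space ?P. t \<le> L2_set (\<lambda>j. (\<Sum>i<l. noise_vec fc v m j (z i)) / real l
      - (\<integral>z. noise_vec fc v m j z \<partial>\<rho>)) {..m}}"
  have pb1: "measure ?P b1 \<le> 2 * exp (- 6 * \<tau>)"
  proof -
    have "measure ?P b1 \<le> 2 * exp (real l * (8 * s\<^sup>2 * (\<sigma>\<^sup>2 * (1 + real m) + (1 + W) * dl)) - s * real l * t)"
      unfolding b1_def by (rule noise_concentration[OF vb vW v1 fcb dl F s0 cond1 cond2]) (use l in auto)
    also have "\<dots> \<le> 2 * exp (- 6 * \<tau>)" using lv slt \<tau> by simp
    finally show ?thesis .
  qed
  define s3 where "s3 = c3 * lam / Lg"
  have s30: "s3 > 0" using c3 lam Lg by (simp add: s3_def)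
  have s3W: "2 * s3 * W \<le> 1"
  proof -
    have "2 * s3 * W = (2 * c3 * kap) / Lg" using lam by (simp add: s3_def W_def)
    also have "\<dots> \<le> 1 / 1" using c3 Lg kap by (intro frac_le) auto
    finally show ?thesis by simp
  qed
  define b2 where "b2 = {z \<in> space ?P. 1 / 4 \<le> L2_set (\<lambda>p. (\<Sum>i<l. v (fst p) (fst (z i)) * v (snd p) (fst (z i))) / real l
        - (\<integral>z. v (fst p) (fst z) * v (snd p) (fst z) \<partial>\<rho>)) ({..<m} \<times> {..<m})}"
  have pb2: "measure ?P b2 \<le> 2 * exp (- 6 * \<tau>)"
  proof -
    have "measure ?P b2 \<le> 2 * exp (real l * (4 * s3\<^sup>2 * W * real m) - s3 * real l * (1 / 4))"
      unfolding b2_def by (rule gram_concentration[OF vb vW v1 s30 s3W]) (use l in auto)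
    also have "real l * (4 * s3\<^sup>2 * W * real m) - s3 * real l * (1 / 4) \<le> - 6 * \<tau>"
    proof -
      \<comment> \<open>The exponent is \<open>- c3 / 4 * y\<close> plus a variance term of at most
        half that size. With \<open>y \<ge> A0 * \<tau>\<close> and \<open>A0 * c3 \<ge> 48\<close>
        it is at most \<open>- 6 * \<tau>\<close>.\<close>
      define y where "y = real l * lam / Lg"
      have yA: "y \<ge> A0 * \<tau>" using ll Lg by (simp add: y_def field_simps)
      have y0: "y \<ge> 0" using Lg lam by (simp add: y_def)
      have "real l * (4 * s3\<^sup>2 * W * real m) \<le> real l * (4 * s3\<^sup>2 * W * (Cm * Lg))"
        using m W0 by (intro mult_left_mono) auto
      also have "\<dots> = (c3 / 8) * (32 * c3 * kap * Cm) * y"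
        using lam Lg by (simp add: s3_def W_def y_def power2_eq_square field_simps)
      also have "\<dots> \<le> (c3 / 8) * 1 * y" using c3 y0 by (intro mult_right_mono mult_left_mono) auto
      finally have 1: "real l * (4 * s3\<^sup>2 * W * real m) \<le> c3 / 8 * y" by simp
      have 2: "s3 * real l * (1 / 4) = c3 / 4 * y" by (simp add: s3_def y_def mult_ac)
      have "48 * \<tau> \<le> A0 * c3 * \<tau>" using A0 \<tau> by (intro mult_right_mono) auto
      also have "\<dots> = c3 * (A0 * \<tau>)" by simp
      also have "\<dots> \<le> c3 * y" using yA c3 by (intro mult_left_mono) auto
      finally have "6 * \<tau> \<le> c3 / 8 * y" by simp
      moreover have "c3 / 4 * y = 2 * (c3 / 8 * y)" by simp
      ultimately show ?thesis using 1 2 by linarith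
    qed
    finally show ?thesis by simp
  qed
  \<comment> \<open>The representer theorem applies to samples inside \<open>I_set\<close>; this is
    an almost sure event.\<close>
  define good where "good = {z \<in> space ?P. \<forall>i\<in>{..<l}. fst (z i) \<in> I_set}"
  have cm: "(\<lambda>z. z i) \<in> ?P \<rightarrow>\<^sub>M \<rho>" if "i < l" for i
    using that by (intro measurable_component_singleton) auto
  have good_sets: "good \<in> sets ?P"
  proof -
    have h: "{z \<in> space ?P. fst (z i) \<in> I_set} \<in> sets ?P" if i: "i < l" for i
      using measurable_sets[OF measurable_compose[OF cm[OF i] measurable_fst_rho] sets_I_set]
      by (simp add: vimage_def Int_def conj_commute)
    show ?thesis unfolding good_def
    proof (rule sets.sets_Collect_finite_All)
      show "{z \<in> space ?P. fst (z i) \<in> I_set} \<in> sets ?P" if "i \<in> {..<l}" for i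
        by (rule h) (use that in simp)
    qed simp
  qed
  have good1: "measure ?P good = 1"
  proof -
    have "AE z in ?P. \<forall>i\<in>{..<l}. fst (z i) \<in> I_set"
      by (intro AE_finite_allI AE_PiM_component prob AE_nu[OF S]) auto
    thus ?thesis using good_sets unfolding good_def by (subst PP.prob_Collect_eq_1)
  qed
  have b1s: "b1 \<in> sets ?P"
  proof -
    have [measurable]: "(\<lambda>z. noise_vec fc v m j (z i)) \<in> borel_measurable ?P" if "i < l" for i j
      by (rule measurable_compose[OF cm[OF that] measurable_noise_vec[OF vb fcb]])
    show ?thesis unfolding b1_def by measurable
  qed
  have b2s: "b2 \<in> sets ?P"
  proof -
    have vm: "(\<lambda>z. v j (fst (z i))) \<in> borel_measurable ?P" if "i < l" "j < m" for i j
      by (rule measurable_compose[OF cm[OF that(1)] bfun_measurable[OF bfun_fst[OF vb[OF that(2)]]]])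
    have [measurable]: "(\<lambda>z. v (fst p) (fst (z i)) * v (snd p) (fst (z i))) \<in> borel_measurable ?P"
      if "i < l" "p \<in> {..<m} \<times> {..<m}" for i p
      using that by (intro borel_measurable_times vm) auto
    show ?thesis unfolding b2_def by measurable
  qed
  define E where "E = good - (b1 \<union> b2)"
  have "measure ?P E \<ge> 1 - exp (- 4 * \<tau>)"
  proof -
    have "1 = measure ?P good" using good1 by simp
    also have "\<dots> \<le> measure ?P (E \<union> (b1 \<union> b2))"
      unfolding E_def using good_sets b1s b2s by (intro PP.finite_measure_mono) auto
    also have "\<dots> \<le> measure ?P E + measure ?P (b1 \<union> b2)"
      unfolding E_def using good_sets b1s b2s by (intro measure_Un_le) auto
    also have "\<dots> \<le> measure ?P E + (measure ?P b1 + measure ?P b2)"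
      using b1s b2s by (intro add_left_mono measure_Un_le) auto
    also have "\<dots> \<le> measure ?P E + 4 * exp (- 6 * \<tau>)" using pb1 pb2 by simp
    also have "4 * exp (- 6 * \<tau>) \<le> exp (- 4 * \<tau>)"
    proof -
      have "1 \<le> \<tau>\<^sup>2" using \<tau> by (rule one_le_power)
      moreover have "1 + 2 * \<tau> + 2 * \<tau>\<^sup>2 \<le> exp (2 * \<tau>)"
        using exp_lower_Taylor_quadratic[of "2 * \<tau>"] \<tau> by (simp add: power_mult_distrib)
      ultimately have "4 \<le> exp (2 * \<tau>)" using \<tau> by linarith
      from mult_right_mono[OF this, of "exp (- 6 * \<tau>)"] show ?thesis by (simp flip: exp_add)
    qed
    finally show ?thesis by simp
  qed
  moreover have "E \<in> sets ?P" unfolding E_def using good_sets b1s b2s by auto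
  moreover have "E \<subseteq> {z \<in> space ?P. err \<rho> \<kappa> (sample_est K I_set l z lam) \<le> ennreal
      ((32 * (C1 + sqrt (2 * (1 + B)) + sqrt B)\<^sup>2 + 16 * (2 + \<sigma>\<^sup>2 + 2 * (1 + B) + 2 * C1 + sqrt B)\<^sup>2 + 4 * (1 + B))
        * \<tau>\<^sup>2 * (lam powr \<beta> + Lg / real l))}"
  proof
    fix z assume z: "z \<in> E"
    have zg: "z \<in> good" "z \<notin> b1" "z \<notin> b2" using z by (simp_all add: E_def)
    have zsp: "z \<in> space ?P" and zS: "\<And>i. i < l \<Longrightarrow> fst (z i) \<in> I_set"
      and z1: "L2_set (\<lambda>j. (\<Sum>i<l. noise_vec fc v m j (z i)) / real l - (\<integral>z. noise_vec fc v m j z \<partial>\<rho>)) {..m} \<le> t"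
      and z2: "L2_set (\<lambda>p. (\<Sum>i<l. v (fst p) (fst (z i)) * v (snd p) (fst (z i))) / real l
        - (\<integral>z. v (fst p) (fst z) * v (snd p) (fst z) \<partial>\<rho>)) ({..<m} \<times> {..<m}) \<le> 1 / 4"
      using zg unfolding good_def b1_def b2_def mem_Collect_eq Ball_def lessThan_iff
      by (blast, blast, meson linear, meson linear)
    define U where "U = sqrt B * sqrt (lam powr \<beta>)"
    have U: "lam\<^sup>2 * (\<integral>x. (u x)\<^sup>2 \<partial>\<nu>) \<le> U\<^sup>2" "0 \<le> U"
      using u(3) B by (simp_all add: U_def power_mult_distrib)
    \<comment> \<open>Both \<open>lam\<close> and \<open>R\<^sup>2\<close> are at least
      \<open>1 / l\<close>. The cube thus provides one power of \<open>l\<close> for each of them in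
      the second claim, with one to spare; in the first claim the two spare powers give the factor
      2.\<close>
    have e3: "1 / real l ^ 3 \<le> lam / 2" and e4: "1 / real l ^ 3 / lam \<le> R\<^sup>2"
    proof -
      have l2: "2 \<le> real l ^ 2" using l power_mono[of 3 "real l" 2] by simp
      have "2 \<le> real l ^ 2 * (real l * lam)" using mult_mono[OF l2 ll1] by simp
      thus "1 / real l ^ 3 \<le> lam / 2" using l0 by (simp add: field_simps power2_eq_square power3_eq_cube)
      have "1 \<le> (R\<^sup>2 * real l) * (real l * lam)" using mult_mono[OF R2l ll1] by simp
      also have "\<dots> \<le> (R\<^sup>2 * real l) * (real l * lam) * real l"
      proof -
        have "0 \<le> (R\<^sup>2 * real l) * (real l * lam)" using l0 lam by (intro mult_nonneg_nonneg) auto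
        from mult_left_mono[OF _ this, of 1 "real l"] show ?thesis using l by simp
      qed
      finally show "1 / real l ^ 3 / lam \<le> R\<^sup>2" using l0 lam by (simp add: field_simps power2_eq_square power3_eq_cube)
    qed
    define A where "A = 2 + \<sigma>\<^sup>2 + 2 * (1 + B)"
    have A: "(\<integral>z. \<bar>snd z - fc (fst z)\<bar> \<partial>\<rho>) \<le> A"
    proof -
      have "dl \<le> 2 * (1 + B)" using mult_left_mono[OF lb1, of "2 * (1 + B)"] B by (simp add: dl_def)
      thus ?thesis using mean_abs_residual[OF fcb dl] by (simp add: A_def)
    qed
    have bound: "err \<rho> \<kappa> (sample_est K I_set l z lam)
        \<le> ennreal (32 * (t + sqrt dl + U)\<^sup>2 + 16 * (1 / real l ^ 3 / lam * (A + t + U)\<^sup>2) + 2 * dl)"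
      using deterministic_bound[where K = K and \<eta> = \<eta> and v = v and m = m and z = z and u = u and U = U and l = l and A = A and t = t,
          OF H[unfolded H_def] eta tail[unfolded H_def] eps[unfolded H_def] e3 lam(1) vb vrep u(1)
          dl[unfolded fc_def H_def] U _ zS z2 z1[unfolded fc_def H_def] A[unfolded fc_def H_def]] l by simp
    have "0 < c * C1" using C1 by linarith
    hence C10: "C1 > 0" using c(1) by (simp add: zero_less_mult_iff)
    have sq1: "sqrt (lam powr \<beta>) \<le> R" unfolding R_def using Lg l0 by (intro real_sqrt_le_mono) simp
    have Ule: "U \<le> sqrt B * R" unfolding U_def by (intro mult_left_mono sq1) (use B in auto)
    have dle: "sqrt dl \<le> sqrt (2 * (1 + B)) * R"
      unfolding dl_def real_sqrt_mult[of "2 * (1 + B)"] by (intro mult_left_mono sq1) (use B in auto)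
    have t1: "R \<le> \<tau> * R" using \<tau> Rpos by simp
    have f1: "t + sqrt dl + U \<le> (C1 + sqrt (2 * (1 + B)) + sqrt B) * (\<tau> * R)"
    proof -
      have "sqrt dl \<le> sqrt (2 * (1 + B)) * (\<tau> * R)" by (rule order_trans[OF dle mult_left_mono[OF t1]]) (use B in simp)
      moreover have "U \<le> sqrt B * (\<tau> * R)" by (rule order_trans[OF Ule mult_left_mono[OF t1]]) (use B in simp)
      ultimately show ?thesis unfolding t_def distrib_right by simp
    qed
    have f2: "A + t + U \<le> (A + 2 * C1 + sqrt B) * \<tau>"
    proof -
      have A0': "A \<ge> 0" using B by (simp add: A_def)
      have "A \<le> A * \<tau>" using A0' \<tau> by (simp add: mult_le_cancel_left1)
      moreover have "t \<le> 2 * C1 * \<tau>" using Rle C10 \<tau> mult_left_mono[OF Rle, of "C1 * \<tau>"] by (simp add: t_def)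
      moreover have "U \<le> sqrt B * \<tau>"
      proof -
        have "sqrt (lam powr \<beta>) \<le> \<tau>" using lb1 \<tau> by (meson order_trans real_sqrt_le_1_iff)
        thus ?thesis unfolding U_def by (intro mult_left_mono) (use B in auto)
      qed
      ultimately show ?thesis by (simp add: distrib_right)
    qed
    have t0: "t \<ge> 0" using C10 \<tau> Rpos by (simp add: t_def)
    have g1: "(t + sqrt dl + U)\<^sup>2 \<le> (C1 + sqrt (2 * (1 + B)) + sqrt B)\<^sup>2 * (\<tau>\<^sup>2 * R\<^sup>2)"
      using power_mono[OF f1, of 2] t0 U(2) dl(2) by (simp add: power_mult_distrib)
    have g2: "1 / real l ^ 3 / lam * (A + t + U)\<^sup>2 \<le> (A + 2 * C1 + sqrt B)\<^sup>2 * (\<tau>\<^sup>2 * R\<^sup>2)"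
    proof -
      have "(A + t + U)\<^sup>2 \<le> ((A + 2 * C1 + sqrt B) * \<tau>)\<^sup>2"
        using f2 t0 U(2) B by (intro power_mono) (auto simp: A_def)
      hence "1 / real l ^ 3 / lam * (A + t + U)\<^sup>2 \<le> R\<^sup>2 * ((A + 2 * C1 + sqrt B) * \<tau>)\<^sup>2"
        using e4 lam by (intro mult_mono) auto
      thus ?thesis by (simp add: power_mult_distrib mult_ac)
    qed
    have g3: "dl \<le> 2 * (1 + B) * (\<tau>\<^sup>2 * R\<^sup>2)"
    proof -
      have "1 * lam powr \<beta> \<le> \<tau>\<^sup>2 * R\<^sup>2" using R2a \<tau> one_le_power[OF \<tau>, of 2] by (intro mult_mono) auto
      thus ?thesis unfolding dl_def using B by (intro mult_left_mono) auto
    qed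
    have "32 * (t + sqrt dl + U)\<^sup>2 + 16 * (1 / real l ^ 3 / lam * (A + t + U)\<^sup>2) + 2 * dl
        \<le> 32 * ((C1 + sqrt (2 * (1 + B)) + sqrt B)\<^sup>2 * (\<tau>\<^sup>2 * R\<^sup>2)) + 16 * ((A + 2 * C1 + sqrt B)\<^sup>2 * (\<tau>\<^sup>2 * R\<^sup>2))
          + 2 * (2 * (1 + B) * (\<tau>\<^sup>2 * R\<^sup>2))"
      by (intro add_mono mult_left_mono g1 g2 g3) auto
    also have "\<dots> = (32 * (C1 + sqrt (2 * (1 + B)) + sqrt B)\<^sup>2 + 16 * (A + 2 * C1 + sqrt B)\<^sup>2 + 4 * (1 + B)) * \<tau>\<^sup>2 * R\<^sup>2"
      by (simp add: distrib_right mult.assoc)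
    finally show "z \<in> {z \<in> space ?P. err \<rho> \<kappa> (sample_est K I_set l z lam) \<le> ennreal
      ((32 * (C1 + sqrt (2 * (1 + B)) + sqrt B)\<^sup>2 + 16 * (2 + \<sigma>\<^sup>2 + 2 * (1 + B) + 2 * C1 + sqrt B)\<^sup>2 + 4 * (1 + B))
        * \<tau>\<^sup>2 * (lam powr \<beta> + Lg / real l))}"
      using bound zsp unfolding R2 A_def by (auto intro: order_trans ennreal_leI)
  qed
  ultimately show ?thesis unfolding prob_at_least_def by blast
qed

end

section \<open>Fixing the constants and choosing \<open>lam\<close>\<close>

lemma core_constants:
  fixes kap Cm X1 X2 X3 :: real
  assumes "kap > 0" "Cm > 0" "X1 \<ge> 0" "X2 \<ge> 0" "X3 \<ge> 0"
  shows "\<exists>c3 A0 c C1. c3 > 0 \<and> 32 * c3 * kap * Cm \<le> 1 \<and> 2 * c3 * kap \<le> 1 \<and> A0 \<ge> 1 \<and> A0 * c3 \<ge> 48 \<and>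
    c > 0 \<and> c * X1 \<le> 1 \<and> c\<^sup>2 * X2 \<le> 1 \<and> c\<^sup>2 * X3 \<le> 1 \<and> c * C1 \<ge> 7"
proof -
  \<comment> \<open>The reciprocal of a sum of positive quantities meets the upper bound for each of
    them at once; \<open>c\<close> below is found in the same way, and \<open>A0\<close> and
    \<open>C1\<close> then compensate by being large.\<close>
  define c3 where "c3 = 1 / (32 * kap * Cm + 2 * kap)"
  have c3: "c3 > 0" using assms by (simp add: c3_def add_pos_pos)
  have c3m: "c3 * (32 * kap * Cm + 2 * kap) = 1" using assms by (simp add: c3_def add_pos_pos less_imp_neq[symmetric])
  have a: "0 < c3 * (32 * kap * Cm)" "0 < c3 * (2 * kap)" using assms c3 by auto
  have b: "32 * c3 * kap * Cm \<le> 1" "2 * c3 * kap \<le> 1" using a c3m by (simp_all add: algebra_simps)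
  define A0 where "A0 = max 1 (48 / c3)"
  have A0: "A0 \<ge> 1" "A0 * c3 \<ge> 48"
  proof -
    have "48 / c3 * c3 \<le> A0 * c3" using c3 by (intro mult_right_mono) (auto simp: A0_def)
    thus "A0 * c3 \<ge> 48" using c3 by simp
  qed (simp add: A0_def)
  define c where "c = 1 / (1 + X1 + X2 + X3)"
  have c: "c > 0" using assms by (simp add: c_def)
  have cm: "c * (1 + X1 + X2 + X3) = 1" using assms by (simp add: c_def)
  have cX: "0 \<le> c * X1" "0 \<le> c * X2" "0 \<le> c * X3" using assms c by auto
  have c1: "c \<le> 1" "c * X1 \<le> 1" "c * X2 \<le> 1" "c * X3 \<le> 1" using cm cX c by (simp_all add: distrib_left)
  have c2: "c\<^sup>2 * X2 \<le> 1" "c\<^sup>2 * X3 \<le> 1"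
    using mult_mono[OF c1(1) c1(3)] mult_mono[OF c1(1) c1(4)] cX c by (simp_all add: power2_eq_square mult.assoc)
  show ?thesis
    by (rule exI[of _ c3], rule exI[of _ A0], rule exI[of _ c], rule exI[of _ "7 / c"])
      (use c3 b A0 c c1 c2 in auto)
qed

text \<open>The conditions that \<open>core_bound\<close> puts on its constants are free of
  \<open>\<beta>\<close>, so the constants can be chosen before \<open>\<beta>\<close> and the
  law.\<close>

lemma learning_rate:
  fixes f1 :: "real \<Rightarrow> real" and b :: "nat \<Rightarrow> real" and r c1 :: real
    and fs :: "nat \<Rightarrow> real \<Rightarrow> real" and N :: nat and p :: "real poly"
    and B Binf L \<sigma> \<omega> :: real
  defines "dd \<equiv> (CARD('d::finite) - 1) * min (degree p) CARD('n::finite)"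
  assumes r: "0 < r" "r < 1"
    and b: "\<And>m. 0 \<le> b m \<and> b m \<le> c1 * r ^ m"
    and f1: "\<forall>t\<in>{-1..1}. (\<lambda>m. b m * t ^ m) sums f1 t"
    and comp: "compose_fs fs N = poly p"
    and p: "\<And>i. coeff p i \<ge> 0" "degree p \<ge> 1"
    and cst: "B > 0" "Binf > 0" "L > 0" "\<sigma> > 0"
  shows "\<exists>A0\<ge>1. \<exists>C0>0. \<forall>\<beta> (\<rho> :: (('n \<Rightarrow> real^'d) \<times> real) measure) \<kappa> \<tau> l lam.
    0 < \<beta> \<longrightarrow> \<beta> \<le> 2 \<longrightarrow> in_G B Binf L \<sigma> \<omega> \<beta> (kerN f1 fs N) \<rho> \<kappa> \<longrightarrow> \<tau> \<ge> 1 \<longrightarrow> l \<ge> 3 \<longrightarrow>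
    0 < lam \<longrightarrow> lam \<le> 1 \<longrightarrow> real l * lam \<ge> A0 * \<tau> * ln (real l) ^ dd \<longrightarrow>
    prob_at_least (PiM {..<l} (\<lambda>_. \<rho>))
      (\<lambda>z. err \<rho> \<kappa> (sample_est (kerN f1 fs N) I_set l z lam)
        \<le> ennreal (C0 * \<tau>\<^sup>2 * (lam powr \<beta> + ln (real l) ^ dd / real l)))
      (1 - exp (- 4 * \<tau>))"
proof -
  define K :: "('n \<Rightarrow> real^'d) \<Rightarrow> ('n \<Rightarrow> real^'d) \<Rightarrow> real" where "K = kerN f1 fs N"
  have "\<exists>kap>0. \<exists>Cm>0. \<exists>Ct>0. \<forall>\<mu>. sets \<mu> = sets (I_meas :: ('n \<Rightarrow> real^'d) measure) \<longrightarrow>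
    lim_kernel \<mu> (cut_off I_set K) \<and> (\<forall>x. cut_off I_set K x x \<le> kap) \<and>
    (\<forall>M. \<exists>m \<eta>. real m \<le> Cm * real (M + 1) ^ dd \<and> (\<forall>a<m. \<eta> a \<in> bfun \<mu>) \<and>
      lim_kernel \<mu> (\<lambda>x y. cut_off I_set K x y - (\<Sum>a<m. \<eta> a x * \<eta> a y)) \<and>
      (\<forall>x. cut_off I_set K x x - (\<Sum>a<m. \<eta> a x * \<eta> a x) \<le> Ct * r ^ M))"
    unfolding K_def dd_def by (rule kernel_decomposition[OF r b f1 comp p])
  then obtain kap Cm Ct where kap: "kap > 0" and Cm: "Cm > 0" and Ct: "Ct > 0" and
    dec: "\<forall>\<mu>. sets \<mu> = sets (I_meas :: ('n \<Rightarrow> real^'d) measure) \<longrightarrow>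
    lim_kernel \<mu> (cut_off I_set K) \<and> (\<forall>x. cut_off I_set K x x \<le> kap) \<and>
    (\<forall>M. \<exists>m \<eta>. real m \<le> Cm * real (M + 1) ^ dd \<and> (\<forall>a<m. \<eta> a \<in> bfun \<mu>) \<and>
      lim_kernel \<mu> (\<lambda>x y. cut_off I_set K x y - (\<Sum>a<m. \<eta> a x * \<eta> a y)) \<and>
      (\<forall>x. cut_off I_set K x x - (\<Sum>a<m. \<eta> a x * \<eta> a x) \<le> Ct * r ^ M))"
    by (elim exE conjE)
  define q where "q = - ln r"
  have q: "q > 0" using r by (simp add: q_def)
  \<comment> \<open>Chosen for \<open>M + 1 \<le> CM * ln l\<close>: the fraction comes from the
    real truncation order, the 2 from rounding up and from the added 1, all scaled by
    \<open>ln l \<ge> 1\<close>.\<close>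
  define CM where "CM = (3 + \<bar>ln Ct\<bar>) / q + 2"
  have CM: "CM > 0" using q by (simp add: CM_def add_nonneg_pos)
  define Cm' where "Cm' = Cm * CM ^ dd"
  have Cm': "Cm' > 0" using Cm CM by (simp add: Cm'_def)
  define F0 where "F0 = 2 * kap * B * (1 + kap) + 2 * Binf"
  have F0: "F0 \<ge> 0" using kap cst by (simp add: F0_def)
  define X1 X2 X3 where "X1 = 8 * sqrt (1 + kap) * L" and "X2 = 32 * (1 + kap) * F0"
    and "X3 = 8 * (\<sigma>\<^sup>2 * (1 + Cm') + 2 * (1 + B) * (1 + kap))"
  have "X1 \<ge> 0" "X2 \<ge> 0" "X3 \<ge> 0" using kap cst F0 Cm' by (simp_all add: X1_def X2_def X3_def)
  from core_constants[OF kap Cm' this] obtain c3 A0 c C1 where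
    c3: "c3 > 0" "32 * c3 * kap * Cm' \<le> 1" "2 * c3 * kap \<le> 1" and A0: "A0 \<ge> 1" "A0 * c3 \<ge> 48" and
    c: "c > 0" "c * X1 \<le> 1" "c\<^sup>2 * X2 \<le> 1" "c\<^sup>2 * X3 \<le> 1" and C1: "c * C1 \<ge> 7" by blast
  have c': "8 * c * sqrt (1 + kap) * L \<le> 1" "32 * c\<^sup>2 * (1 + kap) * F0 \<le> 1"
    "8 * c\<^sup>2 * (\<sigma>\<^sup>2 * (1 + Cm') + 2 * (1 + B) * (1 + kap)) \<le> 1"
    using c(2-4) by (simp_all add: X1_def X2_def X3_def algebra_simps)
  define C0 where "C0 = 32 * (C1 + sqrt (2 * (1 + B)) + sqrt B)\<^sup>2 + 16 * (2 + \<sigma>\<^sup>2 + 2 * (1 + B) + 2 * C1 + sqrt B)\<^sup>2 + 4 * (1 + B)"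
  have C0: "C0 > 0" using cst by (simp add: C0_def add_nonneg_pos)
  have main: "prob_at_least (PiM {..<l} (\<lambda>_. \<rho>))
      (\<lambda>z. err \<rho> \<kappa> (sample_est K I_set l z lam) \<le> ennreal (C0 * \<tau>\<^sup>2 * (lam powr \<beta> + ln (real l) ^ dd / real l)))
      (1 - exp (- 4 * \<tau>))"
    if \<beta>: "0 < \<beta>" "\<beta> \<le> 2" and G: "in_G B Binf L \<sigma> \<omega> \<beta> K \<rho> \<kappa>" and \<tau>: "\<tau> \<ge> 1" and l: "l \<ge> 3"
      and lam: "0 < lam" "lam \<le> 1" and ll: "real l * lam \<ge> A0 * \<tau> * ln (real l) ^ dd"
    for \<beta> \<tau> lam l and \<rho> :: "(('n \<Rightarrow> real^'d) \<times> real) measure" and \<kappa>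
  proof -
    note G' = G[unfolded in_G_def]
    interpret regression_model \<rho> \<kappa> \<sigma> L Binf
    proof (rule regression_model.intro)
      show "prob_space \<rho>" using G' by (elim conjE)
      show "sets \<rho> = sets (I_meas \<Otimes>\<^sub>M (borel :: real measure))" using G' by (elim conjE)
      show "integrable \<rho> (\<lambda>z. (snd z)\<^sup>2)" using G' by (elim conjE)
      show "cond_kernel \<rho> \<kappa>" using G' by (elim conjE)
      show "AE x in marg \<rho>. (regr \<kappa> x)\<^sup>2 \<le> Binf" using G' by (elim conjE)
      have "\<forall>m::nat. m \<ge> 2 \<longrightarrow> (AE x in marg \<rho>.
          (\<integral>\<^sup>+y. ennreal (\<bar>y - regr \<kappa> x\<bar>^m) \<partial>\<kappa> x) \<le> ennreal (fact m * \<sigma>^2 * L^(m-2) / 2))"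
        using G' by (elim conjE)
      thus "AE x in marg \<rho>. (\<integral>\<^sup>+y. ennreal (\<bar>y - regr \<kappa> x\<bar>^m) \<partial>\<kappa> x) \<le> ennreal (fact m * \<sigma>^2 * L^(m-2) / 2)"
        if "m \<ge> 2" for m :: nat using that by blast
    qed (rule cst)
    obtain g where g: "L2_mem (marg \<rho>) g" "(\<integral>x. (g x)\<^sup>2 \<partial>marg \<rho>) \<le> B"
      "is_op_power (marg \<rho>) (T_op K (marg \<rho>)) (\<beta> / 2) g (regr \<kappa>)" using G' by (elim conjE exE)
    have W: "W_omega \<omega> (marg \<rho>)" using G' by (elim conjE)
    have ln1: "ln (real l) \<ge> 1"
    proof -
      have "exp 1 \<le> real l" using exp_le l by linarith
      thus ?thesis using l by (subst ln_ge_iff) auto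
    qed
    note dec' = dec[rule_format, OF sets_nu]
    \<comment> \<open>The real order at which the power of \<open>r\<close> equals
      \<open>l ^ (-3)\<close> times \<open>exp (- \<bar>ln Ct\<bar>)\<close>; the second factor
      outweighs \<open>Ct\<close>.\<close>
    define x where "x = (3 * ln (real l) + \<bar>ln Ct\<bar>) / q"
    have x0: "x \<ge> 0" using ln1 q by (simp add: x_def)
    define M where "M = nat \<lceil>x\<rceil>"
    have Mx: "real M \<ge> x" "real M \<le> x + 1" unfolding M_def using x0 by linarith+
    obtain m \<eta> where m: "real m \<le> Cm * real (M + 1) ^ dd" and eta: "\<forall>a<m. \<eta> a \<in> bfun (marg \<rho>)" and
      tail: "lim_kernel (marg \<rho>) (\<lambda>x y. cut_off I_set K x y - (\<Sum>a<m. \<eta> a x * \<eta> a y))" and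
      eps: "\<forall>x. cut_off I_set K x x - (\<Sum>a<m. \<eta> a x * \<eta> a x) \<le> Ct * r ^ M"
      using dec' by blast
    have e: "Ct * r ^ M \<le> 1 / real l ^ 3"
    proof -
      have "r ^ M = exp (real M * ln r)" using r by (simp add: exp_of_nat_mult)
      also have "real M * ln r \<le> x * ln r" using Mx(1) r by (intro mult_right_mono_neg) auto
      also have "x * ln r = - (3 * ln (real l) + \<bar>ln Ct\<bar>)" using q by (simp add: x_def q_def)
      finally have "r ^ M \<le> exp (- (3 * ln (real l) + \<bar>ln Ct\<bar>))" by simp
      hence "Ct * r ^ M \<le> exp \<bar>ln Ct\<bar> * exp (- (3 * ln (real l) + \<bar>ln Ct\<bar>))"
        using Ct r by (intro mult_mono) (auto simp: ln_ge_iff[symmetric] exp_ln[symmetric] simp del: exp_ln intro: order_trans[OF eq_refl[OF exp_ln[symmetric]]])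
      also have "\<dots> = exp (- (3 * ln (real l)))" by (simp flip: exp_add)
      also have "\<dots> = 1 / exp (ln (real l)) ^ 3" by (simp add: exp_minus exp_of_nat_mult[symmetric] divide_inverse)
      also have "\<dots> = 1 / real l ^ 3" using l by simp
      finally show ?thesis .
    qed
    have mle: "real m \<le> Cm' * ln (real l) ^ dd"
    proof -
      have "real (M + 1) \<le> x + 2" using Mx(2) by simp
      also have "\<dots> \<le> CM * ln (real l)"
      proof -
        have "\<bar>ln Ct\<bar> \<le> \<bar>ln Ct\<bar> * ln (real l)" using mult_left_mono[OF ln1, of "\<bar>ln Ct\<bar>"] by simp
        hence "3 * ln (real l) + \<bar>ln Ct\<bar> \<le> (3 + \<bar>ln Ct\<bar>) * ln (real l)" by (simp add: distrib_right)
        hence "x \<le> (3 + \<bar>ln Ct\<bar>) * ln (real l) / q" unfolding x_def using q by (intro divide_right_mono) auto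
        moreover have "2 \<le> 2 * ln (real l)" using ln1 by simp
        ultimately show ?thesis by (simp add: CM_def distrib_right)
      qed
      finally have "real (M + 1) ^ dd \<le> (CM * ln (real l)) ^ dd" by (intro power_mono) auto
      hence "Cm * real (M + 1) ^ dd \<le> Cm * (CM * ln (real l)) ^ dd" using Cm by (intro mult_left_mono) auto
      thus ?thesis using m by (simp add: Cm'_def power_mult_distrib mult.assoc)
    qed
    show ?thesis unfolding C0_def
    proof (rule core_bound[where m = m and \<eta> = \<eta> and kap = kap and Cm = Cm' and c = c and ?c3.0 = c3 and ?A0.0 = A0 and ?F0.0 = F0 and ?C1.0 = C1 and g = g])
      show "AE x in marg \<rho>. x \<in> I_set" by (rule W_omega_AE_I_set[OF W])
      show "cut_off I_set K x x - (\<Sum>a<m. \<eta> a x * \<eta> a x) \<le> 1 / real l ^ 3" for x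
        using eps e by (meson order_trans)
      show "ln (real l) ^ dd \<ge> 1" using ln1 by (rule one_le_power)
    qed (use dec' kap eta tail mle Cm' g \<beta> lam l \<tau> F0_def c3 A0 c(1) c' C1 ll cst in auto)
  qed
  show ?thesis
    by (rule exI[of _ A0], rule conjI[OF A0(1)], rule exI[of _ C0], rule conjI[OF C0], intro allI impI)
      (unfold K_def[symmetric], rule main)
qed

lemma prob_at_least_mono:
  assumes "prob_at_least M P q" "\<And>z. P z \<Longrightarrow> Q z" shows "prob_at_least M Q q"
  using assms unfolding prob_at_least_def by blast

theorem mainTheorem6:
  fixes f1 :: "real \<Rightarrow> real" and b :: "nat \<Rightarrow> real" and r c1 :: real
    and fs :: "nat \<Rightarrow> real \<Rightarrow> real" and N D :: nat and p :: "real poly"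
    and B Binf L \<sigma> \<omega> :: real
  assumes d2: "CARD('d::finite) \<ge> 2"
    and N2: "N \<ge> 2"
    and r: "0 < r" "r < 1" and c1: "c1 > 0"
    and b: "\<forall>m. 0 \<le> b m \<and> b m \<le> c1 * r ^ m"
    and f1: "\<forall>t\<in>{-1..1}. (\<lambda>m. b m * t ^ m) sums f1 t"
    and comp: "compose_fs fs N = poly p"
    and pcoeff: "\<forall>i. coeff p i \<ge> 0" and pdeg: "degree p = D" and D1: "D \<ge> 1"
    and cst: "B > 0" "Binf > 0" "L > 0" "\<sigma> > 0"
    and om: "\<omega> \<ge> 1"
  shows "\<exists>A>0. \<exists>C>0. \<forall>\<beta>. 0 < \<beta> \<and> \<beta> \<le> 2 \<longrightarrow>
    (\<forall>(\<rho> :: (('n::finite \<Rightarrow> real^'d) \<times> real) measure) \<kappa>.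
       in_G B Binf L \<sigma> \<omega> \<beta> (kerN f1 fs N) \<rho> \<kappa> \<longrightarrow>
    (\<forall>\<tau>::real. \<tau> \<ge> 1 \<longrightarrow>
      (let dd = real ((CARD('d) - 1) * min D CARD('n)) in
      (\<beta> > 1 \<longrightarrow> (\<forall>l::nat.
         real l \<ge> max (exp \<beta>) ((A / \<beta> powr dd) powr (\<beta> / (\<beta> - 1)) * \<tau> powr (2 * \<beta> / (\<beta> - 1))
                     * ln (real l) powr (dd * \<beta> / (\<beta> - 1))) \<longrightarrow>
         prob_at_least (PiM {..<l} (\<lambda>_. \<rho>))
           (\<lambda>z. err \<rho> \<kappa> (sample_est (kerN f1 fs N) I_set l z (real l powr (-1 / \<beta>)))
                  \<le> ennreal (3 * C * \<tau>^2 * ln (real l) powr dd / real l))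
           (1 - exp (-4 * \<tau>)))) \<and>
      (\<beta> = 1 \<longrightarrow> (\<forall>\<mu>::real. \<mu> > dd \<longrightarrow> (\<forall>l::nat.
         real l \<ge> max (exp ((A * \<tau>) powr (1 / (\<mu> - dd)))) (exp 1 * ln (real l) powr \<mu>) \<longrightarrow>
         prob_at_least (PiM {..<l} (\<lambda>_. \<rho>))
           (\<lambda>z. err \<rho> \<kappa> (sample_est (kerN f1 fs N) I_set l z (ln (real l) powr \<mu> / real l))
                  \<le> ennreal (3 * C * \<tau>^2 * ln (real l) powr \<mu> / real l))
           (1 - exp (-4 * \<tau>))))) \<and>
      (\<beta> < 1 \<longrightarrow> (\<forall>l::nat.
         real l \<ge> max (exp ((A * \<tau>) powr (\<beta> / (dd * (1 - \<beta>))))) (exp 1 * ln (real l) powr (dd / \<beta>)) \<longrightarrow>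
         prob_at_least (PiM {..<l} (\<lambda>_. \<rho>))
           (\<lambda>z. err \<rho> \<kappa> (sample_est (kerN f1 fs N) I_set l z (ln (real l) powr (dd / \<beta>) / real l))
                  \<le> ennreal (3 * C * \<tau>^2 * ln (real l) powr dd / real l powr \<beta>))
           (1 - exp (-4 * \<tau>)))))))"
proof -
  define dn where "dn = (CARD('d) - 1) * min D CARD('n)"
  define dd where "dd = real dn"
  have dd1: "dd \<ge> 1"
  proof -
    have "1 \<le> CARD('d) - 1" "1 \<le> min D CARD('n)" using d2 D1 by (auto simp: Suc_le_eq card_gt_0_iff)
    hence "1 * 1 \<le> dn" unfolding dn_def by (intro mult_le_mono)
    thus ?thesis by (simp add: dd_def)
  qed
  have deg: "degree p \<ge> 1" using pdeg D1 by simp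
  from learning_rate[OF r b[rule_format] f1 comp pcoeff[rule_format] deg cst, where 'd = 'd and 'n = 'n and \<omega> = \<omega>, unfolded pdeg, folded dn_def]
  obtain A0 C0 where A0: "A0 \<ge> 1" and C0: "C0 > 0" and
    core: "\<And>\<beta> (\<rho> :: (('n \<Rightarrow> real^'d) \<times> real) measure) \<kappa> \<tau> l lam.
    0 < \<beta> \<Longrightarrow> \<beta> \<le> 2 \<Longrightarrow> in_G B Binf L \<sigma> \<omega> \<beta> (kerN f1 fs N) \<rho> \<kappa> \<Longrightarrow> \<tau> \<ge> 1 \<Longrightarrow> l \<ge> 3 \<Longrightarrow>
    0 < lam \<Longrightarrow> lam \<le> 1 \<Longrightarrow> real l * lam \<ge> A0 * \<tau> * ln (real l) ^ dn \<Longrightarrow>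
    prob_at_least (PiM {..<l} (\<lambda>_. \<rho>))
      (\<lambda>z. err \<rho> \<kappa> (sample_est (kerN f1 fs N) I_set l z lam)
        \<le> ennreal (C0 * \<tau>\<^sup>2 * (lam powr \<beta> + ln (real l) ^ dn / real l)))
      (1 - exp (- 4 * \<tau>))" by blast
  \<comment> \<open>The sample size condition divides \<open>A\<close> by
    \<open>\<beta> powr dd\<close>. As \<open>\<beta> \<le> 2\<close>, the factor
    \<open>2 powr dd\<close> keeps the quotient above \<open>A0\<close> for every
    \<open>\<beta>\<close> in question.\<close>
  define A where "A = A0 * 2 powr dd"
  have A: "A \<ge> A0" "A \<ge> 1"
  proof -
    have "1 \<le> 2 powr dd" using dd1 by (intro ge_one_powr_ge_zero) auto
    thus "A \<ge> A0" unfolding A_def using A0 by (simp add: mult_le_cancel_left1)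
    thus "A \<ge> 1" using A0 by simp
  qed
  have l3: "l \<ge> 3" and lnl: "ln (real l) \<ge> 1" and lnp: "ln (real l) ^ dn = ln (real l) powr dd"
    and lndd: "ln (real l) powr dd \<ge> 1" if "real l \<ge> exp 1" for l
  proof -
    \<comment> \<open>An integer that is at least e exceeds 2, hence is at least 3.\<close>
    have "exp (1::real) \<ge> 5 / 2" using exp_lower_Taylor_quadratic[of 1] by simp
    thus l3: "l \<ge> 3" using that by linarith
    show ln1: "ln (real l) \<ge> 1" using that l3 by (subst ln_ge_iff) auto
    show "ln (real l) ^ dn = ln (real l) powr dd" unfolding dd_def using ln1 by (subst powr_realpow) auto
    show "ln (real l) powr dd \<ge> 1" using ln1 dd1 by (intro ge_one_powr_ge_zero) auto
  qed
  \<comment> \<open>Common end of the three cases: the claimed rate \<open>y / x\<close> has to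
    dominate the bias \<open>lam powr \<beta>\<close> and the variance separately. Numerator and
    denominator are kept apart to match the shape in which the theorem writes its bounds.\<close>
  have conclude: "prob_at_least (PiM {..<l} (\<lambda>_. \<rho>))
      (\<lambda>z. err \<rho> \<kappa> (sample_est (kerN f1 fs N) I_set l z lam) \<le> ennreal (3 * C0 * \<tau>^2 * y / x)) (1 - exp (- 4 * \<tau>))"
    if "0 < \<beta>" "\<beta> \<le> 2" "in_G B Binf L \<sigma> \<omega> \<beta> (kerN f1 fs N) \<rho> \<kappa>" "\<tau> \<ge> 1" "real l \<ge> exp 1"
      "0 < lam" "lam \<le> 1" "real l * lam \<ge> A0 * \<tau> * ln (real l) powr dd"
      and le: "lam powr \<beta> \<le> y / x" "ln (real l) powr dd / real l \<le> y / x"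
    for \<beta> \<tau> lam l x y and \<rho> :: "(('n \<Rightarrow> real^'d) \<times> real) measure" and \<kappa>
  proof (rule prob_at_least_mono[OF core[OF that(1-4) l3[OF that(5)] that(6,7)]])
    show "A0 * \<tau> * ln (real l) ^ dn \<le> real l * lam" using that(8) lnp[OF that(5)] by simp
    fix z assume z: "err \<rho> \<kappa> (sample_est (kerN f1 fs N) I_set l z lam)
        \<le> ennreal (C0 * \<tau>\<^sup>2 * (lam powr \<beta> + ln (real l) ^ dn / real l))"
    have "0 \<le> y / x" using le(1) powr_ge_zero[of lam \<beta>] by linarith
    hence "lam powr \<beta> + ln (real l) ^ dn / real l \<le> 3 * (y / x)"
      using le lnp[OF that(5)] by simp
    hence "C0 * \<tau>\<^sup>2 * (lam powr \<beta> + ln (real l) ^ dn / real l) \<le> C0 * \<tau>\<^sup>2 * (3 * (y / x))"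
      using C0 by (intro mult_left_mono) auto
    also have "\<dots> = 3 * C0 * \<tau>^2 * y / x" by simp
    finally show "err \<rho> \<kappa> (sample_est (kerN f1 fs N) I_set l z lam) \<le> ennreal (3 * C0 * \<tau>^2 * y / x)"
      using z by (meson ennreal_leI order_trans)
  qed
  show ?thesis
  proof (rule exI[of _ A], rule conjI, use A in simp, rule exI[of _ C0], rule conjI[OF C0], intro allI impI,
      unfold Let_def dn_def[symmetric] dd_def[symmetric], intro conjI allI impI)
    fix \<beta> :: real and \<rho> :: "(('n \<Rightarrow> real^'d) \<times> real) measure" and \<kappa> and \<tau> :: real and l :: nat
    assume \<beta>: "0 < \<beta> \<and> \<beta> \<le> 2" and G: "in_G B Binf L \<sigma> \<omega> \<beta> (kerN f1 fs N) \<rho> \<kappa>" and \<tau>: "\<tau> \<ge> 1" and b1: "\<beta> > 1"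
      and l: "max (exp \<beta>) ((A / \<beta> powr dd) powr (\<beta> / (\<beta> - 1)) * \<tau> powr (2 * \<beta> / (\<beta> - 1))
                     * ln (real l) powr (dd * \<beta> / (\<beta> - 1))) \<le> real l"
    have le1: "real l \<ge> exp 1"
    proof -
      have "exp 1 \<le> exp \<beta>" using b1 by simp
      thus ?thesis using l by linarith
    qed
    have l0: "real l > 0" using l3[OF le1] by simp
    \<comment> \<open>Raising the sample size condition to the power
      \<open>(\<beta> - 1) / \<beta>\<close> cancels its exponents and turns the side of
      \<open>l\<close> into \<open>l powr (1 - 1 / \<beta>)\<close>, which is
      \<open>l * lam\<close>.\<close>
    have ex: "\<beta> / (\<beta> - 1) * ((\<beta> - 1) / \<beta>) = 1" "2 * \<beta> / (\<beta> - 1) * ((\<beta> - 1) / \<beta>) = 2"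
      "dd * \<beta> / (\<beta> - 1) * ((\<beta> - 1) / \<beta>) = dd" using b1 by (simp_all add: field_simps)
    define Q where "Q = A / \<beta> powr dd"
    have Q: "Q \<ge> A0"
    proof -
      have "\<beta> powr dd \<le> 2 powr dd" using \<beta> dd1 by (intro powr_mono2) auto
      hence "A0 * \<beta> powr dd \<le> A" unfolding A_def using A0 by (intro mult_left_mono) auto
      thus ?thesis unfolding Q_def using \<beta> by (simp add: field_simps)
    qed
    have Q0: "Q > 0" using Q A0 by linarith
    have "(Q powr (\<beta> / (\<beta> - 1)) * \<tau> powr (2 * \<beta> / (\<beta> - 1)) * ln (real l) powr (dd * \<beta> / (\<beta> - 1))) powr ((\<beta> - 1) / \<beta>)
        \<le> real l powr ((\<beta> - 1) / \<beta>)"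
      using l b1 unfolding Q_def[symmetric] by (intro powr_mono2) auto
    also have "(Q powr (\<beta> / (\<beta> - 1)) * \<tau> powr (2 * \<beta> / (\<beta> - 1)) * ln (real l) powr (dd * \<beta> / (\<beta> - 1))) powr ((\<beta> - 1) / \<beta>)
        = Q * \<tau>\<^sup>2 * ln (real l) powr dd"
    proof -
      have "\<tau> powr 2 = \<tau>\<^sup>2" using \<tau> by (simp add: powr_numeral)
      thus ?thesis using Q0 b1 by (simp add: powr_mult powr_powr ex)
    qed
    finally have key: "Q * \<tau>\<^sup>2 * ln (real l) powr dd \<le> real l powr ((\<beta> - 1) / \<beta>)" .
    have llam: "real l * real l powr (-1 / \<beta>) = real l powr ((\<beta> - 1) / \<beta>)"
    proof -
      have e: "(\<beta> - 1) / \<beta> = 1 + -1 / \<beta>" using \<beta> by (simp add: field_simps)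
      show ?thesis unfolding e powr_add using l0 by simp
    qed
    have c8: "A0 * \<tau> * ln (real l) powr dd \<le> real l * real l powr (-1 / \<beta>)"
    proof -
      have "\<tau> \<le> \<tau>\<^sup>2" using \<tau> by (simp add: power2_eq_square)
      hence "A0 * \<tau> * ln (real l) powr dd \<le> Q * \<tau>\<^sup>2 * ln (real l) powr dd"
        using Q A0 \<tau> by (intro mult_right_mono mult_mono) auto
      thus ?thesis using key llam by linarith
    qed
    have lb: "(real l powr (-1 / \<beta>)) powr \<beta> = 1 / real l"
    proof -
      have e: "-1 / \<beta> * \<beta> = - 1" using \<beta> by simp
      show ?thesis unfolding powr_powr e using l0 by (simp add: powr_minus_divide)
    qed
    have lam1: "real l powr (-1 / \<beta>) \<le> 1"
      using l3[OF le1] \<beta> powr_mono[of "-1 / \<beta>" 0 "real l"] by simp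
    show "prob_at_least (PiM {..<l} (\<lambda>_. \<rho>))
           (\<lambda>z. err \<rho> \<kappa> (sample_est (kerN f1 fs N) I_set l z (real l powr (-1 / \<beta>)))
                  \<le> ennreal (3 * C0 * \<tau>^2 * ln (real l) powr dd / real l))
           (1 - exp (-4 * \<tau>))"
      by (rule conclude[of \<beta>]) (use \<beta> G \<tau> le1 l0 c8 lb lam1 lndd[OF le1] in \<open>auto intro: divide_right_mono\<close>)
  next
    fix \<beta> :: real and \<rho> :: "(('n \<Rightarrow> real^'d) \<times> real) measure" and \<kappa> and \<tau> \<mu> :: real and l :: nat
    assume \<beta>: "0 < \<beta> \<and> \<beta> \<le> 2" and G: "in_G B Binf L \<sigma> \<omega> \<beta> (kerN f1 fs N) \<rho> \<kappa>" and \<tau>: "\<tau> \<ge> 1" and b1: "\<beta> = 1"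
      and \<mu>: "dd < \<mu>"
      and l: "max (exp ((A * \<tau>) powr (1 / (\<mu> - dd)))) (exp 1 * ln (real l) powr \<mu>) \<le> real l"
    have At: "A * \<tau> \<ge> 1" using mult_mono[OF A(2) \<tau>] A(2) by simp
    have "(A * \<tau>) powr (1 / (\<mu> - dd)) \<ge> 1" using At \<mu> by (intro ge_one_powr_ge_zero) auto
    hence "exp 1 \<le> exp ((A * \<tau>) powr (1 / (\<mu> - dd)))" by simp
    hence le1: "real l \<ge> exp 1" using l by linarith
    have l0: "real l > 0" using l3[OF le1] by simp
    note ln1 = lnl[OF le1]
    have "exp ((A * \<tau>) powr (1 / (\<mu> - dd))) \<le> real l" using l by simp
    hence "(A * \<tau>) powr (1 / (\<mu> - dd)) \<le> ln (real l)" using l0 by (simp add: ln_ge_iff)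
    hence "((A * \<tau>) powr (1 / (\<mu> - dd))) powr (\<mu> - dd) \<le> ln (real l) powr (\<mu> - dd)"
      using \<mu> by (intro powr_mono2) auto
    hence key: "A * \<tau> \<le> ln (real l) powr (\<mu> - dd)" using At \<mu> by (simp add: powr_powr)
    \<comment> \<open>\<open>l * lam\<close> is \<open>ln l powr \<mu>\<close> in this case. The
      excess \<open>\<mu> - dd\<close> of its exponent absorbs \<open>A * \<tau>\<close>, and the
      rest matches the dimension of the head.\<close>
    have sp: "ln (real l) powr \<mu> = ln (real l) powr (\<mu> - dd) * ln (real l) powr dd" by (simp flip: powr_add)
    have c8: "A0 * \<tau> * ln (real l) powr dd \<le> real l * (ln (real l) powr \<mu> / real l)"
    proof -
      have "A0 * \<tau> \<le> A * \<tau>" using A \<tau> by (intro mult_right_mono) auto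
      hence "A0 * \<tau> * ln (real l) powr dd \<le> ln (real l) powr (\<mu> - dd) * ln (real l) powr dd"
        using key by (intro mult_right_mono) auto
      thus ?thesis using l0 sp by simp
    qed
    \<comment> \<open>The second lower bound on \<open>l\<close> keeps \<open>lam\<close> below
      1.\<close>
    have lam1: "ln (real l) powr \<mu> / real l \<le> 1"
    proof -
      have "1 * ln (real l) powr \<mu> \<le> exp 1 * ln (real l) powr \<mu>" by (intro mult_right_mono) auto
      thus ?thesis using l l0 by simp
    qed
    have lmu: "ln (real l) powr dd \<le> ln (real l) powr \<mu>" using ln1 \<mu> by (intro powr_mono) auto
    have "0 < ln (real l) powr \<mu>" unfolding powr_gt_zero using ln1 by linarith
    hence lam0: "0 < ln (real l) powr \<mu> / real l" using l0 by (rule divide_pos_pos)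
    show "prob_at_least (PiM {..<l} (\<lambda>_. \<rho>))
           (\<lambda>z. err \<rho> \<kappa> (sample_est (kerN f1 fs N) I_set l z (ln (real l) powr \<mu> / real l))
                  \<le> ennreal (3 * C0 * \<tau>^2 * ln (real l) powr \<mu> / real l))
           (1 - exp (-4 * \<tau>))"
      by (rule conclude[of \<beta>]) (use \<beta> G \<tau> le1 l0 c8 lam1 lmu lam0 b1 in \<open>auto intro: divide_right_mono\<close>)
  next
    fix \<beta> :: real and \<rho> :: "(('n \<Rightarrow> real^'d) \<times> real) measure" and \<kappa> and \<tau> :: real and l :: nat
    assume \<beta>: "0 < \<beta> \<and> \<beta> \<le> 2" and G: "in_G B Binf L \<sigma> \<omega> \<beta> (kerN f1 fs N) \<rho> \<kappa>" and \<tau>: "\<tau> \<ge> 1" and b1: "\<beta> < 1"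
      and l: "max (exp ((A * \<tau>) powr (\<beta> / (dd * (1 - \<beta>))))) (exp 1 * ln (real l) powr (dd / \<beta>)) \<le> real l"
    have At: "A * \<tau> \<ge> 1" using mult_mono[OF A(2) \<tau>] A(2) by simp
    \<comment> \<open>The excess of the exponent \<open>dd / \<beta>\<close> in
      \<open>l * lam\<close> over \<open>dd\<close>; the threshold on \<open>l\<close> contains its
      reciprocal.\<close>
    define w where "w = dd * (1 - \<beta>) / \<beta>"
    have w: "w > 0" "\<beta> / (dd * (1 - \<beta>)) = 1 / w" using \<beta> b1 dd1 by (auto simp: w_def)
    have "(A * \<tau>) powr (1 / w) \<ge> 1" using At w by (intro ge_one_powr_ge_zero) auto
    hence "exp 1 \<le> exp ((A * \<tau>) powr (1 / w))" by simp
    hence le1: "real l \<ge> exp 1" using l unfolding w(2) by linarith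
    have l0: "real l > 0" using l3[OF le1] by simp
    note ln1 = lnl[OF le1]
    have "exp ((A * \<tau>) powr (1 / w)) \<le> real l" using l unfolding w(2) by simp
    hence "(A * \<tau>) powr (1 / w) \<le> ln (real l)" using l0 by (simp add: ln_ge_iff)
    hence "((A * \<tau>) powr (1 / w)) powr w \<le> ln (real l) powr w" using w by (intro powr_mono2) auto
    hence key: "A * \<tau> \<le> ln (real l) powr w" using At w by (simp add: powr_powr)
    have "dd / \<beta> = w + dd" using \<beta> by (simp add: w_def field_simps)
    hence sp: "ln (real l) powr (dd / \<beta>) = ln (real l) powr w * ln (real l) powr dd" by (simp add: powr_add)
    have c8: "A0 * \<tau> * ln (real l) powr dd \<le> real l * (ln (real l) powr (dd / \<beta>) / real l)"
    proof -
      have "A0 * \<tau> \<le> A * \<tau>" using A \<tau> by (intro mult_right_mono) auto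
      hence "A0 * \<tau> * ln (real l) powr dd \<le> ln (real l) powr w * ln (real l) powr dd"
        using key by (intro mult_right_mono) auto
      thus ?thesis using l0 sp by simp
    qed
    have lam1: "ln (real l) powr (dd / \<beta>) / real l \<le> 1"
    proof -
      have "1 * ln (real l) powr (dd / \<beta>) \<le> exp 1 * ln (real l) powr (dd / \<beta>)" by (intro mult_right_mono) auto
      thus ?thesis using l l0 by simp
    qed
    have "0 < ln (real l) powr (dd / \<beta>)" unfolding powr_gt_zero using ln1 by linarith
    hence lam0: "0 < ln (real l) powr (dd / \<beta>) / real l" using l0 by (rule divide_pos_pos)
    have lb: "(ln (real l) powr (dd / \<beta>) / real l) powr \<beta> = ln (real l) powr dd / real l powr \<beta>"
      using ln1 l0 \<beta> by (simp add: powr_divide powr_powr)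
    \<comment> \<open>For \<open>\<beta> < 1\<close> the bias \<open>lam powr \<beta>\<close> sets
      the rate and the variance is of smaller order.\<close>
    have "real l powr \<beta> \<le> real l powr 1" using b1 l3[OF le1] by (intro powr_mono) auto
    hence ld: "ln (real l) powr dd / real l \<le> ln (real l) powr dd / real l powr \<beta>"
      using l0 by (intro divide_left_mono) auto
    show "prob_at_least (PiM {..<l} (\<lambda>_. \<rho>))
           (\<lambda>z. err \<rho> \<kappa> (sample_est (kerN f1 fs N) I_set l z (ln (real l) powr (dd / \<beta>) / real l))
                  \<le> ennreal (3 * C0 * \<tau>^2 * ln (real l) powr dd / real l powr \<beta>))
           (1 - exp (-4 * \<tau>))"
      by (rule conclude[of \<beta>]) (use \<beta> G \<tau> le1 l0 c8 lam1 lb lam0 ld in auto)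
  qed
qed

end
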